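(* Let $p\ge2$. (i) Assume that $A_{12}\cdot\nabla_{X_2}W\not\equiv0$ (i.e. it is not a.e. equal to $0$ in $\omega$). If $$\int_\omega|A_{22}\nabla_{X_2}W\cdot\nabla_{X_2}W|^{\frac{p-2}{2}}(A_{12}\cdot\nabla_{X_2}W)\,W\ge0,$$ then $\nu_\infty^+<\mu^1(\omega)$. (ii) If $A_{12}\cdot\nabla_{X_2}W\le0$ a.e. in $\omega$, then $\nu_\infty^+=\mu^1(\omega)$. Moreover, in this case there is no minimizer realizing $\nu_\infty^+$, i.e. the infimum defining $\nu_\infty^+$ is not attained.
   Context: Let $n\ge2$ and let $\omega\subset\mathbb{R}^{n-1}$ be a bounded, connected open set. Points of $\mathbb{R}^n$ are written $x=(x_1,X_2)$ with $x_1\in\mathbb{R}$, $X_2\in\mathbb{R}^{n-1}$, and $\nabla_{X_2}=(\partial_{x_2},\dots,\partial_{x_n})$. Set $\Omega_\infty^+=(0,\infty)\times\omega$ and $\gamma_\infty^+=(0,\infty)\times\partial\omega$. $A=A(X_2)$, $X_2\in\omega$, is a symmetric $n\times n$ matrix with bounded measurable entries, $A=\begin{pmatrix} a_{11}&A_{12}\\ A_{12}^t&A_{22}\end{pmatrix}$, with $a_{11}$ scalar, $A_{12}$ of size $1\times(n-1)$ and $A_{22}$ of size $(n-1)\times(n-1)$. There are constants $C,\lambda>0$ such that $\|A(X_2)\|\le C$ and $A(X_2)\xi\cdot\xi\ge\lambda|\xi|^2$ for a.e. $X_2\in\omega$ and all $\xi\in\mathbb{R}^n$. $V(\Omega_\infty^+)=\{u\in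 W^{1,p}(\Omega_\infty^+):u=0\text{ on }\gamma_\infty^+\}$ (in the sense of traces) and $$\nu_\infty^+=\inf_{0\ne u\in V(\Omega_\infty^+)}\frac{\int_{\Omega_\infty^+}|A\nabla u\cdot\nabla u|^{p/2}}{\int_{\Omega_\infty^+}|u|^p},\qquad \mu^1(\omega)=\inf_{0\ne u\in W_0^{1,p}(\omega)}\frac{\int_\omega|A_{22}\nabla_{X_2}u\cdot\nabla_{X_2}u|^{p/2}}{\int_\omega|u|^p}.$$ $\mu^1(\omega)$ is simple and attained, and $W\in W_0^{1,p}(\omega)$ is the non-negative minimizer with $\int_\omega|W|^p=1$. *)

theory Defs
  imports "HOL-Analysis.Analysis"
begin

section \<open>Sobolev spaces on open subsets of a Euclidean space\<close>

primrec C_k :: "nat \<Rightarrow> ('a::euclidean_space \<Rightarrow> real) \<Rightarrow> bool" where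
  "C_k 0 f \<longleftrightarrow> continuous_on UNIV f"
| "C_k (Suc k) f \<longleftrightarrow> f differentiable_on UNIV \<and>
     (\<forall>b\<in>Basis. C_k k (\<lambda>x. frechet_derivative f (at x) b))"

definition test_functions :: "'a::euclidean_space set \<Rightarrow> ('a \<Rightarrow> real) set" where
  "test_functions U = {\<phi>. (\<forall>k. C_k k \<phi>) \<and>
     compact (closure {x. \<phi> x \<noteq> 0}) \<and> closure {x. \<phi> x \<noteq> 0} \<subseteq> U}"

definition Lp_on :: "real \<Rightarrow> 'a::euclidean_space set \<Rightarrow> ('a \<Rightarrow> 'b::euclidean_space) \<Rightarrow> bool" where
  "Lp_on p U f \<longleftrightarrow> f \<in> borel_measurable (lebesgue_on U) \<and>
     integrable (lebesgue_on U) (\<lambda>x. norm (f x) powr p)"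

definition locally_integrable_on ::
    "'a::euclidean_space set \<Rightarrow> ('a \<Rightarrow> 'b::euclidean_space) \<Rightarrow> bool" where
  "locally_integrable_on U f \<longleftrightarrow>
     (\<forall>K. compact K \<and> K \<subseteq> U \<longrightarrow> f absolutely_integrable_on K)"

definition is_weak_gradient ::
    "'a::euclidean_space set \<Rightarrow> ('a \<Rightarrow> real) \<Rightarrow> ('a \<Rightarrow> 'a) \<Rightarrow> bool" where
  "is_weak_gradient U u g \<longleftrightarrow> locally_integrable_on U u \<and> locally_integrable_on U g \<and>
     (\<forall>\<phi>\<in>test_functions U. \<forall>b\<in>Basis.
        (LINT x:U|lebesgue. u x * frechet_derivative \<phi> (at x) b)
          = - (LINT x:U|lebesgue. (g x \<bullet> b) * \<phi> x))"

text \<open>Elements of the Sobolev spaces are functions, not classes; only their values on \<open>U\<close> matter.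
  On an open set a weak gradient is unique almost everywhere, so the choice made here does not
  affect the integrals and almost-everywhere statements below.\<close>

definition weak_grad :: "'a::euclidean_space set \<Rightarrow> ('a \<Rightarrow> real) \<Rightarrow> 'a \<Rightarrow> 'a" where
  "weak_grad U u = (SOME g. is_weak_gradient U u g)"

definition W1p :: "real \<Rightarrow> 'a::euclidean_space set \<Rightarrow> ('a \<Rightarrow> real) set" where
  "W1p p U = {u. Lp_on p U u \<and> (\<exists>g. is_weak_gradient U u g \<and> Lp_on p U g)}"

definition W1p_norm :: "real \<Rightarrow> 'a::euclidean_space set \<Rightarrow> ('a \<Rightarrow> real) \<Rightarrow> real" where
  "W1p_norm p U u =
     ((LINT x:U|lebesgue. \<bar>u x\<bar> powr p) + (LINT x:U|lebesgue. norm (weak_grad U u x) powr p))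
       powr (1 / p)"

definition W1p_closure ::
    "real \<Rightarrow> 'a::euclidean_space set \<Rightarrow> ('a \<Rightarrow> real) set \<Rightarrow> ('a \<Rightarrow> real) set" where
  "W1p_closure p U S = {u \<in> W1p p U. \<exists>v. (\<forall>k::nat. v k \<in> S \<inter> W1p p U) \<and>
     (\<lambda>k. W1p_norm p U (\<lambda>x. u x - v k x)) \<longlonglongrightarrow> 0}"

definition W1p_0 :: "real \<Rightarrow> 'a::euclidean_space set \<Rightarrow> ('a \<Rightarrow> real) set" where
  "W1p_0 p U = W1p_closure p U (test_functions U)"

definition nonzero_on :: "'a::euclidean_space set \<Rightarrow> ('a \<Rightarrow> real) \<Rightarrow> bool" where
  "nonzero_on U u \<longleftrightarrow> \<not> (AE x in lebesgue_on U. u x = 0)"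


section \<open>The half-cylinder and the two variational problems\<close>

text \<open>Points of \<open>\<real>\<^sup>n\<close> are pairs \<open>(x\<^sub>1, X\<^sub>2)\<close> in \<^typ>\<open>real \<times> (real ^ 'm)\<close>, so that
  \<open>n = CARD('m) + 1 \<ge> 2\<close>; the norm and inner product of this type are the Euclidean ones.\<close>

definition half_cylinder :: "(real ^ 'm) set \<Rightarrow> (real \<times> (real ^ 'm)) set" where
  "half_cylinder \<omega> = {0<..} \<times> \<omega>"

text \<open>Functions in \<open>W\<^sup>1\<^sup>,\<^sup>p\<close> of the half-cylinder with zero trace on the lateral boundary
  \<open>(0,\<infinity>) \<times> \<partial>\<omega>\<close>. As no regularity of \<open>\<partial>\<omega>\<close> is assumed, the trace condition is, as for \<^const>\<open>W1p_0\<close>,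
  membership in the closure of the smooth functions vanishing near that boundary. Test functions
  of \<open>\<real> \<times> \<omega>\<close> are unrestricted on the base \<open>{0} \<times> \<omega>\<close>.\<close>

definition V_space :: "real \<Rightarrow> (real ^ 'm) set \<Rightarrow> (real \<times> (real ^ 'm) \<Rightarrow> real) set" where
  "V_space p \<omega> = W1p_closure p (half_cylinder \<omega>) (test_functions (UNIV \<times> \<omega>))"

text \<open>The action on \<open>\<xi> = (\<xi>\<^sub>1, \<Xi>\<^sub>2)\<close> of the block matrix with rows \<open>(a, B)\<close> and \<open>(B\<^sup>t, D)\<close>.\<close>

definition block_app ::
    "real \<Rightarrow> real ^ 'm \<Rightarrow> real ^ 'm ^ 'm \<Rightarrow> real \<times> (real ^ 'm) \<Rightarrow> real \<times> (real ^ 'm)" where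
  "block_app a B D \<xi> = (a * fst \<xi> + B \<bullet> snd \<xi>, fst \<xi> *\<^sub>R B + D *v snd \<xi>)"

definition rayleigh ::
    "real \<Rightarrow> 'a::euclidean_space set \<Rightarrow> ('a \<Rightarrow> 'a \<Rightarrow> 'a) \<Rightarrow> ('a \<Rightarrow> real) \<Rightarrow> real" where
  "rayleigh p U M u =
     (LINT x:U|lebesgue. \<bar>M x (weak_grad U u x) \<bullet> weak_grad U u x\<bar> powr (p / 2))
       / (LINT x:U|lebesgue. \<bar>u x\<bar> powr p)"

definition rayleigh_cyl :: "real \<Rightarrow> (real ^ 'm) set \<Rightarrow> (real ^ 'm \<Rightarrow> real) \<Rightarrow>
    (real ^ 'm \<Rightarrow> real ^ 'm) \<Rightarrow> (real ^ 'm \<Rightarrow> real ^ 'm ^ 'm) \<Rightarrow>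
    (real \<times> (real ^ 'm) \<Rightarrow> real) \<Rightarrow> real" where
  "rayleigh_cyl p \<omega> a11 A12 A22 =
     rayleigh p (half_cylinder \<omega>) (\<lambda>x. block_app (a11 (snd x)) (A12 (snd x)) (A22 (snd x)))"

definition rayleigh_sec :: "real \<Rightarrow> (real ^ 'm) set \<Rightarrow> (real ^ 'm \<Rightarrow> real ^ 'm ^ 'm) \<Rightarrow>
    (real ^ 'm \<Rightarrow> real) \<Rightarrow> real" where
  "rayleigh_sec p \<omega> A22 = rayleigh p \<omega> (\<lambda>X \<xi>. A22 X *v \<xi>)"

definition nu_plus :: "real \<Rightarrow> (real ^ 'm) set \<Rightarrow> (real ^ 'm \<Rightarrow> real) \<Rightarrow>
    (real ^ 'm \<Rightarrow> real ^ 'm) \<Rightarrow> (real ^ 'm \<Rightarrow> real ^ 'm ^ 'm) \<Rightarrow> real" where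
  "nu_plus p \<omega> a11 A12 A22 =
     (INF u\<in>{u \<in> V_space p \<omega>. nonzero_on (half_cylinder \<omega>) u}. rayleigh_cyl p \<omega> a11 A12 A22 u)"

definition mu1 :: "real \<Rightarrow> (real ^ 'm) set \<Rightarrow> (real ^ 'm \<Rightarrow> real ^ 'm ^ 'm) \<Rightarrow> real" where
  "mu1 p \<omega> A22 = (INF u\<in>{u \<in> W1p_0 p \<omega>. nonzero_on \<omega> u}. rayleigh_sec p \<omega> A22 u)"

text \<open>A caveat on \<open>|A\<^sub>2\<^sub>2\<nabla>W \<cdot> \<nabla>W|\<^bsup>(p-2)/2\<^esup> (A\<^sub>1\<^sub>2 \<cdot> \<nabla>W) W\<close> written with \<^const>\<open>powr\<close>: for \<open>p = 2\<close> one has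
  \<^term>\<open>0 powr 0 = (0::real)\<close> instead of \<open>1\<close>, but by ellipticity the first factor has base zero only
  where \<open>\<nabla>W = 0\<close> (up to null sets), and there the whole product vanishes anyway.\<close>

end

theory Submission
  imports Defs
begin

text \<open>Write \<open>\<nu>\<close> and \<open>\<mu>\<close> for the two infima, \<open>g = \<nabla>W\<close> and \<open>E = A\<^sub>2\<^sub>2 g \<cdot> g\<close>. Let \<open>h\<close> be a cutoff function on the
  line. The energy of \<open>h(x\<^sub>1/T) W + t h(x\<^sub>1) \<phi>\<close> exceeds \<open>\<mu>\<close> times its \<open>L\<^sup>p\<close> mass by at most
  \<open>- I - t p J + O(t\<^sup>2 + 1/T)\<close>, where \<open>I\<close> and \<open>J\<close> are the integrals of \<open>E\<^bsup>(p-2)/2\<^esup> (A\<^sub>1\<^sub>2 \<cdot> g)\<close> against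
  \<open>W\<close> and \<open>\<phi>\<close>. For \<open>t = 0\<close> and \<open>T \<rightarrow> \<infinity>\<close> this gives \<open>\<nu> \<le> \<mu>\<close>. If \<open>I \<ge> 0\<close> and \<open>A\<^sub>1\<^sub>2 \<cdot> g\<close> does not vanish, some
  \<open>\<phi>\<close> has \<open>J \<noteq> 0\<close>, and a small \<open>t\<close> of the sign of \<open>J\<close> gives \<open>\<nu> < \<mu>\<close>.

  Conversely, Picone's inequality bounds the energy density of \<open>u\<close> from below by
  \<open>E\<^bsup>(p-2)/2\<^esup> A (0, g) \<cdot> \<nabla>(|u|\<^sup>p (W + \<epsilon>)\<^bsup>1-p\<^esup>)\<close> plus a multiple of \<open>|\<partial>\<^sub>1 u|\<^sup>p\<close>. The \<open>X\<^sub>2\<close>-part integrates to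
  \<open>\<mu> \<integral>|u|\<^sup>p (W / (W + \<epsilon>))\<^bsup>p-1\<^esup>\<close> by the Euler--Lagrange equation on slices, and the \<open>x\<^sub>1\<close>-part to a term on
  \<open>x\<^sub>1 = 0\<close> with the sign of \<open>- A\<^sub>1\<^sub>2 \<cdot> g\<close>. Letting \<open>\<epsilon> \<rightarrow> 0\<close>, which needs \<open>W > 0\<close> almost everywhere, yields \<open>\<nu> \<ge> \<mu>\<close>;
  a minimizer would have \<open>\<partial>\<^sub>1 u = 0\<close> and hence vanish.

  Positivity of \<open>W\<close> follows from the same inequality, which bounds \<open>\<nabla> ln (W + \<epsilon>)\<close> locally, uniformly in
  \<open>\<epsilon>\<close>: the indicator of \<open>{W > 0}\<close> has weak gradient zero on the connected set \<open>\<omega>\<close>.\<close>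

section \<open>Smooth functions\<close>

text \<open>The coefficients are only measurable and W and the competitors u are known only as
  limits of test functions in a Sobolev norm. A product such as |u|^p (W + \<epsilon>)^(1-p) is
  therefore never shown to lie in a Sobolev space: identities are proved for test functions and
  carried over along sequences that converge almost everywhere, with their gradients, under one
  p-integrable majorant. The shift \<epsilon> is there because W need not be bounded away from 0.
  The extra multiple of |\<partial>_1 u|^p is the remainder of Clarkson's inequality: \<nabla>u is
  compared with a multiple of (0, g), so the x_1-component of the difference is all of \<partial>_1
  u. The perturbation by \<phi> is indispensable when I = 0: the slowly varying profile alone then
  gains nothing, whereas the gain from \<phi> is linear in t and beats the errors t^2 and 1/T. That
  a minimizer with \<partial>_1 u = 0 vanishes is read off from an integration by parts whose weight
  is zero at x_1 = 0, so that no trace of u on the base has to be made sense of.\<close>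

definition smooth :: "('a::euclidean_space \<Rightarrow> real) \<Rightarrow> bool" where
  "smooth f \<longleftrightarrow> (\<forall>k. C_k k f)"

text \<open>Assembled from the partial derivatives, hence total; it represents the derivative only
  where \<open>f\<close> is differentiable.\<close>

definition grad :: "('a::euclidean_space \<Rightarrow> real) \<Rightarrow> 'a \<Rightarrow> 'a" where
  "grad f x = (\<Sum>b\<in>Basis. frechet_derivative f (at x) b *\<^sub>R b)"

lemma C_k_continuous: "C_k k f \<Longrightarrow> continuous_on UNIV f"
  by (cases k) (auto intro: differentiable_imp_continuous_on)

lemma C_k_Suc_differentiable: "C_k (Suc k) f \<Longrightarrow> f differentiable (at x)"
  by (auto simp: differentiable_on_def)

lemma C_k_Suc_imp: "C_k (Suc k) f \<Longrightarrow> C_k k f"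
proof (induction k arbitrary: f)
  case 0
  then show ?case by (metis C_k.simps(1) C_k_continuous)
next
  case (Suc k)
  then show ?case by (metis C_k.simps(2))
qed

lemma frechet_derivative_eq:
  "(f has_derivative D) (at x) \<Longrightarrow> frechet_derivative f (at x) = D"
  by (metis frechet_derivative_at)

lemma differentiable_has_frechet:
  "f differentiable (at x) \<Longrightarrow> (f has_derivative frechet_derivative f (at x)) (at x)"
  by (simp add: frechet_derivative_works)

text \<open>\<open>C_k\<close> is phrased through \<open>frechet_derivative\<close>. Allowing any
  explicit derivative \<open>D\<close> in its place reduces the closure properties below to the
  calculus rules and induction on \<open>k\<close>.\<close>

lemma C_k_SucI:
  assumes "\<And>x. (f has_derivative D x) (at x)" and "\<And>b. b \<in> Basis \<Longrightarrow> C_k k (\<lambda>x. D x b)"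
  shows "C_k (Suc k) f"
proof -
  have "frechet_derivative f (at x) = D x" for x
    using assms(1) by (rule frechet_derivative_eq)
  then show ?thesis
    using assms by (auto simp: differentiable_on_def differentiable_def intro: has_derivative_at_withinI)
qed

lemma C_k_const: "C_k k (\<lambda>x. c)"
proof (induction k arbitrary: c)
  case (Suc k)
  show ?case by (rule C_k_SucI[where D="\<lambda>x h. 0"]) (use Suc in auto)
qed auto

lemma C_k_add: "C_k k f \<Longrightarrow> C_k k g \<Longrightarrow> C_k k (\<lambda>x. f x + g x)"
proof (induction k arbitrary: f g)
  case 0
  then show ?case by (auto intro: continuous_intros)
next
  case (Suc k)
  note d = Suc.prems[THEN C_k_Suc_differentiable, THEN differentiable_has_frechet]
  show ?case
    by (rule C_k_SucI[OF has_derivative_add[OF d]]) (use Suc in auto)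
qed

lemma C_k_sum: "(\<And>i. i \<in> I \<Longrightarrow> C_k k (f i)) \<Longrightarrow> C_k k (\<lambda>x. \<Sum>i\<in>I. f i x)"
  by (induction I rule: infinite_finite_induct) (auto intro: C_k_add C_k_const)

lemma C_k_mult: "C_k k f \<Longrightarrow> C_k k g \<Longrightarrow> C_k k (\<lambda>x. f x * g x)"
proof (induction k arbitrary: f g)
  case 0
  then show ?case by (auto intro: continuous_intros)
next
  case (Suc k)
  note d = Suc.prems[THEN C_k_Suc_differentiable, THEN differentiable_has_frechet]
  show ?case
  proof (rule C_k_SucI[OF has_derivative_mult[OF d]])
    fix b :: 'a assume "b \<in> Basis"
    then show "C_k k (\<lambda>x. f x * frechet_derivative g (at x) b + frechet_derivative f (at x) b * g x)"
      using Suc.prems[THEN C_k_Suc_imp] Suc.prems by (intro C_k_add Suc.IH) auto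
  qed
qed

lemma C_k_prod: "(\<And>i. i \<in> I \<Longrightarrow> C_k k (f i)) \<Longrightarrow> C_k k (\<lambda>x. \<Prod>i\<in>I. f i x)"
  by (induction I rule: infinite_finite_induct) (auto intro: C_k_mult C_k_const)

lemma C_k_inverse: "C_k k f \<Longrightarrow> (\<And>x. f x \<noteq> 0) \<Longrightarrow> C_k k (\<lambda>x. inverse (f x))"
proof (induction k arbitrary: f)
  case 0
  then show ?case by (auto intro: continuous_intros)
next
  case (Suc k)
  note d = Suc.prems(1)[THEN C_k_Suc_differentiable, THEN differentiable_has_frechet]
  have 1: "C_k k (\<lambda>x. inverse (f x))" using Suc by (blast intro: C_k_Suc_imp)
  show ?case
  proof (rule C_k_SucI[OF Deriv.has_derivative_inverse[OF _ d]])
    fix b :: 'a assume b: "b \<in> Basis"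
    have "C_k k (\<lambda>x. frechet_derivative f (at x) b)" using Suc.prems(1) b by simp
    then have "C_k k (\<lambda>x. (- 1) * ((inverse (f x) * frechet_derivative f (at x) b) * inverse (f x)))"
      by (intro C_k_mult C_k_const 1)
    then show "C_k k (\<lambda>x. - (inverse (f x) * frechet_derivative f (at x) b * inverse (f x)))"
      by simp
  qed (use Suc in auto)
qed

text \<open>By the chain rule each partial derivative of the composition is a fixed linear
  combination of partial derivatives of \<open>f\<close> along the same affine map, so the induction
  hypothesis applies to every summand.\<close>

lemma C_k_affine:
  fixes L :: "'a::euclidean_space \<Rightarrow> 'b::euclidean_space"
  assumes L: "bounded_linear L"
  shows "C_k k f \<Longrightarrow> C_k k (\<lambda>x. f (c + L x))"
proof (induction k arbitrary: f)
  case 0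
  have "continuous_on UNIV (\<lambda>x. c + L x)"
    by (intro continuous_intros linear_continuous_on L)
  then show ?case using 0
    by (auto intro: continuous_on_compose2[of UNIV f])
next
  case (Suc k)
  note d = Suc.prems(1)[THEN C_k_Suc_differentiable, THEN differentiable_has_frechet]
  have DL: "((\<lambda>x. c + L x) has_derivative L) (at x)" for x
    using bounded_linear_imp_has_derivative[OF L] by (auto intro!: derivative_eq_intros)
  have D: "((\<lambda>x. f (c + L x)) has_derivative (\<lambda>h. frechet_derivative f (at (c + L x)) (L h))) (at x)" for x
    by (rule has_derivative_compose[OF DL d])
  show ?case
  proof (rule C_k_SucI[OF D])
    fix b :: 'a assume "b \<in> Basis"
    have "frechet_derivative f (at y) (L b) = (\<Sum>i\<in>Basis. (L b \<bullet> i) * frechet_derivative f (at y) i)" for y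
    proof -
      have lin: "linear (frechet_derivative f (at y))"
        using d has_derivative_bounded_linear bounded_linear.linear by blast
      have "frechet_derivative f (at y) (\<Sum>i\<in>Basis. (L b \<bullet> i) *\<^sub>R i) = (\<Sum>i\<in>Basis. (L b \<bullet> i) *\<^sub>R frechet_derivative f (at y) i)"
        by (simp add: linear_sum[OF lin] linear_scale[OF lin])
      then show ?thesis by (simp add: euclidean_representation)
    qed
    moreover have "C_k k (\<lambda>x. \<Sum>i\<in>Basis. (L b \<bullet> i) * frechet_derivative f (at (c + L x)) i)"
      by (intro C_k_sum C_k_mult C_k_const Suc.IH) (use Suc.prems in auto)
    ultimately show "C_k k (\<lambda>x. frechet_derivative f (at (c + L x)) (L b))" by simp
  qed
qed

lemma smooth_const: "smooth (\<lambda>x. c)"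
  and smooth_add: "smooth f \<Longrightarrow> smooth g \<Longrightarrow> smooth (\<lambda>x. f x + g x)"
  and smooth_mult: "smooth f \<Longrightarrow> smooth g \<Longrightarrow> smooth (\<lambda>x. f x * g x)"
  and smooth_inverse: "smooth f \<Longrightarrow> (\<And>x. f x \<noteq> 0) \<Longrightarrow> smooth (\<lambda>x. inverse (f x))"
  and smooth_sum: "(\<And>i. i \<in> I \<Longrightarrow> smooth (F i)) \<Longrightarrow> smooth (\<lambda>x. \<Sum>i\<in>I. F i x)"
  and smooth_prod: "(\<And>i. i \<in> I \<Longrightarrow> smooth (F i)) \<Longrightarrow> smooth (\<lambda>x. \<Prod>i\<in>I. F i x)"
  by (auto simp: smooth_def intro: C_k_const C_k_add C_k_mult C_k_inverse C_k_sum C_k_prod)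

lemma smooth_affine:
  fixes L :: "'a::euclidean_space \<Rightarrow> 'b::euclidean_space"
  shows "bounded_linear L \<Longrightarrow> smooth f \<Longrightarrow> smooth (\<lambda>x. f (c + L x))"
  by (auto simp: smooth_def intro: C_k_affine)

lemma smooth_power: "smooth f \<Longrightarrow> smooth (\<lambda>x. f x ^ n)"
  by (induction n) (auto intro: smooth_const smooth_mult)

lemma smooth_differentiable: "smooth f \<Longrightarrow> f differentiable (at x)"
  by (metis C_k_Suc_differentiable smooth_def)

lemma smooth_partial: "smooth f \<Longrightarrow> b \<in> Basis \<Longrightarrow> smooth (\<lambda>x. frechet_derivative f (at x) b)"
  by (metis C_k.simps(2) smooth_def)

lemma smooth_continuous: "smooth f \<Longrightarrow> continuous_on UNIV f"
  by (metis C_k_continuous smooth_def)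

lemma grad_inner: "b \<in> Basis \<Longrightarrow> grad f x \<bullet> b = frechet_derivative f (at x) b"
  by (simp add: grad_def inner_sum_left inner_Basis if_distrib cong: if_cong)

lemma differentiable_grad:
  assumes "f differentiable (at x)"
  shows "(f has_derivative (\<lambda>h. grad f x \<bullet> h)) (at x)"
proof -
  have d: "(f has_derivative frechet_derivative f (at x)) (at x)"
    using assms by (rule differentiable_has_frechet)
  have lin: "linear (frechet_derivative f (at x))"
    using d has_derivative_bounded_linear bounded_linear.linear by blast
  have "frechet_derivative f (at x) h = grad f x \<bullet> h" for h
  proof -
    have "frechet_derivative f (at x) (\<Sum>i\<in>Basis. (h \<bullet> i) *\<^sub>R i) = (\<Sum>i\<in>Basis. (h \<bullet> i) *\<^sub>R frechet_derivative f (at x) i)"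
      by (simp add: linear_sum[OF lin] linear_scale[OF lin])
    then show ?thesis
      by (simp only: euclidean_representation grad_def inner_sum_left inner_scaleR_left)
        (simp add: inner_commute mult.commute)
  qed
  then have "frechet_derivative f (at x) = (\<lambda>h. grad f x \<bullet> h)" by auto
  with d show ?thesis by simp
qed

lemma grad_eqI:
  assumes "(f has_derivative (\<lambda>h. g \<bullet> h)) (at x)"
  shows "grad f x = g"
  by (rule euclidean_eqI) (simp add: grad_inner frechet_derivative_eq[OF assms])

lemma smooth_grad: "smooth f \<Longrightarrow> (f has_derivative (\<lambda>h. grad f x \<bullet> h)) (at x)"
  by (rule differentiable_grad[OF smooth_differentiable])

lemma continuous_on_grad: "smooth f \<Longrightarrow> continuous_on UNIV (grad f)"
  unfolding grad_def[abs_def]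
  by (intro continuous_intros smooth_continuous smooth_partial)

section \<open>Test functions\<close>

lemma test_functionsI:
  assumes "smooth f" "compact K" "K \<subseteq> U" "\<And>x. x \<notin> K \<Longrightarrow> f x = 0"
  shows "f \<in> test_functions U"
proof -
  have "closure {x. f x \<noteq> 0} \<subseteq> K"
    using assms by (intro closure_minimal) (auto intro: compact_imp_closed)
  moreover have "compact (closure {x. f x \<noteq> 0})"
    using assms(2) calculation by (meson closed_closure compact_Int_closed inf.absorb_iff2 compact_closure bounded_subset closure_subset compact_imp_bounded)
  ultimately show ?thesis
    using assms by (auto simp: test_functions_def smooth_def)
qed

lemma test_functionsE:
  assumes "f \<in> test_functions U"
  obtains K where "smooth f" "compact K" "K \<subseteq> U" "\<And>x. x \<notin> K \<Longrightarrow> f x = 0" "\<And>x. x \<notin> K \<Longrightarrow> grad f x = 0"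
proof -
  define K where "K = closure {x. f x \<noteq> 0}"
  have f0: "f x = 0" if "x \<notin> K" for x
    using that closure_subset[of "{x. f x \<noteq> 0}"] by (auto simp: K_def)
  have "grad f x = 0" if x: "x \<notin> K" for x
  proof (rule grad_eqI)
    have "((\<lambda>x. 0) has_derivative (\<lambda>h. 0 \<bullet> h)) (at x)" by simp
    moreover have "open (- K)" "x \<in> - K" using x by (auto simp: K_def)
    ultimately show "(f has_derivative (\<lambda>h. 0 \<bullet> h)) (at x)"
      by (rule has_derivative_transform_within_open) (simp add: f0)
  qed
  moreover have "smooth f" "compact K" "K \<subseteq> U"
    using assms by (auto simp: test_functions_def smooth_def K_def)
  ultimately show ?thesis
    using f0 that by blast
qed

lemma test_smooth: "f \<in> test_functions U \<Longrightarrow> smooth f"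
  by (auto simp: test_functions_def smooth_def)

lemma test_add:
  assumes "f \<in> test_functions U" "g \<in> test_functions U"
  shows "(\<lambda>x. f x + g x) \<in> test_functions U"
proof -
  obtain K where K: "smooth f" "compact K" "K \<subseteq> U" "\<And>x. x \<notin> K \<Longrightarrow> f x = 0"
    using test_functionsE[OF assms(1)] by metis
  obtain L where L: "smooth g" "compact L" "L \<subseteq> U" "\<And>x. x \<notin> L \<Longrightarrow> g x = 0"
    using test_functionsE[OF assms(2)] by metis
  show ?thesis
    by (rule test_functionsI[of _ "K \<union> L"]) (use K L in \<open>auto intro: smooth_add\<close>)
qed

lemma test_mult:
  assumes "f \<in> test_functions U" "smooth g"
  shows "(\<lambda>x. f x * g x) \<in> test_functions U"
proof -
  obtain K where K: "smooth f" "compact K" "K \<subseteq> U" "\<And>x. x \<notin> K \<Longrightarrow> f x = 0"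
    using test_functionsE[OF assms(1)] by metis
  show ?thesis
    by (rule test_functionsI[of _ "K"]) (use K assms in \<open>auto intro: smooth_mult\<close>)
qed

lemma test_scale: "f \<in> test_functions U \<Longrightarrow> (\<lambda>x. c * f x) \<in> test_functions U"
  using test_mult[OF _ smooth_const[of c], of f U] by (simp add: mult.commute)

lemma test_bounded:
  assumes "f \<in> test_functions U"
  obtains B where "B \<ge> 0" "\<And>x. \<bar>f x\<bar> \<le> B" "\<And>x. norm (grad f x) \<le> B"
proof -
  obtain K where K: "smooth f" "compact K" "K \<subseteq> U" "\<And>x. x \<notin> K \<Longrightarrow> f x = 0" "\<And>x. x \<notin> K \<Longrightarrow> grad f x = 0"
    by (rule test_functionsE[OF assms]) blast
  have "compact (f ` K)" "compact (grad f ` K)"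
    using K smooth_continuous continuous_on_grad continuous_on_subset[OF _ subset_UNIV] by (blast intro: compact_continuous_image)+
  then obtain B1 B2 where "\<And>x. x \<in> K \<Longrightarrow> \<bar>f x\<bar> \<le> B1" "\<And>x. x \<in> K \<Longrightarrow> norm (grad f x) \<le> B2"
    by (force dest!: compact_imp_bounded simp: bounded_iff)
  then have "\<bar>f x\<bar> \<le> max 0 (max B1 B2)" "norm (grad f x) \<le> max 0 (max B1 B2)" for x
    using K(4,5)[of x] by (cases "x \<in> K"; force)+
  then show ?thesis using that[of "max 0 (max B1 B2)"] by auto
qed

section \<open>Smooth bumps and cutoff functions\<close>

definition exp_bump :: "nat \<Rightarrow> real \<Rightarrow> real" where
  "exp_bump m s = (if s > 0 then (1 / s) ^ m * exp (- 1 / s) else 0)"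

lemma exp_bump_tendsto_0: "(exp_bump m \<longlongrightarrow> 0) (at 0)"
proof -
  have "((\<lambda>s. (1 / s) ^ m / exp (1 / s)) \<longlongrightarrow> (0::real)) (at_right 0)"
    by (rule filterlim_compose[OF tendsto_power_div_exp_0])
      (simp add: filterlim_inverse_at_top_right inverse_eq_divide[symmetric])
  then have "(exp_bump m \<longlongrightarrow> 0) (at_right 0)"
    by (rule Lim_transform_eventually)
      (auto simp: exp_bump_def eventually_at_right_field exp_minus field_simps intro!: exI[of _ 1])
  moreover have "(exp_bump m \<longlongrightarrow> 0) (at_left 0)"
    by (rule Lim_transform_eventually[OF tendsto_const])
      (auto simp: exp_bump_def eventually_at_left_field intro!: exI[of _ "-1"])
  ultimately show ?thesis by (simp add: filterlim_at_split)
qed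

text \<open>The functions s^(-m) exp(-1/s), extended by 0 to s \<le> 0, are closed under
  differentiation up to linear combinations. Carrying the whole family in \<open>m\<close> makes
  smoothness of all members a single induction on the order.\<close>

lemma exp_bump_deriv:
  "(exp_bump m has_real_derivative exp_bump (m + 2) s - m * exp_bump (m + 1) s) (at s)"
proof (cases s "0::real" rule: linorder_cases)
  case less
  have "((\<lambda>x. 0) has_real_derivative 0) (at s)" by simp
  then have "(exp_bump m has_real_derivative 0) (at s)"
    by (rule has_field_derivative_transform_within_open[where S="{..<0}"])
      (use less in \<open>auto simp: exp_bump_def\<close>)
  then show ?thesis using less by (simp add: exp_bump_def)
next
  case equal
  \<comment> \<open>The difference quotient at 0 is exactly \<open>exp_bump (m + 1) h\<close>:
    dividing by h > 0 raises the power by one, and for h < 0 both vanish.\<close>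
  have "((\<lambda>h. (exp_bump m (0 + h) - exp_bump m 0) / h) \<longlongrightarrow> 0) (at 0)"
    by (rule Lim_transform_eventually[OF exp_bump_tendsto_0[of "m + 1"]])
      (auto simp: exp_bump_def eventually_at_filter)
  then show ?thesis using equal by (simp add: DERIV_def exp_bump_def)
next
  case greater
  have 1: "((\<lambda>x. 1 / x) has_real_derivative - ((1 / s) * (1 / s))) (at s)"
    using greater by (auto intro!: derivative_eq_intros)
  have 2: "((\<lambda>x. exp (- 1 / x)) has_real_derivative exp (- 1 / s) * ((1 / s) * (1 / s))) (at s)"
    using greater by (auto intro!: derivative_eq_intros)
  have "((\<lambda>x. (1 / x) ^ m * exp (- 1 / x)) has_real_derivative
      (1 / s) ^ (m + 2) * exp (- 1 / s) - m * ((1 / s) ^ (m + 1) * exp (- 1 / s))) (at s)"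
    by (rule DERIV_cong[OF DERIV_mult[OF DERIV_power[OF 1, of m] 2]])
      (cases m; simp add: algebra_simps)
  then have "(exp_bump m has_real_derivative
      (1 / s) ^ (m + 2) * exp (- 1 / s) - m * ((1 / s) ^ (m + 1) * exp (- 1 / s))) (at s)"
    by (rule has_field_derivative_transform_within_open[where S="{0<..}"])
      (use greater in \<open>auto simp: exp_bump_def\<close>)
  then show ?thesis using greater by (simp add: exp_bump_def)
qed

lemma smooth_exp_bump: "smooth (exp_bump m)"
proof -
  have "C_k k (exp_bump m)" for k
  proof (induction k arbitrary: m)
    case 0
    show ?case
      using DERIV_isCont[OF exp_bump_deriv] by (simp add: continuous_on_eq_continuous_at)
  next
    case (Suc k)
    show ?case
    proof (rule C_k_SucI)
      show "(exp_bump m has_derivative (*) (exp_bump (m + 2) s - m * exp_bump (m + 1) s)) (at s)" for s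
        using exp_bump_deriv by (simp add: has_field_derivative_def)
      show "C_k k (\<lambda>s. (exp_bump (m + 2) s - m * exp_bump (m + 1) s) * b)" for b
        using C_k_mult[OF C_k_add[OF Suc C_k_mult[OF C_k_const Suc]] C_k_const[of k b],
          of "m + 2" "- real m" "m + 1"] by simp
    qed
  qed
  then show ?thesis by (simp add: smooth_def)
qed

abbreviation "step \<equiv> exp_bump 0"

lemma step_nonneg: "step s \<ge> 0" and step_le_1: "step s \<le> 1"
  and step_pos_iff: "step s > 0 \<longleftrightarrow> s > 0" and step_zero: "s \<le> 0 \<Longrightarrow> step s = 0"
  by (auto simp: exp_bump_def)

text \<open>Dilation sharpens the smooth step to a Heaviside function without enlarging its support.
  The limit at 0 is 0, which is why open boxes appear in \<open>box_bump_tendsto\<close>.\<close>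

lemma step_tendsto: "(\<lambda>j. step (real j * s)) \<longlonglongrightarrow> (if s > 0 then 1 else 0)"
proof (cases "s > 0")
  case True
  have "(\<lambda>j. exp (- ((1 / s) * (1 / real j)))) \<longlonglongrightarrow> exp (- ((1 / s) * 0))"
    by (intro tendsto_intros lim_1_over_n)
  then have "(\<lambda>j. step (real j * s)) \<longlonglongrightarrow> exp (- ((1 / s) * 0))"
    by (rule Lim_transform_eventually)
      (use True in \<open>auto simp: exp_bump_def eventually_sequentially intro!: exI[of _ 1]\<close>)
  then show ?thesis using True by simp
next
  case False
  then have "step (real j * s) = 0" for j
    by (intro step_zero) (simp add: mult_nonneg_nonpos)
  with False show ?thesis by simp
qed

text \<open>One rising and one falling step per coordinate. The support stays in the closed box for
  every \<open>j\<close> while the limit is the indicator of the open box, so integrals over boxes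
  are limits of integrals against test functions.\<close>

definition box_bump :: "'a::euclidean_space \<Rightarrow> 'a \<Rightarrow> nat \<Rightarrow> 'a \<Rightarrow> real" where
  "box_bump a b j x =
     (\<Prod>i\<in>Basis. step (real j * (x \<bullet> i - a \<bullet> i)) * step (real j * (b \<bullet> i - x \<bullet> i)))"

lemma smooth_box_bump: "smooth (box_bump a b j)"
proof -
  have "smooth (\<lambda>x. step (- (real j * (a \<bullet> i)) + real j * (x \<bullet> i)))"
    and "smooth (\<lambda>x. step (real j * (b \<bullet> i) + (- real j * (x \<bullet> i))))" for i
    by (intro smooth_affine smooth_exp_bump bounded_linear_mult_const bounded_linear_const_mult
         bounded_linear_inner_left)+
  then show ?thesis
    unfolding box_bump_def[abs_def]
    by (intro smooth_prod smooth_mult) (simp_all add: algebra_simps)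
qed

lemma box_bump_nonneg: "box_bump a b j x \<ge> 0" and box_bump_le_1: "box_bump a b j x \<le> 1"
  unfolding box_bump_def
  by (auto intro!: prod_nonneg prod_le_1 mult_nonneg_nonneg mult_le_one step_nonneg step_le_1)

lemma box_bump_zero:
  assumes "x \<notin> cbox a b" shows "box_bump a b j x = 0"
proof -
  obtain i where i: "i \<in> Basis" "x \<bullet> i < a \<bullet> i \<or> b \<bullet> i < x \<bullet> i"
    using assms by (auto simp: mem_box not_le)
  then have "step (real j * (x \<bullet> i - a \<bullet> i)) * step (real j * (b \<bullet> i - x \<bullet> i)) = 0"
    by (auto intro!: step_zero simp: mult_nonneg_nonpos)
  then show ?thesis
    using i unfolding box_bump_def by (intro prod_zero) auto
qed

lemma box_bump_test: "cbox a b \<subseteq> U \<Longrightarrow> box_bump a b j \<in> test_functions U"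
  by (rule test_functionsI[of _ "cbox a b"]) (auto intro: smooth_box_bump box_bump_zero)

lemma box_bump_tendsto: "(\<lambda>j. box_bump a b j x) \<longlonglongrightarrow> indicator (box a b) x"
proof -
  have "(\<lambda>j. box_bump a b j x) \<longlonglongrightarrow> (\<Prod>i\<in>Basis. (if x \<bullet> i - a \<bullet> i > 0 then 1 else 0) * (if b \<bullet> i - x \<bullet> i > 0 then 1 else 0))"
    unfolding box_bump_def by (intro tendsto_prod tendsto_mult step_tendsto)
  also have "(\<Prod>i\<in>Basis. (if x \<bullet> i - a \<bullet> i > 0 then 1 else 0) * (if b \<bullet> i - x \<bullet> i > 0 then 1 else (0::real))) = indicator (box a b) x"
  proof (cases "x \<in> box a b")
    case True
    then show ?thesis by (auto simp: mem_box intro!: prod.neutral)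
  next
    case False
    then obtain i where "i \<in> Basis" "\<not> (x \<bullet> i - a \<bullet> i > 0 \<and> b \<bullet> i - x \<bullet> i > 0)" by (auto simp: mem_box)
    then show ?thesis using False by (auto intro!: prod_zero bexI[of _ i])
  qed
  finally show ?thesis .
qed

lemma cutoff_exists:
  obtains h :: "real \<Rightarrow> real" where "smooth h" "\<And>s. 0 \<le> h s" "\<And>s. h s \<le> 1"
    "\<And>s. \<bar>s\<bar> \<le> 1 \<Longrightarrow> h s = 1" "\<And>s. \<bar>s\<bar> \<ge> 2 \<Longrightarrow> h s = 0"
proof -
  \<comment> \<open>The two steps are positive for s < 2 and for s > 1, so the denominator never
    vanishes. The quotient is 1 for s \<le> 1 and 0 for s \<ge> 2; its product with its reflection
    is the two-sided cutoff.\<close>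
  define q where "q s = step (2 - s) * inverse (step (2 - s) + step (s - 1))" for s
  have pos: "step (2 - s) + step (s - 1) > 0" for s
    using step_pos_iff[of "2 - s"] step_pos_iff[of "s - 1"] step_nonneg[of "2 - s"] step_nonneg[of "s - 1"]
    by (cases "s < 2") linarith+
  have s1: "smooth (\<lambda>s. step (2 + (- 1) * s))" and s2: "smooth (\<lambda>s. step (- 1 + 1 * s))"
    by (intro smooth_affine smooth_exp_bump bounded_linear_mult_right)+
  have sq: "smooth q"
    unfolding q_def[abs_def]
    using pos s1 s2 by (intro smooth_mult smooth_inverse smooth_add) (auto simp: less_imp_neq[symmetric])
  have sq': "smooth (\<lambda>s. q (0 + (- 1) * s))"
    by (intro smooth_affine sq bounded_linear_mult_right)
  have q01: "0 \<le> q s" "q s \<le> 1" for s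
    using pos[of s] step_nonneg[of "2 - s"] step_nonneg[of "s - 1"] by (auto simp: q_def field_simps)
  have q1: "q s = 1" if "s \<le> 1" for s
    using that pos[of s] step_zero[of "s - 1"] by (auto simp: q_def)
  have q0: "q s = 0" if "s \<ge> 2" for s
    using that step_zero[of "2 - s"] by (auto simp: q_def)
  show ?thesis
  proof (rule that[of "\<lambda>s. q s * q (- s)"])
    show "smooth (\<lambda>s. q s * q (- s))" using smooth_mult[OF sq sq'] by simp
    show "q s * q (- s) = 0" if "\<bar>s\<bar> \<ge> 2" for s
      using that q0[of s] q0[of "-s"] by (cases "s \<ge> 0") auto
  qed (auto intro!: q01 mult_le_one mult_nonneg_nonneg simp: q1)
qed

section \<open>Uniqueness of weak gradients\<close>

lemma LINT_lebesgue_on: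
  fixes f :: "'a::euclidean_space \<Rightarrow> real"
  assumes "U \<in> sets lebesgue"
  shows "(LINT x:U|lebesgue. f x) = integral\<^sup>L (lebesgue_on U) f"
  using assms by (simp add: set_lebesgue_integral_def integral_restrict_space)

text \<open>Boxes form an intersection-stable generator of the Borel sets, and the Borel sets over
  which a fixed integrable function integrates to zero form a Dynkin system. The passage to a Borel
  representative comes first because the induction runs over Borel sets.\<close>

lemma AE_zero_if_box_integrals_zero:
  fixes G :: "'a::euclidean_space \<Rightarrow> real"
  assumes G: "integrable lebesgue G" and z: "\<And>a b. (LINT x:box a b|lebesgue. G x) = 0"
  shows "AE x in lebesgue. G x = 0"
proof -
  obtain g where g[measurable]: "g \<in> borel_measurable lborel" and ae: "AE x in lborel. G x = g x"
    using completion_ex_borel_measurable_real[of G lborel] G by auto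
  have ae': "AE x in lebesgue. G x = g x" using ae by (rule AE_completion)
  have gi: "integrable lborel g"
  proof -
    have "integrable lebesgue g"
      using G ae' borel_measurable_integrable[OF G]
      by (subst (asm) integrable_cong_AE) (auto intro: measurable_completion)
    then show ?thesis by (simp add: integrable_completion)
  qed
  have si: "set_integrable lborel A g" if "A \<in> sets borel" for A
    unfolding set_integrable_def using gi that by (intro integrable_mult_indicator) auto
  have gb: "(LINT x:box a b|lborel. g x) = 0" for a b
  proof -
    have "(LINT x:box a b|lborel. g x) = (LINT x:box a b|lebesgue. g x)"
      unfolding set_lebesgue_integral_def by (subst integral_completion) auto
    also have "\<dots> = (LINT x:box a b|lebesgue. G x)"
      unfolding set_lebesgue_integral_def
    proof (intro integral_cong_AE)
      show "(\<lambda>x. indicator (box a b) x *\<^sub>R g x) \<in> borel_measurable lebesgue"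
        by (intro measurable_completion) simp
      show "(\<lambda>x. indicator (box a b) x *\<^sub>R G x) \<in> borel_measurable lebesgue"
        using borel_measurable_integrable[OF G] by (intro borel_measurable_scaleR borel_measurable_indicator) auto
    qed (use ae' in auto)
    finally show ?thesis using z by simp
  qed
  \<comment> \<open>The total integral is what the complement case of the Dynkin induction needs; it
    is the limit of the integrals over centred boxes.\<close>
  have gU: "(LINT x|lborel. g x) = 0"
  proof -
    have "(\<lambda>n. LINT x|lborel. indicator (box (- real n *\<^sub>R One) (real n *\<^sub>R One)) x *\<^sub>R g x) \<longlonglongrightarrow> (LINT x|lborel. g x)"
    proof (rule integral_dominated_convergence[where w="\<lambda>x. norm (g x)"])
      show "AE x in lborel. (\<lambda>n. indicator (box (- real n *\<^sub>R One) (real n *\<^sub>R One)) x *\<^sub>R g x) \<longlonglongrightarrow> g x"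
      proof (rule AE_I2)
        fix x :: 'a
        obtain N :: nat where N: "norm x < N" using reals_Archimedean2 by blast
        have "x \<in> box (- real n *\<^sub>R One) (real n *\<^sub>R One)" if "n \<ge> N" for n
        proof -
          have "\<bar>x \<bullet> i\<bar> < n" if "i \<in> Basis" for i
            using Basis_le_norm[OF that, of x] N \<open>n \<ge> N\<close> by linarith
          then show ?thesis by (force simp: mem_box abs_less_iff)
        qed
        then show "(\<lambda>n. indicator (box (- real n *\<^sub>R One) (real n *\<^sub>R One)) x *\<^sub>R g x) \<longlonglongrightarrow> g x"
          by (intro tendsto_eventually) (auto simp: eventually_sequentially intro!: exI[of _ N])
      qed
    qed (use gi in \<open>auto simp: indicator_def\<close>)
    moreover have "(LINT x|lborel. indicator (box (- real n *\<^sub>R One) (real n *\<^sub>R One)) x *\<^sub>R g x) = 0" for n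
      using gb by (simp add: set_lebesgue_integral_def)
    ultimately show ?thesis by (simp add: LIMSEQ_const_iff)
  qed
  have "(LINT x:A|lborel. g x) = 0" if "A \<in> sets borel" for A
  proof -
    let ?E = "range (\<lambda>(a, b). box a b :: 'a set)"
    have "Int_stable ?E"
    proof (rule Int_stableI, clarify)
      fix a b c d :: 'a
      show "box a b \<inter> box c d \<in> ?E"
        unfolding box_Int_box by (rule range_eqI[where x="(_, _)"]) simp
    qed
    moreover have "?E \<subseteq> Pow UNIV" by simp
    moreover have "A \<in> sigma_sets UNIV ?E"
      using that by (subst (asm) borel_eq_box) (simp add: sets_measure_of)
    ultimately show ?thesis
    proof (induction rule: sigma_sets_induct_disjoint)
      case (basic A)
      then show ?case using gb by auto
    next
      case empty
      then show ?case by (simp add: set_lebesgue_integral_def)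
    next
      case (compl A)
      then have A: "A \<in> sets borel"
        by (subst borel_eq_box) (simp add: sets_measure_of)
      have "(LINT x:A \<union> (UNIV - A)|lborel. g x) = (LINT x:A|lborel. g x) + (LINT x:UNIV - A|lborel. g x)"
        using A by (intro set_integral_Un si) auto
      then show ?case using compl gU by (simp add: set_lebesgue_integral_def)
    next
      case (union A)
      have A: "A i \<in> sets borel" for i
        using union(2) by (subst borel_eq_box) (auto simp: sets_measure_of)
      have "(LINT x:(\<Union>i. A i)|lborel. g x) = (\<Sum>i. LINT x:A i|lborel. g x)"
        using A union(1) by (intro lebesgue_integral_countable_add si) (auto simp: disjoint_family_on_def)
      then show ?case using union by simp
    qed
  qed
  then have "AE x in lborel. g x = 0"
    using gi by (intro density_unique_real) (auto simp: set_lebesgue_integral_def)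
  then have "AE x in lebesgue. g x = 0" by (rule AE_completion)
  with ae' show ?thesis by auto
qed

text \<open>Testing with \<open>box_bump\<close> gives zero integrals over all boxes whose closed
  box lies in \<open>U\<close>, hence f = 0 almost everywhere in each of them, and countably many of
  them cover \<open>U\<close>.\<close>

lemma du_bois_reymond:
  fixes f :: "'a::euclidean_space \<Rightarrow> real"
  assumes U: "open U" and f: "locally_integrable_on U f"
    and z: "\<And>\<phi>. \<phi> \<in> test_functions U \<Longrightarrow> (LINT x:U|lebesgue. f x * \<phi> x) = 0"
  shows "AE x in lebesgue_on U. f x = 0"
proof -
  have fc: "integrable lebesgue (\<lambda>x. indicator (cbox c d) x * f x)" if "cbox c d \<subseteq> U" for c d
    using f that by (force simp: locally_integrable_on_def set_integrable_def)
  have box0: "(LINT x:box a b|lebesgue. f x) = 0" if ab: "cbox a b \<subseteq> U" for a b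
  proof -
    have fm: "(\<lambda>x. indicator (cbox a b) x * f x) \<in> borel_measurable lebesgue"
      using fc[OF ab] by auto
    have eq: "indicator U x *\<^sub>R (f x * box_bump a b j x) = (indicator (cbox a b) x * f x) * box_bump a b j x" for x j
      using ab box_bump_zero[of x a b j] by (auto simp: indicator_def)
    have "(\<lambda>j. LINT x:U|lebesgue. f x * box_bump a b j x) \<longlonglongrightarrow> (LINT x:box a b|lebesgue. f x)"
      unfolding set_lebesgue_integral_def eq
    proof (rule integral_dominated_convergence[where w="\<lambda>x. norm (indicator (cbox a b) x * f x)"])
      have bm: "box_bump a b j \<in> borel_measurable lebesgue" for j
        using smooth_continuous[OF smooth_box_bump] borel_measurable_continuous_onI measurable_completion
        by (metis measurable_lborel2)
      show "(\<lambda>x. indicator (cbox a b) x * f x * box_bump a b j x) \<in> borel_measurable lebesgue" for j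
        using fm bm by (rule borel_measurable_times)
      have "(\<lambda>x. indicator (box a b) x * (indicator (cbox a b) x * f x)) \<in> borel_measurable lebesgue"
        by (intro borel_measurable_times fm borel_measurable_indicator) auto
      moreover have "(\<lambda>x. indicator (box a b) x * (indicator (cbox a b) x * f x)) = (\<lambda>x. indicator (box a b) x *\<^sub>R f x)"
        using box_subset_cbox by (auto simp: fun_eq_iff indicator_def)
      ultimately show "(\<lambda>x. indicator (box a b) x *\<^sub>R f x) \<in> borel_measurable lebesgue" by simp
      show "AE x in lebesgue. (\<lambda>j. indicator (cbox a b) x * f x * box_bump a b j x) \<longlonglongrightarrow> indicator (box a b) x *\<^sub>R f x"
      proof (rule AE_I2)
        fix x
        have "(\<lambda>j. indicator (cbox a b) x * f x * box_bump a b j x) \<longlonglongrightarrow> indicator (cbox a b) x * f x * indicator (box a b) x"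
          by (intro tendsto_intros box_bump_tendsto)
        moreover have "indicator (cbox a b) x * f x * indicator (box a b) x = indicator (box a b) x *\<^sub>R f x"
          using box_subset_cbox by (auto simp: indicator_def)
        ultimately show "(\<lambda>j. indicator (cbox a b) x * f x * box_bump a b j x) \<longlonglongrightarrow> indicator (box a b) x *\<^sub>R f x" by simp
      qed
      show "AE x in lebesgue. norm (indicator (cbox a b) x * f x * box_bump a b j x) \<le> norm (indicator (cbox a b) x * f x)" for j
        by (simp add: abs_mult box_bump_nonneg box_bump_le_1 mult_left_le)
    qed (use fc[OF ab] in auto)
    then show ?thesis using z[OF box_bump_test[OF ab]] by (simp add: LIMSEQ_const_iff)
  qed
  \<comment> \<open>Truncated to one box, the function has zero integral over every box, since the
    intersection of two boxes is again a box.\<close>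
  have ae: "AE x in lebesgue. x \<in> box c d \<longrightarrow> f x = 0" if cd: "cbox c d \<subseteq> U" for c d
  proof -
    let ?G = "\<lambda>x. indicator (box c d) x *\<^sub>R (indicator (cbox c d) x * f x)"
    have "AE x in lebesgue. ?G x = 0"
    proof (rule AE_zero_if_box_integrals_zero)
      show "integrable lebesgue ?G"
        using fc[OF cd] by (intro integrable_mult_indicator) auto
      fix a b :: 'a
      obtain a' b' where ab: "box a b \<inter> box c d = box a' b'" by (simp add: box_Int_box)
      have "indicator (box a b) x *\<^sub>R ?G x = indicator (box a' b') x *\<^sub>R f x" for x
        using box_subset_cbox[of c d] by (auto simp: indicator_def ab[symmetric])
      then have e: "(LINT x:box a b|lebesgue. ?G x) = (LINT x:box a' b'|lebesgue. f x)"
        unfolding set_lebesgue_integral_def by presburger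
      show "(LINT x:box a b|lebesgue. ?G x) = 0"
      proof (cases "box a' b' = {}")
        case True
        then show ?thesis using e by (simp add: set_lebesgue_integral_def)
      next
        case False
        then have "cbox a' b' = closure (box a' b')" by (simp add: closure_box)
        also have "\<dots> \<subseteq> closure (box c d)" using ab by (intro closure_mono) auto
        also have "\<dots> \<subseteq> cbox c d" by (intro closure_minimal box_subset_cbox closed_cbox)
        finally show ?thesis using cd e box0 by auto
      qed
    qed
    then show ?thesis
      by eventually_elim (use box_subset_cbox[of c d] in \<open>auto simp: indicator_def\<close>)
  qed
  obtain D :: "('a \<times> 'a) set" where D: "countable D" "\<And>z. z \<in> D \<Longrightarrow> cbox (fst z) (snd z) \<subseteq> U" "U \<subseteq> (\<Union>z\<in>D. box (fst z) (snd z))"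
  proof -
    have ex: "\<exists>\<D>. \<D> \<subseteq> {C. C \<noteq> {} \<and> (\<exists>a b. C = box a b \<and> cbox a b \<subseteq> U)} \<and> countable \<D> \<and> \<Union>\<D> = U"
    proof -
      let ?F = "{C. C \<noteq> {} \<and> (\<exists>a b. C = box a b \<and> cbox a b \<subseteq> U)}"
      have "\<Union>?F = U"
      proof
        show "\<Union>?F \<subseteq> U" using box_subset_cbox by blast
        show "U \<subseteq> \<Union>?F"
        proof
          fix x assume "x \<in> U"
          then obtain a b where "x \<in> box a b" "cbox a b \<subseteq> U"
            using U by (meson open_contains_cbox)
          then show "x \<in> \<Union>?F" by blast
        qed
      qed
      moreover obtain \<D> where "\<D> \<subseteq> ?F" "countable \<D>" "\<Union>\<D> = \<Union>?F"
        using Lindelof[of ?F] by (auto simp: open_box)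
      ultimately show ?thesis by auto
    qed
    then obtain \<D> where \<D>: "\<D> \<subseteq> {C. C \<noteq> {} \<and> (\<exists>a b. C = box a b \<and> cbox a b \<subseteq> U)}" "countable \<D>" "\<Union>\<D> = U" by blast
    then have "\<forall>C\<in>\<D>. \<exists>z. C = box (fst z) (snd z) \<and> cbox (fst z) (snd z) \<subseteq> U" by fastforce
    then obtain zf where zf: "\<forall>C\<in>\<D>. C = box (fst (zf C)) (snd (zf C)) \<and> cbox (fst (zf C)) (snd (zf C)) \<subseteq> U"
      by metis
    show ?thesis
    proof (rule that[of "zf ` \<D>"])
      show "countable (zf ` \<D>)" using \<D> by simp
      show "cbox (fst z) (snd z) \<subseteq> U" if "z \<in> zf ` \<D>" for z using zf that by auto
      have "C \<subseteq> (\<Union>z\<in>zf ` \<D>. box (fst z) (snd z))" if "C \<in> \<D>" for C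
        using zf that by force
      then show "U \<subseteq> (\<Union>z\<in>zf ` \<D>. box (fst z) (snd z))" using \<D>(3) by blast
    qed
  qed
  have "AE x in lebesgue. \<forall>z\<in>D. x \<in> box (fst z) (snd z) \<longrightarrow> f x = 0"
    by (rule AE_ball_countable[THEN iffD2]) (use D ae in auto)
  then have "AE x in lebesgue. x \<in> U \<longrightarrow> f x = 0"
    by eventually_elim (use D(3) in blast)
  then show ?thesis
    using U by (subst AE_restrict_space_iff) auto
qed

section \<open>Integration by parts and weak gradients\<close>

text \<open>The gradient is a parameter and only its continuity is asked for. Besides test functions
  this admits a test function multiplied by a C^1 function of another one, which need not be smooth
  and still has to be integrated by parts.\<close>

definition C1_compact :: "('a::euclidean_space \<Rightarrow> real) \<Rightarrow> ('a \<Rightarrow> 'a) \<Rightarrow> 'a set \<Rightarrow> bool" where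
  "C1_compact f Df K \<longleftrightarrow> (\<forall>x. (f has_derivative (\<lambda>h. Df x \<bullet> h)) (at x)) \<and> continuous_on UNIV Df \<and>
     compact K \<and> (\<forall>x. x \<notin> K \<longrightarrow> f x = 0 \<and> Df x = 0)"

lemma C1_compact_continuous: "C1_compact f Df K \<Longrightarrow> continuous_on UNIV f"
  unfolding C1_compact_def by (meson continuous_at_imp_continuous_on has_derivative_continuous)

lemma C1_compact_bounds:
  assumes "C1_compact f Df K"
  obtains B where "B \<ge> 0" "\<And>x. \<bar>f x\<bar> \<le> B" "\<And>x. norm (Df x) \<le> B"
proof -
  have "compact (f ` K)" "compact (Df ` K)"
    using assms C1_compact_continuous[OF assms]
    by (auto simp: C1_compact_def intro!: compact_continuous_image intro: continuous_on_subset)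
  then obtain B1 B2 where B: "\<And>x. x \<in> K \<Longrightarrow> \<bar>f x\<bar> \<le> B1" "\<And>x. x \<in> K \<Longrightarrow> norm (Df x) \<le> B2"
    by (force dest!: compact_imp_bounded simp: bounded_iff)
  have "\<bar>f x\<bar> \<le> max 0 (max B1 B2)" "norm (Df x) \<le> max 0 (max B1 B2)" for x
    using assms B[of x] by (cases "x \<in> K"; force simp: C1_compact_def)+
  then show ?thesis using that[of "max 0 (max B1 B2)"] by auto
qed

lemma C1_compact_lipschitz:
  assumes "C1_compact f Df K" "\<And>x. norm (Df x) \<le> B"
  shows "\<bar>f y - f x\<bar> \<le> B * norm (y - x)"
proof -
  have "norm (f y - f x) \<le> B * norm (y - x)"
  proof (rule differentiable_bound[of UNIV f "\<lambda>x h. Df x \<bullet> h"])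
    show "onorm (\<lambda>h. Df x \<bullet> h) \<le> B" for x
      by (rule onorm_le[THEN order_trans[OF _ order_refl]])
        (metis Cauchy_Schwarz_ineq2 assms(2) mult_right_mono norm_ge_zero order_trans real_norm_def)
  qed (use assms in \<open>auto simp: C1_compact_def\<close>)
  then show ?thesis by simp
qed

lemma borel_measurable_lebesgue_continuous:
  fixes f :: "'a::euclidean_space \<Rightarrow> 'b::euclidean_space"
  shows "continuous_on UNIV f \<Longrightarrow> f \<in> borel_measurable lebesgue"
  by (intro measurable_completion) (simp add: borel_measurable_continuous_onI)

section \<open>Derivatives of integrals under translation\<close>

lemma C1_compact_shift:
  assumes "C1_compact f Df K"
  shows "C1_compact (\<lambda>x. f (x - h)) (\<lambda>x. Df (x - h)) ((+) h ` K)"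
proof -
  have "((\<lambda>x. f (x - h)) has_derivative (\<lambda>k. Df (x - h) \<bullet> k)) (at x)" for x
    using assms by (auto simp: C1_compact_def intro!: has_derivative_compose[of "\<lambda>x. x - h" "\<lambda>k. k" x UNIV f] derivative_eq_intros)
  moreover have "continuous_on UNIV (\<lambda>x. Df (x - h))"
    using assms by (auto simp: C1_compact_def intro!: continuous_on_compose2[of UNIV Df] continuous_intros)
  moreover have "x - h \<notin> K" if "x \<notin> (+) h ` K" for x
    using that by (metis add.commute diff_add_cancel image_eqI)
  ultimately show ?thesis
    using assms by (auto simp: C1_compact_def compact_translation)
qed

text \<open>Differentiation under the integral sign: the difference quotients of \<phi> are bounded
  by its Lipschitz constant and live in a common ball, so dominated convergence applies. The choice
  f = 1 yields integration by parts, a general \<open>f\<close> yields translation invariance of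
  functions with vanishing weak gradient.\<close>

lemma integral_shift_has_derivative_0:
  fixes \<phi> :: "'a::euclidean_space \<Rightarrow> real"
  assumes \<phi>: "C1_compact \<phi> D K" and f: "f \<in> borel_measurable lebesgue" "\<And>x. \<bar>f x\<bar> \<le> B"
  shows "((\<lambda>t. LINT x|lebesgue. f x * \<phi> (x - t *\<^sub>R h)) has_real_derivative
            - (LINT x|lebesgue. f x * (D x \<bullet> h))) (at 0)"
proof -
  obtain L where L: "L \<ge> 0" "\<And>x. \<bar>\<phi> x\<bar> \<le> L" "\<And>x. norm (D x) \<le> L"
    using C1_compact_bounds[OF \<phi>] by blast
  have B: "B \<ge> 0" using f(2)[of 0] by linarith
  obtain R where R: "\<And>x. x \<in> K \<Longrightarrow> norm x \<le> R"
    using \<phi> compact_imp_bounded[of K] unfolding C1_compact_def bounded_iff by blast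
  have \<phi>m: "(\<lambda>x. \<phi> (x - a)) \<in> borel_measurable lebesgue" for a
    using C1_compact_continuous[OF C1_compact_shift[OF \<phi>]] by (rule borel_measurable_lebesgue_continuous)
  have Dm: "(\<lambda>x. D x \<bullet> h) \<in> borel_measurable lebesgue"
    using \<phi> by (intro borel_measurable_lebesgue_continuous continuous_intros) (auto simp: C1_compact_def)
  have int: "integrable lebesgue (\<lambda>x. f x * \<phi> (x - a))" for a
  proof (rule Bochner_Integration.integrable_bound)
    show "integrable lebesgue (\<lambda>x. (B * L) * indicator (cball 0 (R + norm a)) x)"
      using lmeasurable_cball by (auto simp: fmeasurable_def intro!: integrable_mult_right integrable_real_indicator)
    show "AE x in lebesgue. norm (f x * \<phi> (x - a)) \<le> norm (B * L * indicator (cball 0 (R + norm a)) x)"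
    proof (rule AE_I2)
      fix x
      show "norm (f x * \<phi> (x - a)) \<le> norm (B * L * indicator (cball 0 (R + norm a)) x)"
      proof (cases "x - a \<in> K")
        case True
        then have "norm x \<le> R + norm a" using R[OF True] norm_triangle_sub[of x a] by linarith
        then show ?thesis using L f(2)[of x] L(2)[of "x - a"] B by (auto simp: abs_mult intro!: mult_mono)
      next
        case False
        then show ?thesis using \<phi> B L by (auto simp: C1_compact_def)
      qed
    qed
  qed (use f \<phi>m in auto)
  have "((\<lambda>t. ((LINT x|lebesgue. f x * \<phi> (x - (0 + t) *\<^sub>R h)) - (LINT x|lebesgue. f x * \<phi> (x - 0 *\<^sub>R h))) / t)
          \<longlongrightarrow> - (LINT x|lebesgue. f x * (D x \<bullet> h))) (at 0)"
    unfolding tendsto_at_iff_sequentially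
  proof (intro allI impI)
    fix X :: "nat \<Rightarrow> real" assume X: "\<forall>i. X i \<in> UNIV - {0}" "X \<longlonglongrightarrow> 0"
    \<comment> \<open>A null sequence is bounded, so all shifted supports lie in the ball of radius
      \<open>R + b * norm h\<close>, on which the majorant lives.\<close>
    obtain b where b: "\<And>n. \<bar>X n\<bar> \<le> b"
      using convergent_imp_Bseq[of X] X(2) by (auto simp: Bseq_def convergent_def)
    have "(\<lambda>n. LINT x|lebesgue. f x * ((\<phi> (x - X n *\<^sub>R h) - \<phi> x) / X n)) \<longlonglongrightarrow> (LINT x|lebesgue. f x * (- (D x \<bullet> h)))"
    proof (rule integral_dominated_convergence[where w="\<lambda>x. (B * (L * norm h)) * indicator (cball 0 (R + b * norm h)) x"])
      show "integrable lebesgue (\<lambda>x. (B * (L * norm h)) * indicator (cball 0 (R + b * norm h)) x)"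
        using lmeasurable_cball by (auto simp: fmeasurable_def intro!: integrable_mult_right integrable_real_indicator)
      show "(\<lambda>x. f x * (- (D x \<bullet> h))) \<in> borel_measurable lebesgue"
        using f Dm by simp
      show "(\<lambda>x. f x * ((\<phi> (x - X n *\<^sub>R h) - \<phi> x) / X n)) \<in> borel_measurable lebesgue" for n
        using f \<phi>m[of "X n *\<^sub>R h"] \<phi>m[of 0] by simp
      show "AE x in lebesgue. (\<lambda>n. f x * ((\<phi> (x - X n *\<^sub>R h) - \<phi> x) / X n)) \<longlonglongrightarrow> f x * (- (D x \<bullet> h))"
      proof (rule AE_I2)
        fix x
        have d: "((\<lambda>t. x - t *\<^sub>R h) has_derivative (\<lambda>t. - (t *\<^sub>R h))) (at 0)"
          by (auto intro!: derivative_eq_intros)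
        have "((\<lambda>t. \<phi> (x - t *\<^sub>R h)) has_derivative (\<lambda>t. D x \<bullet> (- (t *\<^sub>R h)))) (at 0)"
          using has_derivative_compose[OF d, of \<phi> "\<lambda>h. D x \<bullet> h"] \<phi> by (simp add: C1_compact_def)
        then have "((\<lambda>t. \<phi> (x - t *\<^sub>R h)) has_real_derivative - (D x \<bullet> h)) (at 0)"
          unfolding has_field_derivative_def by (rule has_derivative_eq_rhs) (auto simp: mult.commute)
        then have "((\<lambda>t. (\<phi> (x - t *\<^sub>R h) - \<phi> x) / t) \<longlongrightarrow> - (D x \<bullet> h)) (at 0)"
          by (simp add: DERIV_def)
        then have "(\<lambda>n. (\<phi> (x - X n *\<^sub>R h) - \<phi> x) / X n) \<longlonglongrightarrow> - (D x \<bullet> h)"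
          using X unfolding tendsto_at_iff_sequentially by (auto simp: o_def)
        then show "(\<lambda>n. f x * ((\<phi> (x - X n *\<^sub>R h) - \<phi> x) / X n)) \<longlonglongrightarrow> f x * (- (D x \<bullet> h))"
          by (intro tendsto_intros)
      qed
      show "AE x in lebesgue. norm (f x * ((\<phi> (x - X n *\<^sub>R h) - \<phi> x) / X n))
          \<le> (B * (L * norm h)) * indicator (cball 0 (R + b * norm h)) x" for n
      proof (rule AE_I2)
        fix x
        have Xn: "X n \<noteq> 0" using X by auto
        show "norm (f x * ((\<phi> (x - X n *\<^sub>R h) - \<phi> x) / X n))
          \<le> (B * (L * norm h)) * indicator (cball 0 (R + b * norm h)) x"
        proof (cases "x \<in> cball 0 (R + b * norm h)")
          case True
          have "\<bar>\<phi> (x - X n *\<^sub>R h) - \<phi> x\<bar> \<le> L * (\<bar>X n\<bar> * norm h)"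
            using C1_compact_lipschitz[OF \<phi> L(3), of "x - X n *\<^sub>R h" x] by simp
          then have "\<bar>(\<phi> (x - X n *\<^sub>R h) - \<phi> x) / X n\<bar> \<le> L * norm h"
            using Xn by (simp add: field_simps)
          then show ?thesis
            using True f(2)[of x] B unfolding norm_mult by (auto simp del: abs_divide intro!: mult_mono)
        next
          case False
          have "\<bar>X n\<bar> * norm h \<le> b * norm h" using b[of n] by (intro mult_right_mono) auto
          moreover have "0 \<le> \<bar>X n\<bar> * norm h" by simp
          ultimately have "R < norm x" "R < norm (x - X n *\<^sub>R h)"
            using False norm_triangle_ineq2[of x "X n *\<^sub>R h"] unfolding mem_cball_0 norm_scaleR
            by linarith+
          then have "x \<notin> K" "x - X n *\<^sub>R h \<notin> K" using R by force+
          then show ?thesis using \<phi> False by (simp add: C1_compact_def)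
        qed
      qed
    qed
    moreover have "(LINT x|lebesgue. f x * ((\<phi> (x - X n *\<^sub>R h) - \<phi> x) / X n)) =
        ((LINT x|lebesgue. f x * \<phi> (x - (0 + X n) *\<^sub>R h)) - (LINT x|lebesgue. f x * \<phi> (x - 0 *\<^sub>R h))) / X n" for n
    proof -
      have "(LINT x|lebesgue. f x * ((\<phi> (x - X n *\<^sub>R h) - \<phi> x) / X n))
          = (LINT x|lebesgue. (f x * \<phi> (x - X n *\<^sub>R h) - f x * \<phi> (x - 0)) / X n)"
        by (intro Bochner_Integration.integral_cong) (auto simp: field_simps)
      also have "\<dots> = ((LINT x|lebesgue. f x * \<phi> (x - X n *\<^sub>R h)) - (LINT x|lebesgue. f x * \<phi> (x - 0))) / X n"
        by (subst integral_divide_zero)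
          (simp only: Bochner_Integration.integral_diff[OF int int])
      finally show ?thesis by simp
    qed
    ultimately show "((\<lambda>t. ((LINT x|lebesgue. f x * \<phi> (x - (0 + t) *\<^sub>R h)) - (LINT x|lebesgue. f x * \<phi> (x - 0 *\<^sub>R h))) / t) \<circ> X) \<longlonglongrightarrow> - (LINT x|lebesgue. f x * (D x \<bullet> h))"
      by (simp only: o_def mult_minus_right Bochner_Integration.integral_minus)
  qed
  then show ?thesis by (simp add: DERIV_def)
qed

lemma integral_shift_has_derivative:
  fixes \<phi> :: "'a::euclidean_space \<Rightarrow> real"
  assumes \<phi>: "C1_compact \<phi> D K" and f: "f \<in> borel_measurable lebesgue" "\<And>x. \<bar>f x\<bar> \<le> B"
  shows "((\<lambda>t. LINT x|lebesgue. f x * \<phi> (x - t *\<^sub>R h)) has_real_derivative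
            - (LINT x|lebesgue. f x * (D (x - s *\<^sub>R h) \<bullet> h))) (at s)"
proof -
  have "((\<lambda>t. LINT x|lebesgue. f x * \<phi> (x - t *\<^sub>R h - s *\<^sub>R h)) has_real_derivative
            - (LINT x|lebesgue. f x * (D (x - s *\<^sub>R h) \<bullet> h))) (at 0)"
    by (rule integral_shift_has_derivative_0[OF C1_compact_shift[OF \<phi>] f])
  then have "((\<lambda>t. LINT x|lebesgue. f x * \<phi> (x - (t + s) *\<^sub>R h)) has_real_derivative
            - (LINT x|lebesgue. f x * (D (x - s *\<^sub>R h) \<bullet> h))) (at 0)"
    by (simp add: scaleR_add_left diff_diff_eq)
  then show ?thesis
    using DERIV_shift[of "\<lambda>t. LINT x|lebesgue. f x * \<phi> (x - t *\<^sub>R h)" _ 0 s] by simp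
qed

lemma integral_lebesgue_translate:
  fixes f :: "'a::euclidean_space \<Rightarrow> real"
  assumes [measurable]: "f \<in> borel_measurable borel"
  shows "(LINT x|lebesgue. f (x + h)) = (LINT x|lebesgue. f x)"
proof -
  have "(LINT x|lebesgue. f x) = (LINT x|lborel. f x)"
    by (rule integral_completion) simp
  also have "\<dots> = (LINT x|distr lborel borel ((+) h). f x)"
    by (subst lborel_distr_plus) simp
  also have "\<dots> = (LINT x|lborel. f (h + x))"
    by (rule integral_distr) auto
  also have "\<dots> = (LINT x|lebesgue. f (x + h))"
    by (simp add: add.commute integral_completion)
  finally show ?thesis by simp
qed

text \<open>The integral of a translate does not depend on the shift, so the derivative in the
  shift, which is minus the integral in question, is zero.\<close>

lemma integral_partial_zero:
  fixes \<phi> :: "'a::euclidean_space \<Rightarrow> real"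
  assumes \<phi>: "C1_compact \<phi> D K"
  shows "(LINT x|lebesgue. D x \<bullet> h) = 0"
proof -
  have "((\<lambda>t. LINT x|lebesgue. 1 * \<phi> (x - t *\<^sub>R h)) has_real_derivative
            - (LINT x|lebesgue. 1 * (D x \<bullet> h))) (at 0)"
    by (rule integral_shift_has_derivative_0[OF \<phi>, of _ 1]) auto
  moreover have "(LINT x|lebesgue. \<phi> (x - t *\<^sub>R h)) = (LINT x|lebesgue. \<phi> x)" for t
    using integral_lebesgue_translate[OF borel_measurable_continuous_onI[OF C1_compact_continuous[OF \<phi>]], of "- (t *\<^sub>R h)"] by simp
  ultimately have "((\<lambda>t::real. LINT x|lebesgue. \<phi> x) has_real_derivative - (LINT x|lebesgue. D x \<bullet> h)) (at 0)"
    by simp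
  then show ?thesis using DERIV_unique[OF _ DERIV_const] by force
qed

lemma C1_compact_mult:
  assumes f: "C1_compact f Df K"
    and g: "\<And>x. (g has_derivative (\<lambda>h. Dg x \<bullet> h)) (at x)" "continuous_on UNIV Dg"
  shows "C1_compact (\<lambda>x. f x * g x) (\<lambda>x. f x *\<^sub>R Dg x + g x *\<^sub>R Df x) K"
proof -
  have "((\<lambda>x. f x * g x) has_derivative (\<lambda>h. (f x *\<^sub>R Dg x + g x *\<^sub>R Df x) \<bullet> h)) (at x)" for x
    using has_derivative_mult[of f "\<lambda>h. Df x \<bullet> h" x UNIV g "\<lambda>h. Dg x \<bullet> h"] f g
    by (auto simp: C1_compact_def inner_add_left mult.commute)
  moreover have "continuous_on UNIV g"
    using g(1) by (meson continuous_at_imp_continuous_on has_derivative_continuous)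
  then have "continuous_on UNIV (\<lambda>x. f x *\<^sub>R Dg x + g x *\<^sub>R Df x)"
    using f g C1_compact_continuous[OF f] by (auto simp: C1_compact_def intro!: continuous_intros)
  ultimately show ?thesis using f by (auto simp: C1_compact_def)
qed

lemma C1_compact_test:
  assumes "\<phi> \<in> test_functions U"
  obtains K where "C1_compact \<phi> (grad \<phi>) K" "K \<subseteq> U"
proof -
  obtain K where K: "smooth \<phi>" "compact K" "K \<subseteq> U" "\<And>x. x \<notin> K \<Longrightarrow> \<phi> x = 0" "\<And>x. x \<notin> K \<Longrightarrow> grad \<phi> x = 0"
    by (rule test_functionsE[OF assms]) blast
  then show ?thesis
    using that[of K] by (auto simp: C1_compact_def smooth_grad continuous_on_grad)
qed

section \<open>Weak gradients: smooth functions, differences, uniqueness\<close>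

lemma locally_integrable_continuous:
  fixes f :: "'a::euclidean_space \<Rightarrow> 'b::euclidean_space"
  assumes "continuous_on UNIV f" shows "locally_integrable_on U f"
  unfolding locally_integrable_on_def set_integrable_def
proof (intro allI impI, elim conjE)
  fix K :: "'a set" assume K: "compact K"
  have "integrable lborel (\<lambda>x. indicator K x *\<^sub>R f x)"
    by (rule borel_integrable_compact[OF K continuous_on_subset[OF assms]]) simp
  then show "integrable lebesgue (\<lambda>x. indicator K x *\<^sub>R f x)"
    using integrable_completion[of "\<lambda>x. indicator K x *\<^sub>R f x" lborel] borel_measurable_integrable by blast
qed

lemma locally_integrable_mult_compact:
  fixes f :: "'a::euclidean_space \<Rightarrow> real"
  assumes f: "locally_integrable_on U f" and \<phi>: "continuous_on UNIV \<phi>" "compact K" "K \<subseteq> U" "\<And>x. x \<notin> K \<Longrightarrow> \<phi> x = 0"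
  shows "integrable lebesgue (\<lambda>x. indicator U x *\<^sub>R (f x * \<phi> x))"
proof -
  have i: "integrable lebesgue (\<lambda>x. indicator K x *\<^sub>R f x)"
    using f \<phi> by (auto simp: locally_integrable_on_def set_integrable_def)
  have "compact (\<phi> ` K)" using \<phi> by (intro compact_continuous_image) (auto intro: continuous_on_subset)
  then have "\<exists>B. \<forall>x\<in>K. \<bar>\<phi> x\<bar> \<le> B"
    by (auto dest!: compact_imp_bounded simp: bounded_iff)
  then obtain B where B: "\<And>x. x \<in> K \<Longrightarrow> \<bar>\<phi> x\<bar> \<le> B" by blast
  have eq: "(\<lambda>x. indicator U x *\<^sub>R (f x * \<phi> x)) = (\<lambda>x. (indicator K x *\<^sub>R f x) * \<phi> x)"
    using \<phi> by (auto simp: fun_eq_iff indicator_def)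
  show ?thesis unfolding eq
  proof (rule Bochner_Integration.integrable_bound[OF integrable_mult_right[OF i, of B]])
    show "(\<lambda>x. (indicator K x *\<^sub>R f x) * \<phi> x) \<in> borel_measurable lebesgue"
      using borel_measurable_integrable[OF i] borel_measurable_lebesgue_continuous[OF \<phi>(1)] by (rule borel_measurable_times)
    show "AE x in lebesgue. norm (indicator K x *\<^sub>R f x * \<phi> x) \<le> norm (B * (indicator K x *\<^sub>R f x))"
    proof (rule AE_I2)
      fix x
      show "norm (indicator K x *\<^sub>R f x * \<phi> x) \<le> norm (B * (indicator K x *\<^sub>R f x))"
        using B[of x] by (cases "x \<in> K") (auto simp: abs_mult mult.commute intro!: mult_mono)
    qed
  qed
qed

text \<open>The gradient of the compactly supported product \<phi> v has integral zero.\<close>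

lemma weak_gradient_smooth:
  fixes v :: "'a::euclidean_space \<Rightarrow> real"
  assumes "smooth v"
  shows "is_weak_gradient U v (grad v)"
  unfolding is_weak_gradient_def
proof (intro conjI ballI)
  show lv: "locally_integrable_on U v"
    by (rule locally_integrable_continuous[OF smooth_continuous[OF assms]])
  show "locally_integrable_on U (grad v)"
    by (rule locally_integrable_continuous[OF continuous_on_grad[OF assms]])
  fix \<phi> b assume \<phi>: "\<phi> \<in> test_functions U" and b: "b \<in> (Basis :: 'a set)"
  obtain K where K: "C1_compact \<phi> (grad \<phi>) K" "K \<subseteq> U" by (rule C1_compact_test[OF \<phi>])
  have Kd: "continuous_on UNIV (\<lambda>x. grad \<phi> x \<bullet> b)" "compact K" "\<And>x. x \<notin> K \<Longrightarrow> \<phi> x = 0"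
    "\<And>x. x \<notin> K \<Longrightarrow> grad \<phi> x = 0"
    using K(1) unfolding C1_compact_def by (auto intro!: continuous_on_inner continuous_on_const)
  have v: "\<And>x. (v has_derivative (\<lambda>h. grad v x \<bullet> h)) (at x)" "continuous_on UNIV (grad v)"
    using assms by (auto intro: smooth_grad continuous_on_grad)
  have 1: "integrable lebesgue (\<lambda>x. indicator U x *\<^sub>R (v x * (grad \<phi> x \<bullet> b)))"
    by (rule locally_integrable_mult_compact[OF lv Kd(1,2) K(2)]) (simp add: Kd)
  have 2: "integrable lebesgue (\<lambda>x. indicator U x *\<^sub>R ((grad v x \<bullet> b) * \<phi> x))"
    by (rule locally_integrable_mult_compact[OF locally_integrable_continuous
          C1_compact_continuous[OF K(1)] Kd(2) K(2) Kd(3)])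
      (intro continuous_on_inner continuous_on_const v)
  have "(LINT x|lebesgue. (\<phi> x *\<^sub>R grad v x + v x *\<^sub>R grad \<phi> x) \<bullet> b) = 0"
    by (rule integral_partial_zero[OF C1_compact_mult[OF K(1) v]])
  also have "(LINT x|lebesgue. (\<phi> x *\<^sub>R grad v x + v x *\<^sub>R grad \<phi> x) \<bullet> b) =
     (LINT x|lebesgue. indicator U x *\<^sub>R (v x * (grad \<phi> x \<bullet> b)) + indicator U x *\<^sub>R ((grad v x \<bullet> b) * \<phi> x))"
  proof (intro Bochner_Integration.integral_cong refl)
    fix x
    have "\<phi> x = 0 \<and> grad \<phi> x = 0" if "x \<notin> U" using that Kd K(2) by blast
    then show "(\<phi> x *\<^sub>R grad v x + v x *\<^sub>R grad \<phi> x) \<bullet> b =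
        indicator U x *\<^sub>R (v x * (grad \<phi> x \<bullet> b)) + indicator U x *\<^sub>R ((grad v x \<bullet> b) * \<phi> x)"
      by (cases "x \<in> U") (auto simp: inner_add_left)
  qed
  also have "\<dots> = (LINT x:U|lebesgue. v x * (grad \<phi> x \<bullet> b)) + (LINT x:U|lebesgue. (grad v x \<bullet> b) * \<phi> x)"
    unfolding set_lebesgue_integral_def by (rule Bochner_Integration.integral_add[OF 1 2])
  finally show "(LINT x:U|lebesgue. v x * frechet_derivative \<phi> (at x) b)
          = - (LINT x:U|lebesgue. (grad v x \<bullet> b) * \<phi> x)"
    using b by (simp add: grad_inner)
qed

lemma weak_gradientD:
  assumes "is_weak_gradient U u g"
  shows "locally_integrable_on U u" "locally_integrable_on U g"
    "\<And>\<phi> b. \<phi> \<in> test_functions U \<Longrightarrow> b \<in> Basis \<Longrightarrow>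
       (LINT x:U|lebesgue. u x * frechet_derivative \<phi> (at x) b)
          = - (LINT x:U|lebesgue. (g x \<bullet> b) * \<phi> x)"
proof -
  note d = assms[unfolded is_weak_gradient_def]
  show "locally_integrable_on U u" by (rule conjunct1[OF d])
  show "locally_integrable_on U g" by (rule conjunct1[OF conjunct2[OF d]])
  show "(LINT x:U|lebesgue. u x * frechet_derivative \<phi> (at x) b) = - (LINT x:U|lebesgue. (g x \<bullet> b) * \<phi> x)"
    if "\<phi> \<in> test_functions U" "b \<in> Basis" for \<phi> b
    by (rule bspec[OF bspec[OF conjunct2[OF conjunct2[OF d]] that(1)] that(2)])
qed

lemma locally_integrable_inner:
  "locally_integrable_on U g \<Longrightarrow> locally_integrable_on U (\<lambda>x. g x \<bullet> b)"
  unfolding locally_integrable_on_def set_integrable_def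
proof (intro allI impI)
  fix K
  assume "\<forall>K. compact K \<and> K \<subseteq> U \<longrightarrow> integrable lebesgue (\<lambda>x. indicat_real K x *\<^sub>R g x)"
    and K: "compact K \<and> K \<subseteq> U"
  then have "integrable lebesgue (\<lambda>x. indicat_real K x *\<^sub>R g x)" by simp
  then have "integrable lebesgue (\<lambda>x. (indicat_real K x *\<^sub>R g x) \<bullet> b)"
    by (intro integrable_inner_left)
  then show "integrable lebesgue (\<lambda>x. indicat_real K x *\<^sub>R (g x \<bullet> b))" by simp
qed

lemma locally_integrable_diff:
  "locally_integrable_on U f \<Longrightarrow> locally_integrable_on U g \<Longrightarrow> locally_integrable_on U (\<lambda>x. f x - g x)"
  unfolding locally_integrable_on_def
proof (intro allI impI)
  fix K
  assume "\<forall>K. compact K \<and> K \<subseteq> U \<longrightarrow> f absolutely_integrable_on K"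
    and "\<forall>K. compact K \<and> K \<subseteq> U \<longrightarrow> g absolutely_integrable_on K" and K: "compact K \<and> K \<subseteq> U"
  then have "f absolutely_integrable_on K" "g absolutely_integrable_on K" by simp_all
  then show "(\<lambda>x. f x - g x) absolutely_integrable_on K" by (rule set_integral_diff(1))
qed

lemma weak_gradient_diff:
  fixes u v :: "'a::euclidean_space \<Rightarrow> real"
  assumes u: "is_weak_gradient U u g" and v: "is_weak_gradient U v g'"
  shows "is_weak_gradient U (\<lambda>x. u x - v x) (\<lambda>x. g x - g' x)"
  unfolding is_weak_gradient_def
proof (intro conjI ballI)
  show "locally_integrable_on U (\<lambda>x. u x - v x)" "locally_integrable_on U (\<lambda>x. g x - g' x)"
    by (intro locally_integrable_diff weak_gradientD[OF u] weak_gradientD[OF v])+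
  fix \<phi> b assume \<phi>: "\<phi> \<in> test_functions U" and b: "b \<in> (Basis :: 'a set)"
  obtain K where K: "C1_compact \<phi> (grad \<phi>) K" "K \<subseteq> U" by (rule C1_compact_test[OF \<phi>])
  have Kd: "continuous_on UNIV (\<lambda>x. grad \<phi> x \<bullet> b)" "compact K" "\<And>x. x \<notin> K \<Longrightarrow> \<phi> x = 0"
    "\<And>x. x \<notin> K \<Longrightarrow> grad \<phi> x = 0"
    using K(1) unfolding C1_compact_def by (auto intro!: continuous_on_inner continuous_on_const)
  have 1: "set_integrable lebesgue U (\<lambda>x. w x * frechet_derivative \<phi> (at x) b)" if "locally_integrable_on U w" for w
    unfolding set_integrable_def grad_inner[OF b, symmetric]
    by (rule locally_integrable_mult_compact[OF that Kd(1,2) K(2)]) (simp add: Kd)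
  have 2: "set_integrable lebesgue U (\<lambda>x. (w x \<bullet> b) * \<phi> x)" if "locally_integrable_on U w" for w
    unfolding set_integrable_def
    by (rule locally_integrable_mult_compact[OF locally_integrable_inner[OF that]
          C1_compact_continuous[OF K(1)] Kd(2) K(2) Kd(3)])
  show "(LINT x:U|lebesgue. (u x - v x) * frechet_derivative \<phi> (at x) b) =
      - (LINT x:U|lebesgue. ((g x - g' x) \<bullet> b) * \<phi> x)"
    unfolding left_diff_distrib inner_diff_left
    by (simp only: set_integral_diff(2)[OF 1[OF weak_gradientD(1)[OF u]] 1[OF weak_gradientD(1)[OF v]]]
        set_integral_diff(2)[OF 2[OF weak_gradientD(2)[OF u]] 2[OF weak_gradientD(2)[OF v]]]
        weak_gradientD(3)[OF u \<phi> b] weak_gradientD(3)[OF v \<phi> b])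
qed

text \<open>The difference of two weak gradients is a weak gradient of u - u, and du Bois-Reymond
  applies to each coordinate. This makes the arbitrary choice inside \<open>weak_grad\<close>
  harmless.\<close>

lemma weak_gradient_unique:
  fixes u :: "'a::euclidean_space \<Rightarrow> real"
  assumes "open U" "is_weak_gradient U u g" "is_weak_gradient U u g'"
  shows "AE x in lebesgue_on U. g x = g' x"
proof -
  have d: "is_weak_gradient U (\<lambda>x. u x - u x) (\<lambda>x. g x - g' x)"
    by (rule weak_gradient_diff[OF assms(2,3)])
  have "AE x in lebesgue_on U. (g x - g' x) \<bullet> b = 0" if b: "b \<in> Basis" for b
  proof (rule du_bois_reymond[OF assms(1)])
    show "locally_integrable_on U (\<lambda>x. (g x - g' x) \<bullet> b)"
      by (rule locally_integrable_inner[OF weak_gradientD(2)[OF d]])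
    fix \<phi> assume "\<phi> \<in> test_functions U"
    then have "(LINT x:U|lebesgue. (u x - u x) * frechet_derivative \<phi> (at x) b)
        = - (LINT x:U|lebesgue. ((g x - g' x) \<bullet> b) * \<phi> x)"
      by (rule weak_gradientD(3)[OF d _ b])
    then show "(LINT x:U|lebesgue. ((g x - g' x) \<bullet> b) * \<phi> x) = 0"
      by (simp add: set_lebesgue_integral_def)
  qed
  then have "AE x in lebesgue_on U. \<forall>b\<in>Basis. (g x - g' x) \<bullet> b = 0"
    by (intro AE_finite_allI) auto
  then show ?thesis
    by eventually_elim (auto simp: euclidean_all_zero_iff)
qed

lemma weak_grad_AE_eq:
  assumes "open U" "is_weak_gradient U u g"
  shows "is_weak_gradient U u (weak_grad U u)" "AE x in lebesgue_on U. weak_grad U u x = g x"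
proof -
  show "is_weak_gradient U u (weak_grad U u)"
    unfolding weak_grad_def by (rule someI[of "is_weak_gradient U u", OF assms(2)])
  then show "AE x in lebesgue_on U. weak_grad U u x = g x"
    by (rule weak_gradient_unique[OF assms(1) _ assms(2)])
qed

lemma weak_grad_smooth:
  assumes "open U" "smooth v" shows "AE x in lebesgue_on U. weak_grad U v x = grad v x"
  by (rule weak_grad_AE_eq(2)[OF assms(1) weak_gradient_smooth[OF assms(2)]])

section \<open>Dominated approximation in Sobolev spaces\<close>

lemma powr_add_le:
  fixes a b p :: real assumes "a \<ge> 0" "b \<ge> 0" "p \<ge> 0"
  shows "(a + b) powr p \<le> 2 powr p * (a powr p + b powr p)"
proof -
  have "(a + b) powr p \<le> (2 * max a b) powr p"
    using assms by (intro powr_mono2) auto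
  also have "\<dots> = 2 powr p * max a b powr p" using assms by (intro powr_mult)
  also have "\<dots> \<le> 2 powr p * (a powr p + b powr p)"
    using assms by (intro mult_left_mono) (auto simp: max_def)
  finally show ?thesis .
qed

lemma integrable_powr_add:
  fixes a b :: "'a \<Rightarrow> real"
  assumes [measurable]: "a \<in> borel_measurable M" "b \<in> borel_measurable M"
    and nn: "\<And>x. a x \<ge> 0" "\<And>x. b x \<ge> 0" and p: "p \<ge> 0"
    and i: "integrable M (\<lambda>x. a x powr p)" "integrable M (\<lambda>x. b x powr p)"
  shows "integrable M (\<lambda>x. (a x + b x) powr p)"
proof (rule Bochner_Integration.integrable_bound)
  show "integrable M (\<lambda>x. 2 powr p * (a x powr p + b x powr p))"
    using i by (intro integrable_mult_right Bochner_Integration.integrable_add)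
  show "AE x in M. norm ((a x + b x) powr p) \<le> norm (2 powr p * (a x powr p + b x powr p))"
    using powr_add_le[OF nn p] by (intro AE_I2) (auto simp: abs_of_nonneg)
qed measurable

lemma integrable_powr_bound:
  fixes a b :: "'a \<Rightarrow> real"
  assumes [measurable]: "a \<in> borel_measurable M"
    and le: "AE x in M. 0 \<le> a x \<and> a x \<le> b x" and p: "p \<ge> 0" and i: "integrable M (\<lambda>x. b x powr p)"
  shows "integrable M (\<lambda>x. a x powr p)"
proof (rule Bochner_Integration.integrable_bound[OF i])
  show "AE x in M. norm (a x powr p) \<le> norm (b x powr p)"
    using le by eventually_elim (use p in \<open>auto intro: powr_mono2\<close>)
qed measurable

text \<open>Choose indices at which the integral of the p-th power is at most 2^(-k). Then the
  series of p-th powers has finite integral, so it converges almost everywhere: its terms tend to 0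
  and its p-th root is the majorant \<open>F\<close>. The indices \<open>r k\<close> are not claimed
  to be increasing.\<close>

lemma Lp_null_dominated_subseq:
  fixes f :: "nat \<Rightarrow> 'a \<Rightarrow> real"
  assumes f[measurable]: "\<And>k. f k \<in> borel_measurable M" and nn: "\<And>k x. f k x \<ge> 0" and p: "p > 0"
    and int: "\<And>k. integrable M (\<lambda>x. f k x powr p)"
    and lim: "(\<lambda>k. LINT x|M. f k x powr p) \<longlonglongrightarrow> 0"
  obtains r F where "F \<in> borel_measurable M" "\<And>x. F x \<ge> 0" "integrable M (\<lambda>x. F x powr p)"
    "AE x in M. (\<lambda>k. f (r k) x) \<longlonglongrightarrow> 0" "AE x in M. \<forall>k. f (r k) x \<le> F x"
proof -
  have "\<exists>n. (LINT x|M. f n x powr p) \<le> (1 / 2) ^ k" for k :: nat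
  proof -
    have "\<forall>\<^sub>F n in sequentially. (LINT x|M. f n x powr p) < (1 / 2) ^ k"
      using lim by (rule order_tendstoD) simp
    then show ?thesis by (auto simp: eventually_sequentially intro: less_imp_le)
  qed
  then obtain r where r: "\<And>k. (LINT x|M. f (r k) x powr p) \<le> (1 / 2) ^ k" by metis
  define S where "S x = (\<Sum>k. ennreal (f (r k) x powr p))" for x
  have S[measurable]: "S \<in> borel_measurable M" unfolding S_def[abs_def] by measurable
  have "(\<integral>\<^sup>+x. S x \<partial>M) = (\<Sum>k. \<integral>\<^sup>+x. ennreal (f (r k) x powr p) \<partial>M)"
    unfolding S_def by (rule nn_integral_suminf) measurable
  also have "\<dots> = (\<Sum>k. ennreal (LINT x|M. f (r k) x powr p))"
    by (intro suminf_cong nn_integral_eq_integral int AE_I2) simp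
  also have "\<dots> \<le> (\<Sum>k. ennreal ((1 / 2) ^ k))"
    by (intro suminf_le ennreal_leI r) auto
  also have "\<dots> = ennreal (\<Sum>k. (1 / 2) ^ k)"
    by (intro suminf_ennreal2) (auto intro: summable_geometric)
  finally have Sfin: "(\<integral>\<^sup>+x. S x \<partial>M) < \<infinity>" using ennreal_less_top le_less_trans by fastforce
  then have ae: "AE x in M. S x \<noteq> \<infinity>" by (intro nn_integral_PInf_AE S) auto
  define F where "F x = enn2real (S x) powr (1 / p)" for x
  have Fp: "F x powr p = enn2real (S x)" for x
    using p by (simp add: F_def powr_powr)
  have sm: "summable (\<lambda>k. f (r k) x powr p) \<and> enn2real (S x) = (\<Sum>k. f (r k) x powr p)" if "S x \<noteq> \<infinity>" for x
  proof -
    have s: "summable (\<lambda>k. f (r k) x powr p)"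
      using that by (intro summable_suminf_not_top) (auto simp: S_def)
    have "S x = ennreal (\<Sum>k. f (r k) x powr p)"
      unfolding S_def by (rule suminf_ennreal2[OF _ s]) auto
    then show ?thesis using s by (simp add: suminf_nonneg)
  qed
  have root: "f k x = (f k x powr p) powr (1 / p)" for k x
    using p nn by (simp add: powr_powr)
  show ?thesis
  proof (rule that[of F r])
    show "F \<in> borel_measurable M" unfolding F_def[abs_def] by measurable
    show "F x \<ge> 0" for x by (simp add: F_def)
    have "(\<integral>\<^sup>+x. ennreal (enn2real (S x)) \<partial>M) = (\<integral>\<^sup>+x. S x \<partial>M)"
      using ae by (intro nn_integral_cong_AE) (auto simp: less_top)
    then show "integrable M (\<lambda>x. F x powr p)"
      unfolding Fp using Sfin by (intro integrableI_nonneg) auto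
    show "AE x in M. (\<lambda>k. f (r k) x) \<longlonglongrightarrow> 0"
      using ae
    proof eventually_elim
      fix x assume "S x \<noteq> \<infinity>"
      then have "(\<lambda>k. f (r k) x powr p) \<longlonglongrightarrow> 0" using sm summable_LIMSEQ_zero by blast
      then have "(\<lambda>k. (f (r k) x powr p) powr (1 / p)) \<longlonglongrightarrow> 0"
        using p by (intro tendsto_zero_powrI[where f="\<lambda>k. f (r k) x powr p" and g="\<lambda>k. 1 / p" and b="1 / p"]) auto
      then show "(\<lambda>k. f (r k) x) \<longlonglongrightarrow> 0" unfolding root[symmetric] .
    qed
    show "AE x in M. \<forall>k. f (r k) x \<le> F x"
      using ae
    proof eventually_elim
      fix x assume "S x \<noteq> \<infinity>"
      then have s: "summable (\<lambda>k. f (r k) x powr p)" "enn2real (S x) = (\<Sum>k. f (r k) x powr p)"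
        using sm by blast+
      have "f (r k) x powr p \<le> enn2real (S x)" for k
        using sum_le_suminf[OF s(1), of "{k}"] s(2) by simp
      then show "\<forall>k. f (r k) x \<le> F x"
        unfolding F_def using p by (subst root) (auto intro!: powr_mono2)
    qed
  qed
qed

lemma measurable_continuous_on_lebesgue_on:
  fixes f :: "'a::euclidean_space \<Rightarrow> 'b::euclidean_space"
  shows "continuous_on UNIV f \<Longrightarrow> f \<in> borel_measurable (lebesgue_on U)"
  by (intro measurable_restrict_space1 borel_measurable_lebesgue_continuous)

lemma integrable_bounded_compact:
  fixes f :: "'a::euclidean_space \<Rightarrow> real"
  assumes U: "U \<in> sets lebesgue" and f: "f \<in> borel_measurable (lebesgue_on U)"
    and B: "\<And>x. \<bar>f x\<bar> \<le> B" and K: "compact K" "\<And>x. x \<notin> K \<Longrightarrow> f x = 0"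
  shows "integrable (lebesgue_on U) f"
proof (rule Bochner_Integration.integrable_bound)
  have "K \<in> sets lebesgue" "emeasure lebesgue K < \<infinity>"
    using lmeasurable_compact[OF K(1)] by (auto simp: fmeasurable_def)
  then have "integrable lebesgue (\<lambda>x. B * indicator K x)"
    by (intro integrable_mult_right integrable_real_indicator)
  then show "integrable (lebesgue_on U) (\<lambda>x. B * indicator K x)"
    using U by (subst integrable_restrict_space) (auto intro!: integrable_mult_indicator simp del: scaleR_conv_of_real real_scaleR_def)
  show "AE x in lebesgue_on U. norm (f x) \<le> norm (B * indicator K x)"
  proof (rule AE_I2)
    fix x show "norm (f x) \<le> norm (B * indicator K x)"
      using B[of x] K(2)[of x] by (cases "x \<in> K") auto
  qed
qed (rule f)

text \<open>Completeness of Lebesgue measure. Its main customer is \<open>weak_grad\<close>, which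
  is known to agree with an L^p function only almost everywhere.\<close>

lemma borel_measurable_lebesgue_on_AE:
  fixes f g :: "'a::euclidean_space \<Rightarrow> 'b::euclidean_space"
  assumes U: "U \<in> sets lebesgue" and f: "f \<in> borel_measurable (lebesgue_on U)"
    and ae: "AE x in lebesgue_on U. f x = g x"
  shows "g \<in> borel_measurable (lebesgue_on U)"
proof -
  have "(\<lambda>x. if x \<in> U then f x else 0) \<in> borel_measurable lebesgue"
    using f borel_measurable_if[OF U, of f] by blast
  moreover have "AE x in lebesgue. (if x \<in> U then f x else 0) = (if x \<in> U then g x else 0)"
    using ae U by (subst (asm) AE_restrict_space_iff) auto
  ultimately have "(\<lambda>x. if x \<in> U then g x else 0) \<in> borel_measurable lebesgue"
    by (rule borel_measurable_AE)
  then show ?thesis using borel_measurable_if[OF U, of g] by blast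
qed

lemma Lp_on_measurable: "Lp_on p U f \<Longrightarrow> f \<in> borel_measurable (lebesgue_on U)"
  and Lp_on_integrable: "Lp_on p U f \<Longrightarrow> integrable (lebesgue_on U) (\<lambda>x. norm (f x) powr p)"
  by (auto simp: Lp_on_def)

lemma W1p_smooth_grad:
  assumes U: "open U" and v: "v \<in> W1p p U" "smooth v"
  shows "integrable (lebesgue_on U) (\<lambda>x. norm (grad v x) powr p)"
proof -
  obtain g where g: "is_weak_gradient U v g" "Lp_on p U g"
    using v by (auto simp: W1p_def)
  have ae: "AE x in lebesgue_on U. g x = grad v x"
    by (rule weak_gradient_unique[OF U g(1) weak_gradient_smooth[OF v(2)]])
  have "integrable (lebesgue_on U) (\<lambda>x. norm (g x) powr p)" by (rule Lp_on_integrable[OF g(2)])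
  moreover have "(\<lambda>x. norm (grad v x) powr p) \<in> borel_measurable (lebesgue_on U)"
    using measurable_continuous_on_lebesgue_on[OF continuous_on_grad[OF v(2)], of U] by measurable
  moreover have "(\<lambda>x. norm (g x) powr p) \<in> borel_measurable (lebesgue_on U)"
    using Lp_on_measurable[OF g(2)] by measurable
  ultimately show ?thesis
    using ae by (subst (asm) integrable_cong_AE) auto
qed

text \<open>Converts norm convergence into the form used throughout: test functions and their
  classical gradients converge almost everywhere under one p-integrable majorant, which bounds the
  limit as well. All later limits are then dominated convergence.\<close>

lemma W1p_approx:
  fixes u :: "'a::euclidean_space \<Rightarrow> real"
  assumes U: "open U" and p: "p > 0" and S: "\<And>v. v \<in> S \<Longrightarrow> smooth v"
    and u: "u \<in> W1p_closure p U S"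
  obtains v F where "\<And>k. v k \<in> S" "F \<in> borel_measurable (lebesgue_on U)" "\<And>x. F x \<ge> 0"
    "integrable (lebesgue_on U) (\<lambda>x. F x powr p)"
    "AE x in lebesgue_on U. (\<lambda>k. v k x) \<longlonglongrightarrow> u x"
    "AE x in lebesgue_on U. (\<lambda>k. grad (v k) x) \<longlonglongrightarrow> weak_grad U u x"
    "AE x in lebesgue_on U. \<forall>k. \<bar>v k x\<bar> \<le> F x \<and> norm (grad (v k) x) \<le> F x"
    "AE x in lebesgue_on U. \<bar>u x\<bar> \<le> F x \<and> norm (weak_grad U u x) \<le> F x"
proof -
  let ?M = "lebesgue_on U"
  obtain v where v: "\<And>k::nat. v k \<in> S" "\<And>k. v k \<in> W1p p U"
    and lim: "(\<lambda>k. W1p_norm p U (\<lambda>x. u x - v k x)) \<longlonglongrightarrow> 0"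
    using u by (auto simp: W1p_closure_def)
  obtain g where g: "is_weak_gradient U u g" "Lp_on p U g" and uL: "Lp_on p U u"
    using u by (auto simp: W1p_closure_def W1p_def)
  have sm: "smooth (v k)" for k using S v by blast
  have ms: "U \<in> sets lebesgue" using U by auto
  note [measurable] = Lp_on_measurable[OF uL] Lp_on_measurable[OF g(2)]
    measurable_continuous_on_lebesgue_on[OF continuous_on_grad[OF sm], where U=U]
    measurable_continuous_on_lebesgue_on[OF smooth_continuous[OF sm], where U=U]
  define a where "a k x = \<bar>u x - v k x\<bar>" for k x
  define b where "b k x = norm (g x - grad (v k) x)" for k x
  have [measurable]: "a k \<in> borel_measurable ?M" "b k \<in> borel_measurable ?M" for k
    unfolding a_def[abs_def] b_def[abs_def] by measurable
  have gu: "integrable ?M (\<lambda>x. norm (g x) powr p)" "integrable ?M (\<lambda>x. \<bar>u x\<bar> powr p)"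
    using Lp_on_integrable[OF g(2)] Lp_on_integrable[OF uL] by auto
  have vi: "integrable ?M (\<lambda>x. \<bar>v k x\<bar> powr p)" for k
    using v(2)[of k] by (auto simp: W1p_def Lp_on_def)
  have ai: "integrable ?M (\<lambda>x. a k x powr p)" for k
  proof (rule integrable_powr_bound)
    show "integrable ?M (\<lambda>x. (\<bar>u x\<bar> + \<bar>v k x\<bar>) powr p)"
      using gu vi p by (intro integrable_powr_add) auto
    show "AE x in ?M. 0 \<le> a k x \<and> a k x \<le> \<bar>u x\<bar> + \<bar>v k x\<bar>" by (auto simp: a_def)
  qed (use p in auto)
  have bi: "integrable ?M (\<lambda>x. b k x powr p)" for k
  proof (rule integrable_powr_bound)
    show "integrable ?M (\<lambda>x. (norm (g x) + norm (grad (v k) x)) powr p)"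
      using gu W1p_smooth_grad[OF U v(2) sm] p by (intro integrable_powr_add) auto
    show "AE x in ?M. 0 \<le> b k x \<and> b k x \<le> norm (g x) + norm (grad (v k) x)"
      by (auto simp: b_def norm_triangle_ineq4)
  qed (use p in auto)
  have aewg: "AE x in ?M. weak_grad U (\<lambda>x. u x - v k x) x = g x - grad (v k) x" for k
    by (rule weak_grad_AE_eq(2)[OF U weak_gradient_diff[OF g(1) weak_gradient_smooth[OF sm]]])
  have norm_eq: "W1p_norm p U (\<lambda>x. u x - v k x) powr p = (LINT x|?M. a k x powr p) + (LINT x|?M. b k x powr p)" for k
  proof -
    have m: "weak_grad U (\<lambda>x. u x - v k x) \<in> borel_measurable ?M"
    proof -
      have "(\<lambda>x. g x - grad (v k) x) \<in> borel_measurable ?M" by measurable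
      then show ?thesis
        by (rule borel_measurable_lebesgue_on_AE[OF ms]) (use aewg[of k] in auto)
    qed
    have "(LINT x|?M. norm (weak_grad U (\<lambda>x. u x - v k x) x) powr p) = (LINT x|?M. b k x powr p)"
      using aewg[of k] m unfolding b_def by (intro integral_cong_AE) auto
    then show ?thesis
      using p unfolding W1p_norm_def LINT_lebesgue_on[OF ms] a_def[symmetric]
      by (simp add: powr_powr)
  qed
  \<comment> \<open>The larger of the error in value and the error in gradient, so that one choice
    of indices and one majorant serve both.\<close>
  define f where "f k x = max (a k x) (b k x)" for k x
  have fi: "integrable ?M (\<lambda>x. f k x powr p)" for k
  proof (rule integrable_powr_bound)
    show "integrable ?M (\<lambda>x. (a k x + b k x) powr p)"
      using ai bi p by (intro integrable_powr_add) (auto simp: a_def b_def)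
    show "AE x in ?M. 0 \<le> f k x \<and> f k x \<le> a k x + b k x" by (auto simp: f_def a_def b_def)
    show "f k \<in> borel_measurable ?M" unfolding f_def[abs_def] by measurable
  qed (use p in auto)
  have fle: "(LINT x|?M. f k x powr p) \<le> W1p_norm p U (\<lambda>x. u x - v k x) powr p" for k
  proof -
    have "(LINT x|?M. f k x powr p) \<le> (LINT x|?M. a k x powr p + b k x powr p)"
      using fi ai bi by (intro integral_mono) (auto simp: f_def max_def)
    also have "\<dots> = W1p_norm p U (\<lambda>x. u x - v k x) powr p"
      using ai bi by (simp add: norm_eq)
    finally show ?thesis .
  qed
  have "(\<lambda>k. W1p_norm p U (\<lambda>x. u x - v k x) powr p) \<longlonglongrightarrow> 0"
    using lim p by (intro tendsto_zero_powrI[of _ _ _ p]) (auto simp: W1p_norm_def)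
  then have flim: "(\<lambda>k. LINT x|?M. f k x powr p) \<longlonglongrightarrow> 0"
    by (rule tendsto_sandwich[OF _ _ tendsto_const, rotated 2]) (use fle in \<open>auto intro!: always_eventually\<close>)
  have f0: "f k x \<ge> 0" for k x by (simp add: f_def a_def le_max_iff_disj)
  have fm: "f k \<in> borel_measurable ?M" for k unfolding f_def[abs_def] by measurable
  obtain r F where F: "F \<in> borel_measurable ?M" "\<And>x. F x \<ge> 0" "integrable ?M (\<lambda>x. F x powr p)"
    "AE x in ?M. (\<lambda>k. f (r k) x) \<longlonglongrightarrow> 0" "AE x in ?M. \<forall>k. f (r k) x \<le> F x"
    by (rule Lp_null_dominated_subseq[OF fm f0 p fi flim]) blast
  note [measurable] = F(1)
  have wg: "AE x in ?M. weak_grad U u x = g x" by (rule weak_grad_AE_eq(2)[OF U g(1)])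
  \<comment> \<open>\<open>F\<close> bounds only the errors; adding \<bar>u x\<bar> and
    \<open>norm (g x)\<close> bounds the approximants and the limit too.\<close>
  show ?thesis
  proof (rule that[of "\<lambda>k. v (r k)" "\<lambda>x. F x + (\<bar>u x\<bar> + norm (g x))"])
    show "v (r k) \<in> S" for k using v by blast
    show "(\<lambda>x. F x + (\<bar>u x\<bar> + norm (g x))) \<in> borel_measurable ?M" by measurable
    show "0 \<le> F x + (\<bar>u x\<bar> + norm (g x))" for x using F(2)[of x] by simp
    show "integrable ?M (\<lambda>x. (F x + (\<bar>u x\<bar> + norm (g x))) powr p)"
      using F gu p by (intro integrable_powr_add) auto
    show "AE x in ?M. (\<lambda>k. v (r k) x) \<longlonglongrightarrow> u x"
      using F(4)
    proof eventually_elim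
      fix x assume "(\<lambda>k. f (r k) x) \<longlonglongrightarrow> 0"
      then have "(\<lambda>k. v (r k) x - u x) \<longlonglongrightarrow> 0"
        by (rule Lim_null_comparison[rotated]) (auto simp: f_def a_def abs_minus_commute intro!: always_eventually)
      then show "(\<lambda>k. v (r k) x) \<longlonglongrightarrow> u x" by (simp add: LIM_zero_iff)
    qed
    show "AE x in ?M. (\<lambda>k. grad (v (r k)) x) \<longlonglongrightarrow> weak_grad U u x"
      using F(4) wg
    proof eventually_elim
      fix x assume "(\<lambda>k. f (r k) x) \<longlonglongrightarrow> 0" and eq: "weak_grad U u x = g x"
      have "norm (grad (v (r k)) x - g x) \<le> f (r k) x" for k
        unfolding f_def b_def by (subst norm_minus_commute) simp
      then have "(\<lambda>k. grad (v (r k)) x - g x) \<longlonglongrightarrow> 0"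
        by (intro Lim_null_comparison[OF always_eventually \<open>(\<lambda>k. f (r k) x) \<longlonglongrightarrow> 0\<close>]) blast
      then have "(\<lambda>k. grad (v (r k)) x) \<longlonglongrightarrow> g x" by (rule LIM_zero_cancel)
      then show "(\<lambda>k. grad (v (r k)) x) \<longlonglongrightarrow> weak_grad U u x" by (simp only: eq)
    qed
    show "AE x in ?M. \<forall>k. \<bar>v (r k) x\<bar> \<le> F x + (\<bar>u x\<bar> + norm (g x)) \<and> norm (grad (v (r k)) x) \<le> F x + (\<bar>u x\<bar> + norm (g x))"
      using F(5)
    proof eventually_elim
      fix x assume *: "\<forall>k. f (r k) x \<le> F x"
      show "\<forall>k. \<bar>v (r k) x\<bar> \<le> F x + (\<bar>u x\<bar> + norm (g x)) \<and> norm (grad (v (r k)) x) \<le> F x + (\<bar>u x\<bar> + norm (g x))"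
      proof
        fix k
        have "a (r k) x \<le> F x" "b (r k) x \<le> F x" using *[rule_format, of k] by (auto simp: f_def)
        then show "\<bar>v (r k) x\<bar> \<le> F x + (\<bar>u x\<bar> + norm (g x)) \<and> norm (grad (v (r k)) x) \<le> F x + (\<bar>u x\<bar> + norm (g x))"
          using norm_triangle_sub[of "grad (v (r k)) x" "g x"] norm_minus_commute[of "g x" "grad (v (r k)) x"]
            norm_ge_zero[of "g x"]
          unfolding a_def b_def by (intro conjI) linarith+
      qed
    qed
    show "AE x in ?M. \<bar>u x\<bar> \<le> F x + (\<bar>u x\<bar> + norm (g x)) \<and> norm (weak_grad U u x) \<le> F x + (\<bar>u x\<bar> + norm (g x))"
      using wg by eventually_elim (use F(2) in auto)
  qed
qed

lemma test_in_W1p: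
  assumes U: "open U" and p: "p \<ge> 0" and v: "v \<in> test_functions U'"
  shows "v \<in> W1p p U"
proof -
  obtain K where K: "smooth v" "compact K" "K \<subseteq> U'" "\<And>x. x \<notin> K \<Longrightarrow> v x = 0" "\<And>x. x \<notin> K \<Longrightarrow> grad v x = 0"
    by (rule test_functionsE[OF v]) blast
  obtain B where B: "B \<ge> 0" "\<And>x. \<bar>v x\<bar> \<le> B" "\<And>x. norm (grad v x) \<le> B"
    by (rule test_bounded[OF v]) blast
  have ms: "U \<in> sets lebesgue" using U by auto
  note [measurable] = measurable_continuous_on_lebesgue_on[OF continuous_on_grad[OF K(1)], of U]
    measurable_continuous_on_lebesgue_on[OF smooth_continuous[OF K(1)], of U]
  have i: "integrable (lebesgue_on U) (\<lambda>x. w x powr p)"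
    if w: "w \<in> borel_measurable (lebesgue_on U)" "\<And>x. 0 \<le> w x" "\<And>x. w x \<le> B"
      and w0: "\<And>x. x \<notin> K \<Longrightarrow> w x = 0" for w :: "'a \<Rightarrow> real"
  proof (rule integrable_bounded_compact[OF ms _ _ K(2), of _ "B powr p"])
    show "(\<lambda>x. w x powr p) \<in> borel_measurable (lebesgue_on U)" using w(1) by measurable
    show "\<bar>w x powr p\<bar> \<le> B powr p" for x using w p by (auto intro: powr_mono2)
  qed (use w0 in auto)
  have "Lp_on p U v"
    using i[of "\<lambda>x. \<bar>v x\<bar>"] B K(4) by (auto simp: Lp_on_def)
  moreover have "Lp_on p U (grad v)"
    using i[of "\<lambda>x. norm (grad v x)"] B K(5) by (auto simp: Lp_on_def)
  ultimately show ?thesis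
    using weak_gradient_smooth[OF K(1), of U] by (auto simp: W1p_def)
qed

text \<open>The constant sequence approximates; that the norm of v - v is 0 still uses uniqueness,
  because \<open>weak_grad\<close> of the zero function is a choice. \<open>U'\<close> may exceed
  \<open>U\<close>: for \<open>V_space\<close> it is the full cylinder, which leaves the values on
  the base free.\<close>

lemma test_in_W1p_closure:
  assumes U: "open U" and p: "p > 0" and v: "v \<in> test_functions U'" and S: "S = test_functions U'"
  shows "v \<in> W1p_closure p U S"
proof -
  have ms: "U \<in> sets lebesgue" using U by auto
  have ae: "AE x in lebesgue_on U. weak_grad U (\<lambda>x. 0) x = (0::'a)"
    using weak_grad_smooth[OF U smooth_const[of 0]]
  proof eventually_elim
    fix x :: 'a
    assume "weak_grad U (\<lambda>x. 0) x = grad (\<lambda>x. 0) x"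
    moreover have "grad (\<lambda>x. 0) x = (0::'a)" by (rule grad_eqI) simp
    ultimately show "weak_grad U (\<lambda>x. 0) x = 0" by simp
  qed
  have m: "weak_grad U (\<lambda>x. 0) \<in> borel_measurable (lebesgue_on U)"
  proof (rule borel_measurable_lebesgue_on_AE[OF ms, of "\<lambda>x. 0"])
    show "AE x in lebesgue_on U. 0 = weak_grad U (\<lambda>x. 0) x"
      using ae by eventually_elim simp
  qed simp
  have "(LINT x|lebesgue_on U. norm (weak_grad U (\<lambda>x. 0) x) powr p) = (LINT x|lebesgue_on U. (0::real))"
  proof (rule integral_cong_AE)
    show "AE x in lebesgue_on U. norm (weak_grad U (\<lambda>x. 0) x) powr p = 0"
      using ae by eventually_elim simp
  qed (use m in measurable)
  then have "W1p_norm p U (\<lambda>x. v x - v x) = 0"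
    using p unfolding W1p_norm_def LINT_lebesgue_on[OF ms] by simp
  moreover have "v \<in> W1p p U" by (rule test_in_W1p[OF U less_imp_le[OF p] v])
  ultimately show ?thesis
    using v S by (auto simp: W1p_closure_def intro!: exI[of _ "\<lambda>k. v"])
qed

section \<open>Convexity of powers of quadratic forms\<close>

lemma powr_tangent:
  fixes s r q :: real
  assumes "s \<ge> 0" "r \<ge> 0" "q \<ge> 1"
  shows "s powr q \<ge> r powr q + q * r powr (q - 1) * (s - r)"
proof (cases "r = 0 \<or> s = 0")
  case True
  show ?thesis
  proof (cases "r = 0")
    case False
    then have "r > 0" "s = 0" using True assms by auto
    then have "r powr q = r powr (q - 1) * r"
      by (simp add: powr_diff)
    then have "r powr q + q * r powr (q - 1) * (s - r) = (1 - q) * r powr q"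
      using \<open>s = 0\<close> by (simp add: algebra_simps)
    also have "\<dots> \<le> 0" using assms by (simp add: mult_nonpos_nonneg)
    finally show ?thesis using \<open>s = 0\<close> by simp
  qed auto
next
  case False
  then have pos: "s > 0" "r > 0" using assms by auto
  have "(\<lambda>x. x powr q) s - (\<lambda>x. x powr q) r \<ge> (q * r powr (q - 1)) * (s - r)"
  proof (rule convex_on_imp_above_tangent[of "{0<..}"])
    show "convex_on {0<..} (\<lambda>x. x powr q)" by (rule powr_convex[OF assms(3)])
    have "((\<lambda>x. x powr q) has_real_derivative q * r powr (q - 1)) (at r)"
      using pos by (auto intro!: derivative_eq_intros simp: powr_diff)
    then show "((\<lambda>x. x powr q) has_real_derivative q * r powr (q - 1)) (at r within {0<..})"
      by (rule has_field_derivative_at_within)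
  qed (use pos in \<open>auto simp: interior_open\<close>)
  then show ?thesis by simp
qed

lemma powr_superadd:
  fixes x y q :: real
  assumes "x \<ge> 0" "y \<ge> 0" "q \<ge> 1"
  shows "x powr q + y powr q \<le> (x + y) powr q"
proof (cases "x + y = 0")
  case True
  then have "x = 0" "y = 0" using assms by auto
  then show ?thesis by simp
next
  case False
  have eq: "z powr q = z * z powr (q - 1)" if "z \<ge> 0" for z :: real
    using that assms by (cases "z = 0") (auto simp: powr_diff)
  have "x * x powr (q - 1) \<le> x * (x + y) powr (q - 1)"
    "y * y powr (q - 1) \<le> y * (x + y) powr (q - 1)"
    using assms by (auto intro!: mult_left_mono powr_mono2)
  then show ?thesis using assms by (simp add: eq distrib_right)
qed

text \<open>Add the tangent inequalities at the midpoint, evaluated at both ends: the linear terms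
  cancel.\<close>

lemma powr_midpoint:
  fixes x y q :: real
  assumes "x \<ge> 0" "y \<ge> 0" "q \<ge> 1"
  shows "((x + y) / 2) powr q \<le> (x powr q + y powr q) / 2"
proof -
  have "x powr q + y powr q \<ge> 2 * ((x + y) / 2) powr q
      + q * ((x + y) / 2) powr (q - 1) * (x - (x + y) / 2 + (y - (x + y) / 2))"
    using powr_tangent[of x "(x + y) / 2" q, OF assms(1) _ assms(3)]
      powr_tangent[of y "(x + y) / 2" q, OF assms(2) _ assms(3)] assms(1,2)
    unfolding distrib_left by simp
  moreover have "x - (x + y) / 2 + (y - (x + y) / 2) = 0" by (simp add: field_simps)
  ultimately show ?thesis by simp
qed

text \<open>For m < 1 the power is not Lipschitz at 0; the factor \<open>y\<close> repairs this. The
  larger power is multiplied by at least the smaller argument, which reduces the claim to the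
  tangent inequality for the convex exponent m + 1.\<close>

lemma powr_diff_mult_bound:
  fixes x y m :: real
  assumes "x \<ge> 0" "y \<ge> 0" "m \<ge> 0"
  shows "\<bar>x powr m - y powr m\<bar> * y \<le> (m + 1) * max x y powr m * \<bar>x - y\<bar>"
proof -
  have eq: "z powr (m + 1) = z powr m * z" if "z \<ge> 0" for z :: real
    using that assms by (cases "z = 0") (auto simp: powr_add)
  have t: "z powr m * z - w powr m * w \<le> (m + 1) * z powr m * (z - w)" if "z \<ge> 0" "w \<ge> 0" for z w :: real
  proof -
    have "w powr (m + 1) \<ge> z powr (m + 1) + (m + 1) * z powr (m + 1 - 1) * (w - z)"
      using that assms by (intro powr_tangent) auto
    then show ?thesis unfolding eq[OF that(1)] eq[OF that(2)] by (simp add: algebra_simps)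
  qed
  show ?thesis
  proof (cases "y \<le> x")
    case True
    then have "y powr m \<le> x powr m" using assms by (intro powr_mono2) auto
    then have "\<bar>x powr m - y powr m\<bar> * y = x powr m * y - y powr m * y" by (simp add: left_diff_distrib)
    also have "\<dots> \<le> x powr m * x - y powr m * y" using True by (simp add: mult_left_mono)
    finally show ?thesis using t[of x y] True assms by (simp add: max_def)
  next
    case False
    then have "x powr m \<le> y powr m" using assms by (intro powr_mono2) auto
    then have "\<bar>x powr m - y powr m\<bar> * y = y powr m * y - x powr m * y" by (simp add: left_diff_distrib)
    also have "\<dots> \<le> y powr m * y - x powr m * x" using False by (simp add: mult_left_mono)
    finally show ?thesis using t[of y x] False assms by (simp add: max_def)
  qed
qed

text \<open>Kept abstract because the inequalities below serve two forms: the block matrix at a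
  fixed point of the section, and multiplication on the reals for the mass term |u|^p. Linearity in
  the first argument together with symmetry gives bilinearity.\<close>

definition pos_form :: "('a::real_vector \<Rightarrow> 'a \<Rightarrow> real) \<Rightarrow> bool" where
  "pos_form B \<longleftrightarrow> (\<forall>x y z. B (x + y) z = B x z + B y z) \<and> (\<forall>c x y. B (c *\<^sub>R x) y = c * B x y) \<and>
     (\<forall>x y. B x y = B y x) \<and> (\<forall>x. x \<noteq> 0 \<longrightarrow> B x x > 0)"

context
  fixes B :: "'a::real_vector \<Rightarrow> 'a \<Rightarrow> real"
  assumes B: "pos_form B"
begin

lemma form_add: "B (x + y) z = B x z + B y z" "B z (x + y) = B z x + B z y"
  and form_scale: "B (c *\<^sub>R x) y = c * B x y" "B x (c *\<^sub>R y) = c * B x y"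
  and form_sym: "B x y = B y x"
  and form_pos: "x \<noteq> 0 \<Longrightarrow> B x x > 0"
  using B unfolding pos_form_def by metis+

lemma form_zero: "B 0 x = 0" "B x 0 = 0"
  using form_scale(1)[of 0 0 x] form_scale(2)[of x 0 0] by auto

lemma form_minus: "B (x - y) z = B x z - B y z" "B z (x - y) = B z x - B z y"
  using form_add(1)[of x "- y" z] form_add(2)[of z x "- y"] form_scale(1)[of "-1" y z] form_scale(2)[of z "-1" y] by auto

lemma form_nonneg: "B x x \<ge> 0"
  using form_pos[of x] form_zero by (cases "x = 0") (auto intro: less_imp_le)

lemma form_Cauchy_Schwarz: "\<bar>B x y\<bar> \<le> sqrt (B x x) * sqrt (B y y)"
proof (cases "y = 0")
  case False
  define t where "t = B x y / B y y"
  have p: "B y y > 0" using False by (rule form_pos)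
  have "0 \<le> B (x - t *\<^sub>R y) (x - t *\<^sub>R y)" by (rule form_nonneg)
  also have "\<dots> = B x x - 2 * t * B x y + t * t * B y y"
    by (simp add: form_minus form_scale form_sym[of y x] algebra_simps)
  also have "\<dots> = B x x - (B x y)\<^sup>2 / B y y"
    using p by (simp add: t_def field_simps power2_eq_square)
  finally have "(B x y)\<^sup>2 \<le> B x x * B y y" using p by (simp add: field_simps)
  then have "sqrt ((B x y)\<^sup>2) \<le> sqrt (B x x * B y y)" by (rule real_sqrt_le_mono)
  then show ?thesis by (simp add: real_sqrt_mult)
qed (simp add: form_zero)

lemma form_triangle: "sqrt (B (x + y) (x + y)) \<le> sqrt (B x x) + sqrt (B y y)"
proof (rule real_le_lsqrt)
  have "B (x + y) (x + y) = B x x + 2 * B x y + B y y"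
    by (simp add: form_add form_sym[of y x])
  also have "\<dots> \<le> B x x + 2 * (sqrt (B x x) * sqrt (B y y)) + B y y"
    using form_Cauchy_Schwarz[of x y] by simp
  also have "\<dots> = (sqrt (B x x) + sqrt (B y y))\<^sup>2"
    using form_nonneg by (simp add: power2_sum)
  finally show "B (x + y) (x + y) \<le> (sqrt (B x x) + sqrt (B y y))\<^sup>2" .
qed (use form_nonneg in auto)

text \<open>By Clarkson's inequality for \<open>y\<close> and \<open>z\<close> the convexity estimate at \<open>z\<close> improves by the
  last term.\<close>

lemma form_powr_uniform_convex:
  assumes p: "p \<ge> 2"
  shows "B y y powr (p / 2) \<ge> B z z powr (p / 2) + p * B z z powr ((p - 2) / 2) * B z (y - z)
           + 2 powr (1 - p) * B (y - z) (y - z) powr (p / 2)"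
proof -
  define q where "q = p / 2"
  have q: "q \<ge> 1" using p by (simp add: q_def)
  define d where "d = (1 / 2) *\<^sub>R (y - z)"
  have yzd: "y = z + 2 *\<^sub>R d" by (simp add: d_def)
  have qq: "q - 1 = (p - 2) / 2" by (simp add: q_def field_simps)
  have m: "B (z + d) (z + d) = B z z + 2 * B z d + B d d"
    by (simp add: form_add form_sym[of d z])
  have yy: "B y y = B z z + 4 * B z d + 4 * B d d"
    by (simp add: yzd form_add form_scale form_sym[of d z])
  \<comment> \<open>Clarkson: superadditivity of the power, the parallelogram identity, and
    convexity between the energies of y and z. Here d is half the difference, so z + d is the
    midpoint.\<close>
  have "B (z + d) (z + d) powr q + B d d powr q \<le> (B (z + d) (z + d) + B d d) powr q"
    by (intro powr_superadd form_nonneg q)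
  also have "B (z + d) (z + d) + B d d = (B y y + B z z) / 2"
    by (simp add: m yy)
  also have "((B y y + B z z) / 2) powr q \<le> (B y y powr q + B z z powr q) / 2"
    by (intro powr_midpoint form_nonneg q)
  finally have 1: "2 * B (z + d) (z + d) powr q + 2 * B d d powr q \<le> B y y powr q + B z z powr q" by simp
  \<comment> \<open>The tangent inequality at z is used for the midpoint only; Clarkson's inequality
    carries it on to y and leaves the remainder in d.\<close>
  have "B (z + d) (z + d) powr q \<ge> B z z powr q + q * B z z powr (q - 1) * (2 * B z d + B d d)"
    using powr_tangent[of "B (z + d) (z + d)" "B z z" q, OF form_nonneg form_nonneg q] by (simp add: m)
  moreover have "q * B z z powr (q - 1) * (2 * B z d + B d d) \<ge> q * B z z powr (q - 1) * (2 * B z d)"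
    using q form_nonneg[of d] by (intro mult_left_mono) auto
  ultimately have 2: "2 * B (z + d) (z + d) powr q \<ge> 2 * B z z powr q + p * B z z powr (q - 1) * (2 * B z d)"
    by (simp add: q_def)
  have 3: "B z (y - z) = 2 * B z d" by (simp add: yzd form_scale)
  \<comment> \<open>Origin of the constant: y - z is 2 d, so its energy is 4^q = 2^p times that of
    d, and two copies of the latter are left over.\<close>
  have "B (y - z) (y - z) = 4 * B d d" by (simp add: yzd form_scale)
  then have "B (y - z) (y - z) powr q = 4 powr q * B d d powr q"
    using form_nonneg[of d] by (simp add: powr_mult)
  moreover have "(4::real) powr q = 2 powr p"
    using powr_powr[of 2 2 q] by (simp add: q_def)
  ultimately have 4: "2 powr (1 - p) * B (y - z) (y - z) powr q = 2 * B d d powr q"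
    by (simp add: powr_diff)
  show ?thesis using 1 2 4 unfolding q_def[symmetric] qq[symmetric] 3 by linarith
qed

lemma form_powr_convex:
  assumes p: "p \<ge> 2"
  shows "B y y powr (p / 2) \<ge> B z z powr (p / 2) + p * B z z powr ((p - 2) / 2) * B z (y - z)"
  using form_powr_uniform_convex[OF p, of z y]
  by (smt (verit) mult_nonneg_nonneg powr_ge_zero)

text \<open>A second-order upper bound without second derivatives: the convexity inequality read
  backwards, with base point x + d and value at x, leaves only the change of the first-order
  coefficient to be estimated. Cauchy-Schwarz and \<open>powr_diff_mult_bound\<close> do this even
  for p < 3, where the coefficient is not Lipschitz.\<close>

lemma form_powr_upper:
  assumes p: "p \<ge> 2"
  shows "B (x + d) (x + d) powr (p / 2) \<le> B x x powr (p / 2) + p * B x x powr ((p - 2) / 2) * B x d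
           + p\<^sup>2 * (sqrt (B x x) + sqrt (B d d)) powr (p - 2) * B d d"
proof -
  define m where "m = p - 2"
  define a where "a = x + d"
  define n where "n = (\<lambda>y. sqrt (B y y))"
  have m: "m \<ge> 0" using p by (simp add: m_def)
  have n0: "n y \<ge> 0" for y by (simp add: n_def form_nonneg)
  have nn: "n y * n y = B y y" for y using form_nonneg by (simp add: n_def)
  have npow: "B y y powr ((p - 2) / 2) = n y powr m" for y
    using form_nonneg[of y] by (simp add: n_def m_def powr_half_sqrt[symmetric] powr_powr)
  let ?s = "n x + n d"
  have ax: "\<bar>n a - n x\<bar> \<le> n d"
    using form_triangle[of x d] form_triangle[of a "- d"] form_scale(1)[of "-1" d "- d"] form_scale(2)[of d "-1" d]
    by (simp add: n_def a_def)
  have "B x x powr (p / 2) \<ge> B a a powr (p / 2) + p * B a a powr ((p - 2) / 2) * B a (x - a)"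
    by (rule form_powr_convex[OF p])
  moreover have "B a (x - a) = - B a d" using form_scale(2)[of a "-1" d] by (simp add: a_def)
  ultimately have 1: "B a a powr (p / 2) \<le> B x x powr (p / 2) + p * (n a powr m * B a d)"
    unfolding npow by (simp add: algebra_simps)
  have "B a d = B x d + B d d" by (simp add: a_def form_add)
  then have 2: "n a powr m * B a d = n x powr m * B x d + (n a powr m - n x powr m) * B x d + n a powr m * B d d"
    by (simp add: algebra_simps)
  have "(n a powr m - n x powr m) * B x d \<le> \<bar>n a powr m - n x powr m\<bar> * \<bar>B x d\<bar>"
    by (metis abs_ge_self abs_mult)
  also have "\<dots> \<le> \<bar>n a powr m - n x powr m\<bar> * (n x * n d)"
    unfolding n_def by (intro mult_left_mono form_Cauchy_Schwarz abs_ge_zero)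
  also have "\<dots> = (\<bar>n a powr m - n x powr m\<bar> * n x) * n d" by simp
  also have "\<dots> \<le> ((m + 1) * max (n a) (n x) powr m * \<bar>n a - n x\<bar>) * n d"
    by (intro mult_right_mono powr_diff_mult_bound n0 m)
  also have "\<dots> \<le> ((m + 1) * ?s powr m * n d) * n d"
    using ax m n0[of x] n0[of d] n0[of a]
    by (intro mult_right_mono mult_mono mult_left_mono powr_mono2 n0 order_refl) (auto simp: abs_le_iff)
  also have "\<dots> = (m + 1) * ?s powr m * B d d" by (simp add: nn[symmetric])
  finally have 3: "(n a powr m - n x powr m) * B x d \<le> (m + 1) * ?s powr m * B d d" .
  have 4: "n a powr m * B d d \<le> ?s powr m * B d d"
    using ax n0[of a] m by (intro mult_right_mono powr_mono2 form_nonneg) auto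
  \<comment> \<open>The coefficients m + 1 and 1 of the two remainders add up to p; the second
    factor p of the final bound is the one in the convexity inequality.\<close>
  have "n a powr m * B a d \<le> n x powr m * B x d + p * (?s powr m * B d d)"
    using 2 3 4 by (simp add: m_def algebra_simps)
  then have "p * (n a powr m * B a d) \<le> p * (n x powr m * B x d + p * (?s powr m * B d d))"
    using p by (intro mult_left_mono) auto
  then show ?thesis
    using 1 unfolding npow unfolding a_def[symmetric] m_def[symmetric]
    by (simp add: n_def power2_eq_square algebra_simps)
qed

text \<open>Uniform convexity at z = (u/v) g, the value that the gradient y of u would have if u/v
  were constant and g were the gradient of v. The terms without the remainder regroup into the flux
  of g paired with the gradient of |u|^p v^(1-p).\<close>

lemma form_Picone:
  assumes p: "p \<ge> 2" and v: "v > 0"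
  shows "B y y powr (p / 2) \<ge> p * (\<bar>u\<bar> powr (p - 2) * u) * (v powr (1 - p) * (B g g powr ((p - 2) / 2) * B g y))
           - (p - 1) * (\<bar>u\<bar> powr p * (v powr (- p) * B g g powr (p / 2)))
           + 2 powr (1 - p) * B (y - (u / v) *\<^sub>R g) (y - (u / v) *\<^sub>R g) powr (p / 2)"
proof (cases "u = 0")
  case True
  have "2 powr (1 - p) * B y y powr (p / 2) \<le> 1 * B y y powr (p / 2)"
    using p powr_mono[of "1 - p" 0 2] by (intro mult_right_mono) auto
  then show ?thesis using True by simp
next
  case u: False
  define z where "z = (u / v) *\<^sub>R g"
  define r where "r = \<bar>u\<bar> / v"
  have r: "r > 0" using u v by (simp add: r_def)
  have zz: "B z z = r powr 2 * B g g"
    using r v u by (simp add: z_def form_scale power2_eq_square r_def)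
  have zs: "B z z powr s = r powr (2 * s) * B g g powr s" for s
  proof -
    have "B z z powr s = (r powr 2) powr s * B g g powr s"
      unfolding zz by (intro powr_mult form_nonneg powr_ge_zero)
    then show ?thesis by (simp only: powr_powr)
  qed
  have rs: "r powr s = \<bar>u\<bar> powr s * v powr (- s)" for s
    using v by (simp add: r_def powr_divide powr_minus_divide)
  have e1: "B z z powr (p / 2) = \<bar>u\<bar> powr p * (v powr (- p) * B g g powr (p / 2))"
    using rs[of p] by (simp add: zs)
  have e2: "B z z powr ((p - 2) / 2) = \<bar>u\<bar> powr (p - 2) * (v powr (2 - p) * B g g powr ((p - 2) / 2))"
  proof -
    have h: "2 * ((p - 2) / 2) = p - 2" "- (p - 2) = 2 - p" by simp_all
    show ?thesis using rs[of "p - 2"] unfolding zs h by simp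
  qed
  have e3: "B z (y - z) = (u / v) * B g y - (u / v)\<^sup>2 * B g g"
    by (simp add: z_def form_minus form_scale power2_eq_square algebra_simps)
  have e4: "B g g powr ((p - 2) / 2) * B g g = B g g powr (p / 2)"
    using form_nonneg[of g] by (cases "B g g = 0") (auto simp: diff_divide_distrib powr_diff)
  have e5: "\<bar>u\<bar> powr (p - 2) * u\<^sup>2 = \<bar>u\<bar> powr p"
    using u by (simp add: powr_diff)
  have e6: "v powr (2 - p) * inverse v = v powr (1 - p)" "v powr (2 - p) * (inverse v)\<^sup>2 = v powr (- p)"
    using v by (simp_all add: powr_diff powr_minus field_simps power2_eq_square)
  have "B z z powr ((p - 2) / 2) * B z (y - z) =
      (\<bar>u\<bar> powr (p - 2) * u) * ((v powr (2 - p) * inverse v) * (B g g powr ((p - 2) / 2) * B g y))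
      - (\<bar>u\<bar> powr (p - 2) * u\<^sup>2) * ((v powr (2 - p) * (inverse v)\<^sup>2) * (B g g powr ((p - 2) / 2) * B g g))"
    unfolding e2 e3 by (simp add: field_simps power2_eq_square)
  then have e7: "B z z powr ((p - 2) / 2) * B z (y - z) =
      (\<bar>u\<bar> powr (p - 2) * u) * (v powr (1 - p) * (B g g powr ((p - 2) / 2) * B g y))
      - \<bar>u\<bar> powr p * (v powr (- p) * B g g powr (p / 2))"
    by (simp only: e4 e5 e6)
  have "B y y powr (p / 2) \<ge> B z z powr (p / 2) + p * (B z z powr ((p - 2) / 2) * B z (y - z))
      + 2 powr (1 - p) * B (y - z) (y - z) powr (p / 2)"
    using form_powr_uniform_convex[OF p, of z y] by simp
  then show ?thesis
    unfolding e1 e7 z_def[symmetric] by (simp add: algebra_simps)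
qed

end

section \<open>One-variable preliminaries\<close>

definition abs_powr' :: "real \<Rightarrow> real \<Rightarrow> real" where
  "abs_powr' p s = p * (\<bar>s\<bar> powr (p - 2) * s)"

lemma abs_powr_deriv:
  assumes p: "p \<ge> 2"
  shows "((\<lambda>s. \<bar>s\<bar> powr p) has_real_derivative abs_powr' p s) (at s)"
proof (cases s "0::real" rule: linorder_cases)
  case less
  have "((\<lambda>s. (- s) powr p) has_real_derivative abs_powr' p s) (at s)"
    using less by (auto intro!: derivative_eq_intros simp: abs_powr'_def powr_diff power2_eq_square)
  then show ?thesis
    by (rule has_field_derivative_transform_within_open[where S="{..<0}"]) (use less in auto)
next
  case greater
  have "((\<lambda>s. s powr p) has_real_derivative abs_powr' p s) (at s)"
    using greater by (auto intro!: derivative_eq_intros simp: abs_powr'_def powr_diff power2_eq_square)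
  then show ?thesis
    by (rule has_field_derivative_transform_within_open[where S="{0<..}"]) (use greater in auto)
next
  case equal
  have "((\<lambda>h::real. \<bar>h\<bar> powr (p - 1)) \<longlongrightarrow> 0) (at 0)"
    using p by (auto intro!: tendsto_eq_intros tendsto_zero_powrI[where b="p - 1"] tendsto_rabs_zero)
  then have "((\<lambda>h::real. \<bar>h\<bar> powr p / h) \<longlongrightarrow> 0) (at 0)"
  proof (rule Lim_null_comparison[rotated])
    show "\<forall>\<^sub>F h::real in at 0. norm (\<bar>h\<bar> powr p / h) \<le> \<bar>h\<bar> powr (p - 1)"
      by (auto simp: eventually_at_filter powr_diff)
  qed
  then show ?thesis using equal by (simp add: DERIV_def abs_powr'_def)
qed

lemma continuous_abs_powr': "p \<ge> 2 \<Longrightarrow> continuous_on UNIV (abs_powr' p)"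
proof -
  assume p: "p \<ge> 2"
  show ?thesis
  \<comment> \<open>For p = 2 the factor \<open>\<bar>s\<bar> powr 0\<close> jumps at s = 0, because
    \<open>0 powr 0 = 0\<close>; only the product with s is continuous.\<close>
  proof (cases "p = 2")
    case True
    have "abs_powr' p = (\<lambda>s. 2 * s)" using True by (auto simp: abs_powr'_def fun_eq_iff)
    then show ?thesis by (auto intro: continuous_intros)
  next
    case False
    then show ?thesis using p unfolding abs_powr'_def[abs_def]
      by (intro continuous_intros continuous_on_powr') auto
  qed
qed

lemma continuous_abs_powr: "p > 0 \<Longrightarrow> continuous_on UNIV (\<lambda>s::real. \<bar>s\<bar> powr p)"
  by (intro continuous_on_powr' continuous_intros) auto

lemma abs_abs_powr':
  assumes "p \<ge> 2" shows "\<bar>abs_powr' p s\<bar> = p * \<bar>s\<bar> powr (p - 1)"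
proof (cases "s = 0")
  case False
  have "\<bar>s\<bar> powr (p - 1) = \<bar>s\<bar> powr ((p - 2) + 1)" by simp
  also have "\<dots> = \<bar>s\<bar> powr (p - 2) * \<bar>s\<bar>" using False by (simp only: powr_add) simp
  finally show ?thesis using assms by (simp add: abs_powr'_def abs_mult)
qed (simp add: abs_powr'_def)

text \<open>The profiles needed later, (s + \<epsilon>)^(1-p) and ln (1 + s/\<epsilon>), behave well
  only on s \<ge> 0. Although W \<ge> 0, its approximants may be negative, so the profile is
  continued by its tangent line, which keeps it C^1 with the same bound on the derivative.\<close>

lemma C1_linear_extension:
  fixes G G' :: "real \<Rightarrow> real"
  assumes d: "\<And>s. s \<ge> 0 \<Longrightarrow> (G has_real_derivative G' s) (at s)" and c: "continuous_on {0..} G'"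
    and b: "\<And>s. s \<ge> 0 \<Longrightarrow> \<bar>G' s\<bar> \<le> K"
  obtains e e' where "\<And>s. (e has_real_derivative e' s) (at s)" "continuous_on UNIV e'" "\<And>s. \<bar>e' s\<bar> \<le> K"
    "\<And>s. s \<ge> 0 \<Longrightarrow> e s = G s" "\<And>s. s \<ge> 0 \<Longrightarrow> e' s = G' s"
proof (rule that[of "\<lambda>s. if s \<ge> 0 then G s else G 0 + G' 0 * s" "\<lambda>s. G' (max 0 s)"])
  let ?e = "\<lambda>s. if s \<ge> 0 then G s else G 0 + G' 0 * s"
  show "(?e has_real_derivative G' (max 0 s)) (at s)" for s
  proof (cases s "0::real" rule: linorder_cases)
    case less
    have "((\<lambda>s. G 0 + G' 0 * s) has_real_derivative G' (max 0 s)) (at s)"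
      using less by (auto intro!: derivative_eq_intros simp: max_def)
    then show ?thesis
      by (rule has_field_derivative_transform_within_open[where S="{..<0}"]) (use less in auto)
  next
    case greater
    have "(G has_real_derivative G' (max 0 s)) (at s)"
      using greater d[of s] by (simp add: max_def)
    then show ?thesis
      by (rule has_field_derivative_transform_within_open[where S="{0<..}"]) (use greater in auto)
  next
    case equal
    have "((\<lambda>h. (G (0 + h) - G 0) / h) \<longlongrightarrow> G' 0) (at 0)"
      using d[of 0] by (simp add: DERIV_def)
    then have "((\<lambda>h. (G (0 + h) - G 0) / h) \<longlongrightarrow> G' 0) (at_right 0)"
      by (simp add: filterlim_at_split)
    then have "((\<lambda>h. (?e (0 + h) - ?e 0) / h) \<longlongrightarrow> G' 0) (at_right 0)"
      by (rule Lim_transform_eventually) (auto simp: eventually_at_right_field intro!: exI[of _ 1])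
    moreover have "((\<lambda>h. (?e (0 + h) - ?e 0) / h) \<longlongrightarrow> G' 0) (at_left 0)"
      by (rule Lim_transform_eventually[OF tendsto_const])
        (auto simp: eventually_at_left_field intro!: exI[of _ "-1"])
    ultimately show ?thesis using equal by (simp add: DERIV_def filterlim_at_split)
  qed
  show "continuous_on UNIV (\<lambda>s. G' (max 0 s))"
    by (rule continuous_on_compose2[OF c]) (auto intro: continuous_intros)
  show "\<bar>G' (max 0 s)\<bar> \<le> K" for s using b[of "max 0 s"] by simp
qed auto

text \<open>Approximate the derivative by a polynomial and integrate: value and derivative are then
  both close. A polynomial keeps compositions smooth, and fixing the value at 0 preserves compact
  support when H 0 = 0.\<close>

lemma Weierstrass_C1:
  fixes H H' :: "real \<Rightarrow> real"
  assumes d: "\<And>s. (H has_real_derivative H' s) (at s)" and c: "continuous_on UNIV H'" and K: "K \<ge> 0" and e: "e > 0"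
  obtains P P' where "\<And>f :: 'a::euclidean_space \<Rightarrow> real. smooth f \<Longrightarrow> smooth (\<lambda>x. P (f x))"
    "\<And>s. (P has_real_derivative P' s) (at s)" "continuous_on UNIV P'" "P 0 = H 0"
    "\<And>s. \<bar>s\<bar> \<le> K \<Longrightarrow> \<bar>P s - H s\<bar> \<le> e" "\<And>s. \<bar>s\<bar> \<le> K \<Longrightarrow> \<bar>P' s - H' s\<bar> \<le> e"
proof -
  \<comment> \<open>Small enough for the derivative (e1 \<le> e) and, after integration over a
    length of at most K, for the value (e1 * K \<le> e).\<close>
  define e1 where "e1 = e / (1 + K)"
  have e1: "e1 > 0" "e1 \<le> e" "e1 * K \<le> e" using e K by (auto simp: e1_def field_simps)
  have "continuous_on {-K..K} H'" using c by (rule continuous_on_subset) auto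
  then obtain Q where Q: "real_polynomial_function Q" "\<And>s. s \<in> {-K..K} \<Longrightarrow> \<bar>H' s - Q s\<bar> < e1"
    using Stone_Weierstrass_real_polynomial_function[of "{-K..K}" H' e1] e1 by auto
  obtain a n where Qa: "Q = (\<lambda>x. \<Sum>i\<le>n. a i * x ^ i)"
    using Q(1) real_polynomial_function_iff_sum by auto
  define P where "P x = H 0 + (\<Sum>i\<le>n. a i / real (i + 1) * x ^ (i + 1))" for x :: real
  have dP: "(P has_real_derivative Q s) (at s)" for s
  proof -
    have "((\<lambda>x. a i / real (i + 1) * x ^ (i + 1)) has_real_derivative a i * s ^ i) (at s)" for i
    proof -
      have "((\<lambda>x. x ^ (i + 1)) has_real_derivative real (i + 1) * s ^ i) (at s)"
        using DERIV_pow[of "i + 1" s UNIV] by simp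
      then show ?thesis by (rule DERIV_cong[OF DERIV_cmult]) simp
    qed
    then have "((\<lambda>x. \<Sum>i\<le>n. a i / real (i + 1) * x ^ (i + 1)) has_real_derivative (\<Sum>i\<le>n. a i * s ^ i)) (at s)"
      by (intro DERIV_sum)
    from DERIV_add[OF DERIV_const this] show ?thesis
      unfolding P_def[abs_def] Qa by simp
  qed
  have cQ: "continuous_on UNIV Q" unfolding Qa by (intro continuous_intros)
  show ?thesis
  proof (rule that[of P Q])
    show "smooth (\<lambda>x. P (f x))" if "smooth f" for f :: "'a \<Rightarrow> real"
      unfolding P_def by (intro smooth_add smooth_const smooth_sum smooth_mult smooth_power that)
    show "P 0 = H 0" by (simp add: P_def)
    show "\<bar>Q s - H' s\<bar> \<le> e" if "\<bar>s\<bar> \<le> K" for s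
      using Q(2)[of s] that e1 by (auto simp: abs_le_iff)
    show "\<bar>P s - H s\<bar> \<le> e" if s: "\<bar>s\<bar> \<le> K" for s
    proof -
      have "norm ((\<lambda>s. P s - H s) s - (\<lambda>s. P s - H s) 0) \<le> e1 * norm (s - 0)"
      proof (rule field_differentiable_bound[of "{-K..K}" _ "\<lambda>s. Q s - H' s"])
        show "((\<lambda>s. P s - H s) has_real_derivative Q z - H' z) (at z within {-K..K})" for z
          using DERIV_diff[OF dP d] by (rule has_field_derivative_at_within)
        show "norm (Q z - H' z) \<le> e1" if "z \<in> {-K..K}" for z
          using Q(2)[OF that] by (auto simp: abs_minus_commute)
      qed (use s K in auto)
      then have "\<bar>P s - H s\<bar> \<le> e1 * \<bar>s\<bar>" by (simp add: P_def)
      also have "\<dots> \<le> e1 * K" using s e1 by (intro mult_left_mono) auto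
      finally show ?thesis using e1 by linarith
    qed
  qed (use dP cQ in auto)
qed

lemma grad_compose:
  fixes f :: "'a::euclidean_space \<Rightarrow> real"
  assumes "(f has_derivative (\<lambda>h. D \<bullet> h)) (at x)" "(H has_real_derivative d) (at (f x))"
  shows "((\<lambda>x. H (f x)) has_derivative (\<lambda>h. (d *\<^sub>R D) \<bullet> h)) (at x)"
  using has_derivative_compose[OF assms(1), of H "(*) d"] assms(2) by (simp add: has_field_derivative_def)

section \<open>Block matrices\<close>

lemma block_app_inner:
  "block_app a b D \<xi> \<bullet> \<eta> = (a * fst \<xi> + b \<bullet> snd \<xi>) * fst \<eta> + fst \<xi> * (b \<bullet> snd \<eta>) + (D *v snd \<xi>) \<bullet> snd \<eta>"
  by (simp add: block_app_def inner_prod_def inner_add_left)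

lemma matrix_vector_inner_sum:
  fixes D :: "real ^ 'm ^ 'm"
  shows "(D *v x) \<bullet> y = (\<Sum>i\<in>UNIV. \<Sum>j\<in>UNIV. D $ i $ j * x $ j * y $ i)"
  by (simp add: inner_vec_def matrix_vector_mult_def sum_distrib_right)

lemma pos_form_block:
  fixes D :: "real ^ 'm ^ 'm"
  assumes D: "transpose D = D" and lam: "lam > 0"
    and ell: "\<And>\<xi>. block_app a b D \<xi> \<bullet> \<xi> \<ge> lam * (norm \<xi>)\<^sup>2"
  shows "pos_form (\<lambda>\<xi> \<eta>. block_app a b D \<xi> \<bullet> \<eta>)"
  unfolding pos_form_def
proof (intro conjI allI impI)
  fix x y z :: "real \<times> (real ^ 'm)" and c :: real
  show "block_app a b D (x + y) \<bullet> z = block_app a b D x \<bullet> z + block_app a b D y \<bullet> z"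
    by (simp add: block_app_inner inner_add_right inner_add_left matrix_vector_right_distrib algebra_simps)
  show "block_app a b D (c *\<^sub>R x) \<bullet> y = c * (block_app a b D x \<bullet> y)"
    by (simp add: block_app_inner matrix_vector_mult_scaleR algebra_simps)
  have "(D *v snd x) \<bullet> snd y = (D *v snd y) \<bullet> snd x"
    using dot_lmul_matrix[of "snd x" D "snd y"] D
    by (metis transpose_matrix_vector inner_commute)
  then show "block_app a b D x \<bullet> y = block_app a b D y \<bullet> x"
    unfolding block_app_inner by (simp add: algebra_simps)
  show "block_app a b D x \<bullet> x > 0" if "x \<noteq> 0"
  proof -
    have "lam * (norm x)\<^sup>2 > 0" using that lam by simp
    then show ?thesis using ell[of x] by linarith
  qed
qed

lemma linear_block_app: "linear (block_app a b (D :: real ^ 'm ^ 'm))"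
  by (rule linearI) (simp_all add: block_app_def inner_add_right matrix_vector_right_distrib
      scaleR_add_left algebra_simps matrix_vector_mult_scaleR)

lemma borel_measurable_vec_nth_comp [measurable (raw)]:
  fixes f :: "'a \<Rightarrow> real ^ 'm"
  assumes "f \<in> borel_measurable M" shows "(\<lambda>x. f x $ i) \<in> borel_measurable M"
proof -
  have "(\<lambda>x. f x \<bullet> axis i 1) \<in> borel_measurable M" using assms by measurable
  then show ?thesis by (simp add: inner_axis)
qed

lemma borel_measurable_block_inner:
  fixes f h :: "'a \<Rightarrow> real \<times> (real ^ 'm)"
  assumes [measurable]: "a \<in> borel_measurable M" "\<And>i. (\<lambda>x. b x $ i) \<in> borel_measurable M"
    "\<And>i j. (\<lambda>x. D x $ i $ j) \<in> borel_measurable M" "f \<in> borel_measurable M" "h \<in> borel_measurable M"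
  shows "(\<lambda>x. block_app (a x) (b x) (D x) (f x) \<bullet> h x) \<in> borel_measurable M"
proof -
  have *: "(\<lambda>x. (a x * f1 x + b x \<bullet> f2 x) * h1 x + f1 x * (b x \<bullet> h2 x) + (D x *v f2 x) \<bullet> h2 x) \<in> borel_measurable M"
    if [measurable]: "f1 \<in> borel_measurable M" "h1 \<in> borel_measurable M" "f2 \<in> borel_measurable M" "h2 \<in> borel_measurable M"
    for f1 h1 :: "'a \<Rightarrow> real" and f2 h2 :: "'a \<Rightarrow> real ^ 'm"
    unfolding matrix_vector_inner_sum unfolding inner_vec_def inner_real_def by measurable
  show ?thesis
    unfolding block_app_inner
    by (rule *; rule borel_measurable_continuous_on[OF continuous_on_fst[OF continuous_on_id]]
        borel_measurable_continuous_on[OF continuous_on_snd[OF continuous_on_id]]; fact)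
qed

section \<open>Functions with vanishing weak gradient\<close>

text \<open>By Lindelof countably many of the balls cover \<open>U\<close>, so the exceptional sets
  unite to a null set.\<close>

lemma AE_local_to_global:
  fixes U :: "'a::euclidean_space set"
  assumes l: "\<And>x. x \<in> U \<Longrightarrow> \<exists>r>0. AE y in lebesgue. y \<in> ball x r \<longrightarrow> P y"
  shows "AE y in lebesgue. y \<in> U \<longrightarrow> P y"
proof -
  obtain r where r: "\<And>x. x \<in> U \<Longrightarrow> r x > 0 \<and> (AE y in lebesgue. y \<in> ball x (r x) \<longrightarrow> P y)"
    using l by metis
  obtain \<D> where \<D>: "\<D> \<subseteq> (\<lambda>x. ball x (r x)) ` U" "countable \<D>" "\<Union>\<D> = \<Union>((\<lambda>x. ball x (r x)) ` U)"
    using Lindelof[of "(\<lambda>x. ball x (r x)) ` U"] by force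
  have "AE y in lebesgue. \<forall>D\<in>\<D>. y \<in> D \<longrightarrow> P y"
  proof (rule AE_ball_countable[THEN iffD2])
    show "\<forall>D\<in>\<D>. AE y in lebesgue. y \<in> D \<longrightarrow> P y" using \<D>(1) r by blast
  qed (rule \<D>(2))
  then show ?thesis
  proof eventually_elim
    fix y assume *: "\<forall>D\<in>\<D>. y \<in> D \<longrightarrow> P y"
    show "y \<in> U \<longrightarrow> P y"
    proof
      assume "y \<in> U"
      then have "y \<in> \<Union>\<D>" unfolding \<D>(3) using r by force
      then show "P y" using * by blast
    qed
  qed
qed

lemma locally_integrable_bounded:
  fixes f :: "'a::euclidean_space \<Rightarrow> real"
  assumes [measurable]: "f \<in> borel_measurable borel" and b: "\<And>x. \<bar>f x\<bar> \<le> K"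
  shows "locally_integrable_on U f"
  unfolding locally_integrable_on_def set_integrable_def
proof (intro allI impI)
  fix Q :: "'a set" assume "compact Q \<and> Q \<subseteq> U"
  then have Q: "compact Q" by simp
  have m: "Q \<in> sets lebesgue" "emeasure lebesgue Q < \<infinity>"
    using lmeasurable_compact[OF Q] by (auto simp: fmeasurable_def)
  show "integrable lebesgue (\<lambda>x. indicat_real Q x *\<^sub>R f x)"
  proof (rule Bochner_Integration.integrable_bound)
    show "integrable lebesgue (\<lambda>x. K * indicator Q x)"
      using m by (intro integrable_mult_right integrable_real_indicator)
    show "(\<lambda>x. indicat_real Q x *\<^sub>R f x) \<in> borel_measurable lebesgue"
      using m(1) by (intro borel_measurable_scaleR borel_measurable_indicator measurable_completion) auto
    have "norm (indicat_real Q x *\<^sub>R f x) \<le> norm (K * indicator Q x)" for x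
      using b[of x] by (auto simp: indicator_def)
    then show "AE x in lebesgue. norm (indicat_real Q x *\<^sub>R f x) \<le> norm (K * indicator Q x)" by simp
  qed
qed

text \<open>As \<phi> moves by t h with 0 \<le> t \<le> 1, it stays a test function of
  \<open>U\<close>, so the derivative of its pairing with \<open>f\<close> vanishes. Hence
  \<open>f\<close> and its translate pair equally with all \<phi> supported in the small ball. The
  radius 2 r leaves room for shifts shorter than r.\<close>

lemma zero_weak_gradient_translate:
  fixes f :: "'a::euclidean_space \<Rightarrow> real"
  assumes U: "ball x0 (2 * r) \<subseteq> U" and fm: "f \<in> borel_measurable borel" and b: "\<And>x. \<bar>f x\<bar> \<le> K"
    and z: "\<And>\<phi> h. \<phi> \<in> test_functions U \<Longrightarrow> (LINT x|lebesgue. f x * (grad \<phi> x \<bullet> h)) = 0"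
    and h: "norm h < r"
  shows "AE x in lebesgue. x \<in> ball x0 r \<longrightarrow> f (x + h) = f x"
proof -
  note [measurable] = fm
  have fl: "f \<in> borel_measurable lebesgue" by (intro measurable_completion) simp
  have "AE x in lebesgue_on (ball x0 r). f (x + h) - f x = 0"
  proof (rule du_bois_reymond)
    have b2: "\<bar>f (x + h) - f x\<bar> \<le> K + K" for x using b[of x] b[of "x + h"] by linarith
    show "locally_integrable_on (ball x0 r) (\<lambda>x. f (x + h) - f x)"
      by (rule locally_integrable_bounded[OF _ b2]) simp
    fix \<phi> assume \<phi>: "\<phi> \<in> test_functions (ball x0 r)"
    obtain Q where Q: "smooth \<phi>" "compact Q" "Q \<subseteq> ball x0 r" "\<And>x. x \<notin> Q \<Longrightarrow> \<phi> x = 0" "\<And>x. x \<notin> Q \<Longrightarrow> grad \<phi> x = 0"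
      by (rule test_functionsE[OF \<phi>]) blast
    have C1: "C1_compact \<phi> (grad \<phi>) Q"
      using Q by (auto simp: C1_compact_def smooth_grad continuous_on_grad)
    note [measurable] = borel_measurable_continuous_onI[OF smooth_continuous[OF Q(1)]]
    have d0: "((\<lambda>t. LINT x|lebesgue. f x * \<phi> (x - t *\<^sub>R h)) has_real_derivative 0) (at s)" if s: "0 \<le> s" "s \<le> 1" for s
    proof -
      let ?\<phi> = "\<lambda>x. \<phi> (x - s *\<^sub>R h)"
      have t: "?\<phi> \<in> test_functions U"
      proof (rule test_functionsI[of _ "(+) (s *\<^sub>R h) ` Q"])
        show "smooth ?\<phi>"
          using smooth_affine[OF bounded_linear_ident Q(1), of "- (s *\<^sub>R h)"] by simp
        show "compact ((+) (s *\<^sub>R h) ` Q)" using Q by (intro compact_translation)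
        show "(+) (s *\<^sub>R h) ` Q \<subseteq> U"
        proof
          fix y assume "y \<in> (+) (s *\<^sub>R h) ` Q"
          then obtain q where q: "q \<in> Q" "y = s *\<^sub>R h + q" by auto
          have "norm (s *\<^sub>R h) \<le> norm h" using s by (simp add: mult_left_le_one_le)
          then have "dist x0 y < 2 * r"
            using q Q(3) h norm_triangle_ineq4[of "x0 - q" "s *\<^sub>R h"]
            by (force simp: dist_norm algebra_simps)
          then show "y \<in> U" using U by auto
        qed
        show "?\<phi> x = 0" if "x \<notin> (+) (s *\<^sub>R h) ` Q" for x
        proof (rule Q(4))
          show "x - s *\<^sub>R h \<notin> Q" using that by (metis add_diff_cancel_left' diff_add_cancel add.commute image_eqI)
        qed
      qed
      have "grad ?\<phi> x = grad \<phi> (x - s *\<^sub>R h)" for x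
        using C1_compact_shift[OF C1, of "s *\<^sub>R h"] by (intro grad_eqI) (simp add: C1_compact_def)
      then have "(LINT x|lebesgue. f x * (grad \<phi> (x - s *\<^sub>R h) \<bullet> h)) = 0"
        using z[OF t, of h] by simp
      then show ?thesis
        using integral_shift_has_derivative[OF C1 fl b, of h s] by simp
    qed
    have "continuous_on {0..1} (\<lambda>t::real. LINT x|lebesgue. f x * \<phi> (x - t *\<^sub>R h))"
      by (rule DERIV_atLeastAtMost_imp_continuous_on) (blast intro: d0)
    then have "(LINT x|lebesgue. f x * \<phi> (x - 1 *\<^sub>R h)) = (LINT x|lebesgue. f x * \<phi> (x - 0 *\<^sub>R h))"
      by (rule DERIV_isconst_end[OF zero_less_one]) (rule d0; simp)
    then have 1: "(LINT x|lebesgue. f x * \<phi> (x - h)) = (LINT x|lebesgue. f x * \<phi> x)" by simp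
    have 2: "(LINT x|lebesgue. f x * \<phi> (x - h)) = (LINT x|lebesgue. f (x + h) * \<phi> x)"
      using integral_lebesgue_translate[of "\<lambda>x. f x * \<phi> (x - h)" h] by simp
    have i: "integrable lebesgue (\<lambda>x. q x * \<phi> x)" if "q \<in> borel_measurable borel" "\<And>x. \<bar>q x\<bar> \<le> K" for q
    proof -
      have "integrable lebesgue (\<lambda>x. indicator UNIV x *\<^sub>R (q x * \<phi> x))"
        by (rule locally_integrable_mult_compact[OF locally_integrable_bounded[OF that] smooth_continuous[OF Q(1)] Q(2) _ Q(4)]) auto
      then show ?thesis by simp
    qed
    have "(LINT x:ball x0 r|lebesgue. (f (x + h) - f x) * \<phi> x) = (LINT x|lebesgue. (f (x + h) * \<phi> x - f x * \<phi> x))"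
      unfolding set_lebesgue_integral_def
    proof (rule Bochner_Integration.integral_cong)
      fix x
      have "\<phi> x = 0" if "x \<notin> ball x0 r" using that Q by blast
      then show "indicator (ball x0 r) x *\<^sub>R ((f (x + h) - f x) * \<phi> x) = f (x + h) * \<phi> x - f x * \<phi> x"
        by (cases "x \<in> ball x0 r") (auto simp: left_diff_distrib)
    qed simp
    also have "\<dots> = (LINT x|lebesgue. f (x + h) * \<phi> x) - (LINT x|lebesgue. f x * \<phi> x)"
      using b by (intro Bochner_Integration.integral_diff i) auto
    finally show "(LINT x:ball x0 r|lebesgue. (f (x + h) - f x) * \<phi> x) = 0" using 1 2 by simp
  qed simp
  then show ?thesis by (subst (asm) AE_restrict_space_iff) auto
qed

text \<open>Translation invariance holds for each shift outside a null set depending on the shift.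
  Fubini exchanges the quantifiers: for almost every point it holds for almost all shifts, and a
  single such point determines \<open>f\<close> around it.\<close>

lemma zero_weak_gradient_locally_constant:
  fixes f :: "'a::euclidean_space \<Rightarrow> real"
  assumes U: "ball x0 (2 * r) \<subseteq> U" and r: "r > 0" and fm: "f \<in> borel_measurable borel" and b: "\<And>x. \<bar>f x\<bar> \<le> K"
    and z: "\<And>\<phi> h. \<phi> \<in> test_functions U \<Longrightarrow> (LINT x|lebesgue. f x * (grad \<phi> x \<bullet> h)) = 0"
  shows "\<exists>c. AE y in lebesgue. y \<in> ball x0 (r / 2) \<longrightarrow> f y = c"
proof -
  note [measurable] = fm
  let ?P = "\<lambda>h x. norm h < r \<longrightarrow> norm (x - x0) < r \<longrightarrow> f (x + h) = f x"
  have "AE h in lborel. AE x in lborel. ?P h x"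
  proof (rule AE_I2)
    fix h :: 'a
    show "AE x in lborel. ?P h x"
    proof (cases "norm h < r")
      case True
      then have "AE x in lebesgue. x \<in> ball x0 r \<longrightarrow> f (x + h) = f x"
        by (intro zero_weak_gradient_translate[OF U fm b z])
      then show ?thesis by (simp add: AE_completion_iff dist_norm norm_minus_commute[of x0])
    qed auto
  qed
  moreover have "{z \<in> space (lborel \<Otimes>\<^sub>M lborel). ?P (fst z) (snd z)} \<in> sets (lborel \<Otimes>\<^sub>M lborel)"
    by measurable
  ultimately have "AE x in lborel. AE h in lborel. ?P h x"
    by (subst lborel_pair.AE_commute[symmetric]) auto
  then have "AE x in lebesgue. AE h in lborel. ?P h x" by (rule AE_completion)
  moreover have "\<not> (AE x in lebesgue. x \<notin> ball x0 (r / 2))"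
  proof
    assume "AE x in lebesgue. x \<notin> ball x0 (r / 2)"
    then have "ball x0 (r / 2) \<in> null_sets lebesgue"
      by (subst AE_iff_null_sets) auto
    then have "negligible (ball x0 (r / 2))" by (simp add: negligible_iff_null_sets)
    moreover have "ball x0 (r / 2) \<noteq> {}" using r by simp
    ultimately show False using open_not_negligible[OF open_ball] by blast
  qed
  \<comment> \<open>The smaller ball has positive measure and so contains a point with the exchanged
    property; being within r/2 of the centre, it reaches the whole smaller ball by shifts shorter
    than r.\<close>
  ultimately obtain x where x: "x \<in> ball x0 (r / 2)" "AE h in lborel. ?P h x"
    by (metis (mono_tags, lifting) eventually_mono)
  have xr: "norm (x - x0) < r" using x(1) r by (auto simp: dist_norm norm_minus_commute[of x0])
  have "AE y in lborel. norm (y - x) < r \<longrightarrow> f y = f x"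
  proof -
    have "AE y in distr lborel borel ((+) x). norm (y - x) < r \<longrightarrow> f y = f x"
      using x(2) xr by (subst AE_distr_iff) (auto simp: add.commute)
    then show ?thesis unfolding lborel_distr_plus .
  qed
  then have "AE y in lebesgue. norm (y - x) < r \<longrightarrow> f y = f x" by (rule AE_completion)
  then have "AE y in lebesgue. y \<in> ball x0 (r / 2) \<longrightarrow> f y = f x"
  proof eventually_elim
    fix y assume *: "norm (y - x) < r \<longrightarrow> f y = f x"
    show "y \<in> ball x0 (r / 2) \<longrightarrow> f y = f x"
    proof
      assume "y \<in> ball x0 (r / 2)"
      then have "dist y x < r" using x(1) dist_triangle_half_l[of y x0 r x] by (simp add: dist_commute)
      then show "f y = f x" using * by (simp add: dist_norm)
    qed
  qed
  then show ?thesis by blast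
qed

text \<open>Two balls that meet do so in a nonempty open set, which is not null, so their almost
  everywhere constants agree. The local constant is thus a locally constant function on
  \<open>U\<close>, and connectedness finishes.\<close>

lemma zero_weak_gradient_constant:
  fixes f :: "'a::euclidean_space \<Rightarrow> real"
  assumes U: "open U" "connected U" and fm: "f \<in> borel_measurable borel" and b: "\<And>x. \<bar>f x\<bar> \<le> K"
    and z: "\<And>\<phi> h. \<phi> \<in> test_functions U \<Longrightarrow> (LINT x|lebesgue. f x * (grad \<phi> x \<bullet> h)) = 0"
  shows "\<exists>c. AE x in lebesgue. x \<in> U \<longrightarrow> f x = c"
proof -
  have loc: "\<exists>r c. r > 0 \<and> (AE y in lebesgue. y \<in> ball x r \<longrightarrow> f y = c)" if "x \<in> U" for x
  proof -
    obtain e where e: "e > 0" "ball x e \<subseteq> U" using U(1) \<open>x \<in> U\<close> openE by blast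
    have "\<exists>c. AE y in lebesgue. y \<in> ball x (e / 2 / 2) \<longrightarrow> f y = c"
      by (rule zero_weak_gradient_locally_constant[OF _ _ fm b z]) (use e in auto)
    then obtain c where "AE y in lebesgue. y \<in> ball x (e / 2 / 2) \<longrightarrow> f y = c" ..
    moreover have "e / 2 / 2 > 0" using e by simp
    ultimately show ?thesis by blast
  qed
  then obtain r c where rc: "\<And>x. x \<in> U \<Longrightarrow> r x > 0 \<and> (AE y in lebesgue. y \<in> ball x (r x) \<longrightarrow> f y = c x)"
    by metis
  have same: "c x = c a" if xa: "x \<in> U" "a \<in> U" "x \<in> ball a (r a)" for x a
  proof (rule ccontr)
    assume ne: "c x \<noteq> c a"
    let ?V = "ball x (r x) \<inter> ball a (r a)"
    have "AE y in lebesgue. y \<notin> ?V"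
      using rc[OF xa(1), THEN conjunct2] rc[OF xa(2), THEN conjunct2]
      by eventually_elim (use ne in auto)
    then have "negligible ?V"
      by (subst negligible_iff_null_sets, subst AE_iff_null_sets) auto
    moreover have "x \<in> ?V" using xa rc by auto
    ultimately show False using open_not_negligible[of ?V] open_Int[OF open_ball open_ball] by blast
  qed
  have "c constant_on U"
  proof (rule locally_constant_imp_constant[OF U(2)])
    fix a assume a: "a \<in> U"
    show "\<exists>T. openin (top_of_set U) T \<and> a \<in> T \<and> (\<forall>x\<in>T. c x = c a)"
    proof (intro exI[of _ "U \<inter> ball a (r a)"] conjI ballI)
      show "openin (top_of_set U) (U \<inter> ball a (r a))" by (rule openin_open_Int) simp
      show "a \<in> U \<inter> ball a (r a)" using a rc[OF a] by simp
      show "c x = c a" if "x \<in> U \<inter> ball a (r a)" for x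
        by (rule same) (use that a in blast)+
    qed
  qed
  then obtain k where k: "\<And>x. x \<in> U \<Longrightarrow> c x = k" by (auto simp: constant_on_def)
  have "AE y in lebesgue. y \<in> U \<longrightarrow> f y = k"
  proof (rule AE_local_to_global)
    fix x assume "x \<in> U"
    then show "\<exists>r>0. AE y in lebesgue. y \<in> ball x r \<longrightarrow> f y = k"
      using rc[of x] k[of x] by auto
  qed
  then show ?thesis by blast
qed

section \<open>The section problem\<close>

lemma linear_quadratic_zero:
  fixes a R :: real
  assumes "\<And>t. \<bar>t\<bar> \<le> 1 \<Longrightarrow> 0 \<le> t * a + t\<^sup>2 * R"
  shows "a = 0"
proof (rule ccontr)
  assume a: "a \<noteq> 0"
  \<comment> \<open>Opposite in sign to \<open>a\<close> and so small that the quadratic term is at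
    most half of the linear one.\<close>
  define t where "t = - a / (2 * (\<bar>a\<bar> + \<bar>R\<bar>))"
  have pos: "\<bar>a\<bar> + \<bar>R\<bar> > 0" using a by simp
  have t1: "\<bar>t\<bar> \<le> 1" using pos by (simp add: t_def field_simps)
  have "t\<^sup>2 * R \<le> \<bar>t\<bar> * (\<bar>t\<bar> * \<bar>R\<bar>)"
    by (metis abs_ge_self abs_mult mult.assoc power2_eq_square)
  also have "\<dots> \<le> \<bar>t\<bar> * (\<bar>a\<bar> / 2)"
  proof (rule mult_left_mono)
    have "\<bar>t\<bar> * \<bar>R\<bar> = \<bar>a\<bar> * \<bar>R\<bar> / (2 * (\<bar>a\<bar> + \<bar>R\<bar>))" using pos by (simp add: t_def abs_mult)
    also have "\<dots> \<le> \<bar>a\<bar> / 2" using pos by (simp add: field_simps mult_left_mono)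
    finally show "\<bar>t\<bar> * \<bar>R\<bar> \<le> \<bar>a\<bar> / 2" .
  qed simp
  finally have *: "t\<^sup>2 * R \<le> \<bar>t\<bar> * (\<bar>a\<bar> / 2)" .
  have "t * a = - (\<bar>t\<bar> * \<bar>a\<bar>)"
    using pos by (simp add: t_def abs_mult field_simps)
  moreover have "\<bar>t\<bar> * (\<bar>a\<bar> / 2) < \<bar>t\<bar> * \<bar>a\<bar>"
    using a pos by (intro mult_strict_left_mono) (auto simp: t_def)
  ultimately have "\<bar>t\<bar> * (\<bar>a\<bar> / 2) < - (t * a)" by linarith
  then show False using assms[OF t1] * by linarith
qed

text \<open>The convexity inequality for forms, applied to multiplication on the reals.\<close>

lemma abs_powr_tangent:
  fixes x y p :: real
  assumes "p \<ge> 2"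
  shows "\<bar>x + y\<bar> powr p \<ge> \<bar>x\<bar> powr p + abs_powr' p x * y"
proof -
  have form: "pos_form (\<lambda>a b :: real. a * b)"
    by (auto simp: pos_form_def algebra_simps not_sum_squares_lt_zero zero_less_mult_iff)
  have e: "(z * z) powr (q / 2) = \<bar>z\<bar> powr q" for z q :: real
  proof -
    have "(z * z) powr (q / 2) = (\<bar>z\<bar> * \<bar>z\<bar>) powr (q / 2)" by simp
    also have "\<dots> = \<bar>z\<bar> powr (q / 2) * \<bar>z\<bar> powr (q / 2)" by (rule powr_mult)
    also have "\<dots> = \<bar>z\<bar> powr q" by (simp only: powr_add[symmetric]) simp
    finally show ?thesis .
  qed
  have "((x + y) * (x + y)) powr (p / 2) \<ge> (x * x) powr (p / 2) + p * (x * x) powr ((p - 2) / 2) * (x * ((x + y) - x))"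
    by (rule form_powr_convex[OF form assms])
  then show ?thesis unfolding e by (simp add: abs_powr'_def mult.assoc)
qed

text \<open>The weak gradient \<open>g\<close> of \<open>W\<close> enters only through test functions \<open>w\<^sub>k\<close> that converge to \<open>W\<close>
  almost everywhere, with their gradients, under a \<open>p\<close>-integrable majorant \<open>F\<close>.\<close>

locale cylinder =
  fixes p C lam \<mu> :: real
    and \<omega> :: "(real ^ 'm) set"
    and a11 :: "real ^ 'm \<Rightarrow> real"
    and A12 :: "real ^ 'm \<Rightarrow> real ^ 'm"
    and A22 :: "real ^ 'm \<Rightarrow> real ^ 'm ^ 'm"
    and W :: "real ^ 'm \<Rightarrow> real" and g :: "real ^ 'm \<Rightarrow> real ^ 'm"
    and w :: "nat \<Rightarrow> real ^ 'm \<Rightarrow> real" and F :: "real ^ 'm \<Rightarrow> real"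
  assumes p: "p \<ge> 2"
    and omega: "open \<omega>" "connected \<omega>" "bounded \<omega>"
    and a11_meas: "a11 \<in> borel_measurable (lebesgue_on \<omega>)"
    and A12_meas: "\<And>i. (\<lambda>X. A12 X $ i) \<in> borel_measurable (lebesgue_on \<omega>)"
    and A22_meas: "\<And>i j. (\<lambda>X. A22 X $ i $ j) \<in> borel_measurable (lebesgue_on \<omega>)"
    and A22_sym: "\<And>X. X \<in> \<omega> \<Longrightarrow> transpose (A22 X) = A22 X"
    and constants: "C > 0" "lam > 0"
    and A_bounded: "AE X in lebesgue_on \<omega>. onorm (block_app (a11 X) (A12 X) (A22 X)) \<le> C"
    and A_elliptic: "AE X in lebesgue_on \<omega>. \<forall>\<xi>.
                       block_app (a11 X) (A12 X) (A22 X) \<xi> \<bullet> \<xi> \<ge> lam * (norm \<xi>)\<^sup>2"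
    and w_test: "\<And>k. w k \<in> test_functions \<omega>"
    and F_meas: "F \<in> borel_measurable (lebesgue_on \<omega>)" and F_nonneg: "\<And>X. F X \<ge> 0"
    and F_int: "integrable (lebesgue_on \<omega>) (\<lambda>X. F X powr p)"
    and w_lim: "AE X in lebesgue_on \<omega>. (\<lambda>k. w k X) \<longlonglongrightarrow> W X"
    and w_grad_lim: "AE X in lebesgue_on \<omega>. (\<lambda>k. grad (w k) X) \<longlonglongrightarrow> g X"
    and w_bound: "AE X in lebesgue_on \<omega>. \<forall>k. \<bar>w k X\<bar> \<le> F X \<and> norm (grad (w k) X) \<le> F X"
    and W_bound: "AE X in lebesgue_on \<omega>. \<bar>W X\<bar> \<le> F X \<and> norm (g X) \<le> F X"
    and W_meas: "W \<in> borel_measurable (lebesgue_on \<omega>)" and g_meas: "g \<in> borel_measurable (lebesgue_on \<omega>)"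
    and W_nonneg: "AE X in lebesgue_on \<omega>. W X \<ge> 0"
    and W_normalized: "(LINT X|lebesgue_on \<omega>. \<bar>W X\<bar> powr p) = 1"
    and section_min: "\<And>\<psi>. \<psi> \<in> test_functions \<omega> \<Longrightarrow>
          \<mu> * (LINT X|lebesgue_on \<omega>. \<bar>\<psi> X\<bar> powr p)
            \<le> (LINT X|lebesgue_on \<omega>. \<bar>(A22 X *v grad \<psi> X) \<bullet> grad \<psi> X\<bar> powr (p / 2))"
    and W_energy: "(LINT X|lebesgue_on \<omega>. \<bar>(A22 X *v g X) \<bullet> g X\<bar> powr (p / 2)) = \<mu>"
begin

section \<open>Pointwise bounds and integrability on the section\<close>

abbreviation "M \<equiv> lebesgue_on \<omega>"

definition B :: "real ^ 'm \<Rightarrow> real \<times> (real ^ 'm) \<Rightarrow> real \<times> (real ^ 'm) \<Rightarrow> real" where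
  "B X \<xi> \<eta> = block_app (a11 X) (A12 X) (A22 X) \<xi> \<bullet> \<eta>"

text \<open>Collects every property that holds almost everywhere, so that estimates can be made
  pointwise and only one exceptional null set is ever carried along.\<close>

definition good :: "real ^ 'm \<Rightarrow> bool" where
  "good X \<longleftrightarrow> pos_form (B X) \<and> (\<forall>\<xi>. lam * (norm \<xi>)\<^sup>2 \<le> B X \<xi> \<xi>) \<and>
     (\<forall>\<xi> \<eta>. \<bar>B X \<xi> \<eta>\<bar> \<le> C * norm \<xi> * norm \<eta>) \<and>
     W X \<ge> 0 \<and> \<bar>W X\<bar> \<le> F X \<and> norm (g X) \<le> F X \<and>
     (\<forall>k. \<bar>w k X\<bar> \<le> F X \<and> norm (grad (w k) X) \<le> F X) \<and>
     (\<lambda>k. w k X) \<longlonglongrightarrow> W X \<and> (\<lambda>k. grad (w k) X) \<longlonglongrightarrow> g X"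

lemma goodD:
  assumes "good X"
  shows "pos_form (B X)" "lam * (norm \<xi>)\<^sup>2 \<le> B X \<xi> \<xi>" "\<bar>B X \<xi> \<eta>\<bar> \<le> C * norm \<xi> * norm \<eta>"
    "W X \<ge> 0" "\<bar>W X\<bar> \<le> F X" "norm (g X) \<le> F X" "\<bar>w k X\<bar> \<le> F X" "norm (grad (w k) X) \<le> F X"
    "(\<lambda>k. w k X) \<longlonglongrightarrow> W X" "(\<lambda>k. grad (w k) X) \<longlonglongrightarrow> g X"
  using assms unfolding good_def by blast+

lemma AE_good: "AE X in M. good X"
proof -
  have sp: "AE X in M. X \<in> \<omega>" using AE_space[of M] by simp
  show ?thesis
    using A_bounded A_elliptic w_lim w_grad_lim w_bound W_bound W_nonneg sp
  proof eventually_elim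
    case (elim X)
    have bl: "bounded_linear (block_app (a11 X) (A12 X) (A22 X))"
      using linear_block_app by (rule linear_conv_bounded_linear[THEN iffD1])
    have "\<bar>B X \<xi> \<eta>\<bar> \<le> C * norm \<xi> * norm \<eta>" for \<xi> \<eta>
    proof -
      have "\<bar>B X \<xi> \<eta>\<bar> \<le> norm (block_app (a11 X) (A12 X) (A22 X) \<xi>) * norm \<eta>"
        unfolding B_def by (rule Cauchy_Schwarz_ineq2)
      also have "\<dots> \<le> (onorm (block_app (a11 X) (A12 X) (A22 X)) * norm \<xi>) * norm \<eta>"
        by (intro mult_right_mono onorm[OF bl]) auto
      also have "\<dots> \<le> (C * norm \<xi>) * norm \<eta>"
        by (intro mult_right_mono elim(1)) auto
      finally show ?thesis .
    qed
    moreover have "pos_form (B X)"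
      unfolding B_def[abs_def] by (rule pos_form_block[OF A22_sym[OF elim(8)] constants(2)]) (use elim(2) in blast)
    ultimately show ?case using elim by (auto simp: good_def B_def)
  qed
qed

lemma B_sec: "B X (0, \<xi>) \<eta> = (A12 X \<bullet> \<xi>) * fst \<eta> + (A22 X *v \<xi>) \<bullet> snd \<eta>"
  by (simp add: B_def block_app_inner)

lemma tendsto_B:
  assumes "(f \<longlongrightarrow> \<xi>) net" "(h \<longlongrightarrow> \<eta>) net" shows "((\<lambda>k. B X (f k) (h k)) \<longlongrightarrow> B X \<xi> \<eta>) net"
proof -
  have "bounded_linear (block_app (a11 X) (A12 X) (A22 X))"
    using linear_block_app by (rule linear_conv_bounded_linear[THEN iffD1])
  from bounded_linear.tendsto[OF this assms(1)] show ?thesis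
    unfolding B_def by (intro tendsto_inner assms(2))
qed

lemma finite_M: "finite_measure M"
  using omega by (intro finite_measure_lebesgue_on lmeasurable_open)

lemma omega_sets: "\<omega> \<in> sets lebesgue"
  using omega by auto

lemma integrable_const_M: "integrable M (\<lambda>X. c :: real)"
  using finite_measure.integrable_const[OF finite_M] .

lemma integrable_F_plus: "d \<ge> 0 \<Longrightarrow> integrable M (\<lambda>X. (F X + d) powr p)"
  using F_meas F_nonneg F_int integrable_const_M p by (intro integrable_powr_add) auto

text \<open>The standard criterion on the section: a bound by a multiple of (F + d)^p at good
  points. The constant d admits bounded terms, since \<omega> has finite measure.\<close>

lemma integrable_F_bound:
  fixes f :: "real ^ 'm \<Rightarrow> real"
  assumes "f \<in> borel_measurable M" "d \<ge> 0" "\<And>X. good X \<Longrightarrow> \<bar>f X\<bar> \<le> c * (F X + d) powr p"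
  shows "integrable M f"
proof (rule Bochner_Integration.integrable_bound[OF integrable_mult_right[OF integrable_F_plus[OF assms(2)]]])
  show "AE X in M. norm (f X) \<le> norm (c * (F X + d) powr p)"
    using AE_good by eventually_elim (use assms(3) abs_ge_self order_trans in fastforce)
qed (rule assms(1))

lemma measurable_B:
  assumes "f \<in> borel_measurable M" "h \<in> borel_measurable M"
  shows "(\<lambda>X. B X (f X) (h X)) \<in> borel_measurable M"
  unfolding B_def using a11_meas A12_meas A22_meas assms by (rule borel_measurable_block_inner)

lemma measurable_zero_Pair: "f \<in> borel_measurable M \<Longrightarrow> (\<lambda>X. (0::real, f X :: real ^ 'm)) \<in> borel_measurable M"
  by (rule borel_measurable_Pair) auto

lemma measurable_smooth: "smooth f \<Longrightarrow> f \<in> borel_measurable M" "smooth f \<Longrightarrow> grad f \<in> borel_measurable M"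
  by (intro measurable_continuous_on_lebesgue_on smooth_continuous continuous_on_grad; assumption)+

lemma good_B_nonneg: "good X \<Longrightarrow> B X \<xi> \<xi> \<ge> 0"
  using form_nonneg[OF goodD(1)] by blast

lemma good_B_le: "good X \<Longrightarrow> B X \<xi> \<xi> \<le> C * (norm \<xi> * norm \<xi>)"
proof -
  assume "good X"
  then show ?thesis using goodD(3)[of X \<xi> \<xi>] by (simp add: mult.assoc)
qed

lemma good_B_powr_le:
  assumes "good X" "q \<ge> 0"
  shows "B X \<xi> \<xi> powr q \<le> C powr q * norm \<xi> powr (2 * q)"
proof -
  have "B X \<xi> \<xi> \<le> C * (norm \<xi> * norm \<xi>)" by (rule good_B_le[OF assms(1)])
  then have "B X \<xi> \<xi> powr q \<le> (C * (norm \<xi> * norm \<xi>)) powr q"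
    using assms good_B_nonneg by (intro powr_mono2) auto
  also have "\<dots> = C powr q * (norm \<xi> powr q * norm \<xi> powr q)" using constants by (simp add: powr_mult)
  also have "norm \<xi> powr q * norm \<xi> powr q = norm \<xi> powr (2 * q)" by (simp add: powr_add[symmetric])
  finally show ?thesis .
qed

lemma good_B_powr_ge:
  assumes "good X" "q \<ge> 0"
  shows "lam powr q * norm \<xi> powr (2 * q) \<le> B X \<xi> \<xi> powr q"
proof -
  have "lam * (norm \<xi> * norm \<xi>) \<le> B X \<xi> \<xi>" using goodD(2)[OF assms(1), of \<xi>] by (simp add: power2_eq_square)
  then have "(lam * (norm \<xi> * norm \<xi>)) powr q \<le> B X \<xi> \<xi> powr q"
    using assms constants by (intro powr_mono2) auto
  moreover have "(lam * (norm \<xi> * norm \<xi>)) powr q = lam powr q * (norm \<xi> powr q * norm \<xi> powr q)"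
    using constants by (simp add: powr_mult)
  moreover have "norm \<xi> powr q * norm \<xi> powr q = norm \<xi> powr (2 * q)" by (simp add: powr_add[symmetric])
  ultimately show ?thesis by simp
qed

section \<open>Energy density, flux and the Euler--Lagrange equation\<close>

definition E :: "real ^ 'm \<Rightarrow> real" where "E X = B X (0, g X) (0, g X)"

text \<open>The flux of W: p times \<open>L X y\<close> is the derivative of the energy density |A
  \<xi> \<cdot> \<xi>|^(p/2) at \<xi> = (0, g) in direction y. The argument y ranges over all of
  R^n, because the axial component enters on the cylinder.\<close>

definition L :: "real ^ 'm \<Rightarrow> real \<times> (real ^ 'm) \<Rightarrow> real" where
  "L X y = E X powr ((p - 2) / 2) * B X (0, g X) y"

lemma L_linear: "good X \<Longrightarrow> L X (x + y) = L X x + L X y" "good X \<Longrightarrow> L X (c *\<^sub>R x) = c * L X x"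
  by (auto simp: L_def good_def form_add form_scale algebra_simps)

lemma L_g: "good X \<Longrightarrow> L X (0, g X) = E X powr (p / 2)"
  using good_B_nonneg[of X "(0, g X)"]
  by (cases "E X = 0") (auto simp: L_def E_def diff_divide_distrib powr_diff)

lemma L_bound:
  assumes "good X" shows "\<bar>L X y\<bar> \<le> C powr (p / 2) * norm (g X) powr (p - 1) * norm y"
proof -
  have "E X powr ((p - 2) / 2) \<le> C powr ((p - 2) / 2) * norm (g X) powr (p - 2)"
  proof -
    have h: "2 * ((p - 2) / 2) = p - 2" by simp
    from good_B_powr_le[OF assms, of "(p - 2) / 2" "(0, g X)", unfolded h] show ?thesis
      using p by (simp add: E_def norm_Pair)
  qed
  moreover have "\<bar>B X (0, g X) y\<bar> \<le> C * norm (g X) * norm y"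
  proof -
    have "\<bar>B X (0, g X) y\<bar> \<le> C * norm (0::real, g X) * norm y" by (rule goodD(3)[OF assms])
    then show ?thesis by (simp add: norm_Pair)
  qed
  ultimately have "E X powr ((p - 2) / 2) * \<bar>B X (0, g X) y\<bar> \<le> (C powr ((p - 2) / 2) * norm (g X) powr (p - 2)) * (C * norm (g X) * norm y)"
    by (intro mult_mono) auto
  also have "\<dots> = (C powr ((p - 2) / 2) * C) * (norm (g X) powr (p - 2) * norm (g X)) * norm y" by simp
  also have "C powr ((p - 2) / 2) * C = C powr (p / 2)"
    using constants by (simp add: diff_divide_distrib powr_diff)
  also have "norm (g X) powr (p - 2) * norm (g X) = norm (g X) powr (p - 1)"
  proof (cases "g X = 0")
    case False
    have "norm (g X) powr (p - 1) = norm (g X) powr ((p - 2) + 1)" by simp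
    then show ?thesis using False by (simp only: powr_add) simp
  qed simp
  finally show ?thesis by (simp add: L_def abs_mult)
qed

lemma measurable_E: "E \<in> borel_measurable M"
  unfolding E_def[abs_def] by (intro measurable_B measurable_zero_Pair g_meas)

lemma measurable_L: "f \<in> borel_measurable M \<Longrightarrow> (\<lambda>X. L X (f X)) \<in> borel_measurable M"
  using measurable_E measurable_B[OF measurable_zero_Pair[OF g_meas]]
  unfolding L_def by (intro borel_measurable_times) auto

definition w0 :: "real ^ 'm \<Rightarrow> real" where "w0 X = \<bar>W X\<bar> powr (p - 2) * W X"

lemma measurable_w0: "w0 \<in> borel_measurable M"
  unfolding w0_def[abs_def] using W_meas by measurable

lemma w0_abs: "\<bar>w0 X\<bar> = \<bar>W X\<bar> powr (p - 1)"
  using abs_abs_powr'[OF p, of "W X"] p by (simp add: abs_powr'_def w0_def abs_mult)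

text \<open>Pointwise substitute for Hoelder's inequality: with a common majorant c a product of
  degrees p - 1 and 1 is dominated by c^p.\<close>

lemma powr_mult_le:
  fixes a b c :: real
  assumes "0 \<le> a" "a \<le> c" "0 \<le> b" "b \<le> c"
  shows "a powr (p - 1) * b \<le> c powr p"
proof (cases "c = 0")
  case False
  have "a powr (p - 1) * b \<le> c powr (p - 1) * c"
    using assms p by (intro mult_mono powr_mono2) auto
  also have "\<dots> = c powr p" using False assms by (simp add: powr_diff)
  finally show ?thesis .
qed (use assms in auto)

lemma good_L_le:
  assumes X: "good X" and d: "d \<ge> 0" and y: "norm y \<le> c * (F X + d)" and c: "c \<ge> 0"
  shows "\<bar>L X y\<bar> \<le> (C powr (p / 2) * c) * (F X + d) powr p"
proof -
  have "\<bar>L X y\<bar> \<le> C powr (p / 2) * norm (g X) powr (p - 1) * (c * (F X + d))"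
    using L_bound[OF X, of y] y by (smt (verit) mult_left_mono mult_nonneg_nonneg powr_ge_zero)
  also have "\<dots> = (C powr (p / 2) * c) * (norm (g X) powr (p - 1) * (F X + d))" by simp
  also have "\<dots> \<le> (C powr (p / 2) * c) * (F X + d) powr p"
    using X d c F_nonneg[of X] by (intro mult_left_mono powr_mult_le) (auto simp: good_def)
  finally show ?thesis .
qed

lemma good_w0_le:
  assumes X: "good X" and d: "d \<ge> 0" and y: "\<bar>y\<bar> \<le> c * (F X + d)" and c: "c \<ge> 0"
  shows "\<bar>w0 X * y\<bar> \<le> c * (F X + d) powr p"
proof -
  have "\<bar>w0 X * y\<bar> \<le> \<bar>W X\<bar> powr (p - 1) * (c * (F X + d))"
    unfolding abs_mult w0_abs by (intro mult_left_mono y) auto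
  also have "\<dots> = c * (\<bar>W X\<bar> powr (p - 1) * (F X + d))" by simp
  also have "\<dots> \<le> c * (F X + d) powr p"
    using X d c F_nonneg[of X] by (intro mult_left_mono powr_mult_le) (auto simp: good_def)
  finally show ?thesis .
qed

text \<open>The weak Euler--Lagrange equation of \<open>W\<close>; the second argument stands for the gradient of the first.\<close>

definition EL :: "(real ^ 'm \<Rightarrow> real) \<Rightarrow> (real ^ 'm \<Rightarrow> real ^ 'm) \<Rightarrow> bool" where
  "EL \<psi> D \<longleftrightarrow> (LINT X|M. L X (0, D X)) = \<mu> * (LINT X|M. w0 X * \<psi> X)"

text \<open>Both sides of the equation converge by dominated convergence. This is the device by
  which the admissible test functions are enlarged from smooth functions to C^1 compositions and
  then to functions of W.\<close>

lemma EL_limit: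
  assumes m: "\<And>j. \<psi> j \<in> borel_measurable M" "\<And>j. D j \<in> borel_measurable M" "\<psi>' \<in> borel_measurable M" "D' \<in> borel_measurable M"
    and lim: "\<And>X. good X \<Longrightarrow> (\<lambda>j. \<psi> j X) \<longlonglongrightarrow> \<psi>' X" "\<And>X. good X \<Longrightarrow> (\<lambda>j. D j X) \<longlonglongrightarrow> D' X"
    and d: "d \<ge> 0" "c \<ge> 0"
    and b: "\<And>X j. good X \<Longrightarrow> \<bar>\<psi> j X\<bar> \<le> c * (F X + d)" "\<And>X j. good X \<Longrightarrow> norm (D j X) \<le> c * (F X + d)"
    and EL: "\<And>j. EL (\<psi> j) (D j)"
  shows "EL \<psi>' D'"
proof -
  have 1: "(\<lambda>j. LINT X|M. L X (0, D j X)) \<longlonglongrightarrow> (LINT X|M. L X (0, D' X))"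
  proof (rule integral_dominated_convergence[where w="\<lambda>X. (C powr (p / 2) * c) * (F X + d) powr p"])
    show "integrable M (\<lambda>X. (C powr (p / 2) * c) * (F X + d) powr p)"
      by (intro integrable_mult_right integrable_F_plus d)
    show "AE X in M. (\<lambda>j. L X (0, D j X)) \<longlonglongrightarrow> L X (0, D' X)"
      using AE_good unfolding L_def
      by eventually_elim (intro tendsto_mult tendsto_B tendsto_Pair tendsto_const lim)
    show "AE X in M. norm (L X (0, D j X)) \<le> (C powr (p / 2) * c) * (F X + d) powr p" for j
      using AE_good by eventually_elim (use good_L_le d b(2) in \<open>auto simp: norm_Pair\<close>)
  qed (intro measurable_L measurable_zero_Pair m)+
  have 2: "(\<lambda>j. LINT X|M. w0 X * \<psi> j X) \<longlonglongrightarrow> (LINT X|M. w0 X * \<psi>' X)"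
  proof (rule integral_dominated_convergence[where w="\<lambda>X. c * (F X + d) powr p"])
    show "integrable M (\<lambda>X. c * (F X + d) powr p)"
      by (intro integrable_mult_right integrable_F_plus d)
    show "AE X in M. (\<lambda>j. w0 X * \<psi> j X) \<longlonglongrightarrow> w0 X * \<psi>' X"
      using AE_good by eventually_elim (intro tendsto_mult tendsto_const lim)
    show "AE X in M. norm (w0 X * \<psi> j X) \<le> c * (F X + d) powr p" for j
      using AE_good by eventually_elim (use good_w0_le d b(1) in auto)
  qed (intro borel_measurable_times measurable_w0 m)+
  have "(\<lambda>j. LINT X|M. L X (0, D j X)) \<longlonglongrightarrow> \<mu> * (LINT X|M. w0 X * \<psi>' X)"
    using tendsto_mult_left[OF 2, of \<mu>] EL by (simp add: EL_def)
  with 1 show ?thesis unfolding EL_def by (rule LIMSEQ_unique)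
qed

lemma good_energy_le:
  assumes "good X" "norm \<xi> \<le> c"
  shows "\<bar>\<bar>B X \<xi> \<xi>\<bar> powr (p / 2)\<bar> \<le> C powr (p / 2) * c powr p"
proof -
  have "B X \<xi> \<xi> powr (p / 2) \<le> C powr (p / 2) * norm \<xi> powr p"
    using good_B_powr_le[OF assms(1), of "p / 2"] p by simp
  also have "\<dots> \<le> C powr (p / 2) * c powr p"
    using assms p by (intro mult_left_mono powr_mono2) auto
  finally show ?thesis using good_B_nonneg[OF assms(1)] by simp
qed

text \<open>Minimality is assumed for test functions only. The functions w_k + t \<psi> are test
  functions, and both integrals converge, so W + t \<psi> need not be placed in a function
  space.\<close>

lemma perturbed_min:
  assumes \<psi>: "\<psi> \<in> test_functions \<omega>"
  shows "\<mu> * (LINT X|M. \<bar>W X + t * \<psi> X\<bar> powr p)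
     \<le> (LINT X|M. \<bar>B X (0, g X + t *\<^sub>R grad \<psi> X) (0, g X + t *\<^sub>R grad \<psi> X)\<bar> powr (p / 2))"
proof -
  obtain b where b: "b \<ge> 0" "\<And>x. \<bar>\<psi> x\<bar> \<le> b" "\<And>x. norm (grad \<psi> x) \<le> b"
    by (rule test_bounded[OF \<psi>]) blast
  note sm = test_smooth[OF \<psi>] test_smooth[OF w_test]
  let ?D = "\<lambda>k X. grad (w k) X + t *\<^sub>R grad \<psi> X"
  let ?d = "\<bar>t\<bar> * b"
  have d: "?d \<ge> 0" using b by simp
  have gr: "grad (\<lambda>x. w k x + t * \<psi> x) X = ?D k X" for k X
    using has_derivative_add[OF smooth_grad[OF sm(2), of k X] has_derivative_mult_right[OF smooth_grad[OF sm(1)], of t X]]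
    by (intro grad_eqI) (simp add: inner_add_left)
  have tt: "(\<lambda>x. w k x + t * \<psi> x) \<in> test_functions \<omega>" for k
    by (intro test_add test_scale w_test \<psi>)
  have tb: "\<bar>t * \<psi> X\<bar> \<le> ?d" "norm (t *\<^sub>R grad \<psi> X) \<le> ?d" for X
    using b by (auto simp: abs_mult intro!: mult_left_mono)
  have le: "\<mu> * (LINT X|M. \<bar>w k X + t * \<psi> X\<bar> powr p) \<le> (LINT X|M. \<bar>B X (0, ?D k X) (0, ?D k X)\<bar> powr (p / 2))" for k
    using section_min[OF tt] unfolding gr B_sec by simp
  have 1: "(\<lambda>k. LINT X|M. \<bar>w k X + t * \<psi> X\<bar> powr p) \<longlonglongrightarrow> (LINT X|M. \<bar>W X + t * \<psi> X\<bar> powr p)"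
  proof (rule integral_dominated_convergence[where w="\<lambda>X. (F X + ?d) powr p"])
    show "AE X in M. (\<lambda>k. \<bar>w k X + t * \<psi> X\<bar> powr p) \<longlonglongrightarrow> \<bar>W X + t * \<psi> X\<bar> powr p"
      using AE_good
      by eventually_elim (use p in \<open>auto simp: good_def intro!: tendsto_powr' tendsto_intros\<close>)
    show "AE X in M. norm (\<bar>w k X + t * \<psi> X\<bar> powr p) \<le> (F X + ?d) powr p" for k
      using AE_good
    proof eventually_elim
      case (elim X)
      then have "\<bar>w k X\<bar> \<le> F X" by (simp add: good_def)
      then have "\<bar>w k X + t * \<psi> X\<bar> \<le> F X + ?d" using tb(1)[of X] by linarith
      then show ?case using p by (auto intro: powr_mono2)
    qed
    show "(\<lambda>X. \<bar>W X + t * \<psi> X\<bar> powr p) \<in> borel_measurable M"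
      using W_meas measurable_smooth(1)[OF sm(1)] by measurable
    show "(\<lambda>X. \<bar>w k X + t * \<psi> X\<bar> powr p) \<in> borel_measurable M" for k
      using measurable_smooth(1)[OF sm(2), of k] measurable_smooth(1)[OF sm(1)] by measurable
  qed (rule integrable_F_plus[OF d])
  have 2: "(\<lambda>k. LINT X|M. \<bar>B X (0, ?D k X) (0, ?D k X)\<bar> powr (p / 2))
      \<longlonglongrightarrow> (LINT X|M. \<bar>B X (0, g X + t *\<^sub>R grad \<psi> X) (0, g X + t *\<^sub>R grad \<psi> X)\<bar> powr (p / 2))"
  proof (rule integral_dominated_convergence[where w="\<lambda>X. C powr (p / 2) * (F X + ?d) powr p"])
    show "AE X in M. (\<lambda>k. \<bar>B X (0, ?D k X) (0, ?D k X)\<bar> powr (p / 2))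
       \<longlonglongrightarrow> \<bar>B X (0, g X + t *\<^sub>R grad \<psi> X) (0, g X + t *\<^sub>R grad \<psi> X)\<bar> powr (p / 2)"
      using AE_good
    proof eventually_elim
      case (elim X)
      have "(\<lambda>k. ?D k X) \<longlonglongrightarrow> g X + t *\<^sub>R grad \<psi> X"
        using elim by (intro tendsto_intros) (simp add: good_def)
      then show ?case using p
        by (intro tendsto_powr' tendsto_rabs tendsto_B tendsto_Pair tendsto_const) auto
    qed
    show "AE X in M. norm (\<bar>B X (0, ?D k X) (0, ?D k X)\<bar> powr (p / 2)) \<le> C powr (p / 2) * (F X + ?d) powr p" for k
      using AE_good
    proof eventually_elim
      case (elim X)
      then have "norm (grad (w k) X) \<le> F X" by (simp add: good_def)
      then have "norm (?D k X) \<le> F X + ?d"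
        using tb(2)[of X] norm_triangle_ineq[of "grad (w k) X" "t *\<^sub>R grad \<psi> X"] by linarith
      then show ?case unfolding real_norm_def by (intro good_energy_le elim) (simp add: norm_Pair)
    qed
    have m: "(\<lambda>X. \<bar>B X (0, h X) (0, h X)\<bar> powr (p / 2)) \<in> borel_measurable M" if "h \<in> borel_measurable M" for h
      using measurable_B[OF measurable_zero_Pair[OF that] measurable_zero_Pair[OF that]] by measurable
    show "(\<lambda>X. \<bar>B X (0, g X + t *\<^sub>R grad \<psi> X) (0, g X + t *\<^sub>R grad \<psi> X)\<bar> powr (p / 2)) \<in> borel_measurable M"
      by (intro m borel_measurable_add borel_measurable_scaleR borel_measurable_const g_meas measurable_smooth(2) sm)
    show "(\<lambda>X. \<bar>B X (0, ?D k X) (0, ?D k X)\<bar> powr (p / 2)) \<in> borel_measurable M" for k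
      by (intro m borel_measurable_add borel_measurable_scaleR borel_measurable_const measurable_smooth(2) sm)
  qed (intro integrable_mult_right integrable_F_plus d)
  show ?thesis
    by (rule LIMSEQ_le[OF tendsto_mult_left[OF 1] 2]) (use le in auto)
qed

text \<open>\<open>form_powr_upper\<close> with the form replaced by the bound C: if c dominates
  both vectors and the increment is at most t c, the remainder is of order t^2 c^p, hence integrable
  together with c^p.\<close>

lemma good_energy_upper:
  assumes X: "good X" and d: "norm d \<le> t * c" and x: "norm x + norm d \<le> c" and t: "t \<ge> 0"
  shows "\<bar>B X (x + d) (x + d)\<bar> powr (p / 2) \<le> B X x x powr (p / 2) + p * B X x x powr ((p - 2) / 2) * B X x d
           + p\<^sup>2 * C powr (p / 2) * c powr p * t\<^sup>2"
proof -
  have form: "pos_form (B X)" using X by (simp add: good_def)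
  have c: "c \<ge> 0" using x norm_ge_zero[of x] norm_ge_zero[of d] by linarith
  have sq: "sqrt (B X y y) \<le> sqrt C * norm y" for y
  proof -
    have "B X y y \<le> C * (norm y)\<^sup>2"
      using good_B_le[OF X] by (simp add: power2_eq_square)
    then have "sqrt (B X y y) \<le> sqrt (C * (norm y)\<^sup>2)" by (rule real_sqrt_le_mono)
    then show ?thesis by (simp add: real_sqrt_mult)
  qed
  have "sqrt (B X x x) + sqrt (B X d d) \<le> sqrt C * (norm x + norm d)"
    using sq[of x] sq[of d] by (simp add: distrib_left)
  also have "\<dots> \<le> sqrt C * c" using x constants by (intro mult_left_mono) auto
  finally have s: "(sqrt (B X x x) + sqrt (B X d d)) powr (p - 2) \<le> (sqrt C * c) powr (p - 2)"
    using p good_B_nonneg[OF X] by (intro powr_mono2) auto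
  have "B X d d \<le> C * (norm d * norm d)"
    by (rule good_B_le[OF X])
  also have "\<dots> \<le> C * ((t * c) * (t * c))"
    using d constants c t by (intro mult_left_mono mult_mono) auto
  finally have dd: "B X d d \<le> C * ((t * c) * (t * c))" .
  have "(sqrt (B X x x) + sqrt (B X d d)) powr (p - 2) * B X d d \<le> (sqrt C * c) powr (p - 2) * (C * ((t * c) * (t * c)))"
    using s dd good_B_nonneg[OF X, of d] by (intro mult_mono) auto
  also have "\<dots> = (sqrt C powr (p - 2) * C) * (c powr (p - 2) * (c * c)) * t\<^sup>2"
    using c constants by (simp add: powr_mult power2_eq_square)
  also have "sqrt C powr (p - 2) * C = C powr (p / 2)"
    using constants by (simp add: powr_half_sqrt[symmetric] powr_powr diff_divide_distrib powr_diff)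
  also have "c powr (p - 2) * (c * c) = c powr p"
    using c by (cases "c = 0") (auto simp: powr_diff power2_eq_square)
  finally have "p\<^sup>2 * ((sqrt (B X x x) + sqrt (B X d d)) powr (p - 2) * B X d d) \<le> p\<^sup>2 * (C powr (p / 2) * c powr p * t\<^sup>2)"
    by (rule mult_left_mono) simp
  then show ?thesis
    using form_powr_upper[OF form p, of x d] good_B_nonneg[OF X, of "x + d"] by (simp add: mult.assoc)
qed

lemma integrable_E: "integrable M (\<lambda>X. E X powr (p / 2))"
proof (rule integrable_F_bound[of _ 0 "C powr (p / 2)"])
  show "\<bar>E X powr (p / 2)\<bar> \<le> C powr (p / 2) * (F X + 0) powr p" if "good X" for X
    using good_energy_le[OF that, of "(0, g X)" "F X"] that good_B_nonneg[OF that, of "(0, g X)"]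
    by (simp add: good_def E_def norm_Pair)
qed (use measurable_E in auto)

lemma integral_E: "(LINT X|M. E X powr (p / 2)) = \<mu>"
proof -
  have "(LINT X|M. E X powr (p / 2)) = (LINT X|M. \<bar>(A22 X *v g X) \<bullet> g X\<bar> powr (p / 2))"
  proof (rule integral_cong_AE)
    show "AE X in M. E X powr (p / 2) = \<bar>(A22 X *v g X) \<bullet> g X\<bar> powr (p / 2)"
      using AE_good
    proof eventually_elim
      case (elim X)
      show ?case using good_B_nonneg[OF elim, of "(0, g X)"] by (simp add: E_def B_sec)
    qed
    show "(\<lambda>X. E X powr (p / 2)) \<in> borel_measurable M" using measurable_E by measurable
    have "(\<lambda>X. \<bar>B X (0, g X) (0, g X)\<bar> powr (p / 2)) \<in> borel_measurable M"
      using measurable_B[OF measurable_zero_Pair[OF g_meas] measurable_zero_Pair[OF g_meas]] by measurable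
    then show "(\<lambda>X. \<bar>(A22 X *v g X) \<bullet> g X\<bar> powr (p / 2)) \<in> borel_measurable M"
      by (simp add: B_sec)
  qed
  then show ?thesis by (simp add: W_energy)
qed

lemma mu_nonneg: "\<mu> \<ge> 0"
  unfolding integral_E[symmetric] by (rule integral_nonneg_AE) simp

text \<open>The first variation at W vanishes. One-sided estimates suffice: the mass of W + t \<psi>
  is bounded below by convexity and its energy above with a quadratic remainder, and since t may
  have either sign the linear coefficient must be zero.\<close>

lemma EL_test:
  assumes \<psi>: "\<psi> \<in> test_functions \<omega>"
  shows "EL \<psi> (grad \<psi>)"
proof -
  obtain b where b: "b \<ge> 0" "\<And>x. \<bar>\<psi> x\<bar> \<le> b" "\<And>x. norm (grad \<psi> x) \<le> b"
    by (rule test_bounded[OF \<psi>]) blast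
  note sm = test_smooth[OF \<psi>]
  have iL: "integrable M (\<lambda>X. L X (0, grad \<psi> X))"
  proof (rule integrable_F_bound[of _ b "C powr (p / 2) * 1"])
    show "\<bar>L X (0, grad \<psi> X)\<bar> \<le> C powr (p / 2) * 1 * (F X + b) powr p" if "good X" for X
      using b F_nonneg[of X] by (intro good_L_le that) (auto simp: norm_Pair add_increasing)
  qed (rule measurable_L measurable_zero_Pair measurable_smooth(2) sm b)+
  have iw: "integrable M (\<lambda>X. w0 X * \<psi> X)"
  proof (rule integrable_F_bound[of _ b 1])
    show "\<bar>w0 X * \<psi> X\<bar> \<le> 1 * (F X + b) powr p" if "good X" for X
      using b F_nonneg[of X] by (intro good_w0_le that) (auto simp: add_increasing)
  qed (rule borel_measurable_times measurable_w0 measurable_smooth(1) sm b)+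
  have iW: "integrable M (\<lambda>X. \<bar>W X\<bar> powr p)"
  proof (rule integrable_F_bound[of _ 0 1])
    show "\<bar>\<bar>W X\<bar> powr p\<bar> \<le> 1 * (F X + 0) powr p" if "good X" for X
      using that p by (auto simp: good_def intro: powr_mono2)
  qed (use W_meas in auto)
  define R where "R = p\<^sup>2 * C powr (p / 2) * (LINT X|M. (F X + b) powr p)"
  have "0 \<le> t * (p * ((LINT X|M. L X (0, grad \<psi> X)) - \<mu> * (LINT X|M. w0 X * \<psi> X))) + t\<^sup>2 * R" if t: "\<bar>t\<bar> \<le> 1" for t
  proof -
    have iWt: "integrable M (\<lambda>X. \<bar>W X + t * \<psi> X\<bar> powr p)"
    proof (rule integrable_F_bound[of _ b 1])
      show "\<bar>\<bar>W X + t * \<psi> X\<bar> powr p\<bar> \<le> 1 * (F X + b) powr p" if X: "good X" for X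
      proof -
        have "\<bar>t * \<psi> X\<bar> \<le> 1 * b" unfolding abs_mult using t b by (intro mult_mono) auto
        then have "\<bar>W X + t * \<psi> X\<bar> \<le> F X + b" using goodD(5)[OF X] by linarith
        then show ?thesis using p by (auto intro: powr_mono2)
      qed
      show "(\<lambda>X. \<bar>W X + t * \<psi> X\<bar> powr p) \<in> borel_measurable M"
        using W_meas measurable_smooth(1)[OF sm] by measurable
    qed (rule b)
    have "(LINT X|M. \<bar>W X\<bar> powr p + p * t * (w0 X * \<psi> X)) \<le> (LINT X|M. \<bar>W X + t * \<psi> X\<bar> powr p)"
    proof (rule integral_mono)
      show "\<bar>W X\<bar> powr p + p * t * (w0 X * \<psi> X) \<le> \<bar>W X + t * \<psi> X\<bar> powr p" for X
        using abs_powr_tangent[OF p, of "W X" "t * \<psi> X"] by (simp add: abs_powr'_def w0_def algebra_simps)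
    qed (intro Bochner_Integration.integrable_add integrable_mult_right iW iw iWt)+
    also have "(LINT X|M. \<bar>W X\<bar> powr p + p * t * (w0 X * \<psi> X)) = 1 + p * t * (LINT X|M. w0 X * \<psi> X)"
      using iW iw W_normalized by simp
    finally have "\<mu> * (1 + p * t * (LINT X|M. w0 X * \<psi> X)) \<le> \<mu> * (LINT X|M. \<bar>W X + t * \<psi> X\<bar> powr p)"
      by (rule mult_left_mono) (rule mu_nonneg)
    also have "\<dots> \<le> (LINT X|M. \<bar>B X (0, g X + t *\<^sub>R grad \<psi> X) (0, g X + t *\<^sub>R grad \<psi> X)\<bar> powr (p / 2))"
      by (rule perturbed_min[OF \<psi>])
    also have "\<dots> \<le> (LINT X|M. E X powr (p / 2) + p * t * L X (0, grad \<psi> X) + (p\<^sup>2 * C powr (p / 2)) * (F X + b) powr p * t\<^sup>2)"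
    proof (rule integral_mono_AE)
      have nb: "norm (t *\<^sub>R grad \<psi> X) \<le> \<bar>t\<bar> * b" for X using b by (simp add: mult_left_mono)
      have tb: "\<bar>t\<bar> * b \<le> b" using t b by (simp add: mult_left_le_one_le)
      show "integrable M (\<lambda>X. \<bar>B X (0, g X + t *\<^sub>R grad \<psi> X) (0, g X + t *\<^sub>R grad \<psi> X)\<bar> powr (p / 2))"
      proof (rule integrable_F_bound[of _ b "C powr (p / 2)"])
        show "\<bar>\<bar>B X (0, g X + t *\<^sub>R grad \<psi> X) (0, g X + t *\<^sub>R grad \<psi> X)\<bar> powr (p / 2)\<bar> \<le> C powr (p / 2) * (F X + b) powr p" if X: "good X" for X
        proof (rule good_energy_le[OF X])
          show "norm (0::real, g X + t *\<^sub>R grad \<psi> X) \<le> F X + b"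
            using X nb[of X] tb norm_triangle_ineq[of "g X" "t *\<^sub>R grad \<psi> X"] by (simp add: good_def norm_Pair)
        qed
        have "(\<lambda>X. (0::real, g X + t *\<^sub>R grad \<psi> X)) \<in> borel_measurable M"
          by (intro measurable_zero_Pair borel_measurable_add borel_measurable_scaleR borel_measurable_const g_meas measurable_smooth(2) sm)
        from measurable_B[OF this this]
        show "(\<lambda>X. \<bar>B X (0, g X + t *\<^sub>R grad \<psi> X) (0, g X + t *\<^sub>R grad \<psi> X)\<bar> powr (p / 2)) \<in> borel_measurable M" by measurable
      qed (rule b)
      show "AE X in M. \<bar>B X (0, g X + t *\<^sub>R grad \<psi> X) (0, g X + t *\<^sub>R grad \<psi> X)\<bar> powr (p / 2)
          \<le> E X powr (p / 2) + p * t * L X (0, grad \<psi> X) + (p\<^sup>2 * C powr (p / 2)) * (F X + b) powr p * t\<^sup>2"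
        using AE_good
      proof eventually_elim
        case (elim X)
        have "\<bar>B X ((0, g X) + (0, t *\<^sub>R grad \<psi> X)) ((0, g X) + (0, t *\<^sub>R grad \<psi> X))\<bar> powr (p / 2)
          \<le> B X (0, g X) (0, g X) powr (p / 2) + p * B X (0, g X) (0, g X) powr ((p - 2) / 2) * B X (0, g X) (0, t *\<^sub>R grad \<psi> X)
           + p\<^sup>2 * C powr (p / 2) * (F X + b) powr p * \<bar>t\<bar>\<^sup>2"
        proof (rule good_energy_upper[OF elim])
          have "\<bar>t\<bar> * b \<le> \<bar>t\<bar> * (F X + b)" using F_nonneg[of X] by (intro mult_left_mono) auto
          then show "norm (0::real, t *\<^sub>R grad \<psi> X) \<le> \<bar>t\<bar> * (F X + b)" using nb[of X] by (simp add: norm_Pair)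
          show "norm (0::real, g X) + norm (0::real, t *\<^sub>R grad \<psi> X) \<le> F X + b"
            using elim nb[of X] tb by (simp add: good_def norm_Pair)
        qed simp
        moreover have "B X (0, g X) (0, t *\<^sub>R grad \<psi> X) = t * B X (0, g X) (0, grad \<psi> X)"
          by (simp add: B_sec)
        ultimately show ?case by (simp add: E_def L_def algebra_simps)
      qed
    qed (intro Bochner_Integration.integrable_add integrable_mult_right integrable_mult_left integrable_E iL integrable_F_plus b)
    also have "\<dots> = \<mu> + p * t * (LINT X|M. L X (0, grad \<psi> X)) + R * t\<^sup>2"
      using integrable_E iL integrable_F_plus[OF b(1)] integral_E by (simp add: R_def)
    finally show ?thesis by (simp add: algebra_simps)
  qed
  then have "p * ((LINT X|M. L X (0, grad \<psi> X)) - \<mu> * (LINT X|M. w0 X * \<psi> X)) = 0"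
    by (rule linear_quadratic_zero)
  then show ?thesis using p by (simp add: EL_def)
qed

end

lemma DERIV_imp_continuous_UNIV:
  fixes H :: "real \<Rightarrow> real"
  shows "(\<And>s. (H has_real_derivative H' s) (at s)) \<Longrightarrow> continuous_on UNIV H"
  by (meson DERIV_isCont continuous_at_imp_continuous_on)

lemma C1_lipschitz_growth:
  fixes G G' :: "real \<Rightarrow> real"
  assumes "\<And>s. (G has_real_derivative G' s) (at s)" "\<And>s. \<bar>G' s\<bar> \<le> K"
  shows "\<bar>G s\<bar> \<le> \<bar>G 0\<bar> + K * \<bar>s\<bar>"
proof -
  have "norm (G s - G 0) \<le> K * norm (s - 0)"
    by (rule field_differentiable_bound[of UNIV G G'])
      (use assms in \<open>auto intro: has_field_derivative_at_within\<close>)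
  then show ?thesis by simp
qed

context cylinder
begin

section \<open>Enlarging the class of admissible test functions\<close>

lemma measurable_M_arith:
  fixes c d :: "real ^ 'm \<Rightarrow> real" and u v :: "real ^ 'm \<Rightarrow> real ^ 'm"
  assumes "c \<in> borel_measurable M" "d \<in> borel_measurable M" "u \<in> borel_measurable M" "v \<in> borel_measurable M"
  shows "(\<lambda>X. c X *\<^sub>R u X + d X *\<^sub>R v X) \<in> borel_measurable M"
  using assms by (intro borel_measurable_add borel_measurable_scaleR)

text \<open>The profiles H = |s|^p and G are merely C^1, so the product is not a test function.
  Replacing both by polynomials that are C^1-close on the bounded ranges of \<open>f\<close> and
  \<open>v\<close> makes it one, and \<open>EL_limit\<close> returns to H and G.\<close>

lemma EL_comp:
  fixes H H' G G' :: "real \<Rightarrow> real"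
  assumes H: "\<And>s. (H has_real_derivative H' s) (at s)" "continuous_on UNIV H'" "H 0 = 0"
    and G: "\<And>s. (G has_real_derivative G' s) (at s)" "continuous_on UNIV G'"
    and f: "f \<in> test_functions \<omega>" and v: "v \<in> test_functions \<omega>"
  shows "EL (\<lambda>X. H (f X) * G (v X))
     (\<lambda>X. (G (v X) * H' (f X)) *\<^sub>R grad f X + (H (f X) * G' (v X)) *\<^sub>R grad v X)"
proof -
  obtain b1 where b1: "b1 \<ge> 0" "\<And>x. \<bar>f x\<bar> \<le> b1" "\<And>x. norm (grad f x) \<le> b1"
    by (rule test_bounded[OF f]) blast
  obtain b2 where b2: "b2 \<ge> 0" "\<And>x. \<bar>v x\<bar> \<le> b2" "\<And>x. norm (grad v x) \<le> b2"
    by (rule test_bounded[OF v]) blast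
  define b where "b = max b1 b2"
  have b: "b \<ge> 0" "\<And>x. \<bar>f x\<bar> \<le> b" "\<And>x. norm (grad f x) \<le> b" "\<And>x. \<bar>v x\<bar> \<le> b" "\<And>x. norm (grad v x) \<le> b"
    using b1 b2 by (auto simp: b_def le_max_iff_disj)
  have cH: "continuous_on UNIV H" "continuous_on UNIV G"
    by (rule DERIV_imp_continuous_UNIV, rule H(1) G(1))+
  have "\<exists>A. \<forall>s\<in>{-b..b}. \<bar>q s\<bar> \<le> A" if "continuous_on UNIV q" for q :: "real \<Rightarrow> real"
  proof -
    have "compact (q ` {-b..b})" using that by (intro compact_continuous_image) (auto intro: continuous_on_subset)
    then show ?thesis by (auto dest!: compact_imp_bounded simp: bounded_iff)
  qed
  then obtain A1 A2 A3 A4 where A': "\<forall>s\<in>{-b..b}. \<bar>H s\<bar> \<le> A1" "\<forall>s\<in>{-b..b}. \<bar>H' s\<bar> \<le> A2" "\<forall>s\<in>{-b..b}. \<bar>G s\<bar> \<le> A3" "\<forall>s\<in>{-b..b}. \<bar>G' s\<bar> \<le> A4"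
    using cH H(2) G(2) by meson
  \<comment> \<open>The added 1 leaves room for the approximants, which differ from their limits by
    at most 1 on the relevant range.\<close>
  define A where "A = max (max (max A1 A2) (max A3 A4)) 0 + 1"
  have A: "\<bar>H s\<bar> + 1 \<le> A" "\<bar>H' s\<bar> + 1 \<le> A" "\<bar>G s\<bar> + 1 \<le> A" "\<bar>G' s\<bar> + 1 \<le> A" if "\<bar>s\<bar> \<le> b" for s
  proof -
    have "s \<in> {-b..b}" using that by auto
    then have "\<bar>H s\<bar> \<le> A1" "\<bar>H' s\<bar> \<le> A2" "\<bar>G s\<bar> \<le> A3" "\<bar>G' s\<bar> \<le> A4" using A' by blast+
    then show "\<bar>H s\<bar> + 1 \<le> A" "\<bar>H' s\<bar> + 1 \<le> A" "\<bar>G s\<bar> + 1 \<le> A" "\<bar>G' s\<bar> + 1 \<le> A" unfolding A_def by linarith+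
  qed
  have A0: "A \<ge> 1" by (simp add: A_def)
  define approx where "approx Q e P P' \<longleftrightarrow> (\<forall>h :: real ^ 'm \<Rightarrow> real. smooth h \<longrightarrow> smooth (\<lambda>x. P (h x))) \<and>
     (\<forall>s. (P has_real_derivative P' s) (at s)) \<and> continuous_on UNIV P' \<and> P 0 = Q 0 \<and>
     (\<forall>s. \<bar>s\<bar> \<le> b \<longrightarrow> \<bar>P s - Q s\<bar> \<le> e)" for Q :: "real \<Rightarrow> real" and e and P P' :: "real \<Rightarrow> real"
  have ex: "\<exists>P P'. \<forall>j. approx Q (1 / real (Suc j)) (P j) (P' j) \<and> (\<forall>s. \<bar>s\<bar> \<le> b \<longrightarrow> \<bar>P' j s - Q' s\<bar> \<le> 1 / real (Suc j))"
    if Q: "\<And>s. (Q has_real_derivative Q' s) (at s)" "continuous_on UNIV Q'" for Q Q'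
  proof -
    have "\<exists>P P'. approx Q (1 / real (Suc j)) P P' \<and> (\<forall>s. \<bar>s\<bar> \<le> b \<longrightarrow> \<bar>P' s - Q' s\<bar> \<le> 1 / real (Suc j))" for j
    proof -
      have "1 / real (Suc j) > 0" by simp
      from Weierstrass_C1[OF Q b(1) this, where ?'a="real ^ 'm"]
      show ?thesis unfolding approx_def by metis
    qed
    then show ?thesis by metis
  qed
  obtain P P' where P: "\<And>j. approx H (1 / real (Suc j)) (P j) (P' j)" "\<And>j s. \<bar>s\<bar> \<le> b \<Longrightarrow> \<bar>P' j s - H' s\<bar> \<le> 1 / real (Suc j)"
    using ex[OF H(1,2)] by metis
  obtain Q Q' where Q: "\<And>j. approx G (1 / real (Suc j)) (Q j) (Q' j)" "\<And>j s. \<bar>s\<bar> \<le> b \<Longrightarrow> \<bar>Q' j s - G' s\<bar> \<le> 1 / real (Suc j)"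
    using ex[OF G(1,2)] by metis
  have Pd: "(P j has_real_derivative P' j s) (at s)" "continuous_on UNIV (P' j)" "P j 0 = 0" "\<bar>s\<bar> \<le> b \<Longrightarrow> \<bar>P j s - H s\<bar> \<le> 1 / real (Suc j)" for j s
    using P(1)[of j] H(3) by (auto simp: approx_def)
  have Qd: "(Q j has_real_derivative Q' j s) (at s)" "continuous_on UNIV (Q' j)" "\<bar>s\<bar> \<le> b \<Longrightarrow> \<bar>Q j s - G s\<bar> \<le> 1 / real (Suc j)" for j s
    using Q(1)[of j] by (auto simp: approx_def)
  have sm: "smooth (\<lambda>X. P j (f X))" "smooth (\<lambda>X. Q j (v X))" for j
    using P(1)[of j] Q(1)[of j] test_smooth[OF f] test_smooth[OF v] by (auto simp: approx_def)
  have null: "(\<lambda>j. 1 / real (Suc j)) \<longlonglongrightarrow> 0"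
    using LIMSEQ_inverse_real_of_nat by (simp add: inverse_eq_divide)
  have conv: "(\<lambda>j. q j) \<longlonglongrightarrow> l" if "\<And>j. \<bar>q j - l\<bar> \<le> 1 / real (Suc j)" for q :: "nat \<Rightarrow> real" and l
  proof (rule LIM_zero_cancel, rule Lim_null_comparison[OF always_eventually null])
    show "\<forall>j. norm (q j - l) \<le> 1 / real (Suc j)" using that by simp
  qed
  have near: "\<bar>q\<bar> \<le> A" if "\<bar>q - l\<bar> \<le> 1 / real (Suc j)" "\<bar>l\<bar> + 1 \<le> A" for q l :: real and j
  proof -
    have "1 / real (Suc j) \<le> 1" by simp
    then show ?thesis using that by linarith
  qed
  let ?D = "\<lambda>j X. (Q j (v X) * P' j (f X)) *\<^sub>R grad f X + (P j (f X) * Q' j (v X)) *\<^sub>R grad v X"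
  \<comment> \<open>The approximants of H still vanish at 0, so the product vanishes wherever
    \<open>f\<close> does and keeps compact support in \<omega>.\<close>
  have tst: "(\<lambda>X. P j (f X) * Q j (v X)) \<in> test_functions \<omega>" for j
  proof -
    obtain K where K: "compact K" "K \<subseteq> \<omega>" "\<And>x. x \<notin> K \<Longrightarrow> f x = 0"
      by (rule test_functionsE[OF f]) blast
    show ?thesis
      by (rule test_functionsI[OF smooth_mult[OF sm] K(1,2)]) (simp add: K(3) Pd(3))
  qed
  have gr: "grad (\<lambda>X. P j (f X) * Q j (v X)) X = ?D j X" for j X
  proof (rule grad_eqI)
    have "((\<lambda>X. P j (f X)) has_derivative (\<lambda>h. (P' j (f X) *\<^sub>R grad f X) \<bullet> h)) (at X)"
      "((\<lambda>X. Q j (v X)) has_derivative (\<lambda>h. (Q' j (v X) *\<^sub>R grad v X) \<bullet> h)) (at X)"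
      by (rule grad_compose[OF smooth_grad[OF test_smooth[OF f]] Pd(1)] grad_compose[OF smooth_grad[OF test_smooth[OF v]] Qd(1)])+
    from has_derivative_mult[OF this]
    show "((\<lambda>X. P j (f X) * Q j (v X)) has_derivative (\<lambda>h. ?D j X \<bullet> h)) (at X)"
      by (rule has_derivative_eq_rhs) (simp add: fun_eq_iff inner_add_left algebra_simps)
  qed
  have mf: "f \<in> borel_measurable M" "v \<in> borel_measurable M" "grad f \<in> borel_measurable M" "grad v \<in> borel_measurable M"
    by (intro measurable_smooth test_smooth[OF f] test_smooth[OF v])+
  have mc: "(\<lambda>X. q (h X)) \<in> borel_measurable M" if "continuous_on UNIV q" "h \<in> borel_measurable M" for q :: "real \<Rightarrow> real" and h
    by (rule borel_measurable_continuous_on[OF that])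
  have cP: "continuous_on UNIV (P j)" "continuous_on UNIV (Q j)" for j
    by (rule DERIV_imp_continuous_UNIV, rule Pd(1) Qd(1))+
  note mm = mc[OF cP(1) mf(1)] mc[OF cP(2) mf(2)] mc[OF Pd(2) mf(1)] mc[OF Qd(2) mf(2)]
    mc[OF cH(1) mf(1)] mc[OF cH(2) mf(2)] mc[OF H(2) mf(1)] mc[OF G(2) mf(2)]
  show ?thesis
  proof (rule EL_limit[where \<psi>="\<lambda>j X. P j (f X) * Q j (v X)" and D="?D" and d=1 and c="A * A + 2 * (A * A * b)"])
    show "(\<lambda>X. P j (f X) * Q j (v X)) \<in> borel_measurable M" for j
      by (intro borel_measurable_times mm mf)
    show "?D j \<in> borel_measurable M" for j
      by (intro measurable_M_arith borel_measurable_times mm mf)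
    show "(\<lambda>X. H (f X) * G (v X)) \<in> borel_measurable M"
      by (intro borel_measurable_times mm mf)
    show "(\<lambda>X. (G (v X) * H' (f X)) *\<^sub>R grad f X + (H (f X) * G' (v X)) *\<^sub>R grad v X) \<in> borel_measurable M"
      by (intro measurable_M_arith borel_measurable_times mm mf)
    fix X
    have c1: "(\<lambda>j. P j (f X)) \<longlonglongrightarrow> H (f X)" "(\<lambda>j. Q j (v X)) \<longlonglongrightarrow> G (v X)"
      "(\<lambda>j. P' j (f X)) \<longlonglongrightarrow> H' (f X)" "(\<lambda>j. Q' j (v X)) \<longlonglongrightarrow> G' (v X)"
      by (rule conv, rule Pd(4) Qd(3) P(2) Q(2), rule b)+
    show "(\<lambda>j. P j (f X) * Q j (v X)) \<longlonglongrightarrow> H (f X) * G (v X)" by (intro tendsto_mult c1)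
    show "(\<lambda>j. ?D j X) \<longlonglongrightarrow> (G (v X) * H' (f X)) *\<^sub>R grad f X + (H (f X) * G' (v X)) *\<^sub>R grad v X"
      by (intro tendsto_add tendsto_scaleR tendsto_mult c1 tendsto_const)
    fix j
    have n: "\<bar>P j (f X)\<bar> \<le> A" "\<bar>Q j (v X)\<bar> \<le> A" "\<bar>P' j (f X)\<bar> \<le> A" "\<bar>Q' j (v X)\<bar> \<le> A"
      by (rule near[OF Pd(4)[OF b(2)] A(1)[OF b(2)]], rule near[OF Qd(3)[OF b(4)] A(3)[OF b(4)]],
          rule near[OF P(2)[OF b(2)] A(2)[OF b(2)]], rule near[OF Q(2)[OF b(4)] A(4)[OF b(4)]])
    have cc: "A * A + 2 * (A * A * b) \<le> (A * A + 2 * (A * A * b)) * (F X + 1)"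
      using A0 b(1) F_nonneg[of X] by (simp add: distrib_left)
    have "\<bar>P j (f X) * Q j (v X)\<bar> \<le> A * A" unfolding abs_mult using n A0 by (intro mult_mono) auto
    moreover have AA: "A * A * b \<ge> 0" using A0 b(1) by simp
    ultimately show "\<bar>P j (f X) * Q j (v X)\<bar> \<le> (A * A + 2 * (A * A * b)) * (F X + 1)" using cc by linarith
    have "norm (?D j X) \<le> norm ((Q j (v X) * P' j (f X)) *\<^sub>R grad f X) + norm ((P j (f X) * Q' j (v X)) *\<^sub>R grad v X)"
      by (rule norm_triangle_ineq)
    also have "\<dots> \<le> A * A * b + A * A * b"
      unfolding norm_scaleR abs_mult using n A0 b by (intro add_mono mult_mono) auto
    finally show "norm (?D j X) \<le> (A * A + 2 * (A * A * b)) * (F X + 1)" using cc A0 mult_nonneg_nonneg[of A A] by linarith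
  next
    show "EL (\<lambda>X. P j (f X) * Q j (v X)) (?D j)" for j
      using EL_test[OF tst[of j]] unfolding gr[abs_def] .
  qed (use A0 b(1) in auto)
qed

text \<open>Take v = w_k in \<open>EL_comp\<close> and let k tend to infinity. The bound on G' gives
  G linear growth, so the test functions and their gradients stay below a multiple of F + 1.\<close>

lemma EL_W:
  fixes G G' :: "real \<Rightarrow> real"
  assumes G: "\<And>s. (G has_real_derivative G' s) (at s)" "continuous_on UNIV G'" "\<And>s. \<bar>G' s\<bar> \<le> K"
    and f: "f \<in> test_functions \<omega>"
  shows "EL (\<lambda>X. \<bar>f X\<bar> powr p * G (W X))
     (\<lambda>X. (G (W X) * abs_powr' p (f X)) *\<^sub>R grad f X + (\<bar>f X\<bar> powr p * G' (W X)) *\<^sub>R g X)"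
proof -
  obtain b where b: "b \<ge> 0" "\<And>x. \<bar>f x\<bar> \<le> b" "\<And>x. norm (grad f x) \<le> b"
    by (rule test_bounded[OF f]) blast
  have K: "K \<ge> 0" using G(3)[of 0] by linarith
  define A where "A = b powr p + p * b powr (p - 1)"
  have fA: "\<bar>\<bar>f X\<bar> powr p\<bar> \<le> A" "\<bar>abs_powr' p (f X)\<bar> \<le> A" for X
  proof -
    have "\<bar>f X\<bar> powr p \<le> b powr p" "\<bar>f X\<bar> powr (p - 1) \<le> b powr (p - 1)" using b p by (auto intro!: powr_mono2)
    moreover have "p * \<bar>f X\<bar> powr (p - 1) \<le> p * b powr (p - 1)" using calculation(2) p by simp
    moreover have "0 \<le> b powr p" "0 \<le> p * b powr (p - 1)" using p by simp_all
    moreover have "\<bar>\<bar>f X\<bar> powr p\<bar> = \<bar>f X\<bar> powr p" by simp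
    ultimately show "\<bar>\<bar>f X\<bar> powr p\<bar> \<le> A" "\<bar>abs_powr' p (f X)\<bar> \<le> A"
      unfolding abs_abs_powr'[OF p] A_def by linarith+
  qed
  have A0: "A \<ge> 0" using p b by (simp add: A_def)
  define c where "c = (\<bar>G 0\<bar> + K) * A * (1 + b) + A * K"
  have c0: "c \<ge> 0" using A0 K b by (simp add: c_def)
  have mf: "f \<in> borel_measurable M" "grad f \<in> borel_measurable M"
    by (intro measurable_smooth test_smooth[OF f])+
  have mw: "w k \<in> borel_measurable M" "grad (w k) \<in> borel_measurable M" for k
    by (intro measurable_smooth test_smooth[OF w_test])+
  have cG: "continuous_on UNIV G" by (rule DERIV_imp_continuous_UNIV[OF G(1)])
  have mc: "(\<lambda>X. q (h X)) \<in> borel_measurable M" if "continuous_on UNIV q" "h \<in> borel_measurable M" for q :: "real \<Rightarrow> real" and h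
    by (rule borel_measurable_continuous_on[OF that])
  have cp: "continuous_on UNIV (\<lambda>s::real. \<bar>s\<bar> powr p)" using p by (intro continuous_abs_powr) simp
  have iG: "isCont G s" "isCont G' s" for s
    using cG G(2) by (auto simp: continuous_on_eq_continuous_at)
  note ms = mc[OF cp mf(1)] mc[OF continuous_abs_powr'[OF p] mf(1)] mc[OF cG mw(1)] mc[OF cG W_meas]
    mc[OF G(2) mw(1)] mc[OF G(2) W_meas] mf mw W_meas g_meas
  show ?thesis
  proof (rule EL_limit[where \<psi>="\<lambda>k X. \<bar>f X\<bar> powr p * G (w k X)" and d=1 and c=c
       and D="\<lambda>k X. (G (w k X) * abs_powr' p (f X)) *\<^sub>R grad f X + (\<bar>f X\<bar> powr p * G' (w k X)) *\<^sub>R grad (w k) X"])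
    show "(\<lambda>X. \<bar>f X\<bar> powr p * G (w k X)) \<in> borel_measurable M" for k
      by (intro borel_measurable_times ms)
    show "(\<lambda>X. \<bar>f X\<bar> powr p * G (W X)) \<in> borel_measurable M"
      by (intro borel_measurable_times ms)
    show "(\<lambda>X. (G (w k X) * abs_powr' p (f X)) *\<^sub>R grad f X + (\<bar>f X\<bar> powr p * G' (w k X)) *\<^sub>R grad (w k) X) \<in> borel_measurable M" for k
      by (intro measurable_M_arith borel_measurable_times ms)
    show "(\<lambda>X. (G (W X) * abs_powr' p (f X)) *\<^sub>R grad f X + (\<bar>f X\<bar> powr p * G' (W X)) *\<^sub>R g X) \<in> borel_measurable M"
      by (intro measurable_M_arith borel_measurable_times ms)
    fix X assume X: "good X"
    have t: "(\<lambda>k. G (w k X)) \<longlonglongrightarrow> G (W X)" "(\<lambda>k. G' (w k X)) \<longlonglongrightarrow> G' (W X)"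
      using goodD(9)[OF X] iG isCont_tendsto_compose by blast+
    show "(\<lambda>k. \<bar>f X\<bar> powr p * G (w k X)) \<longlonglongrightarrow> \<bar>f X\<bar> powr p * G (W X)"
      by (intro tendsto_mult tendsto_const t)
    show "(\<lambda>k. (G (w k X) * abs_powr' p (f X)) *\<^sub>R grad f X + (\<bar>f X\<bar> powr p * G' (w k X)) *\<^sub>R grad (w k) X)
       \<longlonglongrightarrow> (G (W X) * abs_powr' p (f X)) *\<^sub>R grad f X + (\<bar>f X\<bar> powr p * G' (W X)) *\<^sub>R g X"
      by (intro tendsto_add tendsto_scaleR tendsto_mult tendsto_const t goodD(10)[OF X])
    fix k
    have "\<bar>G (w k X)\<bar> \<le> \<bar>G 0\<bar> + K * F X"
      using C1_lipschitz_growth[OF G(1,3), of "w k X"] mult_left_mono[OF goodD(7)[OF X, of k] K] by linarith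
    also have "\<dots> \<le> (\<bar>G 0\<bar> + K) * (F X + 1)" using K F_nonneg[of X] by (simp add: algebra_simps)
    finally have Gb: "\<bar>G (w k X)\<bar> \<le> (\<bar>G 0\<bar> + K) * (F X + 1)" .
    have nn: "0 \<le> (\<bar>G 0\<bar> + K) * (F X + 1)" using K F_nonneg[of X] by simp
    have 1: "\<bar>G (w k X) * h\<bar> \<le> (\<bar>G 0\<bar> + K) * (F X + 1) * A" if "\<bar>h\<bar> \<le> A" for h
      unfolding abs_mult using Gb that nn by (intro mult_mono) auto
    have 2: "(\<bar>G 0\<bar> + K) * (F X + 1) * A * (1 + b) + A * K * (F X + 1) = c * (F X + 1)"
      by (simp add: c_def algebra_simps)
    have 3: "0 \<le> (\<bar>G 0\<bar> + K) * (F X + 1) * A * b" "0 \<le> A * K * (F X + 1)" "0 \<le> (\<bar>G 0\<bar> + K) * (F X + 1) * A"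
      using nn A0 b(1) K F_nonneg[of X] by auto
    show "\<bar>\<bar>f X\<bar> powr p * G (w k X)\<bar> \<le> c * (F X + 1)"
      using 1[OF fA(1)[of X]] 2 3 by (simp add: mult.commute[of "\<bar>f X\<bar> powr p"] distrib_left)
    have "norm ((G (w k X) * abs_powr' p (f X)) *\<^sub>R grad f X + (\<bar>f X\<bar> powr p * G' (w k X)) *\<^sub>R grad (w k) X)
       \<le> \<bar>G (w k X) * abs_powr' p (f X)\<bar> * norm (grad f X) + \<bar>\<bar>f X\<bar> powr p * G' (w k X)\<bar> * norm (grad (w k) X)"
      by (rule norm_triangle_le) simp
    also have "\<dots> \<le> (\<bar>G 0\<bar> + K) * (F X + 1) * A * b + A * K * (F X + 1)"
    proof (rule add_mono)
      show "\<bar>G (w k X) * abs_powr' p (f X)\<bar> * norm (grad f X) \<le> (\<bar>G 0\<bar> + K) * (F X + 1) * A * b"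
        by (rule mult_mono[OF 1[OF fA(2)] b(3) 3(3)]) simp
      have "\<bar>\<bar>f X\<bar> powr p * G' (w k X)\<bar> \<le> A * K"
        unfolding abs_mult[of "\<bar>f X\<bar> powr p"] by (rule mult_mono[OF fA(1) G(3) A0]) simp
      then show "\<bar>\<bar>f X\<bar> powr p * G' (w k X)\<bar> * norm (grad (w k) X) \<le> A * K * (F X + 1)"
        using goodD(8)[OF X, of k] A0 K by (intro mult_mono) auto
    qed
    finally show "norm ((G (w k X) * abs_powr' p (f X)) *\<^sub>R grad f X + (\<bar>f X\<bar> powr p * G' (w k X)) *\<^sub>R grad (w k) X) \<le> c * (F X + 1)"
      using 2 3 by (simp add: distrib_left)
  next
    show "EL (\<lambda>X. \<bar>f X\<bar> powr p * G (w k X)) (\<lambda>X. (G (w k X) * abs_powr' p (f X)) *\<^sub>R grad f X + (\<bar>f X\<bar> powr p * G' (w k X)) *\<^sub>R grad (w k) X)" for k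
      using p by (intro EL_comp[OF abs_powr_deriv[OF p] continuous_abs_powr'[OF p] _ G(1,2) f w_test]) simp
  qed (use c0 in auto)
qed

text \<open>The power of W + \<epsilon> in Picone's test function, followed by its derivative with
  respect to W.\<close>

definition vinv :: "real \<Rightarrow> real ^ 'm \<Rightarrow> real" where "vinv \<epsilon> X = (W X + \<epsilon>) powr (1 - p)"
definition vinv' :: "real \<Rightarrow> real ^ 'm \<Rightarrow> real" where "vinv' \<epsilon> X = (1 - p) * (W X + \<epsilon>) powr (- p)"

lemma measurable_vinv: "vinv \<epsilon> \<in> borel_measurable M" "vinv' \<epsilon> \<in> borel_measurable M"
  using W_meas unfolding vinv_def[abs_def] vinv'_def[abs_def] by measurable

lemma vinv_bounds:
  assumes X: "good X" and \<epsilon>: "\<epsilon> > 0"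
  shows "\<bar>vinv \<epsilon> X\<bar> \<le> \<epsilon> powr (1 - p)" "\<bar>vinv' \<epsilon> X\<bar> \<le> p * \<epsilon> powr (- p)"
proof -
  have v: "W X + \<epsilon> \<ge> \<epsilon>" using goodD(4)[OF X] by simp
  have "vinv \<epsilon> X \<le> \<epsilon> powr (1 - p)" "(W X + \<epsilon>) powr (- p) \<le> \<epsilon> powr (- p)"
    unfolding vinv_def using v \<epsilon> p by (auto intro!: powr_mono2')
  then show "\<bar>vinv \<epsilon> X\<bar> \<le> \<epsilon> powr (1 - p)" "\<bar>vinv' \<epsilon> X\<bar> \<le> p * \<epsilon> powr (- p)"
    using p unfolding vinv_def vinv'_def by (auto simp: abs_mult intro!: mult_mono)
qed

lemma EL_vinv:
  assumes f: "f \<in> test_functions \<omega>" and \<epsilon>: "\<epsilon> > 0"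
  shows "EL (\<lambda>X. \<bar>f X\<bar> powr p * vinv \<epsilon> X)
     (\<lambda>X. (vinv \<epsilon> X * abs_powr' p (f X)) *\<^sub>R grad f X + (\<bar>f X\<bar> powr p * vinv' \<epsilon> X) *\<^sub>R g X)"
proof -
  have d: "((\<lambda>s. (s + \<epsilon>) powr (1 - p)) has_real_derivative (1 - p) * (s + \<epsilon>) powr (- p)) (at s)" if "s \<ge> 0" for s
  proof -
    have "((\<lambda>z. z powr (1 - p)) has_real_derivative (1 - p) * (s + \<epsilon>) powr (1 - p - 1)) (at (s + \<epsilon>))"
      using that \<epsilon> by (intro has_real_derivative_powr) simp
    then show ?thesis by (simp add: DERIV_shift)
  qed
  have c: "continuous_on {0..} (\<lambda>s. (1 - p) * (s + \<epsilon>) powr (- p))"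
    using \<epsilon> by (intro continuous_intros) auto
  have b: "\<bar>(1 - p) * (s + \<epsilon>) powr (- p)\<bar> \<le> (p - 1) * \<epsilon> powr (- p)" if "s \<ge> 0" for s
  proof -
    have "(s + \<epsilon>) powr (- p) \<le> \<epsilon> powr (- p)" using that \<epsilon> p by (intro powr_mono2') auto
    then show ?thesis using p by (simp add: abs_mult)
  qed
  \<comment> \<open>only the values on \<open>[0, \<infinity>)\<close> matter, since \<open>W \<ge> 0\<close>\<close>
  obtain e e' where e: "\<And>s. (e has_real_derivative e' s) (at s)" "continuous_on UNIV e'" "\<And>s. \<bar>e' s\<bar> \<le> (p - 1) * \<epsilon> powr (- p)"
    "\<And>s. s \<ge> 0 \<Longrightarrow> e s = (s + \<epsilon>) powr (1 - p)" "\<And>s. s \<ge> 0 \<Longrightarrow> e' s = (1 - p) * (s + \<epsilon>) powr (- p)"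
    by (rule C1_linear_extension[OF d c b]) blast+
  have E: "EL (\<lambda>X. \<bar>f X\<bar> powr p * e (W X))
     (\<lambda>X. (e (W X) * abs_powr' p (f X)) *\<^sub>R grad f X + (\<bar>f X\<bar> powr p * e' (W X)) *\<^sub>R g X)"
    by (rule EL_W[OF e(1-3) f])
  have ae: "AE X in M. e (W X) = vinv \<epsilon> X \<and> e' (W X) = vinv' \<epsilon> X"
    using AE_good by eventually_elim (auto simp: vinv_def vinv'_def e(4,5) dest: goodD(4))
  have mf: "f \<in> borel_measurable M" "grad f \<in> borel_measurable M"
    by (intro measurable_smooth test_smooth[OF f])+
  have mc: "(\<lambda>X. q (h X)) \<in> borel_measurable M" if "continuous_on UNIV q" "h \<in> borel_measurable M" for q :: "real \<Rightarrow> real" and h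
    by (rule borel_measurable_continuous_on[OF that])
  have ce: "continuous_on UNIV e" by (rule DERIV_imp_continuous_UNIV[OF e(1)])
  have cp: "continuous_on UNIV (\<lambda>s::real. \<bar>s\<bar> powr p)" using p by (intro continuous_abs_powr) simp
  note ms = mc[OF cp mf(1)] mc[OF continuous_abs_powr'[OF p] mf(1)] mc[OF ce W_meas] mc[OF e(2) W_meas] mf g_meas measurable_vinv
  have "(LINT X|M. L X (0, (e (W X) * abs_powr' p (f X)) *\<^sub>R grad f X + (\<bar>f X\<bar> powr p * e' (W X)) *\<^sub>R g X))
     = (LINT X|M. L X (0, (vinv \<epsilon> X * abs_powr' p (f X)) *\<^sub>R grad f X + (\<bar>f X\<bar> powr p * vinv' \<epsilon> X) *\<^sub>R g X))"
  proof (rule integral_cong_AE)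
    show "AE X in M. L X (0, (e (W X) * abs_powr' p (f X)) *\<^sub>R grad f X + (\<bar>f X\<bar> powr p * e' (W X)) *\<^sub>R g X)
       = L X (0, (vinv \<epsilon> X * abs_powr' p (f X)) *\<^sub>R grad f X + (\<bar>f X\<bar> powr p * vinv' \<epsilon> X) *\<^sub>R g X)"
      using ae by eventually_elim simp
  qed (intro measurable_L measurable_zero_Pair measurable_M_arith borel_measurable_times ms)+
  moreover have "(LINT X|M. w0 X * (\<bar>f X\<bar> powr p * e (W X))) = (LINT X|M. w0 X * (\<bar>f X\<bar> powr p * vinv \<epsilon> X))"
  proof (rule integral_cong_AE)
    show "AE X in M. w0 X * (\<bar>f X\<bar> powr p * e (W X)) = w0 X * (\<bar>f X\<bar> powr p * vinv \<epsilon> X)"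
      using ae by eventually_elim simp
  qed (intro borel_measurable_times measurable_w0 ms)+
  ultimately show ?thesis using E unfolding EL_def by simp
qed

text \<open>Here y stands for the gradient of u, and the argument of \<open>L\<close> is then
  formally the gradient of |u|^p (W + \<epsilon>)^(1-p). The defect \<delta> has the same first
  component as y, because (0, g) has none; this is what later controls \<partial>_1 u.\<close>

lemma Picone_pointwise:
  fixes u \<epsilon> :: real and y :: "real \<times> (real ^ 'm)"
  assumes X: "good X" and \<epsilon>: "\<epsilon> > 0"
  defines "\<delta> \<equiv> y - (u / (W X + \<epsilon>)) *\<^sub>R (0, g X)"
  shows "L X ((vinv \<epsilon> X * abs_powr' p u) *\<^sub>R y + (\<bar>u\<bar> powr p * vinv' \<epsilon> X) *\<^sub>R (0, g X))
      + 2 powr (1 - p) * \<bar>B X \<delta> \<delta>\<bar> powr (p / 2) \<le> \<bar>B X y y\<bar> powr (p / 2)"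
proof -
  have v: "W X + \<epsilon> > 0" using goodD(4)[OF X] \<epsilon> by simp
  have "L X ((vinv \<epsilon> X * abs_powr' p u) *\<^sub>R y + (\<bar>u\<bar> powr p * vinv' \<epsilon> X) *\<^sub>R (0, g X))
     = (vinv \<epsilon> X * abs_powr' p u) * L X y + (\<bar>u\<bar> powr p * vinv' \<epsilon> X) * E X powr (p / 2)"
    by (simp only: L_linear[OF X] L_g[OF X])
  then show ?thesis
    using form_Picone[OF goodD(1)[OF X] p v, of u "(0, g X)" y] good_B_nonneg[OF X, of y] good_B_nonneg[OF X, of \<delta>]
    unfolding \<delta>_def by (simp add: L_def E_def vinv_def vinv'_def abs_powr'_def algebra_simps)
qed

section \<open>Positivity of W\<close>

lemma integral_M_eq_lebesgue:
  fixes q :: "real ^ 'm \<Rightarrow> real"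
  assumes "\<And>X. X \<notin> \<omega> \<Longrightarrow> q X = 0"
  shows "(LINT X|M. q X) = (LINT X|lebesgue. q X)"
proof -
  have "(LINT X|M. q X) = (LINT X|lebesgue. indicator \<omega> X *\<^sub>R q X)"
    using omega_sets by (intro integral_restrict_space) auto
  also have "\<dots> = (LINT X|lebesgue. q X)"
    using assms by (intro Bochner_Integration.integral_cong) (auto simp: indicator_def)
  finally show ?thesis .
qed

lemma integrable_energy_sec:
  assumes h: "h \<in> borel_measurable M" and d: "d \<ge> 0" and c: "c \<ge> 0"
    and b: "\<And>X. good X \<Longrightarrow> norm (h X) \<le> c * (F X + d)"
  shows "integrable M (\<lambda>X. \<bar>B X (0, h X) (0, h X)\<bar> powr (p / 2))"
proof (rule integrable_F_bound[OF _ d])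
  show "(\<lambda>X. \<bar>B X (0, h X) (0, h X)\<bar> powr (p / 2)) \<in> borel_measurable M"
    using measurable_B[OF measurable_zero_Pair[OF h] measurable_zero_Pair[OF h]] by measurable
  fix X assume X: "good X"
  have "\<bar>\<bar>B X (0, h X) (0, h X)\<bar> powr (p / 2)\<bar> \<le> C powr (p / 2) * (c * (F X + d)) powr p"
    using b[OF X] by (intro good_energy_le X) (simp add: norm_Pair)
  also have "\<dots> = (C powr (p / 2) * c powr p) * (F X + d) powr p" by (simp add: powr_mult)
  finally show "\<bar>\<bar>B X (0, h X) (0, h X)\<bar> powr (p / 2)\<bar> \<le> (C powr (p / 2) * c powr p) * (F X + d) powr p" .
qed

lemma quotient_bound:
  assumes X: "good X" and \<epsilon>: "\<epsilon> > 0" and u: "\<bar>u\<bar> \<le> b" and z: "norm z \<le> b"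
  shows "norm (z - (u / (W X + \<epsilon>)) *\<^sub>R g X) \<le> (b / \<epsilon>) * (F X + \<epsilon>)"
proof -
  have b: "b \<ge> 0" using u by linarith
  have "\<bar>u / (W X + \<epsilon>)\<bar> \<le> b / \<epsilon>"
    unfolding abs_divide using goodD(4)[OF X] \<epsilon> u by (intro frac_le) auto
  then have "norm ((u / (W X + \<epsilon>)) *\<^sub>R g X) \<le> (b / \<epsilon>) * F X"
    unfolding norm_scaleR using goodD(6)[OF X] b \<epsilon> by (intro mult_mono) auto
  then have "norm (z - (u / (W X + \<epsilon>)) *\<^sub>R g X) \<le> b + (b / \<epsilon>) * F X"
    using z norm_triangle_ineq4[of z "(u / (W X + \<epsilon>)) *\<^sub>R g X"] by linarith
  also have "\<dots> = (b / \<epsilon>) * (F X + \<epsilon>)" using \<epsilon> by (simp add: field_simps)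
  finally show ?thesis .
qed

text \<open>Integrate Picone's inequality for u = f. The Euler--Lagrange term is nonnegative and may
  be dropped, so the remainder is bounded by the energy of \<open>f\<close>; it controls \<nabla>f -
  f g/(W + \<epsilon>) in L^p, hence f g/(W + \<epsilon>) in L^1. No constant depends on
  \<epsilon>.\<close>

lemma log_gradient_bound:
  assumes f: "f \<in> test_functions \<omega>"
  obtains K where "\<And>\<epsilon>. \<epsilon> > 0 \<Longrightarrow> integrable M (\<lambda>X. \<bar>f X\<bar> * norm (g X) / (W X + \<epsilon>))"
    "\<And>\<epsilon>. \<epsilon> > 0 \<Longrightarrow> (LINT X|M. \<bar>f X\<bar> * norm (g X) / (W X + \<epsilon>)) \<le> K"
proof -
  obtain b where b: "b \<ge> 0" "\<And>x. \<bar>f x\<bar> \<le> b" "\<And>x. norm (grad f x) \<le> b"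
    by (rule test_bounded[OF f]) blast
  have mf: "f \<in> borel_measurable M" "grad f \<in> borel_measurable M"
    by (intro measurable_smooth test_smooth[OF f])+
  define J where "J = (LINT X|M. \<bar>B X (0, grad f X) (0, grad f X)\<bar> powr (p / 2))"
  define k where "k = 2 powr (1 - p) * lam powr (p / 2)"
  have k: "k > 0" using constants by (simp add: k_def)
  have *: "integrable M (\<lambda>X. \<bar>f X\<bar> * norm (g X) / (W X + \<epsilon>)) \<and>
     (LINT X|M. \<bar>f X\<bar> * norm (g X) / (W X + \<epsilon>)) \<le> (LINT X|M. b + 1) + J / k" if \<epsilon>: "\<epsilon> > 0" for \<epsilon>
  proof -
    let ?h = "\<lambda>X. grad f X - (f X / (W X + \<epsilon>)) *\<^sub>R g X"
    let ?R = "\<lambda>X. \<bar>B X (0, ?h X) (0, ?h X)\<bar> powr (p / 2)"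
    let ?Y = "\<lambda>X. (vinv \<epsilon> X * abs_powr' p (f X)) *\<^sub>R grad f X + (\<bar>f X\<bar> powr p * vinv' \<epsilon> X) *\<^sub>R g X"
    have mh: "?h \<in> borel_measurable M"
      using W_meas by (intro borel_measurable_diff borel_measurable_scaleR borel_measurable_divide borel_measurable_add mf g_meas borel_measurable_const)
    have iR: "integrable M ?R"
    proof (rule integrable_energy_sec[OF mh])
      show "norm (?h X) \<le> (b / \<epsilon>) * (F X + \<epsilon>)" if "good X" for X
        by (rule quotient_bound[OF that \<epsilon> b(2,3)])
    qed (use \<epsilon> b in auto)
    have iJ: "integrable M (\<lambda>X. \<bar>B X (0, grad f X) (0, grad f X)\<bar> powr (p / 2))"
    proof (rule integrable_energy_sec[OF mf(2)])
      show "norm (grad f X) \<le> b * (F X + 1)" for X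
        using b(3)[of X] mult_left_mono[of 1 "F X + 1" b] b(1) F_nonneg[of X] by simp
    qed (use b in auto)
    have mp: "(\<lambda>X. \<bar>f X\<bar> powr p) \<in> borel_measurable M" "(\<lambda>X. abs_powr' p (f X)) \<in> borel_measurable M"
      using mf(1) unfolding abs_powr'_def by measurable
    have mY: "?Y \<in> borel_measurable M"
      by (intro measurable_M_arith borel_measurable_times mp mf g_meas measurable_vinv)
    have pic: "L X (0, ?Y X) + 2 powr (1 - p) * ?R X \<le> \<bar>B X (0, grad f X) (0, grad f X)\<bar> powr (p / 2)" if X: "good X" for X
      using Picone_pointwise[OF X \<epsilon>, of "f X" "(0, grad f X)"] by simp
    have iL: "integrable M (\<lambda>X. L X (0, ?Y X))"
    proof (rule integrable_F_bound[of _ \<epsilon>])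
      fix X assume X: "good X"
      note v1 = vinv_bounds[OF X \<epsilon>]
      have f1: "\<bar>f X\<bar> powr p \<le> b powr p" "\<bar>abs_powr' p (f X)\<bar> \<le> p * b powr (p - 1)"
        unfolding abs_abs_powr'[OF p] using b p by (auto intro!: powr_mono2 mult_left_mono)
      have "norm (?Y X) \<le> \<bar>vinv \<epsilon> X\<bar> * \<bar>abs_powr' p (f X)\<bar> * norm (grad f X) + \<bar>f X\<bar> powr p * \<bar>vinv' \<epsilon> X\<bar> * norm (g X)"
        by (rule norm_triangle_le) (simp add: abs_mult)
      also have "\<dots> \<le> \<epsilon> powr (1 - p) * (p * b powr (p - 1)) * b + b powr p * (p * \<epsilon> powr (- p)) * F X"
        using v1 f1 b goodD(6)[OF X] p by (intro add_mono mult_mono) auto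
      also have "\<dots> \<le> ((\<epsilon> powr (1 - p) * (p * b powr (p - 1)) * b) / \<epsilon> + b powr p * (p * \<epsilon> powr (- p))) * (F X + \<epsilon>)"
      proof -
        have aux: "c1 + c2 * q \<le> (c1 / \<epsilon> + c2) * (q + \<epsilon>)" if "c1 \<ge> 0" "c2 \<ge> 0" "q \<ge> 0" for c1 c2 q :: real
        proof -
          have "(c1 / \<epsilon> + c2) * (q + \<epsilon>) = c1 + c2 * q + (c1 / \<epsilon> * q + c2 * \<epsilon>)" using \<epsilon> by (simp add: field_simps)
          moreover have "0 \<le> c1 / \<epsilon> * q + c2 * \<epsilon>" using that \<epsilon> by simp
          ultimately show ?thesis by linarith
        qed
        show ?thesis using p b F_nonneg by (intro aux) auto
      qed
      finally show "\<bar>L X (0, ?Y X)\<bar> \<le> (C powr (p / 2) * ((\<epsilon> powr (1 - p) * (p * b powr (p - 1)) * b) / \<epsilon> + b powr p * (p * \<epsilon> powr (- p)))) * (F X + \<epsilon>) powr p"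
        using p b \<epsilon> by (intro good_L_le X) (auto simp: norm_Pair)
    qed (use \<epsilon> in \<open>auto intro!: measurable_L measurable_zero_Pair mY\<close>)
    \<comment> \<open>The sign of W enters here: \<mu>, \<open>w0\<close> and \<open>vinv\<close>
      are nonnegative, so W acts as a supersolution.\<close>
    have "0 \<le> \<mu> * (LINT X|M. w0 X * (\<bar>f X\<bar> powr p * vinv \<epsilon> X))"
    proof (intro mult_nonneg_nonneg mu_nonneg integral_nonneg_AE)
      show "AE X in M. 0 \<le> w0 X * (\<bar>f X\<bar> powr p * vinv \<epsilon> X)"
        using AE_good by eventually_elim (auto simp: w0_def vinv_def dest: goodD(4))
    qed
    also have "\<dots> = (LINT X|M. L X (0, ?Y X))"
      using EL_vinv[OF f \<epsilon>] by (simp add: EL_def)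
    finally have L0: "0 \<le> (LINT X|M. L X (0, ?Y X))" .
    have "(LINT X|M. L X (0, ?Y X) + 2 powr (1 - p) * ?R X) \<le> J"
      unfolding J_def
    proof (rule integral_mono_AE)
      show "AE X in M. L X (0, ?Y X) + 2 powr (1 - p) * ?R X \<le> \<bar>B X (0, grad f X) (0, grad f X)\<bar> powr (p / 2)"
        using AE_good by eventually_elim (rule pic)
    qed (intro Bochner_Integration.integrable_add integrable_mult_right iL iR iJ)+
    moreover have "(LINT X|M. L X (0, ?Y X) + 2 powr (1 - p) * ?R X) = (LINT X|M. L X (0, ?Y X)) + 2 powr (1 - p) * (LINT X|M. ?R X)"
      using iL iR by simp
    ultimately have RJ: "2 powr (1 - p) * (LINT X|M. ?R X) \<le> J" using L0 by linarith
    have pt: "\<bar>f X\<bar> * norm (g X) / (W X + \<epsilon>) \<le> (b + 1) + ?R X / lam powr (p / 2)" if X: "good X" for X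
    proof -
      have v: "W X + \<epsilon> > 0" using goodD(4)[OF X] \<epsilon> by simp
      have "\<bar>f X\<bar> * norm (g X) / (W X + \<epsilon>) = norm ((f X / (W X + \<epsilon>)) *\<^sub>R g X)"
        using v by simp
      also have "\<dots> \<le> norm (grad f X) + norm (?h X)"
        using norm_triangle_ineq4[of "grad f X" "?h X"] by simp
      \<comment> \<open>Trades the L^p bound for an L^1 bound; the constant 1 is integrable on the
        bounded section.\<close>
      also have "norm (?h X) \<le> 1 + norm (?h X) powr p"
      proof (cases "norm (?h X) \<le> 1")
        case True
        then show ?thesis by (simp add: add_increasing2)
      next
        case False
        then have "norm (?h X) powr 1 \<le> norm (?h X) powr p" using p by (intro powr_mono) auto
        then show ?thesis using False by simp
      qed
      also have "norm (?h X) powr p \<le> ?R X / lam powr (p / 2)"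
        using good_B_powr_ge[OF X, of "p / 2" "(0, ?h X)"] good_B_nonneg[OF X, of "(0, ?h X)"] p constants
        by (simp add: norm_Pair field_simps)
      finally show ?thesis using b(3)[of X] by simp
    qed
    have iq: "integrable M (\<lambda>X. (b + 1) + ?R X / lam powr (p / 2))"
      by (intro Bochner_Integration.integrable_add integrable_const_M integrable_divide iR)
    have i: "integrable M (\<lambda>X. \<bar>f X\<bar> * norm (g X) / (W X + \<epsilon>))"
    proof (rule Bochner_Integration.integrable_bound[OF iq])
      show "AE X in M. norm (\<bar>f X\<bar> * norm (g X) / (W X + \<epsilon>)) \<le> norm ((b + 1) + ?R X / lam powr (p / 2))"
        using AE_good
      proof eventually_elim
        case (elim X)
        have "0 \<le> \<bar>f X\<bar> * norm (g X) / (W X + \<epsilon>)" using goodD(4)[OF elim] \<epsilon> by simp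
        then show ?case using pt[OF elim] unfolding real_norm_def by linarith
      qed
    qed (use mf g_meas W_meas in measurable)
    have "(LINT X|M. \<bar>f X\<bar> * norm (g X) / (W X + \<epsilon>)) \<le> (LINT X|M. (b + 1) + ?R X / lam powr (p / 2))"
      by (rule integral_mono_AE[OF i iq]) (use AE_good in eventually_elim, rule pt)
    also have "\<dots> = (LINT X|M. b + 1) + (LINT X|M. ?R X) / lam powr (p / 2)"
      using integrable_const_M[of "b + 1"] iR by simp
    also have "(LINT X|M. ?R X) / lam powr (p / 2) \<le> J / k"
    proof -
      have "(LINT X|M. ?R X) / lam powr (p / 2) = (2 powr (1 - p) * (LINT X|M. ?R X)) / k"
        by (simp add: k_def)
      also have "\<dots> \<le> J / k" using RJ k by (intro divide_right_mono) auto
      finally show ?thesis .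
    qed
    finally show ?thesis using i by simp
  qed
  show ?thesis by (rule that[of "(LINT X|M. b + 1) + J / k"]) (use * in blast)+
qed

text \<open>Integration by parts moves the derivative from \<open>f\<close> to the logarithm, whose
  gradient is g/(W + \<epsilon>). Writing ln (1 + W/\<epsilon>) instead of ln (W + \<epsilon>) makes
  the function vanish where W does.\<close>

lemma log_weak_gradient:
  assumes f: "f \<in> test_functions \<omega>" and \<epsilon>: "\<epsilon> > 0"
    and i: "integrable M (\<lambda>X. \<bar>f X\<bar> * norm (g X) / (W X + \<epsilon>))"
    and K: "(LINT X|M. \<bar>f X\<bar> * norm (g X) / (W X + \<epsilon>)) \<le> K"
  shows "\<bar>LINT X|M. ln (1 + W X / \<epsilon>) * (grad f X \<bullet> h)\<bar> \<le> K * norm h"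
proof -
  obtain b where b: "b \<ge> 0" "\<And>x. \<bar>f x\<bar> \<le> b" "\<And>x. norm (grad f x) \<le> b"
    by (rule test_bounded[OF f]) blast
  obtain Q where Q: "C1_compact f (grad f) Q" "Q \<subseteq> \<omega>" by (rule C1_compact_test[OF f])
  have Q0: "f X = 0" "grad f X = 0" if "X \<notin> \<omega>" for X
    using Q that by (auto simp: C1_compact_def)
  have mf: "f \<in> borel_measurable M" "grad f \<in> borel_measurable M"
    by (intro measurable_smooth test_smooth[OF f])+
  have d: "((\<lambda>s. ln (1 + s / \<epsilon>)) has_real_derivative 1 / (s + \<epsilon>)) (at s)" if "s \<ge> 0" for s
    using that \<epsilon> by (auto intro!: derivative_eq_intros simp: field_simps add_pos_nonneg)
  have c: "continuous_on {0..} (\<lambda>s. 1 / (s + \<epsilon>))"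
    using \<epsilon> by (intro continuous_intros) auto
  have bd: "\<bar>1 / (s + \<epsilon>)\<bar> \<le> 1 / \<epsilon>" if "s \<ge> 0" for s
    using that \<epsilon> by (simp add: frac_le)
  obtain e e' where e: "\<And>s. (e has_real_derivative e' s) (at s)" "continuous_on UNIV e'" "\<And>s. \<bar>e' s\<bar> \<le> 1 / \<epsilon>"
    "\<And>s. s \<ge> 0 \<Longrightarrow> e s = ln (1 + s / \<epsilon>)" "\<And>s. s \<ge> 0 \<Longrightarrow> e' s = 1 / (s + \<epsilon>)"
    by (rule C1_linear_extension[OF d c bd]) blast+
  have \<epsilon>0: "0 \<le> 1 / \<epsilon>" using \<epsilon> by simp
  have ce: "continuous_on UNIV e" by (rule DERIV_imp_continuous_UNIV[OF e(1)])
  have mc: "(\<lambda>X. q (v X)) \<in> borel_measurable M" if "continuous_on UNIV q" "v \<in> borel_measurable M" for q :: "real \<Rightarrow> real" and v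
    by (rule borel_measurable_continuous_on[OF that])
  have e0: "\<bar>e s\<bar> \<le> (1 / \<epsilon>) * \<bar>s\<bar>" for s
    using C1_lipschitz_growth[OF e(1,3), of s] e(4)[of 0] by simp
  \<comment> \<open>The derivative of f e(v) in direction h. For v = w_k the product is C^1 with
    compact support, so the integral vanishes, and dominated convergence gives the same for W and
    g.\<close>
  let ?q = "\<lambda>v Dv X. e (v X) * (grad f X \<bullet> h) + f X * e' (v X) * (Dv X \<bullet> h)"
  have z: "(LINT X|M. ?q (w k) (grad (w k)) X) = 0" for k
  proof -
    have dw: "((\<lambda>x. e (w k x)) has_derivative (\<lambda>h. (e' (w k X) *\<^sub>R grad (w k) X) \<bullet> h)) (at X)" for X
      by (rule grad_compose[OF smooth_grad[OF test_smooth[OF w_test]] e(1)])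
    have cw: "continuous_on UNIV (\<lambda>X. e' (w k X) *\<^sub>R grad (w k) X)"
      using smooth_continuous[OF test_smooth[OF w_test]] continuous_on_grad[OF test_smooth[OF w_test]]
      by (intro continuous_on_scaleR continuous_on_compose2[OF e(2)]) auto
    have "(LINT X|lebesgue. (f X *\<^sub>R (e' (w k X) *\<^sub>R grad (w k) X) + e (w k X) *\<^sub>R grad f X) \<bullet> h) = 0"
      by (rule integral_partial_zero[OF C1_compact_mult[OF Q(1) dw cw]])
    moreover have "(LINT X|M. ?q (w k) (grad (w k)) X) = (LINT X|lebesgue. ?q (w k) (grad (w k)) X)"
      by (rule integral_M_eq_lebesgue) (simp add: Q0)
    ultimately show ?thesis by (simp add: inner_add_left algebra_simps)
  qed
  have "(\<lambda>k. LINT X|M. ?q (w k) (grad (w k)) X) \<longlonglongrightarrow> (LINT X|M. ?q W g X)"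
  proof (rule integral_dominated_convergence[where w="\<lambda>X. (2 * (b * norm h / \<epsilon>)) * (F X + 1) powr p"])
    show "integrable M (\<lambda>X. (2 * (b * norm h / \<epsilon>)) * (F X + 1) powr p)"
      by (intro integrable_mult_right integrable_F_plus) simp
    show "AE X in M. (\<lambda>k. ?q (w k) (grad (w k)) X) \<longlonglongrightarrow> ?q W g X"
      using AE_good
    proof eventually_elim
      case (elim X)
      have "isCont e (W X)" "isCont e' (W X)" using ce e(2) by (auto simp: continuous_on_eq_continuous_at)
      then have "(\<lambda>k. e (w k X)) \<longlonglongrightarrow> e (W X)" "(\<lambda>k. e' (w k X)) \<longlonglongrightarrow> e' (W X)"
        using goodD(9)[OF elim] isCont_tendsto_compose by blast+
      then show ?case
        by (intro tendsto_add tendsto_mult tendsto_inner tendsto_const goodD(10)[OF elim])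
    qed
    show "AE X in M. norm (?q (w k) (grad (w k)) X) \<le> (2 * (b * norm h / \<epsilon>)) * (F X + 1) powr p" for k
      using AE_good
    proof eventually_elim
      case (elim X)
      have "\<bar>e (w k X)\<bar> \<le> (1 / \<epsilon>) * F X"
        using e0[of "w k X"] mult_left_mono[OF goodD(7)[OF elim, of k], of "1 / \<epsilon>"] \<epsilon>0 by linarith
      moreover have hh: "\<bar>grad f X \<bullet> h\<bar> \<le> b * norm h" "\<bar>grad (w k) X \<bullet> h\<bar> \<le> F X * norm h"
        using Cauchy_Schwarz_ineq2[of "grad f X" h] Cauchy_Schwarz_ineq2[of "grad (w k) X" h]
          mult_right_mono[OF b(3)[of X], of "norm h"] mult_right_mono[OF goodD(8)[OF elim, of k], of "norm h"] by auto
      ultimately have 1: "\<bar>e (w k X) * (grad f X \<bullet> h)\<bar> \<le> ((1 / \<epsilon>) * F X) * (b * norm h)"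
        unfolding abs_mult using F_nonneg[of X] \<epsilon> by (intro mult_mono) auto
      have 2: "\<bar>f X * e' (w k X) * (grad (w k) X \<bullet> h)\<bar> \<le> (b * (1 / \<epsilon>)) * (F X * norm h)"
        unfolding abs_mult using hh b e(3) F_nonneg[of X] \<epsilon> by (intro mult_mono) auto
      have "F X + 1 \<le> (F X + 1) powr p" using powr_mono[of 1 p "F X + 1"] p F_nonneg[of X] by simp
      then have "b * norm h / \<epsilon> * F X \<le> b * norm h / \<epsilon> * (F X + 1) powr p"
        using b(1) \<epsilon> by (intro mult_left_mono) auto
      moreover have "((1 / \<epsilon>) * F X) * (b * norm h) = b * norm h / \<epsilon> * F X" "(b * (1 / \<epsilon>)) * (F X * norm h) = b * norm h / \<epsilon> * F X"
        by simp_all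
      ultimately show ?case using 1 2 unfolding real_norm_def by linarith
    qed
    show "?q W g \<in> borel_measurable M"
      using mc[OF ce W_meas] mc[OF e(2) W_meas] mf g_meas
      by (intro borel_measurable_add borel_measurable_times borel_measurable_inner borel_measurable_const)
    show "?q (w k) (grad (w k)) \<in> borel_measurable M" for k
      using mc[OF ce measurable_smooth(1)[OF test_smooth[OF w_test]]] mc[OF e(2) measurable_smooth(1)[OF test_smooth[OF w_test]]]
        mf measurable_smooth(2)[OF test_smooth[OF w_test]]
      by (intro borel_measurable_add borel_measurable_times borel_measurable_inner borel_measurable_const)
  qed
  then have q0: "(LINT X|M. ?q W g X) = 0" unfolding z by (simp add: LIMSEQ_const_iff)
  have m1: "(\<lambda>X. e (W X) * (grad f X \<bullet> h)) \<in> borel_measurable M"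
    by (intro borel_measurable_times borel_measurable_inner borel_measurable_const mc[OF ce W_meas] mf)
  have m2: "(\<lambda>X. f X * e' (W X) * (g X \<bullet> h)) \<in> borel_measurable M"
    by (intro borel_measurable_times borel_measurable_inner borel_measurable_const mc[OF e(2) W_meas] mf g_meas)
  have pt2: "\<bar>f X * e' (W X) * (g X \<bullet> h)\<bar> \<le> norm h * (\<bar>f X\<bar> * norm (g X) / (W X + \<epsilon>))" if X: "good X" for X
  proof -
    have v: "W X + \<epsilon> > 0" using goodD(4)[OF X] \<epsilon> by simp
    have "\<bar>f X * e' (W X) * (g X \<bullet> h)\<bar> = (\<bar>f X\<bar> / (W X + \<epsilon>)) * \<bar>g X \<bullet> h\<bar>"
      using v e(5)[OF goodD(4)[OF X]] by (simp add: abs_mult)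
    also have "\<dots> \<le> (\<bar>f X\<bar> / (W X + \<epsilon>)) * (norm (g X) * norm h)"
      using v by (intro mult_left_mono Cauchy_Schwarz_ineq2) auto
    finally show ?thesis by (simp add: mult.commute mult.left_commute)
  qed
  have i2: "integrable M (\<lambda>X. f X * e' (W X) * (g X \<bullet> h))"
  proof (rule Bochner_Integration.integrable_bound[OF integrable_mult_right[OF i, of "norm h"] m2])
    show "AE X in M. norm (f X * e' (W X) * (g X \<bullet> h)) \<le> norm (norm h * (\<bar>f X\<bar> * norm (g X) / (W X + \<epsilon>)))"
      using AE_good by eventually_elim (use pt2 abs_ge_self order_trans in fastforce)
  qed
  have i1: "integrable M (\<lambda>X. e (W X) * (grad f X \<bullet> h))"
  proof (rule integrable_F_bound[OF m1, of 1 "b * norm h / \<epsilon>"])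
    fix X assume X: "good X"
    have "\<bar>e (W X)\<bar> \<le> (1 / \<epsilon>) * F X"
      using e0[of "W X"] mult_left_mono[OF goodD(5)[OF X], of "1 / \<epsilon>"] \<epsilon>0 by linarith
    moreover have "\<bar>grad f X \<bullet> h\<bar> \<le> b * norm h"
      using Cauchy_Schwarz_ineq2[of "grad f X" h] mult_right_mono[OF b(3)[of X], of "norm h"] by auto
    ultimately have "\<bar>e (W X) * (grad f X \<bullet> h)\<bar> \<le> ((1 / \<epsilon>) * F X) * (b * norm h)"
      unfolding abs_mult using F_nonneg[of X] \<epsilon> by (intro mult_mono) auto
    also have "\<dots> = b * norm h / \<epsilon> * F X" by simp
    also have "\<dots> \<le> b * norm h / \<epsilon> * (F X + 1) powr p"
      using powr_mono[of 1 p "F X + 1"] p F_nonneg[of X] b(1) \<epsilon> by (intro mult_left_mono) auto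
    finally show "\<bar>e (W X) * (grad f X \<bullet> h)\<bar> \<le> b * norm h / \<epsilon> * (F X + 1) powr p" .
  qed simp
  have "(LINT X|M. ln (1 + W X / \<epsilon>) * (grad f X \<bullet> h)) = (LINT X|M. e (W X) * (grad f X \<bullet> h))"
  proof (rule integral_cong_AE)
    show "AE X in M. ln (1 + W X / \<epsilon>) * (grad f X \<bullet> h) = e (W X) * (grad f X \<bullet> h)"
      using AE_good by eventually_elim (simp add: e(4) goodD(4))
    have "(\<lambda>X. grad f X \<bullet> h) \<in> borel_measurable M" using mf(2) by (intro borel_measurable_inner borel_measurable_const)
    then show "(\<lambda>X. ln (1 + W X / \<epsilon>) * (grad f X \<bullet> h)) \<in> borel_measurable M"
      using W_meas by measurable
  qed (rule m1)
  also have "\<dots> = - (LINT X|M. f X * e' (W X) * (g X \<bullet> h))"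
    using q0 Bochner_Integration.integral_add[OF i1 i2] by simp
  also have "\<bar>\<dots>\<bar> \<le> (LINT X|M. norm h * (\<bar>f X\<bar> * norm (g X) / (W X + \<epsilon>)))"
  proof -
    have "\<bar>LINT X|M. f X * e' (W X) * (g X \<bullet> h)\<bar> \<le> (LINT X|M. \<bar>f X * e' (W X) * (g X \<bullet> h)\<bar>)"
      by (rule integral_abs_bound)
    also have "\<dots> \<le> (LINT X|M. norm h * (\<bar>f X\<bar> * norm (g X) / (W X + \<epsilon>)))"
      by (rule integral_mono_AE[OF integrable_abs[OF i2] integrable_mult_right[OF i]]) (use AE_good in eventually_elim, rule pt2)
    finally show ?thesis by simp
  qed
  also have "\<dots> = norm h * (LINT X|M. \<bar>f X\<bar> * norm (g X) / (W X + \<epsilon>))" by (rule integral_mult_right_zero)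
  also have "\<dots> \<le> K * norm h" using mult_left_mono[OF K norm_ge_zero[of h]] by (simp add: mult.commute)
  finally show ?thesis .
qed

text \<open>\<open>ln (1 + W / \<epsilon>) / ln (1 / \<epsilon>)\<close> converges to the indicator of \<open>{W > 0}\<close>, while its gradient tends to
  zero.\<close>

lemma indicator_weak_gradient:
  assumes f: "f \<in> test_functions \<omega>"
  shows "(LINT X|M. (if W X > 0 then 1 else 0) * (grad f X \<bullet> h)) = 0"
proof -
  obtain b where b: "b \<ge> 0" "\<And>x. \<bar>f x\<bar> \<le> b" "\<And>x. norm (grad f x) \<le> b"
    by (rule test_bounded[OF f]) blast
  obtain K where K: "\<And>\<epsilon>. \<epsilon> > 0 \<Longrightarrow> integrable M (\<lambda>X. \<bar>f X\<bar> * norm (g X) / (W X + \<epsilon>))"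
    "\<And>\<epsilon>. \<epsilon> > 0 \<Longrightarrow> (LINT X|M. \<bar>f X\<bar> * norm (g X) / (W X + \<epsilon>)) \<le> K"
    by (rule log_gradient_bound[OF f]) blast
  have mg: "(\<lambda>X. grad f X \<bullet> h) \<in> borel_measurable M"
    by (intro borel_measurable_inner borel_measurable_const measurable_smooth(2) test_smooth[OF f])
  \<comment> \<open>Here \<epsilon> = exp (-(n + 1)), so that ln (1 / \<epsilon>) is simply n +
    1.\<close>
  let ?l = "\<lambda>n s. ln (1 + s / exp (- real (Suc n))) / real (Suc n)"
  have lnb: "real (Suc n) + ln s \<le> ln (1 + s / exp (- real (Suc n)))" if "s > 0" for s n
  proof -
    have "real (Suc n) + ln s = ln (s / exp (- real (Suc n)))" using that by (simp add: ln_div)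
    also have "\<dots> \<le> ln (1 + s / exp (- real (Suc n)))" using that by (intro ln_mono) auto
    finally show ?thesis .
  qed
  have lub: "ln (1 + s / exp (- real (Suc n))) \<le> real (Suc n) + ln (1 + s)" if "s \<ge> 0" for s n
  proof -
    have "s / exp (- N) = exp N * s" for N :: real by (simp add: exp_minus field_simps)
    moreover have "1 \<le> exp (real (Suc n))" by simp
    ultimately have "1 + s / exp (- real (Suc n)) \<le> exp (real (Suc n)) * (1 + s)"
      by (simp only: distrib_left mult_1_right add_le_cancel_right)
    then have "ln (1 + s / exp (- real (Suc n))) \<le> ln (exp (real (Suc n)) * (1 + s))"
      using that by (intro ln_mono) (auto intro!: add_pos_nonneg)
    also have "\<dots> = real (Suc n) + ln (1 + s)" using that by (simp add: ln_mult)
    finally show ?thesis .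
  qed
  have div1: "1 + a / N \<le> l / N" if "N > 0" "N + a \<le> l" for N a l :: real
    using divide_right_mono[OF that(2), of N] that(1) by (simp add: add_divide_distrib)
  have div2: "l / N \<le> 1 + a / N" if "N > 0" "l \<le> N + a" for N a l :: real
    using divide_right_mono[OF that(2), of N] that(1) by (simp add: add_divide_distrib)
  have null: "(\<lambda>n. c / real (Suc n)) \<longlonglongrightarrow> 0" for c :: real
    using tendsto_mult_left[OF LIMSEQ_inverse_real_of_nat, of c] by (simp add: divide_inverse)
  \<comment> \<open>For s > 0 the quotient lies between 1 + ln s / (n + 1) and 1 + ln (1 + s) / (n +
    1); at s = 0 it is 0 for every n.\<close>
  have lim: "(\<lambda>n. ?l n s) \<longlonglongrightarrow> (if s > 0 then 1 else 0)" if s: "s \<ge> 0" for s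
  proof (cases "s > 0")
    case True
    have "(\<lambda>n. ?l n s) \<longlonglongrightarrow> 1"
    proof (rule tendsto_sandwich)
      show "\<forall>\<^sub>F n in sequentially. 1 + ln s / real (Suc n) \<le> ?l n s"
        by (intro always_eventually allI div1[OF _ lnb[OF True]]) simp
      show "\<forall>\<^sub>F n in sequentially. ?l n s \<le> 1 + ln (1 + s) / real (Suc n)"
        by (intro always_eventually allI div2[OF _ lub[OF s]]) simp
      show "(\<lambda>n. 1 + ln s / real (Suc n)) \<longlonglongrightarrow> 1" "(\<lambda>n. 1 + ln (1 + s) / real (Suc n)) \<longlonglongrightarrow> 1"
        using tendsto_add[OF tendsto_const null, of 1] by auto
    qed
    then show ?thesis using True by simp
  next
    case False
    then have "s = 0" using s by simp
    then show ?thesis by simp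
  qed
  have "(\<lambda>n. LINT X|M. ?l n (W X) * (grad f X \<bullet> h)) \<longlonglongrightarrow> (LINT X|M. (if W X > 0 then 1 else 0) * (grad f X \<bullet> h))"
  proof (rule integral_dominated_convergence[where w="\<lambda>X. (b * norm h) * (F X + 1) powr p"])
    show "integrable M (\<lambda>X. (b * norm h) * (F X + 1) powr p)"
      by (intro integrable_mult_right integrable_F_plus) simp
    show "AE X in M. (\<lambda>n. ?l n (W X) * (grad f X \<bullet> h)) \<longlonglongrightarrow> (if W X > 0 then 1 else 0) * (grad f X \<bullet> h)"
      using AE_good by eventually_elim (intro tendsto_mult tendsto_const lim goodD(4))
    show "AE X in M. norm (?l n (W X) * (grad f X \<bullet> h)) \<le> (b * norm h) * (F X + 1) powr p" for n
      using AE_good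
    proof eventually_elim
      case (elim X)
      have W0: "W X \<ge> 0" by (rule goodD(4)[OF elim])
      have "ln (1 + W X) \<le> W X" using W0 by (intro ln_add_one_self_le_self) auto
      then have "ln (1 + W X / exp (- real (Suc n))) \<le> real (Suc n) + real (Suc n) * W X"
        using lub[OF W0, of n] W0 mult_right_mono[of 1 "real (Suc n)" "W X"] by simp
      then have "?l n (W X) \<le> 1 + W X" by (simp add: field_simps)
      also have "\<dots> \<le> (F X + 1) powr p"
        using powr_mono[of 1 p "F X + 1"] p F_nonneg[of X] goodD(5)[OF elim] by simp
      finally have "?l n (W X) \<le> (F X + 1) powr p" .
      moreover have "?l n (W X) \<ge> 0" using W0 by (intro divide_nonneg_nonneg ln_ge_zero) auto
      moreover have "\<bar>grad f X \<bullet> h\<bar> \<le> b * norm h"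
        using Cauchy_Schwarz_ineq2[of "grad f X" h] mult_right_mono[OF b(3)[of X], of "norm h"] by auto
      ultimately have "\<bar>?l n (W X)\<bar> * \<bar>grad f X \<bullet> h\<bar> \<le> (F X + 1) powr p * (b * norm h)"
        by (intro mult_mono) (auto simp del: abs_divide)
      then show ?case by (simp only: real_norm_def abs_mult mult.commute)
    qed
    show "(\<lambda>X. (if W X > 0 then 1 else 0) * (grad f X \<bullet> h)) \<in> borel_measurable M"
      "(\<lambda>X. ?l n (W X) * (grad f X \<bullet> h)) \<in> borel_measurable M" for n
      using mg W_meas by measurable
  qed
  \<comment> \<open>The bound for the gradient of the logarithm is uniform in \<epsilon>, so
    division by n + 1 sends it to 0.\<close>
  moreover have "(\<lambda>n. LINT X|M. ?l n (W X) * (grad f X \<bullet> h)) \<longlonglongrightarrow> 0"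
  proof (rule Lim_null_comparison[OF always_eventually null[of "K * norm h"]], rule allI)
    fix n
    have "(LINT X|M. ?l n (W X) * (grad f X \<bullet> h)) = (LINT X|M. ln (1 + W X / exp (- real (Suc n))) * (grad f X \<bullet> h) / real (Suc n))"
      by (intro Bochner_Integration.integral_cong) auto
    also have "\<dots> = (LINT X|M. ln (1 + W X / exp (- real (Suc n))) * (grad f X \<bullet> h)) / real (Suc n)"
      by (rule integral_divide_zero)
    finally have "\<bar>LINT X|M. ?l n (W X) * (grad f X \<bullet> h)\<bar> = \<bar>LINT X|M. ln (1 + W X / exp (- real (Suc n))) * (grad f X \<bullet> h)\<bar> / real (Suc n)"
      by simp
    also have "\<dots> \<le> K * norm h / real (Suc n)"
      by (intro divide_right_mono log_weak_gradient[OF f _ K]) auto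
    finally show "norm (LINT X|M. ?l n (W X) * (grad f X \<bullet> h)) \<le> K * norm h / real (Suc n)" by simp
  qed
  ultimately show ?thesis by (rule LIMSEQ_unique)
qed

text \<open>The indicator of {W > 0} has vanishing weak gradient on the connected set \<omega>,
  hence is constant. Any constant other than 1 would give W = 0 almost everywhere, against the
  normalization.\<close>

lemma W_pos: "AE X in M. W X > 0"
proof -
  define \<theta>0 where "\<theta>0 X = (if X \<in> \<omega> then (if W X > 0 then 1 else 0) else (0::real))" for X
  have "(\<lambda>X. if W X > 0 then 1 else (0::real)) \<in> borel_measurable M" using W_meas by measurable
  then have m0: "\<theta>0 \<in> borel_measurable lebesgue"
    unfolding \<theta>0_def[abs_def] using borel_measurable_if[OF omega_sets, of "\<lambda>X. if W X > 0 then 1 else (0::real)"] by blast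
  then obtain \<theta>1 where \<theta>1: "\<theta>1 \<in> borel_measurable lborel" "AE X in lborel. \<theta>0 X = \<theta>1 X"
    using completion_ex_borel_measurable_real by blast
  \<comment> \<open>\<open>zero_weak_gradient_constant\<close> asks for a bounded Borel function on
    the whole space; clipping a Borel representative to [0, 1] does not change it almost
    everywhere.\<close>
  define \<theta> where "\<theta> X = max 0 (min 1 (\<theta>1 X))" for X
  have \<theta>m: "\<theta> \<in> borel_measurable borel" unfolding \<theta>_def[abs_def] using \<theta>1(1) by simp
  have ae: "AE X in lebesgue. \<theta>0 X = \<theta> X"
    using AE_completion[OF \<theta>1(2)] by eventually_elim (auto simp: \<theta>_def \<theta>0_def split: if_splits)
  have "\<exists>c. AE X in lebesgue. X \<in> \<omega> \<longrightarrow> \<theta> X = c"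
  proof (rule zero_weak_gradient_constant[OF omega(1,2) \<theta>m])
    show "\<bar>\<theta> X\<bar> \<le> 1" for X by (simp add: \<theta>_def)
    fix \<phi> :: "real ^ 'm \<Rightarrow> real" and h assume \<phi>: "\<phi> \<in> test_functions \<omega>"
    have mg: "(\<lambda>X. grad \<phi> X \<bullet> h) \<in> borel_measurable lebesgue"
      using continuous_on_grad[OF test_smooth[OF \<phi>]]
      by (intro borel_measurable_lebesgue_continuous continuous_on_inner continuous_on_const)
    have "(LINT X|lebesgue. \<theta> X * (grad \<phi> X \<bullet> h)) = (LINT X|lebesgue. \<theta>0 X * (grad \<phi> X \<bullet> h))"
    proof (rule integral_cong_AE)
      show "AE X in lebesgue. \<theta> X * (grad \<phi> X \<bullet> h) = \<theta>0 X * (grad \<phi> X \<bullet> h)"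
        using ae by eventually_elim simp
      show "(\<lambda>X. \<theta> X * (grad \<phi> X \<bullet> h)) \<in> borel_measurable lebesgue"
        using \<theta>m by (intro borel_measurable_times mg measurable_completion) simp
    qed (intro borel_measurable_times mg m0)
    also have "\<dots> = (LINT X|M. \<theta>0 X * (grad \<phi> X \<bullet> h))"
      by (rule integral_M_eq_lebesgue[symmetric]) (simp add: \<theta>0_def)
    also have "\<dots> = (LINT X|M. (if W X > 0 then 1 else 0) * (grad \<phi> X \<bullet> h))"
      by (rule Bochner_Integration.integral_cong) (auto simp: \<theta>0_def)
    also have "\<dots> = 0" by (rule indicator_weak_gradient[OF \<phi>])
    finally show "(LINT X|lebesgue. \<theta> X * (grad \<phi> X \<bullet> h)) = 0" .
  qed
  then obtain c where "AE X in lebesgue. X \<in> \<omega> \<longrightarrow> \<theta> X = c" by blast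
  then have "AE X in lebesgue. X \<in> \<omega> \<longrightarrow> \<theta>0 X = c" using ae by eventually_elim simp
  then have c: "AE X in M. \<theta>0 X = c" using omega_sets by (subst AE_restrict_space_iff) auto
  have sp: "AE X in M. X \<in> \<omega>" using AE_space[of M] by simp
  show ?thesis
  proof (cases "c = 1")
    case True
    show ?thesis using c sp by eventually_elim (auto simp: \<theta>0_def True split: if_splits)
  next
    case False
    have "AE X in M. W X = 0"
      using c sp AE_good
    proof eventually_elim
      case (elim X)
      then show ?case using False goodD(4)[OF elim(3)] by (auto simp: \<theta>0_def split: if_splits)
    qed
    then have "(LINT X|M. \<bar>W X\<bar> powr p) = (LINT X|M. 0)"
      using W_meas by (intro integral_cong_AE) (auto elim: eventually_mono)
    then show ?thesis using W_normalized by simp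
  qed
qed

end

section \<open>Integration over the half-cylinder\<close>

lemma AE_lborel_snd:
  fixes P :: "'b::euclidean_space \<Rightarrow> bool"
  assumes "AE X in lborel. P X"
  shows "AE x :: 'a::euclidean_space \<times> 'b in lborel. P (snd x)"
proof -
  obtain N where N: "{X \<in> space lborel. \<not> P X} \<subseteq> N" "emeasure lborel N = 0" "N \<in> sets (lborel :: 'b measure)"
    using assms by (rule AE_E)
  have [measurable]: "N \<in> sets borel" using N(3) by simp
  have "N \<in> null_sets lborel" using N(2,3) by auto
  then have ae: "AE X in lborel. X \<notin> N" by (rule AE_not_in)
  have "AE x in (lborel :: 'a measure) \<Otimes>\<^sub>M (lborel :: 'b measure). snd x \<notin> N"
  proof (rule lborel_pair.AE_pair_measure)
    show "{x \<in> space (lborel \<Otimes>\<^sub>M lborel). snd x \<notin> N} \<in> sets ((lborel :: 'a measure) \<Otimes>\<^sub>M (lborel :: 'b measure))"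
      by measurable
    show "AE x in lborel. AE y in lborel. snd (x :: 'a, y) \<notin> N" using ae by simp
  qed
  then have "AE x :: 'a \<times> 'b in lborel. snd x \<notin> N" unfolding lborel_prod .
  then show ?thesis by eventually_elim (use N(1) in auto)
qed

lemma integral_derivative_half_line:
  fixes q q' :: "real \<Rightarrow> real"
  assumes d: "\<And>s. (q has_real_derivative q' s) (at s)" and c: "continuous_on UNIV q'"
    and z: "\<And>s. s \<ge> R \<Longrightarrow> q s = 0" "\<And>s. s \<ge> R \<Longrightarrow> q' s = 0" and R: "R \<ge> 0"
  shows "(LINT s|lborel. indicator {0<..} s * q' s) = - q 0"
proof -
  have [measurable]: "q' \<in> borel_measurable borel" using c by (rule borel_measurable_continuous_onI)
  have "(LINT s|lborel. indicator {0<..} s * q' s) = (LINT s|lborel. indicator {0..R} s * q' s)"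
  proof (rule integral_cong_AE)
    show "AE s in lborel. indicator {0<..} s * q' s = indicator {0..R} s * q' s"
      using AE_lborel_singleton[of 0]
      by eventually_elim (use z in \<open>auto simp: indicator_def\<close>)
  qed measurable
  also have "\<dots> = (LINT s|lborel. q' s * indicator {0..R} s)" by (simp add: mult.commute)
  also have "\<dots> = q R - q 0"
    by (rule integral_FTC_Icc_real[OF R]) (use d c in \<open>auto simp: continuous_on_eq_continuous_at\<close>)
  finally show ?thesis using z(1)[of R] by simp
qed

context cylinder
begin

abbreviation "U \<equiv> half_cylinder \<omega>"
abbreviation "N \<equiv> lebesgue_on (half_cylinder \<omega>)"

lemma open_U: "open U"
  unfolding half_cylinder_def using omega by (intro open_Times) auto

lemma U_sets: "U \<in> sets lebesgue" using open_U by auto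

lemma in_U: "x \<in> U \<longleftrightarrow> fst x > 0 \<and> snd x \<in> \<omega>"
  by (cases x) (auto simp: half_cylinder_def)

text \<open>Null sets of the section have null cylinders over them; in particular the good points of
  the section are good on the whole half-cylinder.\<close>

lemma AE_N:
  assumes "AE X in M. P X" shows "AE x in N. P (snd x)"
proof -
  have "AE X in lebesgue. X \<in> \<omega> \<longrightarrow> P X" using assms omega_sets by (subst (asm) AE_restrict_space_iff) auto
  then have "AE X in lborel. X \<in> \<omega> \<longrightarrow> P X" by (simp add: AE_completion_iff)
  then have "AE x :: real \<times> (real ^ 'm) in lborel. snd x \<in> \<omega> \<longrightarrow> P (snd x)" by (rule AE_lborel_snd)
  then have "AE x :: real \<times> (real ^ 'm) in lebesgue. snd x \<in> \<omega> \<longrightarrow> P (snd x)" by (rule AE_completion)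
  then have "AE x in lebesgue. x \<in> U \<longrightarrow> P (snd x)" by eventually_elim (auto simp: in_U)
  then show ?thesis using U_sets by (subst AE_restrict_space_iff) auto
qed

lemma borel_representative:
  fixes m :: "real ^ 'm \<Rightarrow> real"
  assumes m: "m \<in> borel_measurable M"
  obtains m1 where "m1 \<in> borel_measurable borel" "AE X in lborel. (if X \<in> \<omega> then m X else 0) = m1 X"
proof -
  have "(\<lambda>X. if X \<in> \<omega> then m X else 0) \<in> borel_measurable lebesgue"
    using m borel_measurable_if[OF omega_sets, of m] by blast
  from completion_ex_borel_measurable_real[OF this] show ?thesis using that by auto
qed

lemma measurable_N_snd:
  fixes m :: "real ^ 'm \<Rightarrow> real"
  assumes m: "m \<in> borel_measurable M"
  shows "(\<lambda>x. m (snd x)) \<in> borel_measurable N"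
proof -
  obtain m1 where m1: "m1 \<in> borel_measurable borel" "AE X in lborel. (if X \<in> \<omega> then m X else 0) = m1 X"
    by (rule borel_representative[OF m])
  have ae: "AE x :: real \<times> (real ^ 'm) in lebesgue. (if snd x \<in> \<omega> then m (snd x) else 0) = m1 (snd x)"
    by (rule AE_completion[OF AE_lborel_snd[OF m1(2)]])
  have "(\<lambda>x :: real \<times> (real ^ 'm). m1 (snd x)) \<in> borel_measurable lborel"
    using measurable_compose[OF borel_measurable_continuous_onI[OF continuous_on_snd[OF continuous_on_id]] m1(1)]
    by simp
  then have "(\<lambda>x :: real \<times> (real ^ 'm). m1 (snd x)) \<in> borel_measurable N"
    by (intro measurable_restrict_space1 measurable_completion)
  then show ?thesis
  proof (rule borel_measurable_lebesgue_on_AE[OF U_sets])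
    have "AE x in lebesgue. x \<in> U \<longrightarrow> m1 (snd x) = m (snd x)"
      using ae by eventually_elim (auto simp: in_U)
    then show "AE x in N. m1 (snd x) = m (snd x)"
      using U_sets by (subst AE_restrict_space_iff) auto
  qed
qed

text \<open>Lebesgue measure on the cylinder is only the completion of a product measure, so
  \<open>m\<close> is replaced by a Borel representative and Fubini is applied to
  \<open>lborel\<close>. Both orders are needed: x_1 innermost produces the boundary term, X_2
  innermost the Euler--Lagrange equation on slices.\<close>

lemma Fubini_product:
  fixes m :: "real ^ 'm \<Rightarrow> real" and f :: "real \<times> (real ^ 'm) \<Rightarrow> real"
  assumes f: "f \<in> borel_measurable borel" and b: "\<And>x. \<bar>f x\<bar> \<le> b" and R: "\<forall>x. \<bar>fst x\<bar> > R \<longrightarrow> f x = 0"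
    and m: "integrable M m"
  shows "integrable N (\<lambda>x. f x * m (snd x))"
    and "(LINT x|N. f x * m (snd x)) = (LINT X|M. (LINT s|lborel. indicator {0<..} s * f (s, X)) * m X)"
    and "(LINT x|N. f x * m (snd x)) = (LINT s|lborel. indicator {0<..} s * (LINT X|M. f (s, X) * m X))"
    and "integrable lborel (\<lambda>s. indicator {0<..} s * (LINT X|M. f (s, X) * m X))"
proof -
  obtain m1 where m1: "m1 \<in> borel_measurable borel" "AE X in lborel. (if X \<in> \<omega> then m X else 0) = m1 X"
    by (rule borel_representative[OF borel_measurable_integrable[OF m]])
  note [measurable] = f m1(1)
  have b0: "b \<ge> 0" using b[of 0] by linarith
  let ?m0 = "\<lambda>X. if X \<in> \<omega> then m X else 0"
  have m0i: "integrable lebesgue ?m0"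
  proof -
    have "?m0 = (\<lambda>X. indicator \<omega> X *\<^sub>R m X)" by (auto simp: indicator_def)
    then show ?thesis using m omega_sets by (subst (asm) integrable_restrict_space) auto
  qed
  have im1: "integrable lborel m1"
  proof -
    have "integrable lebesgue m1"
      using m0i AE_completion[OF m1(2)] borel_measurable_integrable[OF m0i]
      by (subst (asm) integrable_cong_AE) (auto intro: measurable_completion)
    then show ?thesis by (simp add: integrable_completion)
  qed
  \<comment> \<open>Borel on the product space and almost everywhere equal to the integrand extended
    by zero from the half-cylinder.\<close>
  define k where "k x = indicator {0<..} (fst x) * f x * m1 (snd x)" for x
  have km: "k \<in> borel_measurable (lborel \<Otimes>\<^sub>M lborel)"
  proof -
    have "f \<in> borel_measurable (lborel \<Otimes>\<^sub>M lborel)" by (simp add: lborel_prod)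
    then show ?thesis unfolding k_def[abs_def] by measurable
  qed
  have kle: "\<bar>k (s, X)\<bar> \<le> b * indicator {-R..R} s * \<bar>m1 X\<bar>" for s X
    using b[of "(s, X)"] R[rule_format, of "(s, X)"] b0 by (auto simp: k_def indicator_def abs_mult intro!: mult_right_mono)
  have ks: "integrable lborel (\<lambda>X. k (s, X))" for s
  proof (rule Bochner_Integration.integrable_bound[OF integrable_mult_right[OF im1, of b]])
    have "\<bar>k (s, X)\<bar> \<le> \<bar>b * m1 X\<bar>" for X
      using kle[of s X] b0 by (cases "s \<in> {-R..R}") (auto simp: abs_mult intro: order_trans)
    then show "AE X in lborel. norm (k (s, X)) \<le> norm (b * m1 X)" by simp
  qed (use measurable_compose[OF measurable_Pair1'[of s lborel lborel] km] in simp)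
  have ki: "integrable (lborel \<Otimes>\<^sub>M lborel) k"
  proof (rule lborel_pair.Fubini_integrable[OF km])
    show "integrable lborel (\<lambda>s. LINT X|lborel. norm (k (s, X)))"
    proof (rule Bochner_Integration.integrable_bound)
      show "integrable lborel (\<lambda>s. (b * (LINT X|lborel. \<bar>m1 X\<bar>)) * indicator {-R..R} s)"
        by (intro integrable_mult_right integrable_real_indicator) (auto simp: emeasure_lborel_Icc_eq)
      show "(\<lambda>s. LINT X|lborel. norm (k (s, X))) \<in> borel_measurable lborel"
        using km by measurable
      show "AE s in lborel. norm (LINT X|lborel. norm (k (s, X))) \<le> norm ((b * (LINT X|lborel. \<bar>m1 X\<bar>)) * indicator {-R..R} s)"
      proof (rule AE_I2)
        fix s
        have "(LINT X|lborel. norm (k (s, X))) \<le> (LINT X|lborel. b * indicator {-R..R} s * \<bar>m1 X\<bar>)"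
          using kle by (intro integral_mono integrable_norm ks integrable_mult_right integrable_abs im1) auto
        also have "\<dots> = (b * (LINT X|lborel. \<bar>m1 X\<bar>)) * indicator {-R..R} s" by simp
        finally show "norm (LINT X|lborel. norm (k (s, X))) \<le> norm ((b * (LINT X|lborel. \<bar>m1 X\<bar>)) * indicator {-R..R} s)"
          by (simp add: abs_of_nonneg)
      qed
    qed
  qed (use ks in auto)
  have kl: "k \<in> borel_measurable lborel" using km by (simp add: lborel_prod)
  have aek: "AE x in lebesgue. indicator U x * (f x * m (snd x)) = k x"
    using AE_completion[OF AE_lborel_snd[OF m1(2), where ?'a=real]]
    by eventually_elim (auto simp: k_def in_U indicator_def split: if_splits)
  have fm: "(\<lambda>x. f x * m (snd x)) \<in> borel_measurable N"
    by (rule borel_measurable_times[OF measurable_restrict_space1[OF measurable_completion]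
          measurable_N_snd[OF borel_measurable_integrable[OF m]]]) simp
  have fm': "(\<lambda>x. indicator U x * (f x * m (snd x))) \<in> borel_measurable lebesgue"
    using fm U_sets by (subst (asm) borel_measurable_restrict_space_iff) (auto simp: mult.commute)
  have kleb: "integrable lebesgue k" "(LINT x|lebesgue. k x) = integral\<^sup>L (lborel \<Otimes>\<^sub>M lborel) k"
    using ki kl by (simp_all add: integrable_completion integral_completion lborel_prod)
  have int0: "integrable lebesgue (\<lambda>x. indicator U x * (f x * m (snd x)))"
    using kleb(1) aek kl fm' by (subst integrable_cong_AE) (auto intro: measurable_completion)
  then show 1: "integrable N (\<lambda>x. f x * m (snd x))"
    using U_sets by (subst integrable_restrict_space) auto
  have "(LINT x|N. f x * m (snd x)) = (LINT x|lebesgue. indicator U x * (f x * m (snd x)))"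
    using U_sets by (subst integral_restrict_space) auto
  also have "\<dots> = (LINT x|lebesgue. k x)"
    using aek kl fm' by (intro integral_cong_AE) (auto intro: measurable_completion)
  finally have eq: "(LINT x|N. f x * m (snd x)) = integral\<^sup>L (lborel \<Otimes>\<^sub>M lborel) k" using kleb(2) by simp
  have trans: "(LINT X|lborel. q X * m1 X) = (LINT X|M. q X * m X)" if q: "q \<in> borel_measurable borel" for q
  proof -
    note [measurable] = q
    have "(LINT X|lborel. q X * m1 X) = (LINT X|lebesgue. q X * m1 X)"
      by (rule integral_completion[symmetric]) simp
    also have "\<dots> = (LINT X|lebesgue. q X * ?m0 X)"
    proof (rule integral_cong_AE)
      show "AE X in lebesgue. q X * m1 X = q X * ?m0 X"
        using AE_completion[OF m1(2)] by eventually_elim simp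
      show "(\<lambda>X. q X * m1 X) \<in> borel_measurable lebesgue" by (intro measurable_completion) simp
      show "(\<lambda>X. q X * ?m0 X) \<in> borel_measurable lebesgue"
        by (intro borel_measurable_times borel_measurable_integrable[OF m0i] measurable_completion) simp
    qed
    also have "\<dots> = (LINT X|M. q X * ?m0 X)" by (rule integral_M_eq_lebesgue[symmetric]) simp
    also have "\<dots> = (LINT X|M. q X * m X)" by (rule Bochner_Integration.integral_cong) auto
    finally show ?thesis .
  qed
  have fs: "(\<lambda>X. f (s, X)) \<in> borel_measurable borel" "(\<lambda>s. f (s, X)) \<in> borel_measurable borel" for s X
    by measurable
  have in1: "(LINT X|lborel. k (s, X)) = indicator {0<..} s * (LINT X|M. f (s, X) * m X)" for s
  proof -
    have "(LINT X|lborel. k (s, X)) = (LINT X|lborel. indicator {0<..} s * (f (s, X) * m1 X))"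
      by (simp add: k_def mult.assoc)
    also have "\<dots> = indicator {0<..} s * (LINT X|lborel. f (s, X) * m1 X)" by (rule integral_mult_right_zero)
    finally show ?thesis using trans[OF fs(1)] by simp
  qed
  show "(LINT x|N. f x * m (snd x)) = (LINT s|lborel. indicator {0<..} s * (LINT X|M. f (s, X) * m X))"
    unfolding eq in1[symmetric] by (rule lborel_pair.integral_fst'[OF ki, symmetric])
  show "integrable lborel (\<lambda>s. indicator {0<..} s * (LINT X|M. f (s, X) * m X))"
    unfolding in1[symmetric] by (rule lborel_pair.integrable_fst'[OF ki])
  have "integral\<^sup>L (lborel \<Otimes>\<^sub>M lborel) k = (LINT X|lborel. LINT s|lborel. k (s, X))"
    using lborel_pair.integral_snd[of "\<lambda>s X. k (s, X)"] ki by (simp add: case_prod_beta')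
  also have "\<dots> = (LINT X|lborel. (LINT s|lborel. indicator {0<..} s * f (s, X)) * m1 X)"
    by (simp add: k_def)
  also have "\<dots> = (LINT X|M. (LINT s|lborel. indicator {0<..} s * f (s, X)) * m X)"
  proof (rule trans)
    have "f \<in> borel_measurable (borel \<Otimes>\<^sub>M borel)" using f by (simp add: borel_prod)
    then have "(\<lambda>z. indicator {0<..} (snd z) * f (snd z, fst z)) \<in> borel_measurable (borel \<Otimes>\<^sub>M lborel)"
      by measurable
    then show "(\<lambda>X. LINT s|lborel. indicator {0<..} s * f (s, X)) \<in> borel_measurable borel"
      by (intro lborel.borel_measurable_lebesgue_integral) (simp add: case_prod_beta')
  qed
  finally show "(LINT x|N. f x * m (snd x)) = (LINT X|M. (LINT s|lborel. indicator {0<..} s * f (s, X)) * m X)"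
    using eq by simp
qed

end

section \<open>The inequality on the half-cylinder\<close>

lemma norm_fst_le': "norm (fst z) \<le> norm z" and norm_snd_le': "norm (snd z) \<le> norm z"
  using norm_fst_le[of "fst z" "snd z"] norm_snd_le[of "snd z" "fst z"] by simp_all

context cylinder
begin

lemma test_cyl:
  fixes u :: "real \<times> (real ^ 'm) \<Rightarrow> real"
  assumes u: "u \<in> test_functions (UNIV \<times> \<omega>)"
  obtains R where "R \<ge> 0" "\<And>x. \<bar>fst x\<bar> \<ge> R \<Longrightarrow> u x = 0" "\<And>x. \<bar>fst x\<bar> \<ge> R \<Longrightarrow> grad u x = 0"
proof -
  obtain K where K: "smooth u" "compact K" "K \<subseteq> UNIV \<times> \<omega>" "\<And>x. x \<notin> K \<Longrightarrow> u x = 0" "\<And>x. x \<notin> K \<Longrightarrow> grad u x = 0"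
    by (rule test_functionsE[OF u]) blast
  obtain R where R: "\<And>x. x \<in> K \<Longrightarrow> norm x \<le> R"
    using compact_imp_bounded[OF K(2)] unfolding bounded_iff by blast
  have out: "x \<notin> K" if "\<bar>fst x\<bar> \<ge> max 0 R + 1" for x
    using R[of x] norm_fst_le'[of x] that by force
  show ?thesis
    by (rule that[of "max 0 R + 1"]) (use out K(4,5) in simp_all)
qed

lemma slice_test:
  fixes u :: "real \<times> (real ^ 'm) \<Rightarrow> real"
  assumes u: "u \<in> test_functions (UNIV \<times> \<omega>)"
  shows "(\<lambda>X. u (s, X)) \<in> test_functions \<omega>" "grad (\<lambda>X. u (s, X)) X = snd (grad u (s, X))"
proof -
  obtain K where K: "smooth u" "compact K" "K \<subseteq> UNIV \<times> \<omega>" "\<And>x. x \<notin> K \<Longrightarrow> u x = 0"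
    by (rule test_functionsE[OF u]) blast
  have bl: "bounded_linear (\<lambda>X. (0::real, X :: real ^ 'm))"
    by (intro bounded_linear_Pair bounded_linear_zero bounded_linear_ident)
  show "(\<lambda>X. u (s, X)) \<in> test_functions \<omega>"
  proof (rule test_functionsI)
    show "smooth (\<lambda>X. u (s, X))"
      using smooth_affine[OF bl K(1), of "(s, 0)"] by simp
    show "compact (snd ` K)" by (intro compact_continuous_image continuous_on_snd continuous_on_id K)
    show "snd ` K \<subseteq> \<omega>" using K(3) by auto
    show "u (s, X) = 0" if "X \<notin> snd ` K" for X
      using that by (intro K(4)) force
  qed
  show "grad (\<lambda>X. u (s, X)) X = snd (grad u (s, X))"
  proof (rule grad_eqI)
    have d: "((\<lambda>X. (s, X)) has_derivative (\<lambda>h. (0, h))) (at X)"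
      by (intro has_derivative_Pair has_derivative_const has_derivative_ident)
    show "((\<lambda>X. u (s, X)) has_derivative (\<lambda>h. snd (grad u (s, X)) \<bullet> h)) (at X)"
      using has_derivative_compose[OF d smooth_grad[OF K(1)]] by (simp add: inner_prod_def)
  qed
qed

lemma slice_deriv:
  assumes u: "smooth u"
  shows "((\<lambda>s. u (s, X)) has_real_derivative fst (grad u (s, X))) (at s)"
proof -
  have d: "((\<lambda>s. (s, X)) has_derivative (\<lambda>h. (h, 0))) (at s)"
    by (intro has_derivative_Pair has_derivative_const has_derivative_ident)
  show ?thesis
    using has_derivative_compose[OF d smooth_grad[OF u]]
    by (simp add: inner_prod_def has_field_derivative_def mult.commute[of _ "fst _"])
qed

lemma integrable_vinv_L:
  assumes \<epsilon>: "\<epsilon> > 0"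
  shows "integrable M (\<lambda>X. vinv \<epsilon> X * L X y)" "integrable M (\<lambda>X. vinv' \<epsilon> X * L X (0, g X))"
    "integrable M (\<lambda>X. w0 X * vinv \<epsilon> X)"
proof -
  show "integrable M (\<lambda>X. vinv \<epsilon> X * L X y)"
  proof (rule integrable_F_bound[of _ 1 "\<epsilon> powr (1 - p) * (C powr (p / 2) * norm y)"])
    fix X assume X: "good X"
    have "norm y \<le> norm y * (F X + 1)" using F_nonneg[of X] by (simp add: distrib_left)
    then have "\<bar>L X y\<bar> \<le> (C powr (p / 2) * norm y) * (F X + 1) powr p" by (intro good_L_le X) auto
    then have "\<bar>vinv \<epsilon> X\<bar> * \<bar>L X y\<bar> \<le> \<epsilon> powr (1 - p) * ((C powr (p / 2) * norm y) * (F X + 1) powr p)"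
      using vinv_bounds[OF X \<epsilon>] by (intro mult_mono) auto
    then show "\<bar>vinv \<epsilon> X * L X y\<bar> \<le> \<epsilon> powr (1 - p) * (C powr (p / 2) * norm y) * (F X + 1) powr p"
      by (simp add: abs_mult mult.assoc)
  qed (intro borel_measurable_times measurable_vinv measurable_L borel_measurable_const, simp)
  show "integrable M (\<lambda>X. vinv' \<epsilon> X * L X (0, g X))"
  proof (rule integrable_F_bound[of _ 1 "p * \<epsilon> powr (- p) * (C powr (p / 2) * 1)"])
    fix X assume X: "good X"
    have "\<bar>L X (0, g X)\<bar> \<le> (C powr (p / 2) * 1) * (F X + 1) powr p"
      using goodD(6)[OF X] by (intro good_L_le X) (auto simp: norm_Pair)
    then have "\<bar>vinv' \<epsilon> X\<bar> * \<bar>L X (0, g X)\<bar> \<le> p * \<epsilon> powr (- p) * ((C powr (p / 2) * 1) * (F X + 1) powr p)"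
      using vinv_bounds[OF X \<epsilon>] p by (intro mult_mono) auto
    then show "\<bar>vinv' \<epsilon> X * L X (0, g X)\<bar> \<le> p * \<epsilon> powr (- p) * (C powr (p / 2) * 1) * (F X + 1) powr p"
      by (simp add: abs_mult mult.assoc)
  qed (intro borel_measurable_times measurable_vinv measurable_L measurable_zero_Pair g_meas, simp)
  show "integrable M (\<lambda>X. w0 X * vinv \<epsilon> X)"
  proof (rule integrable_F_bound[of _ 1 "\<epsilon> powr (1 - p)"])
    fix X assume X: "good X"
    have "\<bar>vinv \<epsilon> X\<bar> \<le> \<epsilon> powr (1 - p) * (F X + 1)"
      using vinv_bounds(1)[OF X \<epsilon>] mult_left_mono[of 1 "F X + 1" "\<epsilon> powr (1 - p)"] F_nonneg[of X] by simp
    then show "\<bar>w0 X * vinv \<epsilon> X\<bar> \<le> \<epsilon> powr (1 - p) * (F X + 1) powr p"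
      by (intro good_w0_le X) auto
  qed (intro borel_measurable_times measurable_vinv measurable_w0, simp)
qed

lemma measurable_B_N:
  assumes "f \<in> borel_measurable N" "h \<in> borel_measurable N"
  shows "(\<lambda>x. B (snd x) (f x) (h x)) \<in> borel_measurable N"
  unfolding B_def
  by (intro borel_measurable_block_inner assms measurable_N_snd a11_meas
      measurable_N_snd[OF A12_meas] measurable_N_snd[OF A22_meas])

lemma measurable_N_smooth: "smooth u \<Longrightarrow> u \<in> borel_measurable N" "smooth u \<Longrightarrow> grad u \<in> borel_measurable N"
  by (intro measurable_continuous_on_lebesgue_on smooth_continuous continuous_on_grad; assumption)+

lemma measurable_fst_snd:
  fixes f :: "'z \<Rightarrow> real \<times> (real ^ 'm)"
  assumes "f \<in> borel_measurable S"
  shows "(\<lambda>x. fst (f x)) \<in> borel_measurable S" "(\<lambda>x. snd (f x)) \<in> borel_measurable S"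
  by (rule borel_measurable_continuous_on[OF continuous_on_fst[OF continuous_on_id] assms]
      borel_measurable_continuous_on[OF continuous_on_snd[OF continuous_on_id] assms])+

lemma integrable_test_energy:
  assumes u: "u \<in> test_functions (UNIV \<times> \<omega>)"
  shows "integrable N (\<lambda>x. \<bar>B (snd x) (grad u x) (grad u x)\<bar> powr (p / 2))"
    "integrable N (\<lambda>x. \<bar>fst (grad u x)\<bar> powr p)" "integrable N (\<lambda>x. \<bar>u x\<bar> powr p)"
proof -
  obtain K where K: "smooth u" "compact K" "K \<subseteq> UNIV \<times> \<omega>" "\<And>x. x \<notin> K \<Longrightarrow> u x = 0" "\<And>x. x \<notin> K \<Longrightarrow> grad u x = 0"
    by (rule test_functionsE[OF u]) blast
  obtain b where b: "b \<ge> 0" "\<And>x. \<bar>u x\<bar> \<le> b" "\<And>x. norm (grad u x) \<le> b"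
    by (rule test_bounded[OF u]) blast
  note m = measurable_N_smooth[OF K(1)]
  have i: "integrable N (\<lambda>x. q x powr p)" if q: "q \<in> borel_measurable N" "\<And>x. 0 \<le> q x" "\<And>x. q x \<le> b" "\<And>x. x \<notin> K \<Longrightarrow> q x = 0" for q
  proof (rule integrable_bounded_compact[OF U_sets _ _ K(2), of _ "b powr p"])
    show "(\<lambda>x. q x powr p) \<in> borel_measurable N" using q(1) by measurable
    show "\<bar>q x powr p\<bar> \<le> b powr p" for x using q(2)[of x] q(3)[of x] p by (simp add: powr_mono2)
  qed (use q(4) in auto)
  show "integrable N (\<lambda>x. \<bar>u x\<bar> powr p)" by (rule i) (use m b K(4) in auto)
  have f: "\<bar>fst (grad u x)\<bar> \<le> norm (grad u x)" for x using norm_fst_le'[of "grad u x"] by simp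
  show "integrable N (\<lambda>x. \<bar>fst (grad u x)\<bar> powr p)"
  proof (rule i)
    show "\<bar>fst (grad u x)\<bar> \<le> b" for x by (rule order_trans[OF f b(3)])
  qed (use measurable_fst_snd(1)[OF m(2)] K(5) in auto)
  have ng: "integrable N (\<lambda>x. norm (grad u x) powr p)" by (rule i) (use m b K(5) in auto)
  show "integrable N (\<lambda>x. \<bar>B (snd x) (grad u x) (grad u x)\<bar> powr (p / 2))"
  proof (rule Bochner_Integration.integrable_bound[OF integrable_mult_right[OF ng, of "C powr (p / 2)"]])
    show "(\<lambda>x. \<bar>B (snd x) (grad u x) (grad u x)\<bar> powr (p / 2)) \<in> borel_measurable N"
      using measurable_B_N[OF m(2) m(2)] by measurable
    show "AE x in N. norm (\<bar>B (snd x) (grad u x) (grad u x)\<bar> powr (p / 2)) \<le> norm (C powr (p / 2) * norm (grad u x) powr p)"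
      using AE_N[OF AE_good]
    proof eventually_elim
      case (elim x)
      show ?case using good_energy_le[OF elim order_refl, of "grad u x"] by simp
    qed
  qed
qed

text \<open>The bracket is the x_1-derivative of a(x_1) |u|^p, so integrating over x_1 > 0 first
  leaves its value at x_1 = 0. The weight a = 1 serves the lower bound, a = arctan the case of
  equality.\<close>

lemma boundary_term:
  assumes u: "u \<in> test_functions (UNIV \<times> \<omega>)" and m: "integrable M m"
    and a: "\<And>s. (a has_real_derivative a' s) (at s)" "continuous_on UNIV a'" "\<And>s. \<bar>a s\<bar> \<le> k" "\<And>s. \<bar>a' s\<bar> \<le> k"
  shows "(LINT x|N. (a' (fst x) * \<bar>u x\<bar> powr p + a (fst x) * (abs_powr' p (u x) * fst (grad u x))) * m (snd x))
      = - (LINT X|M. a 0 * \<bar>u (0, X)\<bar> powr p * m X)"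
    and "integrable N (\<lambda>x. (a' (fst x) * \<bar>u x\<bar> powr p + a (fst x) * (abs_powr' p (u x) * fst (grad u x))) * m (snd x))"
proof -
  have sm: "smooth u" by (rule test_smooth[OF u])
  obtain R where R: "R \<ge> 0" "\<And>x. \<bar>fst x\<bar> \<ge> R \<Longrightarrow> u x = 0" "\<And>x. \<bar>fst x\<bar> \<ge> R \<Longrightarrow> grad u x = 0"
    by (rule test_cyl[OF u]) blast
  obtain b where b: "b \<ge> 0" "\<And>x. \<bar>u x\<bar> \<le> b" "\<And>x. norm (grad u x) \<le> b"
    by (rule test_bounded[OF u]) blast
  have k: "k \<ge> 0" using a(3)[of 0] by linarith
  let ?f = "\<lambda>x. a' (fst x) * \<bar>u x\<bar> powr p + a (fst x) * (abs_powr' p (u x) * fst (grad u x))"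
  have ca: "continuous_on UNIV a" by (rule DERIV_imp_continuous_UNIV[OF a(1)])
  have cu: "continuous_on UNIV u" by (rule smooth_continuous[OF sm])
  have cf: "continuous_on UNIV ?f"
    by (intro continuous_on_add continuous_on_mult continuous_on_fst continuous_on_grad[OF sm] continuous_on_id
        continuous_on_compose2[OF a(2)] continuous_on_compose2[OF ca] continuous_on_compose2[OF continuous_abs_powr'[OF p] cu]
        continuous_on_compose2[OF continuous_abs_powr[of p] cu]) (use p in auto)
  have fb: "\<bar>?f x\<bar> \<le> k * b powr p + k * (p * b powr (p - 1) * b)" for x
  proof -
    have "\<bar>u x\<bar> powr p \<le> b powr p" "\<bar>abs_powr' p (u x)\<bar> \<le> p * b powr (p - 1)"
      unfolding abs_abs_powr'[OF p] using b(1) b(2)[of x] p by (auto intro!: powr_mono2 mult_left_mono)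
    moreover have "\<bar>fst (grad u x)\<bar> \<le> b" using norm_fst_le'[of "grad u x"] b(3)[of x] by simp
    ultimately have "\<bar>a' (fst x)\<bar> * (\<bar>u x\<bar> powr p) \<le> k * b powr p"
      "\<bar>a (fst x)\<bar> * (\<bar>abs_powr' p (u x)\<bar> * \<bar>fst (grad u x)\<bar>) \<le> k * (p * b powr (p - 1) * b)"
      using a(3,4) k p by (auto intro!: mult_mono)
    then show ?thesis
      using abs_triangle_ineq[of "a' (fst x) * \<bar>u x\<bar> powr p" "a (fst x) * (abs_powr' p (u x) * fst (grad u x))"]
      by (simp add: abs_mult)
  qed
  have fR: "\<forall>x. \<bar>fst x\<bar> > R \<longrightarrow> ?f x = 0"
    using R(2,3) p by simp
  note Fub = Fubini_product[OF borel_measurable_continuous_onI[OF cf] fb fR m]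
  have half: "(LINT s|lborel. indicator {0<..} s * ?f (s, X)) = - (a 0 * \<bar>u (0, X)\<bar> powr p)" for X
  proof (rule integral_derivative_half_line[where R=R])
    show "((\<lambda>s. a s * \<bar>u (s, X)\<bar> powr p) has_real_derivative ?f (s, X)) (at s)" for s
      by (rule DERIV_cong[OF DERIV_mult[OF a(1) DERIV_chain2[OF abs_powr_deriv[OF p] slice_deriv[OF sm]]]]) simp
    show "continuous_on UNIV (\<lambda>s. ?f (s, X))"
      by (rule continuous_on_compose2[OF cf, of UNIV "\<lambda>s. (s, X)"]) (auto intro: continuous_intros)
  qed (use R p in auto)
  have "(LINT x|N. ?f x * m (snd x)) = (LINT X|M. (LINT s|lborel. indicator {0<..} s * ?f (s, X)) * m X)"
    by (rule Fub(2))
  also have "\<dots> = - (LINT X|M. a 0 * \<bar>u (0, X)\<bar> powr p * m X)"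
    unfolding half by simp
  finally show "(LINT x|N. ?f x * m (snd x)) = - (LINT X|M. a 0 * \<bar>u (0, X)\<bar> powr p * m X)" .
  show "integrable N (\<lambda>x. ?f x * m (snd x))" by (rule Fub(1))
qed

text \<open>For each x_1 the slice of u is a test function of \<omega>, so \<open>EL_vinv\<close>
  applies to it; the rest is integration over x_1.\<close>

lemma slice_term:
  assumes u: "u \<in> test_functions (UNIV \<times> \<omega>)" and \<epsilon>: "\<epsilon> > 0"
  shows "integrable N (\<lambda>x. L (snd x) (0, (vinv \<epsilon> (snd x) * abs_powr' p (u x)) *\<^sub>R snd (grad u x) + (\<bar>u x\<bar> powr p * vinv' \<epsilon> (snd x)) *\<^sub>R g (snd x)))"
    and "integrable N (\<lambda>x. \<bar>u x\<bar> powr p * (w0 (snd x) * vinv \<epsilon> (snd x)))"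
    and "(LINT x|N. L (snd x) (0, (vinv \<epsilon> (snd x) * abs_powr' p (u x)) *\<^sub>R snd (grad u x) + (\<bar>u x\<bar> powr p * vinv' \<epsilon> (snd x)) *\<^sub>R g (snd x)))
       = \<mu> * (LINT x|N. \<bar>u x\<bar> powr p * (w0 (snd x) * vinv \<epsilon> (snd x)))"
proof -
  have sm: "smooth u" by (rule test_smooth[OF u])
  obtain R where R: "R \<ge> 0" "\<And>x. \<bar>fst x\<bar> \<ge> R \<Longrightarrow> u x = 0" "\<And>x. \<bar>fst x\<bar> \<ge> R \<Longrightarrow> grad u x = 0"
    by (rule test_cyl[OF u]) blast
  obtain b where b: "b \<ge> 0" "\<And>x. \<bar>u x\<bar> \<le> b" "\<And>x. norm (grad u x) \<le> b"
    by (rule test_bounded[OF u]) blast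
  have cu: "continuous_on UNIV u" by (rule smooth_continuous[OF sm])
  let ?fi = "\<lambda>i x. abs_powr' p (u x) * (snd (grad u x) $ i)"
  let ?mi = "\<lambda>i X. vinv \<epsilon> X * L X (0, axis i 1)"
  let ?f0 = "\<lambda>x. \<bar>u x\<bar> powr p"
  let ?m0 = "\<lambda>X. vinv' \<epsilon> X * L X (0, g X)"
  have cfi: "continuous_on UNIV (?fi i)" for i
    by (intro continuous_on_mult continuous_on_compose2[OF continuous_abs_powr'[OF p] cu] continuous_on_component
        continuous_on_snd continuous_on_grad[OF sm]) auto
  have fib: "\<bar>?fi i x\<bar> \<le> p * b powr (p - 1) * b" for i x
  proof -
    have "\<bar>abs_powr' p (u x)\<bar> \<le> p * b powr (p - 1)"
      unfolding abs_abs_powr'[OF p] using b(1) b(2)[of x] p by (auto intro!: powr_mono2 mult_left_mono)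
    moreover have "\<bar>snd (grad u x) $ i\<bar> \<le> b"
      using component_le_norm_cart[of "snd (grad u x)" i] norm_snd_le'[of "grad u x"] b(3)[of x] by linarith
    ultimately show ?thesis unfolding abs_mult using p by (intro mult_mono) auto
  qed
  have fiR: "\<forall>x. \<bar>fst x\<bar> > R \<longrightarrow> ?fi i x = 0" for i using R(3) by simp
  have cf0: "continuous_on UNIV ?f0"
    using p by (intro continuous_on_compose2[OF continuous_abs_powr[of p] cu]) auto
  have f0b: "\<bar>?f0 x\<bar> \<le> b powr p" for x using b(1) b(2)[of x] p by (auto intro!: powr_mono2)
  have f0R: "\<forall>x. \<bar>fst x\<bar> > R \<longrightarrow> ?f0 x = 0" using R(2) p by simp
  note Fi = Fubini_product[OF borel_measurable_continuous_onI[OF cfi] fib fiR integrable_vinv_L(1)[OF \<epsilon>]]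
  note F0 = Fubini_product[OF borel_measurable_continuous_onI[OF cf0] f0b f0R integrable_vinv_L(2)[OF \<epsilon>]]
  note Fw = Fubini_product[OF borel_measurable_continuous_onI[OF cf0] f0b f0R integrable_vinv_L(3)[OF \<epsilon>]]
  \<comment> \<open>\<open>Fubini_product\<close> handles a bounded Borel function times one
    function of X_2. Linearity of the flux splits the integrand into finitely many such products,
    one per coordinate of the gradient and one for the term in g.\<close>
  have dec: "L X (0, (vinv \<epsilon> X * a) *\<^sub>R z + (c * vinv' \<epsilon> X) *\<^sub>R g X)
     = (\<Sum>i\<in>UNIV. (a * (z $ i)) * (vinv \<epsilon> X * L X (0, axis i 1))) + c * (vinv' \<epsilon> X * L X (0, g X))"
    if X: "good X" for X a c z
  proof -
    have zz: "L X (0, z) = (\<Sum>i\<in>UNIV. (z $ i) * L X (0, axis i 1))"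
    proof -
      have "L X (0, y) = E X powr ((p - 2) / 2) * ((A22 X *v g X) \<bullet> y)" for y by (simp add: L_def B_sec)
      then show ?thesis
        by (simp add: inner_vec_def[of _ z] inner_axis sum_distrib_left sum_distrib_right algebra_simps)
    qed
    have "L X (0, (vinv \<epsilon> X * a) *\<^sub>R z + (c * vinv' \<epsilon> X) *\<^sub>R g X) = L X ((vinv \<epsilon> X * a) *\<^sub>R (0, z) + (c * vinv' \<epsilon> X) *\<^sub>R (0, g X))"
      by simp
    also have "\<dots> = (vinv \<epsilon> X * a) * L X (0, z) + (c * vinv' \<epsilon> X) * L X (0, g X)"
      by (simp only: L_linear[OF X])
    finally show ?thesis by (simp add: zz sum_distrib_left algebra_simps)
  qed
  let ?k = "\<lambda>x. L (snd x) (0, (vinv \<epsilon> (snd x) * abs_powr' p (u x)) *\<^sub>R snd (grad u x) + (\<bar>u x\<bar> powr p * vinv' \<epsilon> (snd x)) *\<^sub>R g (snd x))"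
  let ?K = "\<lambda>x. (\<Sum>i\<in>UNIV. ?fi i x * ?mi i (snd x)) + ?f0 x * ?m0 (snd x)"
  have iK: "integrable N ?K"
    by (intro Bochner_Integration.integrable_add Bochner_Integration.integrable_sum Fi F0)
  have ae: "AE x in N. ?k x = ?K x"
    using AE_N[OF AE_good] by eventually_elim (rule dec)
  have mL: "(\<lambda>x. L (snd x) (q x)) \<in> borel_measurable N" if "q \<in> borel_measurable N" for q
  proof -
    have mg: "(\<lambda>x. (0::real, g (snd x))) \<in> borel_measurable N"
    proof (rule borel_measurable_Pair)
      have "(\<lambda>x. g (snd x)) = (\<lambda>x. \<chi> i. g (snd x) $ i)" by simp
      have "\<And>i. (\<lambda>x. g (snd x) \<bullet> i) \<in> borel_measurable N"
        by (rule measurable_N_snd) (intro borel_measurable_inner g_meas borel_measurable_const)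
      then show "(\<lambda>x. g (snd x)) \<in> borel_measurable N"
        by (subst borel_measurable_euclidean_space) blast
    qed simp
    show ?thesis unfolding L_def
      using measurable_N_snd[OF measurable_E] measurable_B_N[OF mg that] by measurable
  qed
  have mk: "?k \<in> borel_measurable N"
  proof -
    have "(\<lambda>x. g (snd x)) \<in> borel_measurable N"
    proof -
      have "\<And>i. (\<lambda>x. g (snd x) \<bullet> i) \<in> borel_measurable N"
        by (rule measurable_N_snd) (intro borel_measurable_inner g_meas borel_measurable_const)
      then show ?thesis by (subst borel_measurable_euclidean_space) blast
    qed
    then show ?thesis
      by (intro mL borel_measurable_Pair borel_measurable_const borel_measurable_add borel_measurable_scaleR
          borel_measurable_times measurable_N_snd measurable_vinv measurable_fst_snd(2) measurable_N_smooth sm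
          borel_measurable_continuous_on[OF continuous_abs_powr'[OF p] measurable_N_smooth(1)[OF sm]]
          borel_measurable_continuous_on[OF continuous_abs_powr[of p] measurable_N_smooth(1)[OF sm]]) (use p in auto)
  qed
  show "integrable N ?k" using iK ae mk by (subst integrable_cong_AE) auto
  show "integrable N (\<lambda>x. \<bar>u x\<bar> powr p * (w0 (snd x) * vinv \<epsilon> (snd x)))" by (rule Fw(1))
  have "(LINT x|N. ?k x) = (LINT x|N. ?K x)"
    using iK ae mk by (intro integral_cong_AE) auto
  also have "\<dots> = (\<Sum>i\<in>UNIV. LINT x|N. ?fi i x * ?mi i (snd x)) + (LINT x|N. ?f0 x * ?m0 (snd x))"
    by (subst Bochner_Integration.integral_add[OF Bochner_Integration.integrable_sum[OF Fi(1)] F0(1)])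
      (subst Bochner_Integration.integral_sum[OF Fi(1)], rule refl)
  also have "\<dots> = (LINT s|lborel. (\<Sum>i\<in>UNIV. indicator {0<..} s * (LINT X|M. ?fi i (s, X) * ?mi i X))
      + indicator {0<..} s * (LINT X|M. ?f0 (s, X) * ?m0 X))"
    unfolding Fi(3) F0(3)
    by (subst Bochner_Integration.integral_add[OF Bochner_Integration.integrable_sum[OF Fi(4)] F0(4)])
      (subst Bochner_Integration.integral_sum[OF Fi(4)], rule refl)
  also have "\<dots> = (LINT s|lborel. \<mu> * (indicator {0<..} s * (LINT X|M. ?f0 (s, X) * (w0 X * vinv \<epsilon> X))))"
  proof (rule Bochner_Integration.integral_cong[OF refl])
    fix s :: real
    have slice_int: "integrable M (\<lambda>X. q (s, X) * m X)" if q: "continuous_on UNIV q" "\<And>x. \<bar>q x\<bar> \<le> B" and m: "integrable M m"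
      for q :: "real \<times> (real ^ 'm) \<Rightarrow> real" and B m
    proof (rule Bochner_Integration.integrable_bound[OF integrable_mult_right[OF m, of B]])
      have "continuous_on UNIV (\<lambda>X. q (s, X))"
        by (rule continuous_on_compose2[OF q(1)]) (auto intro: continuous_intros)
      then show "(\<lambda>X. q (s, X) * m X) \<in> borel_measurable M"
        by (intro borel_measurable_times measurable_continuous_on_lebesgue_on borel_measurable_integrable[OF m])
      have "\<bar>q (s, X)\<bar> * \<bar>m X\<bar> \<le> \<bar>B\<bar> * \<bar>m X\<bar>" for X
        using q(2)[of "(s, X)"] by (intro mult_right_mono) auto
      then show "AE X in M. norm (q (s, X) * m X) \<le> norm (B * m X)" by (simp add: abs_mult)
    qed
    note ii = slice_int[OF cfi fib integrable_vinv_L(1)[OF \<epsilon>]] and i0 = slice_int[OF cf0 f0b integrable_vinv_L(2)[OF \<epsilon>]]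
    let ?us = "\<lambda>X. u (s, X)"
    have "(\<Sum>i\<in>UNIV. LINT X|M. ?fi i (s, X) * ?mi i X) + (LINT X|M. ?f0 (s, X) * ?m0 X)
       = (LINT X|M. (\<Sum>i\<in>UNIV. ?fi i (s, X) * ?mi i X) + ?f0 (s, X) * ?m0 X)"
      by (subst Bochner_Integration.integral_add[OF Bochner_Integration.integrable_sum[OF ii] i0])
        (subst Bochner_Integration.integral_sum[OF ii], rule refl)
    also have "\<dots> = (LINT X|M. L X (0, (vinv \<epsilon> X * abs_powr' p (?us X)) *\<^sub>R grad ?us X + (\<bar>?us X\<bar> powr p * vinv' \<epsilon> X) *\<^sub>R g X))"
    proof (rule integral_cong_AE)
      show "AE X in M. (\<Sum>i\<in>UNIV. ?fi i (s, X) * ?mi i X) + ?f0 (s, X) * ?m0 X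
         = L X (0, (vinv \<epsilon> X * abs_powr' p (?us X)) *\<^sub>R grad ?us X + (\<bar>?us X\<bar> powr p * vinv' \<epsilon> X) *\<^sub>R g X)"
        using AE_good
      proof eventually_elim
        case (elim X)
        show ?case unfolding slice_test(2)[OF u] by (rule dec[OF elim, symmetric])
      qed
      show "(\<lambda>X. (\<Sum>i\<in>UNIV. ?fi i (s, X) * ?mi i X) + ?f0 (s, X) * ?m0 X) \<in> borel_measurable M"
        by (intro borel_measurable_integrable Bochner_Integration.integrable_add Bochner_Integration.integrable_sum ii i0)
      have ms: "?us \<in> borel_measurable M" "grad ?us \<in> borel_measurable M"
        by (intro measurable_smooth test_smooth[OF slice_test(1)[OF u]])+
      show "(\<lambda>X. L X (0, (vinv \<epsilon> X * abs_powr' p (?us X)) *\<^sub>R grad ?us X + (\<bar>?us X\<bar> powr p * vinv' \<epsilon> X) *\<^sub>R g X)) \<in> borel_measurable M"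
        by (intro measurable_L measurable_zero_Pair measurable_M_arith borel_measurable_times measurable_vinv ms g_meas
          borel_measurable_continuous_on[OF continuous_abs_powr'[OF p] ms(1)]
          borel_measurable_continuous_on[OF continuous_abs_powr[of p] ms(1)]) (use p in auto)
    qed
    also have "\<dots> = \<mu> * (LINT X|M. w0 X * (\<bar>?us X\<bar> powr p * vinv \<epsilon> X))"
      using EL_vinv[OF slice_test(1)[OF u] \<epsilon>] by (simp add: EL_def)
    also have "(LINT X|M. w0 X * (\<bar>?us X\<bar> powr p * vinv \<epsilon> X)) = (LINT X|M. ?f0 (s, X) * (w0 X * vinv \<epsilon> X))"
      by (intro Bochner_Integration.integral_cong) auto
    finally have eq: "(\<Sum>i\<in>UNIV. LINT X|M. ?fi i (s, X) * ?mi i X) + (LINT X|M. ?f0 (s, X) * ?m0 X)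
      = \<mu> * (LINT X|M. ?f0 (s, X) * (w0 X * vinv \<epsilon> X))" .
    show "(\<Sum>i\<in>UNIV. indicator {0<..} s * (LINT X|M. ?fi i (s, X) * ?mi i X))
      + indicator {0<..} s * (LINT X|M. ?f0 (s, X) * ?m0 X) = \<mu> * (indicator {0<..} s * (LINT X|M. ?f0 (s, X) * (w0 X * vinv \<epsilon> X)))"
      unfolding sum_distrib_left[symmetric] distrib_left[symmetric] eq by (rule mult.left_commute)
  qed
  also have "\<dots> = \<mu> * (LINT x|N. ?f0 x * (w0 (snd x) * vinv \<epsilon> (snd x)))"
    unfolding Fw(3) by (rule integral_mult_right_zero)
  finally show "(LINT x|N. ?k x) = \<mu> * (LINT x|N. \<bar>u x\<bar> powr p * (w0 (snd x) * vinv \<epsilon> (snd x)))" .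
qed

lemma L_1: "L X (1, 0) = E X powr ((p - 2) / 2) * (A12 X \<bullet> g X)"
  by (simp add: L_def B_sec)

text \<open>Clarkson's coefficient times the ellipticity bound for the defect in Picone's
  inequality.\<close>

definition \<kappa> :: real where "\<kappa> = 2 powr (1 - p) * lam powr (p / 2)"

lemma kappa_pos: "\<kappa> > 0"
  using constants by (simp add: \<kappa>_def)

text \<open>The flux in Picone's inequality is split into its axial part \<open>?T1\<close> and its
  part \<open>?T2\<close> along the section. The first integrates to minus the integral of |u(0,
  X)|^p against a multiple of A12 \<cdot> g, which is nonnegative by the sign condition; the second
  is evaluated by \<open>slice_term\<close>.\<close>

lemma cylinder_inequality_eps:
  assumes A: "AE X in M. A12 X \<bullet> g X \<le> 0" and u: "u \<in> test_functions (UNIV \<times> \<omega>)" and \<epsilon>: "\<epsilon> > 0"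
  shows "\<kappa> * (LINT x|N. \<bar>fst (grad u x)\<bar> powr p) + \<mu> * (LINT x|N. \<bar>u x\<bar> powr p * (w0 (snd x) * vinv \<epsilon> (snd x)))
     \<le> (LINT x|N. \<bar>B (snd x) (grad u x) (grad u x)\<bar> powr (p / 2))"
proof -
  let ?m = "\<lambda>X. vinv \<epsilon> X * L X (1, 0)"
  let ?T1 = "\<lambda>x. (0 * \<bar>u x\<bar> powr p + 1 * (abs_powr' p (u x) * fst (grad u x))) * ?m (snd x)"
  let ?T2 = "\<lambda>x. L (snd x) (0, (vinv \<epsilon> (snd x) * abs_powr' p (u x)) *\<^sub>R snd (grad u x) + (\<bar>u x\<bar> powr p * vinv' \<epsilon> (snd x)) *\<^sub>R g (snd x))"
  have d1: "((\<lambda>s. 1) has_real_derivative 0) (at s)" for s :: real by simp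
  note bt = boundary_term[OF u integrable_vinv_L(1)[OF \<epsilon>] d1 continuous_on_const, of 1 "(1, 0)"]
  have i1: "integrable N ?T1" by (rule bt(2)) simp_all
  have "(LINT x|N. ?T1 x) = - (LINT X|M. 1 * \<bar>u (0, X)\<bar> powr p * ?m X)" by (rule bt(1)) simp_all
  also have "\<dots> \<ge> 0"
  proof -
    have "(LINT X|M. - (1 * \<bar>u (0, X)\<bar> powr p * ?m X)) \<ge> 0"
    proof (rule integral_nonneg_AE)
      show "AE X in M. 0 \<le> - (1 * \<bar>u (0, X)\<bar> powr p * ?m X)"
        using A by eventually_elim (auto simp: L_1 vinv_def mult_nonneg_nonpos)
    qed
    then show ?thesis by simp
  qed
  finally have T1: "(LINT x|N. ?T1 x) \<ge> 0" .
  note st = slice_term[OF u \<epsilon>]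
  note ie = integrable_test_energy[OF u]
  have "(LINT x|N. ?T1 x + ?T2 x + \<kappa> * \<bar>fst (grad u x)\<bar> powr p) \<le> (LINT x|N. \<bar>B (snd x) (grad u x) (grad u x)\<bar> powr (p / 2))"
  proof (rule integral_mono_AE)
    show "AE x in N. ?T1 x + ?T2 x + \<kappa> * \<bar>fst (grad u x)\<bar> powr p \<le> \<bar>B (snd x) (grad u x) (grad u x)\<bar> powr (p / 2)"
      using AE_N[OF AE_good]
    proof eventually_elim
      case (elim x)
      let ?X = "snd x" and ?y = "grad u x"
      let ?\<delta> = "?y - (u x / (W ?X + \<epsilon>)) *\<^sub>R (0, g ?X)"
      have "(vinv \<epsilon> ?X * abs_powr' p (u x)) *\<^sub>R ?y + (\<bar>u x\<bar> powr p * vinv' \<epsilon> ?X) *\<^sub>R (0, g ?X)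
        = (vinv \<epsilon> ?X * abs_powr' p (u x) * fst ?y) *\<^sub>R (1, 0)
          + (0, (vinv \<epsilon> ?X * abs_powr' p (u x)) *\<^sub>R snd ?y + (\<bar>u x\<bar> powr p * vinv' \<epsilon> ?X) *\<^sub>R g ?X)"
        by (rule prod_eqI) simp_all
      then have "L ?X ((vinv \<epsilon> ?X * abs_powr' p (u x)) *\<^sub>R ?y + (\<bar>u x\<bar> powr p * vinv' \<epsilon> ?X) *\<^sub>R (0, g ?X)) = ?T1 x + ?T2 x"
        by (simp only: L_linear[OF elim]) simp
      \<comment> \<open>The first component of the defect is \<partial>_1 u itself, and ellipticity
        bounds the energy of the defect from below by its norm.\<close>
      moreover have "\<kappa> * \<bar>fst ?y\<bar> powr p \<le> 2 powr (1 - p) * \<bar>B ?X ?\<delta> ?\<delta>\<bar> powr (p / 2)"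
      proof -
        have "\<bar>fst ?y\<bar> powr p \<le> norm ?\<delta> powr p"
          using norm_fst_le'[of ?\<delta>] p by (intro powr_mono2) auto
        then have "lam powr (p / 2) * \<bar>fst ?y\<bar> powr p \<le> lam powr (p / 2) * norm ?\<delta> powr p"
          by (rule mult_left_mono) simp
        also have "\<dots> \<le> \<bar>B ?X ?\<delta> ?\<delta>\<bar> powr (p / 2)"
          using good_B_powr_ge[OF elim, of "p / 2" ?\<delta>] good_B_nonneg[OF elim, of ?\<delta>] p by simp
        finally show ?thesis unfolding \<kappa>_def mult.assoc by (rule mult_left_mono) simp
      qed
      ultimately show ?case using Picone_pointwise[OF elim \<epsilon>, of "u x" ?y] by linarith
    qed
  qed (intro Bochner_Integration.integrable_add integrable_mult_right i1 st(1) ie)+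
  moreover have "(LINT x|N. ?T1 x + ?T2 x + \<kappa> * \<bar>fst (grad u x)\<bar> powr p)
     = (LINT x|N. ?T1 x) + (LINT x|N. ?T2 x) + \<kappa> * (LINT x|N. \<bar>fst (grad u x)\<bar> powr p)"
    by (subst Bochner_Integration.integral_add[OF Bochner_Integration.integrable_add[OF i1 st(1)] integrable_mult_right[OF ie(2)]])
      (subst Bochner_Integration.integral_add[OF i1 st(1)], subst integral_mult_right_zero, rule refl)
  ultimately show ?thesis using T1 st(3) by linarith
qed

text \<open>The factor \<open>w0 * vinv\<close> is (W / (W + \<epsilon>))^(p-1): it is at most 1,
  which gives the majorant, and tends to 1 almost everywhere because W > 0.\<close>

lemma cylinder_inequality:
  assumes A: "AE X in M. A12 X \<bullet> g X \<le> 0" and u: "u \<in> test_functions (UNIV \<times> \<omega>)"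
  shows "\<kappa> * (LINT x|N. \<bar>fst (grad u x)\<bar> powr p) + \<mu> * (LINT x|N. \<bar>u x\<bar> powr p)
     \<le> (LINT x|N. \<bar>B (snd x) (grad u x) (grad u x)\<bar> powr (p / 2))"
proof -
  define \<epsilon> where "\<epsilon> n = 1 / real (Suc n)" for n
  have \<epsilon>: "\<epsilon> n > 0" for n by (simp add: \<epsilon>_def)
  have null: "\<epsilon> \<longlonglongrightarrow> 0"
    unfolding \<epsilon>_def using LIMSEQ_inverse_real_of_nat by (simp add: inverse_eq_divide)
  note ie = integrable_test_energy[OF u]
  have vid: "w0 X * vinv e X = (W X / (W X + e)) powr (p - 1)" if "good X" "W X > 0" "e > 0" for X e
  proof -
    have "w0 X = W X powr (p - 1)"
      using w0_abs[of X] that(2) by (simp add: w0_def abs_mult)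
    moreover have "vinv e X = inverse ((W X + e) powr (p - 1))"
      unfolding vinv_def using powr_minus[of "W X + e" "p - 1"] by simp
    ultimately show ?thesis using powr_divide[of "W X" "W X + e" "p - 1"] by (simp add: field_simps)
  qed
  have "(\<lambda>n. LINT x|N. \<bar>u x\<bar> powr p * (w0 (snd x) * vinv (\<epsilon> n) (snd x))) \<longlonglongrightarrow> (LINT x|N. \<bar>u x\<bar> powr p)"
  proof (rule integral_dominated_convergence[OF _ _ ie(3)])
    show "(\<lambda>x. \<bar>u x\<bar> powr p) \<in> borel_measurable N" by (rule borel_measurable_integrable[OF ie(3)])
    show "(\<lambda>x. \<bar>u x\<bar> powr p * (w0 (snd x) * vinv (\<epsilon> n) (snd x))) \<in> borel_measurable N" for n
      by (rule borel_measurable_integrable[OF slice_term(2)[OF u \<epsilon>]])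
    show "AE x in N. (\<lambda>n. \<bar>u x\<bar> powr p * (w0 (snd x) * vinv (\<epsilon> n) (snd x))) \<longlonglongrightarrow> \<bar>u x\<bar> powr p"
      using AE_N[OF AE_good] AE_N[OF W_pos]
    proof eventually_elim
      case (elim x)
      have "(\<lambda>n. (W (snd x) / (W (snd x) + \<epsilon> n)) powr (p - 1)) \<longlonglongrightarrow> (W (snd x) / (W (snd x) + 0)) powr (p - 1)"
        using elim(2) by (intro tendsto_powr tendsto_divide tendsto_add tendsto_const null) auto
      then have "(\<lambda>n. w0 (snd x) * vinv (\<epsilon> n) (snd x)) \<longlonglongrightarrow> 1"
        using elim(2) vid[OF elim \<epsilon>] by simp
      from tendsto_mult[OF tendsto_const this, of "\<bar>u x\<bar> powr p"] show ?case by simp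
    qed
    show "AE x in N. norm (\<bar>u x\<bar> powr p * (w0 (snd x) * vinv (\<epsilon> n) (snd x))) \<le> \<bar>u x\<bar> powr p" for n
      using AE_N[OF AE_good] AE_N[OF W_pos]
    proof eventually_elim
      case (elim x)
      have "W (snd x) / (W (snd x) + \<epsilon> n) \<le> 1" using elim(2) \<epsilon>[of n] by simp
      then have "(W (snd x) / (W (snd x) + \<epsilon> n)) powr (p - 1) \<le> 1 powr (p - 1)"
        using elim(2) \<epsilon>[of n] p by (intro powr_mono2) auto
      then have "\<bar>u x\<bar> powr p * (W (snd x) / (W (snd x) + \<epsilon> n)) powr (p - 1) \<le> \<bar>u x\<bar> powr p * 1"
        by (intro mult_left_mono) auto
      then show ?case unfolding vid[OF elim \<epsilon>] by simp
    qed
  qed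
  then have "(\<lambda>n. \<kappa> * (LINT x|N. \<bar>fst (grad u x)\<bar> powr p) + \<mu> * (LINT x|N. \<bar>u x\<bar> powr p * (w0 (snd x) * vinv (\<epsilon> n) (snd x))))
     \<longlonglongrightarrow> \<kappa> * (LINT x|N. \<bar>fst (grad u x)\<bar> powr p) + \<mu> * (LINT x|N. \<bar>u x\<bar> powr p)"
    by (intro tendsto_add tendsto_mult tendsto_const)
  then show ?thesis
    by (rule LIMSEQ_le_const2) (use cylinder_inequality_eps[OF A u \<epsilon>] in blast)
qed

section \<open>Passage to the limit on the half-cylinder and the case of equality\<close>

lemma limits_N:
  fixes v :: "nat \<Rightarrow> real \<times> (real ^ 'm) \<Rightarrow> real"
  assumes v: "\<And>k. v k \<in> test_functions (UNIV \<times> \<omega>)"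
    and \<Phi>: "\<Phi> \<in> borel_measurable N" "integrable N (\<lambda>x. \<Phi> x powr p)"
    and m: "u \<in> borel_measurable N" "G \<in> borel_measurable N"
    and lim: "AE x in N. (\<lambda>k. v k x) \<longlonglongrightarrow> u x" "AE x in N. (\<lambda>k. grad (v k) x) \<longlonglongrightarrow> G x"
    and b: "AE x in N. \<forall>k. \<bar>v k x\<bar> \<le> \<Phi> x \<and> norm (grad (v k) x) \<le> \<Phi> x"
  shows "(\<lambda>k. LINT x|N. \<bar>B (snd x) (grad (v k) x) (grad (v k) x)\<bar> powr (p / 2))
      \<longlonglongrightarrow> (LINT x|N. \<bar>B (snd x) (G x) (G x)\<bar> powr (p / 2))"
    and "(\<lambda>k. LINT x|N. \<bar>v k x\<bar> powr p) \<longlonglongrightarrow> (LINT x|N. \<bar>u x\<bar> powr p)"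
    and "(\<lambda>k. LINT x|N. \<bar>fst (grad (v k) x)\<bar> powr p) \<longlonglongrightarrow> (LINT x|N. \<bar>fst (G x)\<bar> powr p)"
    and "\<And>a a' c. continuous_on UNIV a \<Longrightarrow> continuous_on UNIV a' \<Longrightarrow> (\<And>s. \<bar>a s\<bar> \<le> c) \<Longrightarrow> (\<And>s. \<bar>a' s\<bar> \<le> c) \<Longrightarrow>
      (\<lambda>k. LINT x|N. a' (fst x) * \<bar>v k x\<bar> powr p + a (fst x) * (abs_powr' p (v k x) * fst (grad (v k) x)))
        \<longlonglongrightarrow> (LINT x|N. a' (fst x) * \<bar>u x\<bar> powr p + a (fst x) * (abs_powr' p (u x) * fst (G x)))"
proof -
  have sm: "smooth (v k)" for k by (rule test_smooth[OF v])
  note mv = measurable_N_smooth[OF sm]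
  have mB: "(\<lambda>x. \<bar>B (snd x) (h x) (h x)\<bar> powr (p / 2)) \<in> borel_measurable N" if "h \<in> borel_measurable N" for h
    using measurable_B_N[OF that that] by measurable
  have f1: "\<bar>fst (grad (v k) x)\<bar> \<le> norm (grad (v k) x)" for k x
    using norm_fst_le'[of "grad (v k) x"] by simp
  show "(\<lambda>k. LINT x|N. \<bar>B (snd x) (grad (v k) x) (grad (v k) x)\<bar> powr (p / 2))
      \<longlonglongrightarrow> (LINT x|N. \<bar>B (snd x) (G x) (G x)\<bar> powr (p / 2))"
  proof (rule integral_dominated_convergence[OF _ _ integrable_mult_right[OF \<Phi>(2), of "C powr (p / 2)"]])
    show "AE x in N. (\<lambda>k. \<bar>B (snd x) (grad (v k) x) (grad (v k) x)\<bar> powr (p / 2)) \<longlonglongrightarrow> \<bar>B (snd x) (G x) (G x)\<bar> powr (p / 2)"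
      using lim(2) by eventually_elim (use p in \<open>intro tendsto_powr' tendsto_rabs tendsto_B tendsto_const; auto\<close>)
    show "AE x in N. norm (\<bar>B (snd x) (grad (v k) x) (grad (v k) x)\<bar> powr (p / 2)) \<le> C powr (p / 2) * \<Phi> x powr p" for k
      using b AE_N[OF AE_good]
    proof eventually_elim
      case (elim x)
      show ?case unfolding real_norm_def by (rule good_energy_le[OF elim(2)]) (use elim(1) in blast)
    qed
  qed (intro mB mv m)+
  show "(\<lambda>k. LINT x|N. \<bar>v k x\<bar> powr p) \<longlonglongrightarrow> (LINT x|N. \<bar>u x\<bar> powr p)"
  proof (rule integral_dominated_convergence[OF _ _ \<Phi>(2)])
    show "AE x in N. (\<lambda>k. \<bar>v k x\<bar> powr p) \<longlonglongrightarrow> \<bar>u x\<bar> powr p"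
      using lim(1) by eventually_elim (use p in \<open>intro tendsto_powr' tendsto_rabs tendsto_const; auto\<close>)
    show "AE x in N. norm (\<bar>v k x\<bar> powr p) \<le> \<Phi> x powr p" for k
      using b by eventually_elim (use p in \<open>auto intro: powr_mono2\<close>)
    show "(\<lambda>x. \<bar>u x\<bar> powr p) \<in> borel_measurable N" using m by measurable
    show "(\<lambda>x. \<bar>v k x\<bar> powr p) \<in> borel_measurable N" for k using mv(1)[of k] by measurable
  qed
  show "(\<lambda>k. LINT x|N. \<bar>fst (grad (v k) x)\<bar> powr p) \<longlonglongrightarrow> (LINT x|N. \<bar>fst (G x)\<bar> powr p)"
  proof (rule integral_dominated_convergence[OF _ _ \<Phi>(2)])
    show "AE x in N. (\<lambda>k. \<bar>fst (grad (v k) x)\<bar> powr p) \<longlonglongrightarrow> \<bar>fst (G x)\<bar> powr p"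
      using lim(2) by eventually_elim (use p in \<open>intro tendsto_powr' tendsto_rabs tendsto_fst tendsto_const; auto\<close>)
    show "AE x in N. norm (\<bar>fst (grad (v k) x)\<bar> powr p) \<le> \<Phi> x powr p" for k
      using b
    proof eventually_elim
      case (elim x)
      then have "\<bar>fst (grad (v k) x)\<bar> \<le> \<Phi> x" using f1[of k x] by (meson order_trans)
      then show ?case using p by (simp add: powr_mono2)
    qed
    show "(\<lambda>x. \<bar>fst (G x)\<bar> powr p) \<in> borel_measurable N" using measurable_fst_snd(1)[OF m(2)] by measurable
    show "(\<lambda>x. \<bar>fst (grad (v k) x)\<bar> powr p) \<in> borel_measurable N" for k
      using measurable_fst_snd(1)[OF mv(2), of k] by measurable
  qed
  fix a a' :: "real \<Rightarrow> real" and c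
  assume ca: "continuous_on UNIV a" "continuous_on UNIV a'" and ac: "\<And>s. \<bar>a s\<bar> \<le> c" "\<And>s. \<bar>a' s\<bar> \<le> c"
  have c0: "c \<ge> 0" using ac(1)[of 0] by linarith
  have ma: "(\<lambda>x. q (fst x)) \<in> borel_measurable N" if "continuous_on UNIV q" for q :: "real \<Rightarrow> real"
    by (intro measurable_continuous_on_lebesgue_on continuous_on_compose2[OF that] continuous_on_fst continuous_on_id) simp
  have mq: "(\<lambda>x. a' (fst x) * \<bar>q x\<bar> powr p + a (fst x) * (abs_powr' p (q x) * fst (h x))) \<in> borel_measurable N"
    if "q \<in> borel_measurable N" "h \<in> borel_measurable N" for q and h :: "real \<times> (real ^ 'm) \<Rightarrow> real \<times> (real ^ 'm)"
  proof (intro borel_measurable_add borel_measurable_times ma ca)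
    show "(\<lambda>x. \<bar>q x\<bar> powr p) \<in> borel_measurable N" using that(1) by measurable
    show "(\<lambda>x. abs_powr' p (q x)) \<in> borel_measurable N"
      by (rule borel_measurable_continuous_on[OF continuous_abs_powr'[OF p] that(1)])
    show "(\<lambda>x. fst (h x)) \<in> borel_measurable N" by (rule measurable_fst_snd(1)[OF that(2)])
  qed
  show "(\<lambda>k. LINT x|N. a' (fst x) * \<bar>v k x\<bar> powr p + a (fst x) * (abs_powr' p (v k x) * fst (grad (v k) x)))
        \<longlonglongrightarrow> (LINT x|N. a' (fst x) * \<bar>u x\<bar> powr p + a (fst x) * (abs_powr' p (u x) * fst (G x)))"
  proof (rule integral_dominated_convergence[OF _ _ integrable_mult_right[OF \<Phi>(2), of "c + c * p"]])
    show "AE x in N. (\<lambda>k. a' (fst x) * \<bar>v k x\<bar> powr p + a (fst x) * (abs_powr' p (v k x) * fst (grad (v k) x)))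
        \<longlonglongrightarrow> a' (fst x) * \<bar>u x\<bar> powr p + a (fst x) * (abs_powr' p (u x) * fst (G x))"
      using lim
    proof eventually_elim
      case (elim x)
      have "isCont (abs_powr' p) (u x)" using continuous_abs_powr'[OF p] by (simp add: continuous_on_eq_continuous_at)
      from isCont_tendsto_compose[OF this elim(1)]
      have 1: "(\<lambda>k. abs_powr' p (v k x)) \<longlonglongrightarrow> abs_powr' p (u x)" .
      have 2: "(\<lambda>k. \<bar>v k x\<bar> powr p) \<longlonglongrightarrow> \<bar>u x\<bar> powr p"
        using p by (intro tendsto_powr' tendsto_rabs tendsto_const elim(1)) auto
      show ?case by (intro tendsto_add tendsto_mult tendsto_const tendsto_fst 1 2 elim(2))
    qed
    show "AE x in N. norm (a' (fst x) * \<bar>v k x\<bar> powr p + a (fst x) * (abs_powr' p (v k x) * fst (grad (v k) x))) \<le> (c + c * p) * \<Phi> x powr p" for k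
      using b
    proof eventually_elim
      case (elim x)
      then have vb: "\<bar>v k x\<bar> \<le> \<Phi> x" "\<bar>fst (grad (v k) x)\<bar> \<le> \<Phi> x" using f1[of k x] by (meson order_trans)+
      have "\<bar>a' (fst x)\<bar> * (\<bar>v k x\<bar> powr p) \<le> c * \<Phi> x powr p"
        using ac c0 vb p by (intro mult_mono powr_mono2) auto
      moreover have "\<bar>a (fst x)\<bar> * (\<bar>abs_powr' p (v k x)\<bar> * \<bar>fst (grad (v k) x)\<bar>) \<le> c * (p * \<Phi> x powr p)"
      proof (rule mult_mono[OF ac(1) _ c0])
        have "\<bar>v k x\<bar> powr (p - 1) * \<bar>fst (grad (v k) x)\<bar> \<le> \<Phi> x powr p"
          by (rule powr_mult_le) (use vb in auto)
        then show "\<bar>abs_powr' p (v k x)\<bar> * \<bar>fst (grad (v k) x)\<bar> \<le> p * \<Phi> x powr p"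
          unfolding abs_abs_powr'[OF p] mult.assoc using p by (intro mult_left_mono) auto
      qed simp
      ultimately show ?case
        using abs_triangle_ineq[of "a' (fst x) * \<bar>v k x\<bar> powr p" "a (fst x) * (abs_powr' p (v k x) * fst (grad (v k) x))"]
        by (simp add: abs_mult algebra_simps)
    qed
  qed (intro mq mv m)+
qed

text \<open>The inequality survives the limit together with its \<kappa>-term. Equality therefore
  forces the axial derivative to vanish, and a p-integrable function on an infinite half-cylinder
  that does not depend on x_1 must be zero.\<close>

lemma V_inequality:
  fixes v :: "nat \<Rightarrow> real \<times> (real ^ 'm) \<Rightarrow> real"
  assumes A: "AE X in M. A12 X \<bullet> g X \<le> 0"
    and v: "\<And>k. v k \<in> test_functions (UNIV \<times> \<omega>)"
    and \<Phi>: "\<Phi> \<in> borel_measurable N" "integrable N (\<lambda>x. \<Phi> x powr p)"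
    and m: "u \<in> borel_measurable N" "G \<in> borel_measurable N"
    and lim: "AE x in N. (\<lambda>k. v k x) \<longlonglongrightarrow> u x" "AE x in N. (\<lambda>k. grad (v k) x) \<longlonglongrightarrow> G x"
    and b: "AE x in N. \<forall>k. \<bar>v k x\<bar> \<le> \<Phi> x \<and> norm (grad (v k) x) \<le> \<Phi> x"
    and uG: "AE x in N. \<bar>u x\<bar> \<le> \<Phi> x \<and> norm (G x) \<le> \<Phi> x"
  shows "\<mu> * (LINT x|N. \<bar>u x\<bar> powr p) \<le> (LINT x|N. \<bar>B (snd x) (G x) (G x)\<bar> powr (p / 2))"
    and "(LINT x|N. \<bar>B (snd x) (G x) (G x)\<bar> powr (p / 2)) = \<mu> * (LINT x|N. \<bar>u x\<bar> powr p) \<Longrightarrow> AE x in N. u x = 0"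
proof -
  note lims = limits_N[OF v \<Phi> m lim b]
  have main: "\<kappa> * (LINT x|N. \<bar>fst (G x)\<bar> powr p) + \<mu> * (LINT x|N. \<bar>u x\<bar> powr p)
     \<le> (LINT x|N. \<bar>B (snd x) (G x) (G x)\<bar> powr (p / 2))"
    by (rule LIMSEQ_le[OF tendsto_add[OF tendsto_mult[OF tendsto_const lims(3)] tendsto_mult[OF tendsto_const lims(2)]] lims(1)])
      (use cylinder_inequality[OF A v] in blast)
  have nn: "0 \<le> (LINT x|N. \<bar>fst (G x)\<bar> powr p)" by (rule integral_nonneg_AE) simp
  then show "\<mu> * (LINT x|N. \<bar>u x\<bar> powr p) \<le> (LINT x|N. \<bar>B (snd x) (G x) (G x)\<bar> powr (p / 2))"
    using main mult_nonneg_nonneg[OF less_imp_le[OF kappa_pos] nn] by linarith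
  assume eq: "(LINT x|N. \<bar>B (snd x) (G x) (G x)\<bar> powr (p / 2)) = \<mu> * (LINT x|N. \<bar>u x\<bar> powr p)"
  have "\<kappa> * (LINT x|N. \<bar>fst (G x)\<bar> powr p) \<le> 0" using main eq by linarith
  then have 0: "(LINT x|N. \<bar>fst (G x)\<bar> powr p) = 0" using nn kappa_pos by (simp add: mult_le_0_iff)
  have mf: "(\<lambda>x. \<bar>fst (G x)\<bar> powr p) \<in> borel_measurable N" using measurable_fst_snd(1)[OF m(2)] by measurable
  have if0: "integrable N (\<lambda>x. \<bar>fst (G x)\<bar> powr p)"
  proof (rule Bochner_Integration.integrable_bound[OF \<Phi>(2) mf])
    show "AE x in N. norm (\<bar>fst (G x)\<bar> powr p) \<le> norm (\<Phi> x powr p)"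
      using uG
    proof eventually_elim
      case (elim x)
      then have "\<bar>fst (G x)\<bar> \<le> \<Phi> x" using norm_fst_le'[of "G x"] by simp
      then show ?case using p by (simp add: powr_mono2)
    qed
  qed
  have G0: "AE x in N. fst (G x) = 0"
    using integral_nonneg_eq_0_iff_AE[OF if0] 0 by simp
  have mu: "(\<lambda>x. \<bar>u x\<bar> powr p) \<in> borel_measurable N" using m by measurable
  have iu: "integrable N (\<lambda>x. \<bar>u x\<bar> powr p)"
  proof (rule Bochner_Integration.integrable_bound[OF \<Phi>(2) mu])
    show "AE x in N. norm (\<bar>u x\<bar> powr p) \<le> norm (\<Phi> x powr p)"
      using uG by eventually_elim (use p in \<open>auto intro: powr_mono2\<close>)
  qed
  \<comment> \<open>The weight arctan is bounded, vanishes at 0 and has a positive derivative. The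
    boundary term is thus zero for every approximant, and once \<partial>_1 u = 0 the identity in
    the limit says that the integral of arctan' |u|^p is zero.\<close>
  let ?a' = "\<lambda>s::real. inverse (1 + s\<^sup>2)"
  have da: "(arctan has_real_derivative ?a' s) (at s)" for s by (rule DERIV_arctan)
  have ca': "continuous_on UNIV ?a'" by (intro continuous_intros) (metis add_pos_nonneg less_numeral_extra(3) zero_le_power2 zero_less_one)
  have ab: "\<bar>arctan s\<bar> \<le> 2" "\<bar>?a' s\<bar> \<le> 2" for s
  proof -
    show "\<bar>arctan s\<bar> \<le> 2" using arctan_bounded[of s] pi_less_4 by (simp add: abs_le_iff)
    have "inverse (1 + s\<^sup>2) \<le> 1" by (rule inverse_le_1_iff[THEN iffD2]) simp
    moreover have "inverse (1 + s\<^sup>2) \<ge> 0" by simp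
    ultimately show "\<bar>?a' s\<bar> \<le> 2" by linarith
  qed
  have "(LINT x|N. ?a' (fst x) * \<bar>v k x\<bar> powr p + arctan (fst x) * (abs_powr' p (v k x) * fst (grad (v k) x))) = 0" for k
    using boundary_term(1)[OF v integrable_const_M[of 1] da ca' ab, of k] by simp
  moreover have "(\<lambda>k. LINT x|N. ?a' (fst x) * \<bar>v k x\<bar> powr p + arctan (fst x) * (abs_powr' p (v k x) * fst (grad (v k) x)))
     \<longlonglongrightarrow> (LINT x|N. ?a' (fst x) * \<bar>u x\<bar> powr p + arctan (fst x) * (abs_powr' p (u x) * fst (G x)))"
    by (rule lims(4)[OF DERIV_imp_continuous_UNIV[OF da] ca' ab])
  ultimately have z: "(LINT x|N. ?a' (fst x) * \<bar>u x\<bar> powr p + arctan (fst x) * (abs_powr' p (u x) * fst (G x))) = 0"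
    by (simp add: LIMSEQ_const_iff)
  have mfst: "(\<lambda>x. q (fst x)) \<in> borel_measurable N" if "continuous_on UNIV q" for q :: "real \<Rightarrow> real"
    by (intro measurable_continuous_on_lebesgue_on continuous_on_compose2[OF that] continuous_on_fst continuous_on_id) simp
  have ma: "(\<lambda>x. ?a' (fst x) * \<bar>u x\<bar> powr p) \<in> borel_measurable N"
    by (intro borel_measurable_times mu mfst[OF ca'])
  have ia: "integrable N (\<lambda>x. ?a' (fst x) * \<bar>u x\<bar> powr p)"
  proof (rule Bochner_Integration.integrable_bound[OF integrable_mult_right[OF iu, of 2] ma])
    have "norm (?a' (fst x) * \<bar>u x\<bar> powr p) \<le> norm (2 * \<bar>u x\<bar> powr p)" for x
      unfolding real_norm_def abs_mult using ab(2)[of "fst x"] by (intro mult_right_mono) auto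
    then show "AE x in N. norm (?a' (fst x) * \<bar>u x\<bar> powr p) \<le> norm (2 * \<bar>u x\<bar> powr p)" by simp
  qed
  have "(LINT x|N. ?a' (fst x) * \<bar>u x\<bar> powr p) = 0"
  proof -
    have "(LINT x|N. ?a' (fst x) * \<bar>u x\<bar> powr p) = (LINT x|N. ?a' (fst x) * \<bar>u x\<bar> powr p + arctan (fst x) * (abs_powr' p (u x) * fst (G x)))"
    proof (rule integral_cong_AE[OF ma])
      show "(\<lambda>x. ?a' (fst x) * \<bar>u x\<bar> powr p + arctan (fst x) * (abs_powr' p (u x) * fst (G x))) \<in> borel_measurable N"
        by (intro borel_measurable_add ma borel_measurable_times mfst[OF DERIV_imp_continuous_UNIV[OF da]]
            borel_measurable_continuous_on[OF continuous_abs_powr'[OF p] m(1)] measurable_fst_snd(1)[OF m(2)])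
      show "AE x in N. ?a' (fst x) * \<bar>u x\<bar> powr p = ?a' (fst x) * \<bar>u x\<bar> powr p + arctan (fst x) * (abs_powr' p (u x) * fst (G x))"
        using G0 by eventually_elim simp
    qed
    then show ?thesis using z by simp
  qed
  then have "AE x in N. ?a' (fst x) * \<bar>u x\<bar> powr p = 0"
    using integral_nonneg_eq_0_iff_AE[OF ia] by simp
  then show "AE x in N. u x = 0"
  proof eventually_elim
    case (elim x)
    have "1 + (fst x)\<^sup>2 \<noteq> 0" by (metis add_pos_nonneg less_numeral_extra(3) zero_le_power2 zero_less_one)
    then show ?case using elim by simp
  qed
qed

end

section \<open>Slowly varying trial functions\<close>

lemma smooth_fst:
  fixes a :: "real \<Rightarrow> real"
  assumes "smooth a" shows "smooth (\<lambda>x :: real \<times> 'b::euclidean_space. a (fst x))"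
  using smooth_affine[OF bounded_linear_fst assms, of 0] by simp

lemma smooth_snd:
  assumes "smooth f" shows "smooth (\<lambda>x :: real \<times> 'b::euclidean_space. f (snd x))"
  using smooth_affine[OF bounded_linear_snd assms, of 0] by simp

lemma smooth_real_deriv:
  fixes a :: "real \<Rightarrow> real"
  assumes "smooth a" shows "(a has_real_derivative grad a s) (at s)"
  using smooth_grad[OF assms, of s] by (simp add: has_field_derivative_def)

lemma product_derivative:
  fixes a :: "real \<Rightarrow> real" and f :: "'b::euclidean_space \<Rightarrow> real"
  assumes "smooth a" "smooth f"
  shows "((\<lambda>x. a (fst x) * f (snd x)) has_derivative
     (\<lambda>h. (grad a (fst x) * f (snd x), a (fst x) *\<^sub>R grad f (snd x)) \<bullet> h)) (at x)"
proof -
  have 1: "((\<lambda>x :: real \<times> 'b. a (fst x)) has_derivative (\<lambda>h. grad a (fst x) \<bullet> fst h)) (at x)"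
    by (rule has_derivative_compose[OF has_derivative_fst[OF has_derivative_ident] smooth_grad[OF assms(1)]])
  have 2: "((\<lambda>x :: real \<times> 'b. f (snd x)) has_derivative (\<lambda>h. grad f (snd x) \<bullet> snd h)) (at x)"
    by (rule has_derivative_compose[OF has_derivative_snd[OF has_derivative_ident] smooth_grad[OF assms(2)]])
  from has_derivative_mult[OF 1 2] show ?thesis
    by (rule has_derivative_eq_rhs) (simp add: fun_eq_iff inner_prod_def algebra_simps)
qed

context cylinder
begin

lemma product_test:
  fixes a :: "real \<Rightarrow> real" and f :: "real ^ 'm \<Rightarrow> real"
  assumes a: "smooth a" "\<And>s. \<bar>s\<bar> \<ge> R \<Longrightarrow> a s = 0" and f: "f \<in> test_functions \<omega>"
  shows "(\<lambda>x. a (fst x) * f (snd x)) \<in> test_functions (UNIV \<times> \<omega>)"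
proof -
  obtain K where K: "smooth f" "compact K" "K \<subseteq> \<omega>" "\<And>x. x \<notin> K \<Longrightarrow> f x = 0"
    by (rule test_functionsE[OF f]) blast
  show ?thesis
  proof (rule test_functionsI)
    show "smooth (\<lambda>x. a (fst x) * f (snd x))" by (intro smooth_mult smooth_fst smooth_snd a K)
    show "compact ({-R..R} \<times> K)" by (intro compact_Times K) auto
    show "{-R..R} \<times> K \<subseteq> UNIV \<times> \<omega>" using K(3) by auto
    show "a (fst x) * f (snd x) = 0" if "x \<notin> {-R..R} \<times> K" for x
    proof (cases "snd x \<in> K")
      case True
      then have "\<bar>fst x\<bar> \<ge> R" using that by (cases x) auto
      then show ?thesis using a(2) by simp
    next
      case False
      then show ?thesis using K(4) by simp
    qed
  qed
qed

lemma integral_product: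
  fixes a :: "real \<Rightarrow> real"
  assumes a: "a \<in> borel_measurable borel" "\<And>s. \<bar>a s\<bar> \<le> b" "\<forall>s. \<bar>s\<bar> > R \<longrightarrow> a s = 0" and m: "integrable M m"
  shows "integrable N (\<lambda>x. a (fst x) * m (snd x))"
    and "(LINT x|N. a (fst x) * m (snd x)) = (LINT s|lborel. indicator {0<..} s * a s) * (LINT X|M. m X)"
proof -
  have am: "(\<lambda>x :: real \<times> (real ^ 'm). a (fst x)) \<in> borel_measurable borel"
    by (rule measurable_compose[OF borel_measurable_continuous_onI[OF continuous_on_fst[OF continuous_on_id]] a(1)])
  have aR: "\<forall>x :: real \<times> (real ^ 'm). \<bar>fst x\<bar> > R \<longrightarrow> a (fst x) = 0" using a(3) by blast
  note Fub = Fubini_product[OF am a(2) aR m]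
  show "integrable N (\<lambda>x. a (fst x) * m (snd x))" by (rule Fub(1))
  have "(LINT x|N. a (fst x) * m (snd x)) = (LINT X|M. (LINT s|lborel. indicator {0<..} s * a (fst (s, X))) * m X)"
    by (rule Fub(2))
  then show "(LINT x|N. a (fst x) * m (snd x)) = (LINT s|lborel. indicator {0<..} s * a s) * (LINT X|M. m X)"
    by simp
qed

text \<open>The functions are \<open>h(x\<^sub>1/T) w\<^sub>k + t h(x\<^sub>1) \<phi>\<close> with a cutoff \<open>h\<close>: the terms of order \<open>T\<close> cancel
  because \<open>W\<close> is a minimizer, the terms in \<open>\<nabla>\<phi>\<close> and \<open>\<phi>\<close> by the Euler--Lagrange equation, and to first
  order only the boundary \<open>x\<^sub>1 = 0\<close> contributes.\<close>

lemma trial_functions: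
  assumes \<phi>: "\<phi> \<in> test_functions \<omega>"
  obtains K where "\<And>t T. \<bar>t\<bar> \<le> 1 \<Longrightarrow> T \<ge> 2 \<Longrightarrow>
    \<exists>v n d. (\<forall>k. v k \<in> test_functions (UNIV \<times> \<omega>)) \<and>
      (\<lambda>k. LINT x|N. \<bar>B (snd x) (grad (v k) x) (grad (v k) x)\<bar> powr (p / 2)) \<longlonglongrightarrow> n \<and>
      (\<lambda>k. LINT x|N. \<bar>v k x\<bar> powr p) \<longlonglongrightarrow> d \<and>
      n - \<mu> * d \<le> - (LINT X|M. W X * L X (1, 0)) - t * p * (LINT X|M. \<phi> X * L X (1, 0)) + K * (t\<^sup>2 + 1 / T) \<and>
      (t = 0 \<longrightarrow> d \<ge> T)"
proof -
  obtain h :: "real \<Rightarrow> real" where h: "smooth h" "\<And>s. 0 \<le> h s" "\<And>s. h s \<le> 1"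
    "\<And>s. \<bar>s\<bar> \<le> 1 \<Longrightarrow> h s = 1" "\<And>s. \<bar>s\<bar> \<ge> 2 \<Longrightarrow> h s = 0"
    by (rule cutoff_exists) blast
  have ht: "h \<in> test_functions UNIV"
    by (rule test_functionsI[OF h(1), of "{-2..2}"]) (use h(5) in auto)
  obtain H where H: "H \<ge> 0" "\<And>s. norm (grad h s) \<le> H"
    by (rule test_bounded[OF ht]) blast
  have h'0: "grad h s = 0" if "\<bar>s\<bar> > 2" for s
  proof (rule grad_eqI)
    have "((\<lambda>s. 0) has_derivative (\<lambda>h. 0 \<bullet> h)) (at s)" by simp
    moreover have "open {s :: real. \<bar>s\<bar> > 2}" by (intro open_Collect_less continuous_intros)
    moreover have "s \<in> {s. \<bar>s\<bar> > 2}" using that by simp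
    ultimately show "(h has_derivative (\<lambda>h. 0 \<bullet> h)) (at s)"
      by (rule has_derivative_transform_within_open) (use h(5) in auto)
  qed
  have dh: "(h has_real_derivative grad h s) (at s)" for s by (rule smooth_real_deriv[OF h(1)])
  have cgh: "continuous_on UNIV (grad h)" by (rule continuous_on_grad[OF h(1)])
  have ch: "continuous_on UNIV h" by (rule smooth_continuous[OF h(1)])
  obtain b where b: "b \<ge> 0" "\<And>x. \<bar>\<phi> x\<bar> \<le> b" "\<And>x. norm (grad \<phi> x) \<le> b"
    by (rule test_bounded[OF \<phi>]) blast
  \<comment> \<open>Chosen so that (F + b) + 2 (H + 1) (F + b) = k1 (F + b): the first summand
    bounds the main part of the gradient, the second the perturbation.\<close>
  define k1 where "k1 = 2 * H + 3"
  have k1: "k1 \<ge> 3" using H by (simp add: k1_def)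
  define c where "c X = k1 * (F X + b)" for X
  have c_int: "integrable M (\<lambda>X. c X powr p)"
    unfolding c_def using integrable_mult_right[OF integrable_F_plus[OF b(1)], of "k1 powr p"] by (simp add: powr_mult)
  define K0 where "K0 = p\<^sup>2 * C powr (p / 2) * (LINT X|M. c X powr p)"
  have K0: "K0 \<ge> 0" unfolding K0_def by (intro mult_nonneg_nonneg integral_nonneg_AE) auto
  note smp = test_smooth[OF \<phi>] and smw = test_smooth[OF w_test]
  note mphi = measurable_smooth[OF smp]
  have L10_int: "integrable M (\<lambda>X. q X * L X (1, 0))" if q: "q \<in> borel_measurable M" "\<And>X. good X \<Longrightarrow> \<bar>q X\<bar> \<le> F X + b" for q
  proof (rule integrable_F_bound[OF _ b(1), of _ "C powr (p / 2)"])
    fix X assume X: "good X"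
    have "\<bar>L X (1, 0)\<bar> \<le> C powr (p / 2) * norm (g X) powr (p - 1)"
      using L_bound[OF X, of "(1, 0)"] by (simp add: norm_Pair)
    then have "\<bar>q X\<bar> * \<bar>L X (1, 0)\<bar> \<le> (F X + b) * (C powr (p / 2) * norm (g X) powr (p - 1))"
      using q(2)[OF X] F_nonneg[of X] b(1) by (intro mult_mono) auto
    also have "\<dots> = C powr (p / 2) * (norm (g X) powr (p - 1) * (F X + b))" by simp
    also have "\<dots> \<le> C powr (p / 2) * (F X + b) powr p"
      using goodD(6)[OF X] b(1) F_nonneg[of X] by (intro mult_left_mono powr_mult_le) auto
    finally show "\<bar>q X * L X (1, 0)\<bar> \<le> C powr (p / 2) * (F X + b) powr p" by (simp add: abs_mult)
  qed (intro borel_measurable_times q measurable_L borel_measurable_const)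
  have iWL: "integrable M (\<lambda>X. W X * L X (1, 0))"
    by (rule L10_int[OF W_meas]) (use goodD(5) b(1) add_increasing2 in fastforce)
  have ipL: "integrable M (\<lambda>X. \<phi> X * L X (1, 0))"
    by (rule L10_int[OF mphi(1)]) (use b(2) F_nonneg in \<open>auto intro: add_increasing\<close>)
  have iL: "integrable M (\<lambda>X. L X (0, grad \<phi> X))"
  proof (rule integrable_F_bound[of _ b "C powr (p / 2) * 1"])
    show "\<bar>L X (0, grad \<phi> X)\<bar> \<le> C powr (p / 2) * 1 * (F X + b) powr p" if "good X" for X
      using b F_nonneg[of X] by (intro good_L_le that) (auto simp: norm_Pair add_increasing)
  qed (rule measurable_L measurable_zero_Pair mphi(2) b)+
  have iw: "integrable M (\<lambda>X. w0 X * \<phi> X)"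
  proof (rule integrable_F_bound[of _ b 1])
    show "\<bar>w0 X * \<phi> X\<bar> \<le> 1 * (F X + b) powr p" if "good X" for X
      using b F_nonneg[of X] by (intro good_w0_le that) (auto simp: add_increasing)
  qed (rule borel_measurable_times measurable_w0 mphi(1) b)+
  have iW: "integrable M (\<lambda>X. \<bar>W X\<bar> powr p)"
  proof (rule integrable_F_bound[of _ 0 1])
    show "\<bar>\<bar>W X\<bar> powr p\<bar> \<le> 1 * (F X + 0) powr p" if "good X" for X
      using goodD(5)[OF that] p by (auto intro: powr_mono2)
  qed (use W_meas in auto)
  have main: "\<exists>v n d. (\<forall>k. v k \<in> test_functions (UNIV \<times> \<omega>)) \<and>
      (\<lambda>k. LINT x|N. \<bar>B (snd x) (grad (v k) x) (grad (v k) x)\<bar> powr (p / 2)) \<longlonglongrightarrow> n \<and>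
      (\<lambda>k. LINT x|N. \<bar>v k x\<bar> powr p) \<longlonglongrightarrow> d \<and>
      n - \<mu> * d \<le> - (LINT X|M. W X * L X (1, 0)) - t * p * (LINT X|M. \<phi> X * L X (1, 0)) + (8 * K0) * (t\<^sup>2 + 1 / T) \<and>
      (t = 0 \<longrightarrow> d \<ge> T)" if t: "\<bar>t\<bar> \<le> 1" and T: "T \<ge> 2" for t T
  proof -
    define \<eta> where "\<eta> s = h (s / T)" for s
    define \<eta>' where "\<eta>' s = grad h (s / T) / T" for s
    have T0: "T > 0" using T by simp
    have s\<eta>: "smooth \<eta>"
      using smooth_affine[OF bounded_linear_mult_right[of "1 / T"] h(1), of 0] by (simp add: \<eta>_def[abs_def])
    have d\<eta>: "(\<eta> has_real_derivative \<eta>' s) (at s)" for s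
    proof -
      have "((\<lambda>s. s / T) has_real_derivative 1 / T) (at s)" using T0 by (auto intro!: derivative_eq_intros)
      from DERIV_chain2[OF dh this] show ?thesis by (simp add: \<eta>_def[abs_def] \<eta>'_def)
    qed
    have g\<eta>: "grad \<eta> s = \<eta>' s" for s
      using DERIV_unique[OF smooth_real_deriv[OF s\<eta>] d\<eta>] .
    have \<eta>01: "0 \<le> \<eta> s" "\<eta> s \<le> 1" for s by (simp_all add: \<eta>_def h)
    have \<eta>0: "\<eta> s = 0" if "\<bar>s\<bar> \<ge> 2 * T" for s
      unfolding \<eta>_def using that T0 by (intro h(5)) (simp add: field_simps)
    have \<eta>1: "\<eta> s = 1" if "\<bar>s\<bar> \<le> T" for s
      unfolding \<eta>_def using that T0 by (intro h(4)) (simp add: field_simps)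
    have \<eta>'0: "\<eta>' s = 0" if "\<bar>s\<bar> > 2 * T" for s
      unfolding \<eta>'_def using that T0 by (subst h'0) (simp_all add: field_simps)
    have \<eta>'b: "\<bar>\<eta>' s\<bar> \<le> H / T" for s
      unfolding \<eta>'_def abs_divide using H(2)[of "s / T"] T0 by (simp add: divide_right_mono)
    have c\<eta>: "continuous_on UNIV \<eta>" by (rule smooth_continuous[OF s\<eta>])
    have c\<eta>': "continuous_on UNIV \<eta>'"
      unfolding \<eta>'_def[abs_def] using T0 by (intro continuous_intros continuous_on_compose2[OF cgh]) auto
    note cm = borel_measurable_continuous_onI
    \<comment> \<open>The slow cutoff \<eta> spreads the section profile over a length of order T,
      while the perturbation by \<phi> stays near the base. \<open>u\<close> and \<open>G\<close>
      are the limits of \<open>v k\<close> and its gradient, with W and g in place of the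
      approximants.\<close>
    define v where "v k x = \<eta> (fst x) * w k (snd x) + t * (h (fst x) * \<phi> (snd x))" for k and x :: "real \<times> (real ^ 'm)"
    define u where "u x = \<eta> (fst x) * W (snd x) + t * (h (fst x) * \<phi> (snd x))" for x :: "real \<times> (real ^ 'm)"
    define G where "G x = (\<eta>' (fst x) * W (snd x) + t * (grad h (fst x) * \<phi> (snd x)),
      \<eta> (fst x) *\<^sub>R g (snd x) + t *\<^sub>R (h (fst x) *\<^sub>R grad \<phi> (snd x)))" for x
    define \<Phi> where "\<Phi> x = indicator {- (2 * T)..2 * T} (fst x) * c (snd x)" for x :: "real \<times> (real ^ 'm)"
    have vt: "v k \<in> test_functions (UNIV \<times> \<omega>)" for k
      unfolding v_def[abs_def]
      by (intro test_add test_scale product_test[OF s\<eta> \<eta>0 w_test] product_test[OF h(1) h(5) \<phi>])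
    have gv: "grad (v k) x = (\<eta>' (fst x) * w k (snd x) + t * (grad h (fst x) * \<phi> (snd x)),
      \<eta> (fst x) *\<^sub>R grad (w k) (snd x) + t *\<^sub>R (h (fst x) *\<^sub>R grad \<phi> (snd x)))" for k x
    proof (rule grad_eqI)
      show "(v k has_derivative (\<lambda>z. (\<eta>' (fst x) * w k (snd x) + t * (grad h (fst x) * \<phi> (snd x)),
          \<eta> (fst x) *\<^sub>R grad (w k) (snd x) + t *\<^sub>R (h (fst x) *\<^sub>R grad \<phi> (snd x))) \<bullet> z)) (at x)"
        unfolding v_def[abs_def]
        by (rule has_derivative_eq_rhs[OF has_derivative_add[OF product_derivative[OF s\<eta> smw]
              has_derivative_mult_right[OF product_derivative[OF h(1) smp]]]])
          (simp add: fun_eq_iff g\<eta> inner_prod_def inner_add_left algebra_simps)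
    qed
    have bound: "\<bar>\<eta> (fst x) * y + t * (h (fst x) * \<phi> (snd x))\<bar> \<le> \<Phi> x \<and>
      norm (\<eta>' (fst x) * y + t * (grad h (fst x) * \<phi> (snd x)), \<eta> (fst x) *\<^sub>R z + t *\<^sub>R (h (fst x) *\<^sub>R grad \<phi> (snd x))) \<le> \<Phi> x"
      if y: "\<bar>y\<bar> \<le> F (snd x)" and z: "norm z \<le> F (snd x)" for x :: "real \<times> (real ^ 'm)" and y z
    proof (cases "\<bar>fst x\<bar> \<le> 2 * T")
      case True
      have HT: "H / T \<le> H" using T H(1) mult_left_mono[of 1 T H] by (simp add: field_simps)
      have F0: "F (snd x) \<ge> 0" by (rule F_nonneg)
      have 1: "\<bar>\<eta> (fst x) * y\<bar> \<le> F (snd x)"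
        using mult_mono[of "\<bar>\<eta> (fst x)\<bar>" 1 "\<bar>y\<bar>" "F (snd x)"] \<eta>01[of "fst x"] y by (simp add: abs_mult)
      have 2: "\<bar>t * (h (fst x) * \<phi> (snd x))\<bar> \<le> b"
        using mult_mono[OF t mult_mono[of "\<bar>h (fst x)\<bar>" 1 "\<bar>\<phi> (snd x)\<bar>" b]] h(2,3)[of "fst x"] b(2)[of "snd x"] b(1) by (simp add: abs_mult)
      have 3: "\<bar>\<eta>' (fst x) * y\<bar> \<le> H * F (snd x)"
        using mult_mono[of "\<bar>\<eta>' (fst x)\<bar>" H "\<bar>y\<bar>" "F (snd x)"] \<eta>'b[of "fst x"] HT y H(1) by (simp add: abs_mult)
      have 4: "\<bar>t * (grad h (fst x) * \<phi> (snd x))\<bar> \<le> H * b"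
        using mult_mono[OF t mult_mono[of "\<bar>grad h (fst x)\<bar>" H "\<bar>\<phi> (snd x)\<bar>" b]] H(2)[of "fst x"] H(1) b(2)[of "snd x"] b(1) by (simp add: abs_mult)
      have 5: "norm (\<eta> (fst x) *\<^sub>R z) \<le> F (snd x)"
        using mult_mono[of "\<bar>\<eta> (fst x)\<bar>" 1 "norm z" "F (snd x)"] \<eta>01[of "fst x"] z by simp
      have 6: "norm (t *\<^sub>R (h (fst x) *\<^sub>R grad \<phi> (snd x))) \<le> b"
        using mult_mono[OF t mult_mono[of "\<bar>h (fst x)\<bar>" 1 "norm (grad \<phi> (snd x))" b]] h(2,3)[of "fst x"] b(3)[of "snd x"] b(1) by (simp add: abs_mult mult.assoc)
      have 7: "norm (q, r) \<le> \<bar>q\<bar> + norm r" for q :: real and r :: "real ^ 'm"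
        unfolding norm_Pair using sqrt_sum_squares_le_sum[of "\<bar>q\<bar>" "norm r"] by simp
      have 8: "norm (\<eta> (fst x) *\<^sub>R z + t *\<^sub>R (h (fst x) *\<^sub>R grad \<phi> (snd x))) \<le> F (snd x) + b"
        using norm_triangle_ineq[of "\<eta> (fst x) *\<^sub>R z" "t *\<^sub>R (h (fst x) *\<^sub>R grad \<phi> (snd x))"] 5 6 by linarith
      have "\<Phi> x = k1 * (F (snd x) + b)" using True by (auto simp: \<Phi>_def c_def indicator_def)
      also have "\<dots> = 2 * (H * F (snd x)) + 2 * (H * b) + 3 * F (snd x) + 3 * b" by (simp add: k1_def algebra_simps)
      finally have \<Phi>: "\<Phi> x = 2 * (H * F (snd x)) + 2 * (H * b) + 3 * F (snd x) + 3 * b" .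
      have "0 \<le> H * F (snd x)" "0 \<le> H * b" using H(1) F0 b(1) by auto
      then show ?thesis
        using 1 2 3 4 8 7[of "\<eta>' (fst x) * y + t * (grad h (fst x) * \<phi> (snd x))" "\<eta> (fst x) *\<^sub>R z + t *\<^sub>R (h (fst x) *\<^sub>R grad \<phi> (snd x))"] F0 b(1)
        unfolding \<Phi> by linarith
    next
      case False
      then have "\<bar>fst x\<bar> > 2" using T by linarith
      moreover have "\<Phi> x = 0" using False by (auto simp: \<Phi>_def indicator_def)
      ultimately show ?thesis using False \<eta>0[of "fst x"] \<eta>'0[of "fst x"] h(5)[of "fst x"] h'0[of "fst x"] by (simp add: zero_prod_def[symmetric])
    qed
    have ind_pow: "\<Phi> x powr p = indicator {- (2 * T)..2 * T} (fst x) * c (snd x) powr p" for x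
      using p by (simp add: \<Phi>_def indicator_def)
    have im: "indicator {- r..r} \<in> borel_measurable borel" for r :: real by simp
    have ib: "\<bar>indicator {- r..r} s :: real\<bar> \<le> 1" "\<forall>s. \<bar>s\<bar> > r \<longrightarrow> indicator {- r..r} s = (0::real)" for r s :: real
      by (auto simp: indicator_def)
    have \<Phi>i: "integrable N (\<lambda>x. \<Phi> x powr p)"
      unfolding ind_pow by (rule integral_product(1)[OF im ib c_int])
    have mfst: "(\<lambda>x. q (fst x)) \<in> borel_measurable N" if "continuous_on UNIV q" for q :: "real \<Rightarrow> real"
      by (intro measurable_continuous_on_lebesgue_on continuous_on_compose2[OF that] continuous_on_fst continuous_on_id) simp
    have cM: "c \<in> borel_measurable M" unfolding c_def[abs_def] using F_meas by measurable
    have \<Phi>m: "\<Phi> \<in> borel_measurable N"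
      unfolding \<Phi>_def[abs_def]
    proof (intro borel_measurable_times measurable_N_snd[OF cM] measurable_restrict_space1 measurable_completion)
      show "(\<lambda>x :: real \<times> (real ^ 'm). indicator {- (2 * T)..2 * T} (fst x) :: real) \<in> borel_measurable lborel"
        using measurable_compose[OF borel_measurable_continuous_onI[OF continuous_on_fst[OF continuous_on_id]] im] by simp
    qed
    have m_vec: "(\<lambda>x. q (snd x)) \<in> borel_measurable N" if "q \<in> borel_measurable M" for q :: "real ^ 'm \<Rightarrow> real ^ 'm"
    proof -
      have "\<And>i. (\<lambda>x. q (snd x) \<bullet> i) \<in> borel_measurable N"
        by (rule measurable_N_snd) (intro borel_measurable_inner that borel_measurable_const)
      then show ?thesis by (subst borel_measurable_euclidean_space) blast
    qed
    have um: "u \<in> borel_measurable N"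
      unfolding u_def[abs_def]
      by (intro borel_measurable_add borel_measurable_times borel_measurable_const mfst c\<eta> ch measurable_N_snd[OF W_meas] measurable_N_snd[OF mphi(1)])
    have Gm: "G \<in> borel_measurable N"
      unfolding G_def[abs_def]
      by (intro borel_measurable_Pair borel_measurable_add borel_measurable_times borel_measurable_scaleR borel_measurable_const
          mfst[OF c\<eta>] mfst[OF c\<eta>'] mfst[OF ch] mfst[OF cgh] measurable_N_snd[OF W_meas] measurable_N_snd[OF mphi(1)] m_vec[OF g_meas] m_vec[OF mphi(2)])
    have lim1: "AE x in N. (\<lambda>k. v k x) \<longlonglongrightarrow> u x"
      using AE_N[OF AE_good]
      by eventually_elim (auto simp: v_def u_def intro!: tendsto_intros goodD(9))
    have lim2: "AE x in N. (\<lambda>k. grad (v k) x) \<longlonglongrightarrow> G x"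
      using AE_N[OF AE_good]
      by eventually_elim (auto simp: gv G_def intro!: tendsto_intros goodD(9,10))
    have bd: "AE x in N. \<forall>k. \<bar>v k x\<bar> \<le> \<Phi> x \<and> norm (grad (v k) x) \<le> \<Phi> x"
      using AE_N[OF AE_good]
    proof eventually_elim
      case (elim x)
      show ?case unfolding v_def gv using bound[OF goodD(7)[OF elim] goodD(8)[OF elim]] by blast
    qed
    have bd': "AE x in N. \<bar>u x\<bar> \<le> \<Phi> x \<and> norm (G x) \<le> \<Phi> x"
      using AE_N[OF AE_good]
    proof eventually_elim
      case (elim x)
      show ?case unfolding u_def G_def by (rule bound[OF goodD(5)[OF elim] goodD(6)[OF elim]])
    qed
    note lims = limits_N[OF vt \<Phi>m \<Phi>i um Gm lim1 lim2 bd]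
    define n where "n = (LINT x|N. \<bar>B (snd x) (G x) (G x)\<bar> powr (p / 2))"
    define d where "d = (LINT x|N. \<bar>u x\<bar> powr p)"
    have i_n: "integrable N (\<lambda>x. \<bar>B (snd x) (G x) (G x)\<bar> powr (p / 2))"
    proof (rule Bochner_Integration.integrable_bound[OF integrable_mult_right[OF \<Phi>i, of "C powr (p / 2)"]])
      show "(\<lambda>x. \<bar>B (snd x) (G x) (G x)\<bar> powr (p / 2)) \<in> borel_measurable N"
        using measurable_B_N[OF Gm Gm] by measurable
      show "AE x in N. norm (\<bar>B (snd x) (G x) (G x)\<bar> powr (p / 2)) \<le> norm (C powr (p / 2) * \<Phi> x powr p)"
        using AE_N[OF AE_good] bd'
      proof eventually_elim
        case (elim x)
        show ?case using good_energy_le[OF elim(1) conjunct2[OF elim(2)]] by simp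
      qed
    qed
    have i_d: "integrable N (\<lambda>x. \<bar>u x\<bar> powr p)"
    proof (rule Bochner_Integration.integrable_bound[OF \<Phi>i])
      show "(\<lambda>x. \<bar>u x\<bar> powr p) \<in> borel_measurable N" using um by measurable
      show "AE x in N. norm (\<bar>u x\<bar> powr p) \<le> norm (\<Phi> x powr p)"
        using bd' by eventually_elim (use p in \<open>auto intro: powr_mono2\<close>)
    qed
    \<comment> \<open>Profiles in x_1 of the terms of the expansion: a1 is \<eta>^p and a2 its
      derivative; a3 and a4 belong to the terms linear in t, with h' and with h; a5 bounds the
      quadratic remainder.\<close>
    define a1 where "a1 s = \<bar>\<eta> s\<bar> powr p" for s
    define a2 where "a2 s = abs_powr' p (\<eta> s) * \<eta>' s" for s
    define a3 where "a3 s = abs_powr' p (\<eta> s) * grad h s" for s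
    define a4 where "a4 s = abs_powr' p (\<eta> s) * h s" for s
    define a5 where "a5 s = t\<^sup>2 * (2 * indicator {-2..2} s) + (2 / T\<^sup>2) * indicator {- (2 * T)..2 * T} s" for s :: real
    have \<eta>p: "\<bar>abs_powr' p (\<eta> s)\<bar> \<le> p" for s
      unfolding abs_abs_powr'[OF p] using powr_mono2[of "p - 1" "\<eta> s" 1] \<eta>01[of s] p by simp
    have ca: "continuous_on UNIV a1" "continuous_on UNIV a2" "continuous_on UNIV a3" "continuous_on UNIV a4"
      unfolding a1_def[abs_def] a2_def[abs_def] a3_def[abs_def] a4_def[abs_def]
      by (intro continuous_on_mult continuous_on_compose2[OF continuous_abs_powr'[OF p] c\<eta>] c\<eta>' cgh ch
          continuous_on_compose2[OF continuous_abs_powr[of p] c\<eta>]; (use p in auto))+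
    have a_b: "\<bar>a1 s\<bar> \<le> 1" "\<bar>a2 s\<bar> \<le> p * (H / T)" "\<bar>a3 s\<bar> \<le> p * H" "\<bar>a4 s\<bar> \<le> p * 1" for s
    proof -
      show "\<bar>a1 s\<bar> \<le> 1" unfolding a1_def using powr_mono2[of p "\<eta> s" 1] \<eta>01[of s] p by simp
      show "\<bar>a2 s\<bar> \<le> p * (H / T)" unfolding a2_def abs_mult using p by (intro mult_mono \<eta>p \<eta>'b) auto
      show "\<bar>a3 s\<bar> \<le> p * H" unfolding a3_def abs_mult using p H(2)[of s] by (intro mult_mono \<eta>p) auto
      show "\<bar>a4 s\<bar> \<le> p * 1" unfolding a4_def abs_mult using p h(2,3)[of s] by (intro mult_mono \<eta>p) auto
    qed
    have a_0: "\<forall>s. \<bar>s\<bar> > 2 * T \<longrightarrow> a1 s = 0" "\<forall>s. \<bar>s\<bar> > 2 * T \<longrightarrow> a2 s = 0"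
      "\<forall>s. \<bar>s\<bar> > 2 * T \<longrightarrow> a3 s = 0" "\<forall>s. \<bar>s\<bar> > 2 * T \<longrightarrow> a4 s = 0"
      using \<eta>0 p by (auto simp: a1_def a2_def a3_def a4_def abs_powr'_def)
    have a5m: "a5 \<in> borel_measurable borel" unfolding a5_def[abs_def] by measurable
    have a5b: "\<bar>a5 s\<bar> \<le> t\<^sup>2 * 2 + 2 / T\<^sup>2" for s
      unfolding a5_def by (auto simp: indicator_def abs_of_nonneg)
    have a50: "\<forall>s. \<bar>s\<bar> > 2 * T \<longrightarrow> a5 s = 0"
      using T by (auto simp: a5_def indicator_def)
    note P1 = integral_product[OF cm[OF ca(1)] a_b(1) a_0(1) integrable_E]
    note P1' = integral_product[OF cm[OF ca(1)] a_b(1) a_0(1) iW]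
    note P2 = integral_product[OF cm[OF ca(2)] a_b(2) a_0(2) iWL]
    note P3 = integral_product[OF cm[OF ca(3)] a_b(3) a_0(3) ipL]
    note P4 = integral_product[OF cm[OF ca(4)] a_b(4) a_0(4) iL]
    note P4' = integral_product[OF cm[OF ca(4)] a_b(4) a_0(4) iw]
    note P5 = integral_product[OF a5m a5b a50 c_int]
    let ?I = "\<lambda>a. LINT s|lborel. indicator {0<..} s * a s"
    let ?rhs = "\<lambda>x. a1 (fst x) * E (snd x) powr (p / 2) - \<mu> * (a1 (fst x) * \<bar>W (snd x)\<bar> powr p)
       + a2 (fst x) * (W (snd x) * L (snd x) (1, 0)) + t * (a3 (fst x) * (\<phi> (snd x) * L (snd x) (1, 0)))
       + t * (a4 (fst x) * L (snd x) (0, grad \<phi> (snd x))) - \<mu> * t * (a4 (fst x) * (w0 (snd x) * \<phi> (snd x)))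
       + (p\<^sup>2 * C powr (p / 2)) * (a5 (fst x) * c (snd x) powr p)"
    have pt: "\<bar>B (snd x) (G x) (G x)\<bar> powr (p / 2) - \<mu> * \<bar>u x\<bar> powr p \<le> ?rhs x" if X: "good (snd x)" for x
    proof -
      let ?s = "fst x" and ?X = "snd x"
      define \<xi> where "\<xi> = \<eta> ?s *\<^sub>R (0::real, g ?X)"
      define \<delta> where "\<delta> = (\<eta>' ?s * W ?X + t * (grad h ?s * \<phi> ?X), t *\<^sub>R (h ?s *\<^sub>R grad \<phi> ?X))"
      have Gx: "G x = \<xi> + \<delta>" by (simp add: G_def \<xi>_def \<delta>_def)
      define i1 where "i1 = (indicator {-2..2} ?s :: real)"
      define i2 where "i2 = (indicator {- (2 * T)..2 * T} ?s :: real)"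
      \<comment> \<open>Size of the perturbation \<delta> relative to the majorant c: |t| where h
        may be nonzero, 1/T where \<eta>' may be. Its square is at most \<open>a5\<close>, and since
        the 1/T^2 part lives on a length of order T the integral is of order t^2 + 1/T.\<close>
      define \<tau> where "\<tau> = \<bar>t\<bar> * i1 + (1 / T) * i2"
      have i12: "0 \<le> i1" "i1 \<le> 1" "0 \<le> i2" "i2 \<le> 1" "i1 * i1 = i1" "i2 * i2 = i2" by (auto simp: i1_def i2_def indicator_def)
      have \<tau>0: "\<tau> \<ge> 0" using i12 T0 by (simp add: \<tau>_def)
      have \<tau>2: "\<tau> \<le> 2"
      proof -
        have "\<bar>t\<bar> * i1 \<le> 1 * 1" using t i12 by (intro mult_mono) auto
        moreover have "(1 / T) * i2 \<le> 1 * 1" using T i12 by (intro mult_mono) auto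
        ultimately show ?thesis unfolding \<tau>_def by linarith
      qed
      have FX: "F ?X \<ge> 0" by (rule F_nonneg)
      have nd: "norm \<delta> \<le> \<tau> * ((H + 1) * (F ?X + b))"
      proof -
        have e1: "\<bar>\<eta>' ?s * W ?X\<bar> \<le> (1 / T) * i2 * (H * F ?X)"
        proof (cases "\<bar>?s\<bar> > 2 * T")
          case True
          then show ?thesis using \<eta>'0[of ?s] i12 T0 H(1) FX by simp
        next
          case False
          then have "i2 = 1" by (auto simp: i2_def indicator_def)
          then show ?thesis
            using mult_mono[OF \<eta>'b[of ?s] goodD(5)[OF X]] H(1) T0 by (simp add: abs_mult)
        qed
        have e2: "\<bar>t * (grad h ?s * \<phi> ?X)\<bar> \<le> \<bar>t\<bar> * i1 * (H * b)"
        proof (cases "\<bar>?s\<bar> > 2")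
          case True
          then show ?thesis using h'0[of ?s] i12 H(1) b(1) by simp
        next
          case False
          then have "i1 = 1" by (auto simp: i1_def indicator_def)
          moreover have "\<bar>grad h ?s\<bar> * \<bar>\<phi> ?X\<bar> \<le> H * b"
            using H(1) H(2)[of ?s] b(2) by (intro mult_mono) auto
          ultimately show ?thesis by (simp add: abs_mult mult_left_mono)
        qed
        have e3: "norm (t *\<^sub>R (h ?s *\<^sub>R grad \<phi> ?X)) \<le> \<bar>t\<bar> * i1 * b"
        proof (cases "\<bar>?s\<bar> > 2")
          case True
          then show ?thesis using h(5)[of ?s] i12 b(1) by simp
        next
          case False
          then have "i1 = 1" by (auto simp: i1_def indicator_def)
          moreover have "\<bar>h ?s\<bar> * norm (grad \<phi> ?X) \<le> 1 * b"
            using h(2,3)[of ?s] b(3) by (intro mult_mono) auto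
          ultimately show ?thesis by (simp add: abs_mult mult.assoc mult_left_mono)
        qed
        have "norm \<delta> \<le> \<bar>\<eta>' ?s * W ?X + t * (grad h ?s * \<phi> ?X)\<bar> + norm (t *\<^sub>R (h ?s *\<^sub>R grad \<phi> ?X))"
          unfolding \<delta>_def norm_Pair using sqrt_sum_squares_le_sum[of "\<bar>\<eta>' ?s * W ?X + t * (grad h ?s * \<phi> ?X)\<bar>" "norm (t *\<^sub>R (h ?s *\<^sub>R grad \<phi> ?X))"] by simp
        also have "\<dots> \<le> (1 / T) * i2 * (H * F ?X) + \<bar>t\<bar> * i1 * (H * b) + \<bar>t\<bar> * i1 * b"
          using e1 e2 e3 by linarith
        also have "\<dots> \<le> (1 / T) * i2 * ((H + 1) * (F ?X + b)) + \<bar>t\<bar> * i1 * ((H + 1) * (F ?X + b))"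
        proof -
          have "(1 / T) * i2 * (H * F ?X) \<le> (1 / T) * i2 * ((H + 1) * (F ?X + b))"
            using i12 T0 H(1) FX b(1) by (intro mult_left_mono mult_mono) auto
          moreover have "\<bar>t\<bar> * i1 * (H * b + b) \<le> \<bar>t\<bar> * i1 * ((H + 1) * (F ?X + b))"
          proof (rule mult_left_mono)
            have "(H + 1) * b \<le> (H + 1) * (F ?X + b)" using H(1) FX by (intro mult_left_mono) auto
            then show "H * b + b \<le> (H + 1) * (F ?X + b)" by (simp add: distrib_right)
          qed (use i12 in auto)
          ultimately show ?thesis by (simp add: distrib_left)
        qed
        also have "\<dots> = \<tau> * ((H + 1) * (F ?X + b))" by (simp add: \<tau>_def algebra_simps)
        finally show ?thesis .
      qed
      have Fb: "F ?X + b \<ge> 0" using FX b(1) by simp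
      have nd1: "norm \<delta> \<le> \<tau> * c ?X"
      proof -
        have "(H + 1) * (F ?X + b) \<le> c ?X"
          unfolding c_def k1_def using Fb H(1) by (intro mult_right_mono) auto
        then show ?thesis using nd mult_left_mono[OF _ \<tau>0] by (meson order_trans)
      qed
      have nx: "norm \<xi> + norm \<delta> \<le> c ?X"
      proof -
        have "norm \<xi> \<le> F ?X + b"
          using mult_mono[OF \<eta>01(2)[of ?s] goodD(6)[OF X]] \<eta>01[of ?s] b(1) by (simp add: \<xi>_def norm_Pair)
        moreover have "norm \<delta> \<le> 2 * ((H + 1) * (F ?X + b))"
          using Fb H(1) by (intro order_trans[OF nd] mult_right_mono \<tau>2) simp
        moreover have "F ?X + b + 2 * ((H + 1) * (F ?X + b)) = c ?X"
          by (simp add: c_def k1_def algebra_simps)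
        ultimately show ?thesis by linarith
      qed
      have \<tau>sq: "\<tau>\<^sup>2 \<le> a5 ?s"
      proof -
        have "\<tau>\<^sup>2 \<le> 2 * (\<bar>t\<bar> * i1)\<^sup>2 + 2 * ((1 / T) * i2)\<^sup>2"
          using zero_le_power2[of "\<bar>t\<bar> * i1 - (1 / T) * i2"] unfolding \<tau>_def power2_sum power2_diff by linarith
        also have "\<dots> = 2 * (t\<^sup>2 * (i1 * i1)) + 2 * ((1 / T\<^sup>2) * (i2 * i2))"
          by (simp add: power_mult_distrib power2_eq_square)
        also have "\<dots> = a5 ?s" unfolding i12 by (simp add: a5_def i1_def i2_def)
        finally show ?thesis .
      qed
      have BX: "B ?X \<xi> \<xi> = (\<eta> ?s)\<^sup>2 * E ?X" "B ?X \<xi> \<delta> = \<eta> ?s * B ?X (0, g ?X) \<delta>"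
        using form_scale[OF goodD(1)[OF X]] by (simp_all add: \<xi>_def E_def power2_eq_square del: scaleR_Pair)
      have E0: "E ?X \<ge> 0" unfolding E_def by (rule good_B_nonneg[OF X])
      have pw: "((\<eta> ?s)\<^sup>2 * E ?X) powr q = \<eta> ?s powr (2 * q) * E ?X powr q" for q
      proof -
        have "((\<eta> ?s)\<^sup>2 * E ?X) powr q = (\<eta> ?s * \<eta> ?s) powr q * E ?X powr q"
          by (simp add: powr_mult power2_eq_square)
        also have "(\<eta> ?s * \<eta> ?s) powr q = \<eta> ?s powr q * \<eta> ?s powr q" by (rule powr_mult)
        also have "\<dots> = \<eta> ?s powr (2 * q)" by (simp add: powr_add[symmetric])
        finally show ?thesis .
      qed
      have e1: "B ?X \<xi> \<xi> powr (p / 2) = a1 ?s * E ?X powr (p / 2)"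
        unfolding BX pw a1_def using \<eta>01[of ?s] by simp
      have e2: "p * B ?X \<xi> \<xi> powr ((p - 2) / 2) * B ?X \<xi> \<delta> = abs_powr' p (\<eta> ?s) * L ?X \<delta>"
      proof -
        have q: "2 * ((p - 2) / 2) = p - 2" by simp
        show ?thesis unfolding BX pw q abs_powr'_def L_def using \<eta>01[of ?s] by (simp add: algebra_simps)
      qed
      have "\<delta> = (\<eta>' ?s * W ?X + t * (grad h ?s * \<phi> ?X)) *\<^sub>R (1, 0) + (t * h ?s) *\<^sub>R (0, grad \<phi> ?X)"
        by (simp add: \<delta>_def)
      then have e3: "L ?X \<delta> = (\<eta>' ?s * W ?X + t * (grad h ?s * \<phi> ?X)) * L ?X (1, 0) + (t * h ?s) * L ?X (0, grad \<phi> ?X)"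
        by (simp only: L_linear[OF X])
      have "\<bar>B ?X (G x) (G x)\<bar> powr (p / 2) \<le> a1 ?s * E ?X powr (p / 2) + abs_powr' p (\<eta> ?s) * L ?X \<delta>
         + p\<^sup>2 * C powr (p / 2) * c ?X powr p * \<tau>\<^sup>2"
        using good_energy_upper[OF X nd1 nx \<tau>0] unfolding Gx e1 e2 .
      moreover have "p\<^sup>2 * C powr (p / 2) * c ?X powr p * \<tau>\<^sup>2 \<le> p\<^sup>2 * C powr (p / 2) * c ?X powr p * a5 ?s"
        by (rule mult_left_mono[OF \<tau>sq]) simp
      ultimately have up: "\<bar>B ?X (G x) (G x)\<bar> powr (p / 2) \<le> a1 ?s * E ?X powr (p / 2) + abs_powr' p (\<eta> ?s) * L ?X \<delta>
         + p\<^sup>2 * C powr (p / 2) * c ?X powr p * a5 ?s" by linarith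
      \<comment> \<open>A lower bound by the tangent at \<eta> W suffices for the mass, which enters
        with the factor -\<mu> \<le> 0.\<close>
      have "\<bar>u x\<bar> powr p \<ge> \<bar>\<eta> ?s * W ?X\<bar> powr p + abs_powr' p (\<eta> ?s * W ?X) * (t * (h ?s * \<phi> ?X))"
        unfolding u_def by (rule abs_powr_tangent[OF p])
      moreover have "\<bar>\<eta> ?s * W ?X\<bar> powr p = a1 ?s * \<bar>W ?X\<bar> powr p" by (simp add: a1_def abs_mult powr_mult)
      moreover have "abs_powr' p (\<eta> ?s * W ?X) = abs_powr' p (\<eta> ?s) * w0 ?X"
        by (simp add: abs_powr'_def w0_def abs_mult powr_mult)
      ultimately have "\<bar>u x\<bar> powr p \<ge> a1 ?s * \<bar>W ?X\<bar> powr p + abs_powr' p (\<eta> ?s) * w0 ?X * (t * (h ?s * \<phi> ?X))" by simp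
      then have "\<mu> * \<bar>u x\<bar> powr p \<ge> \<mu> * (a1 ?s * \<bar>W ?X\<bar> powr p + abs_powr' p (\<eta> ?s) * w0 ?X * (t * (h ?s * \<phi> ?X)))"
        by (rule mult_left_mono) (rule mu_nonneg)
      with up show ?thesis unfolding e3 a2_def a3_def a4_def by (simp add: algebra_simps)
    qed
    have irhs: "integrable N ?rhs"
      by (intro Bochner_Integration.integrable_add Bochner_Integration.integrable_diff integrable_mult_right P1 P1' P2 P3 P4 P4' P5)
    have "n - \<mu> * d = (LINT x|N. \<bar>B (snd x) (G x) (G x)\<bar> powr (p / 2) - \<mu> * \<bar>u x\<bar> powr p)"
      unfolding n_def d_def using i_n i_d by simp
    also have "\<dots> \<le> (LINT x|N. ?rhs x)"
    proof (rule integral_mono_AE)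
      show "AE x in N. \<bar>B (snd x) (G x) (G x)\<bar> powr (p / 2) - \<mu> * \<bar>u x\<bar> powr p \<le> ?rhs x"
        using AE_N[OF AE_good] by eventually_elim (rule pt)
    qed (intro Bochner_Integration.integrable_diff integrable_mult_right i_n i_d irhs)+
    also have "(LINT x|N. ?rhs x) = ?I a1 * (LINT X|M. E X powr (p / 2)) - \<mu> * (?I a1 * (LINT X|M. \<bar>W X\<bar> powr p))
       + ?I a2 * (LINT X|M. W X * L X (1, 0)) + t * (?I a3 * (LINT X|M. \<phi> X * L X (1, 0)))
       + t * (?I a4 * (LINT X|M. L X (0, grad \<phi> X))) - \<mu> * t * (?I a4 * (LINT X|M. w0 X * \<phi> X))
       + (p\<^sup>2 * C powr (p / 2)) * (?I a5 * (LINT X|M. c X powr p))"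
      unfolding P1(2)[symmetric] P1'(2)[symmetric] P2(2)[symmetric] P3(2)[symmetric] P4(2)[symmetric] P4'(2)[symmetric] P5(2)[symmetric]
      using P1(1) P1'(1) P2(1) P3(1) P4(1) P4'(1) P5(1)
      by (simp add: Bochner_Integration.integral_add Bochner_Integration.integral_diff)
    \<comment> \<open>The two a1-terms cancel because W has energy \<mu> and mass 1; this removes
      everything of order T. The two a4-terms cancel by the Euler--Lagrange equation for
      \<phi>.\<close>
    also have "\<dots> = ?I a2 * (LINT X|M. W X * L X (1, 0)) + t * (?I a3 * (LINT X|M. \<phi> X * L X (1, 0))) + K0 * ?I a5"
      using EL_test[OF \<phi>] unfolding EL_def integral_E W_normalized K0_def by (simp add: algebra_simps)
    \<comment> \<open>a2 is the derivative of \<eta>^p, and \<eta> equals 1 at 0.\<close>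
    also have "?I a2 = - 1"
    proof -
      have "?I a2 = - (\<bar>\<eta> 0\<bar> powr p)"
      proof (rule integral_derivative_half_line[where R="2 * T + 1"])
        show "((\<lambda>s. \<bar>\<eta> s\<bar> powr p) has_real_derivative a2 s) (at s)" for s
          unfolding a2_def by (rule DERIV_chain2[OF abs_powr_deriv[OF p] d\<eta>])
        show "\<bar>\<eta> s\<bar> powr p = 0" if "s \<ge> 2 * T + 1" for s using \<eta>0[of s] that T p by simp
        show "a2 s = 0" if "s \<ge> 2 * T + 1" for s using a_0(2)[rule_format, of s] that T by simp
      qed (use ca(2) T in auto)
      then show ?thesis using \<eta>1[of 0] T by simp
    qed
    \<comment> \<open>Since T \<ge> 2, \<eta> = 1 wherever h' is nonzero; hence a3 = p h', with h(0)
      = 1.\<close>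
    also have "?I a3 = - p"
    proof -
      have a3: "a3 s = p * grad h s" for s
      proof (cases "\<bar>s\<bar> > 2")
        case True
        then show ?thesis using h'0[of s] by (simp add: a3_def)
      next
        case False
        then have "\<eta> s = 1" using \<eta>1[of s] T by simp
        then show ?thesis by (simp add: a3_def abs_powr'_def)
      qed
      have "?I a3 = - (p * h 0)"
      proof (rule integral_derivative_half_line[where R=3])
        show "((\<lambda>s. p * h s) has_real_derivative a3 s) (at s)" for s
          unfolding a3 by (rule DERIV_cmult[OF dh])
        show "p * h s = 0" if "s \<ge> 3" for s using h(5)[of s] that by simp
        show "a3 s = 0" if "s \<ge> 3" for s using h'0[of s] that by (simp add: a3)
      qed (use ca(3) in auto)
      then show ?thesis using h(4)[of 0] by simp
    qed
    also have "?I a5 = 4 * t\<^sup>2 + 4 / T"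
    proof -
      have ii: "(LINT s|lborel. indicator {0<..} s * indicator {- r..r} s) = r" "integrable lborel (\<lambda>s. indicator {0<..} s * indicator {- r..r} s :: real)"
        if "r > 0" for r :: real
      proof -
        have e: "(\<lambda>s. indicator {0<..} s * indicator {- r..r} s :: real) = indicator {0<..r}"
          using that by (auto simp: indicator_def fun_eq_iff)
        show "(LINT s|lborel. indicator {0<..} s * indicator {- r..r} s) = r" unfolding e using that by simp
        show "integrable lborel (\<lambda>s. indicator {0<..} s * indicator {- r..r} s :: real)"
          unfolding e by (intro integrable_real_indicator) (use that in auto)
      qed
      have "?I a5 = (LINT s|lborel. (2 * t\<^sup>2) * (indicator {0<..} s * indicator {-2..2} s) + (2 / T\<^sup>2) * (indicator {0<..} s * indicator {- (2 * T)..2 * T} s))"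
        by (intro Bochner_Integration.integral_cong) (auto simp: a5_def algebra_simps)
      also have "\<dots> = (2 * t\<^sup>2) * 2 + (2 / T\<^sup>2) * (2 * T)"
        using ii[of 2] ii[of "2 * T"] T0 by (subst Bochner_Integration.integral_add) (auto intro!: integrable_mult_right)
      finally show ?thesis using T0 by (simp add: power2_eq_square)
    qed
    finally have "n - \<mu> * d \<le> - (LINT X|M. W X * L X (1, 0)) - t * p * (LINT X|M. \<phi> X * L X (1, 0)) + K0 * (4 * t\<^sup>2 + 4 / T)"
      by (simp add: mult.assoc)
    moreover have "K0 * (4 * t\<^sup>2 + 4 / T) \<le> (8 * K0) * (t\<^sup>2 + 1 / T)"
    proof -
      have "4 * t\<^sup>2 + 4 / T \<le> 8 * (t\<^sup>2 + 1 / T)" using T0 by (simp add: field_simps)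
      from mult_left_mono[OF this K0] show ?thesis by (simp only: mult.left_commute mult.assoc)
    qed
    ultimately have est: "n - \<mu> * d \<le> - (LINT X|M. W X * L X (1, 0)) - t * p * (LINT X|M. \<phi> X * L X (1, 0)) + (8 * K0) * (t\<^sup>2 + 1 / T)"
      by linarith
    \<comment> \<open>With t = 0 the limit function is W itself for 0 < x_1 \<le> T. The growing
      mass is what later absorbs the fixed boundary term.\<close>
    have dT: "d \<ge> T" if "t = 0"
    proof -
      have "(LINT x|N. indicator {- T..T} (fst x) * \<bar>W (snd x)\<bar> powr p) = (LINT s|lborel. indicator {0<..} s * indicator {- T..T} s) * (LINT X|M. \<bar>W X\<bar> powr p)"
        by (rule integral_product(2)[OF im ib iW])
      also have "(\<lambda>s. indicator {0<..} s * indicator {- T..T} s :: real) = indicator {0<..T}"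
        using T0 by (auto simp: indicator_def fun_eq_iff)
      finally have "(LINT x|N. indicator {- T..T} (fst x) * \<bar>W (snd x)\<bar> powr p) = T" using T0 W_normalized by simp
      moreover have "(LINT x|N. indicator {- T..T} (fst x) * \<bar>W (snd x)\<bar> powr p) \<le> d"
        unfolding d_def
      proof (rule integral_mono[OF integral_product(1)[OF im ib iW] i_d])
        show "indicator {- T..T} (fst x) * \<bar>W (snd x)\<bar> powr p \<le> \<bar>u x\<bar> powr p" for x
          using \<eta>1[of "fst x"] that by (auto simp: u_def indicator_def)
      qed
      ultimately show ?thesis by simp
    qed
    show ?thesis
      by (intro exI[of _ v] exI[of _ n] exI[of _ d] conjI allI vt lims(1)[folded n_def] lims(2)[folded d_def] est impI dT)
  qed
  show ?thesis by (rule that[of "8 * K0"]) (rule main)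
qed

end

section \<open>Comparison of the two infima\<close>

lemma W1p_measurable:
  assumes U: "open U" and u: "u \<in> W1p p U"
  shows "u \<in> borel_measurable (lebesgue_on U)" "weak_grad U u \<in> borel_measurable (lebesgue_on U)"
    "integrable (lebesgue_on U) (\<lambda>x. \<bar>u x\<bar> powr p)"
proof -
  obtain g where g: "is_weak_gradient U u g" "Lp_on p U g" and uL: "Lp_on p U u"
    using u by (auto simp: W1p_def)
  show "u \<in> borel_measurable (lebesgue_on U)" by (rule Lp_on_measurable[OF uL])
  show "integrable (lebesgue_on U) (\<lambda>x. \<bar>u x\<bar> powr p)" using Lp_on_integrable[OF uL] by simp
  have ae: "AE x in lebesgue_on U. g x = weak_grad U u x"
    using weak_grad_AE_eq(2)[OF U g(1)] by eventually_elim (rule sym)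
  have ms: "U \<in> sets lebesgue" using U by auto
  show "weak_grad U u \<in> borel_measurable (lebesgue_on U)"
    by (rule borel_measurable_lebesgue_on_AE[OF ms Lp_on_measurable[OF g(2)] ae])
qed

lemma nonzero_on_iff:
  assumes U: "open U" and u: "u \<in> W1p p U"
  shows "nonzero_on U u \<longleftrightarrow> (LINT x|lebesgue_on U. \<bar>u x\<bar> powr p) > 0"
proof -
  have n: "(LINT x|lebesgue_on U. \<bar>u x\<bar> powr p) \<ge> 0" by (rule integral_nonneg_AE) simp
  have "(LINT x|lebesgue_on U. \<bar>u x\<bar> powr p) = 0 \<longleftrightarrow> (AE x in lebesgue_on U. u x = 0)"
    by (subst integral_nonneg_eq_0_iff_AE[OF W1p_measurable(3)[OF U u]]) simp_all
  with n show ?thesis unfolding nonzero_on_def by linarith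
qed

lemma rayleigh_nonneg: "rayleigh p U A u \<ge> 0"
  unfolding rayleigh_def set_lebesgue_integral_def
  by (intro divide_nonneg_nonneg integral_nonneg_AE) simp_all

text \<open>The quotients are bounded below by 0, without which an infimum over the reals carries no
  information.\<close>

lemma rayleigh_INF_le: "u \<in> S \<Longrightarrow> (INF u\<in>S. rayleigh p U A u) \<le> rayleigh p U A u"
  by (intro cINF_lower bdd_belowI2[of _ 0] rayleigh_nonneg)

lemma rayleigh_lebesgue_on:
  assumes "open U"
  shows "rayleigh p U A u = (LINT x|lebesgue_on U. \<bar>A x (weak_grad U u x) \<bullet> weak_grad U u x\<bar> powr (p / 2))
       / (LINT x|lebesgue_on U. \<bar>u x\<bar> powr p)"
proof -
  have "U \<in> sets lebesgue" using assms by auto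
  then show ?thesis unfolding rayleigh_def by (simp only: LINT_lebesgue_on)
qed

lemma rayleigh_smooth:
  assumes U: "open U" and v: "smooth v"
    and m: "(\<lambda>x. \<bar>A x (grad v x) \<bullet> grad v x\<bar> powr (p / 2)) \<in> borel_measurable (lebesgue_on U)"
  shows "rayleigh p U A v = (LINT x|lebesgue_on U. \<bar>A x (grad v x) \<bullet> grad v x\<bar> powr (p / 2))
       / (LINT x|lebesgue_on U. \<bar>v x\<bar> powr p)"
proof -
  have ae: "AE x in lebesgue_on U. \<bar>A x (grad v x) \<bullet> grad v x\<bar> powr (p / 2)
      = \<bar>A x (weak_grad U v x) \<bullet> weak_grad U v x\<bar> powr (p / 2)"
    using weak_grad_smooth[OF U v] by eventually_elim simp
  have "U \<in> sets lebesgue" using U by auto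
  from borel_measurable_lebesgue_on_AE[OF this m ae]
  show ?thesis unfolding rayleigh_lebesgue_on[OF U] using integral_cong_AE[OF m _ ae] by simp
qed

context cylinder
begin

abbreviation "\<nu> \<equiv> nu_plus p \<omega> a11 A12 A22"

lemma rayleigh_cyl_eq:
  "rayleigh_cyl p \<omega> a11 A12 A22 u
     = (LINT x|N. \<bar>B (snd x) (weak_grad U u x) (weak_grad U u x)\<bar> powr (p / 2)) / (LINT x|N. \<bar>u x\<bar> powr p)"
  unfolding rayleigh_cyl_def rayleigh_lebesgue_on[OF open_U] B_def ..

lemma rayleigh_cyl_test:
  assumes v: "v \<in> test_functions (UNIV \<times> \<omega>)"
  shows "rayleigh_cyl p \<omega> a11 A12 A22 v
     = (LINT x|N. \<bar>B (snd x) (grad v x) (grad v x)\<bar> powr (p / 2)) / (LINT x|N. \<bar>v x\<bar> powr p)"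
  unfolding rayleigh_cyl_def B_def
  by (rule rayleigh_smooth)
    (rule open_U test_smooth[OF v] borel_measurable_integrable[OF integrable_test_energy(1)[OF v, unfolded B_def]])+

text \<open>The strict inequality already excludes zero mass, since the energy is nonnegative. The
  second conclusion is recorded because a greatest lower bound over the reals needs a nonempty set
  of competitors.\<close>

lemma nu_less:
  assumes v: "v \<in> test_functions (UNIV \<times> \<omega>)"
    and less: "(LINT x|N. \<bar>B (snd x) (grad v x) (grad v x)\<bar> powr (p / 2)) < c * (LINT x|N. \<bar>v x\<bar> powr p)"
  shows "\<nu> < c" "{u \<in> V_space p \<omega>. nonzero_on U u} \<noteq> {}"
proof -
  let ?n = "LINT x|N. \<bar>B (snd x) (grad v x) (grad v x)\<bar> powr (p / 2)" and ?d = "LINT x|N. \<bar>v x\<bar> powr p"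
  have nn: "?n \<ge> 0" "?d \<ge> 0" by (rule integral_nonneg_AE; simp)+
  have "?d \<noteq> 0"
  proof
    assume "?d = 0"
    with less have "?n < c * 0" by (simp only:)
    with nn(1) show False by linarith
  qed
  then have d: "?d > 0" using nn(2) by linarith
  have V: "v \<in> V_space p \<omega>"
    unfolding V_space_def using p by (intro test_in_W1p_closure[OF open_U _ v]) auto
  then have "v \<in> W1p p U" by (simp add: V_space_def W1p_closure_def)
  with d have nz: "nonzero_on U v" using nonzero_on_iff[OF open_U] by blast
  with V show "{u \<in> V_space p \<omega>. nonzero_on U u} \<noteq> {}" by blast
  have "\<nu> \<le> rayleigh_cyl p \<omega> a11 A12 A22 v"
    unfolding nu_plus_def rayleigh_cyl_def by (rule rayleigh_INF_le) (use V nz in blast)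
  also have "\<dots> < c" unfolding rayleigh_cyl_test[OF v] using less d by (simp add: divide_less_eq)
  finally show "\<nu> < c" .
qed

text \<open>A strict inequality between limits holds for some index, so a test function far enough
  along the sequence is a competitor.\<close>

lemma nu_less_limit:
  assumes v: "\<And>k. v k \<in> test_functions (UNIV \<times> \<omega>)"
    and n: "(\<lambda>k. LINT x|N. \<bar>B (snd x) (grad (v k) x) (grad (v k) x)\<bar> powr (p / 2)) \<longlonglongrightarrow> n"
    and d: "(\<lambda>k. LINT x|N. \<bar>v k x\<bar> powr p) \<longlonglongrightarrow> d" and less: "n < c * d"
  shows "\<nu> < c" "{u \<in> V_space p \<omega>. nonzero_on U u} \<noteq> {}"
proof -
  have "(\<lambda>k. (LINT x|N. \<bar>B (snd x) (grad (v k) x) (grad (v k) x)\<bar> powr (p / 2)) - c * (LINT x|N. \<bar>v k x\<bar> powr p)) \<longlonglongrightarrow> n - c * d"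
    by (intro tendsto_intros n d)
  then have "\<forall>\<^sub>F k in sequentially. (LINT x|N. \<bar>B (snd x) (grad (v k) x) (grad (v k) x)\<bar> powr (p / 2)) - c * (LINT x|N. \<bar>v k x\<bar> powr p) < 0"
    by (rule order_tendstoD(2)) (use less in simp)
  from eventually_happens[OF this]
  obtain k where "(LINT x|N. \<bar>B (snd x) (grad (v k) x) (grad (v k) x)\<bar> powr (p / 2)) < c * (LINT x|N. \<bar>v k x\<bar> powr p)"
    by auto
  from nu_less[OF v this] show "\<nu> < c" "{u \<in> V_space p \<omega>. nonzero_on U u} \<noteq> {}" .
qed

lemma L_axial: "L X (1, 0) = E X powr ((p - 2) / 2) * (A12 X \<bullet> g X)"
  by (simp add: L_def B_sec)

text \<open>\<open>L X (1, 0)\<close> is A12 \<cdot> g times a power of E that is positive wherever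
  g is nonzero. So it is not zero almost everywhere, and du Bois-Reymond supplies a \<phi> with J
  \<noteq> 0.\<close>

lemma nu_less_mu:
  assumes A: "\<not> (AE X in M. A12 X \<bullet> g X = 0)" and I: "(LINT X|M. W X * L X (1, 0)) \<ge> 0"
  shows "\<nu> < \<mu>"
proof -
  have il: "integrable M (\<lambda>X. L X (1, 0))"
  proof (rule integrable_F_bound[of _ 1 "C powr (p / 2) * 1"])
    show "\<bar>L X (1, 0)\<bar> \<le> C powr (p / 2) * 1 * (F X + 1) powr p" if "good X" for X
      using F_nonneg[of X] by (intro good_L_le that) (auto simp: norm_Pair)
  qed (rule measurable_L borel_measurable_const zero_le_one)+
  have li: "locally_integrable_on \<omega> (\<lambda>X. L X (1, 0))"
    unfolding locally_integrable_on_def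
  proof (intro allI impI, elim conjE)
    fix K :: "(real ^ 'm) set" assume K: "compact K" "K \<subseteq> \<omega>"
    have "set_integrable lebesgue \<omega> (\<lambda>X. L X (1, 0))"
      using il omega_sets by (simp add: set_integrable_def integrable_restrict_space)
    then show "(\<lambda>X. L X (1, 0)) absolutely_integrable_on K"
      by (rule set_integrable_subset) (use K(2) fmeasurableD[OF lmeasurable_compact[OF K(1)]] in auto)
  qed
  have "\<not> (AE X in M. L X (1, 0) = 0)"
  proof
    assume "AE X in M. L X (1, 0) = 0"
    then have "AE X in M. A12 X \<bullet> g X = 0"
      using AE_good
    proof eventually_elim
      case (elim X)
      show ?case
      proof (cases "g X = 0")
        case False
        then have "0 < lam * (norm (0 :: real, g X))\<^sup>2" using constants(2) by (simp add: norm_Pair)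
        then have "E X > 0" using goodD(2)[OF elim(2), of "(0, g X)"] unfolding E_def by (rule less_le_trans)
        then show ?thesis using elim(1) by (simp add: L_axial)
      qed simp
    qed
    with A show False by contradiction
  qed
  then obtain \<phi> where \<phi>: "\<phi> \<in> test_functions \<omega>" "(LINT X:\<omega>|lebesgue. L X (1, 0) * \<phi> X) \<noteq> 0"
    using du_bois_reymond[OF omega(1) li] by blast
  define J where "J = (LINT X|M. \<phi> X * L X (1, 0))"
  have J: "J \<noteq> 0" using \<phi>(2) unfolding LINT_lebesgue_on[OF omega_sets] J_def by (simp add: mult.commute)
  obtain K where K: "\<And>t T. \<bar>t\<bar> \<le> 1 \<Longrightarrow> T \<ge> 2 \<Longrightarrow>
    \<exists>v n d. (\<forall>k. v k \<in> test_functions (UNIV \<times> \<omega>)) \<and>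
      (\<lambda>k. LINT x|N. \<bar>B (snd x) (grad (v k) x) (grad (v k) x)\<bar> powr (p / 2)) \<longlonglongrightarrow> n \<and>
      (\<lambda>k. LINT x|N. \<bar>v k x\<bar> powr p) \<longlonglongrightarrow> d \<and>
      n - \<mu> * d \<le> - (LINT X|M. W X * L X (1, 0)) - t * p * (LINT X|M. \<phi> X * L X (1, 0)) + K * (t\<^sup>2 + 1 / T) \<and>
      (t = 0 \<longrightarrow> d \<ge> T)"
    by (rule trial_functions[OF \<phi>(1)]) blast
  define K' where "K' = \<bar>K\<bar> + 1"
  have K': "K' > 0" "K \<le> K'" by (auto simp: K'_def)
  \<comment> \<open>s is |t|, and T = 2 / s^2 makes 1/T half of s^2. The error is then at most 3/2
    K' s^2, and s \<le> p |J| / (4 K') keeps it below the linear gain s p |J|.\<close>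
  define s where "s = min 1 (p * \<bar>J\<bar> / (4 * K'))"
  have s: "s > 0" "s \<le> 1" "s \<le> p * \<bar>J\<bar> / (4 * K')" using K' J p by (auto simp: s_def)
  define t where "t = s * sgn J"
  define T where "T = 2 / s\<^sup>2"
  have t: "\<bar>t\<bar> \<le> 1" using s J by (simp add: t_def abs_mult)
  have t2: "t\<^sup>2 = s\<^sup>2" using J by (simp add: t_def power_mult_distrib sgn_if)
  have T: "T \<ge> 2" using s by (simp add: T_def le_divide_eq power_le_one)
  have tJ: "t * p * J = s * (p * \<bar>J\<bar>)" by (simp add: t_def abs_sgn mult_ac)
  obtain v n d where v: "\<And>k. v k \<in> test_functions (UNIV \<times> \<omega>)"
      "(\<lambda>k. LINT x|N. \<bar>B (snd x) (grad (v k) x) (grad (v k) x)\<bar> powr (p / 2)) \<longlonglongrightarrow> n"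
      "(\<lambda>k. LINT x|N. \<bar>v k x\<bar> powr p) \<longlonglongrightarrow> d"
      "n - \<mu> * d \<le> - (LINT X|M. W X * L X (1, 0)) - t * p * J + K * (t\<^sup>2 + 1 / T)"
    using K[OF t T] unfolding J_def by blast
  have "K * (t\<^sup>2 + 1 / T) \<le> K' * (t\<^sup>2 + 1 / T)" using K' T by (intro mult_right_mono) auto
  also have "\<dots> = s * (3 / 2 * (K' * s))" unfolding t2 T_def by (simp add: power2_eq_square)
  also have "\<dots> < s * (p * \<bar>J\<bar>)"
  proof (rule mult_strict_left_mono[OF _ s(1)])
    have "K' * s \<le> p * \<bar>J\<bar> / 4" using s(3) K' by (simp add: field_simps)
    moreover have "p * \<bar>J\<bar> > 0" using p J by simp
    ultimately show "3 / 2 * (K' * s) < p * \<bar>J\<bar>" by linarith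
  qed
  finally have "n < \<mu> * d" using v(4) I unfolding tJ by linarith
  from nu_less_limit(1)[OF v(1,2,3) this] show ?thesis .
qed

text \<open>The unperturbed trial functions: \<phi> and t are 0, the excess of the energy is bounded
  uniformly in T, and the mass is at least T.\<close>

lemma nu_le_mu: "\<nu> \<le> \<mu>" and V_nonempty: "{u \<in> V_space p \<omega>. nonzero_on U u} \<noteq> {}"
proof -
  define I where "I = (LINT X|M. W X * L X (1, 0))"
  have z: "(\<lambda>X. 0) \<in> test_functions \<omega>"
    by (rule test_functionsI[OF smooth_const, of "{}"]) auto
  obtain K where K: "\<And>t T. \<bar>t\<bar> \<le> 1 \<Longrightarrow> T \<ge> 2 \<Longrightarrow>
    \<exists>v n d. (\<forall>k. v k \<in> test_functions (UNIV \<times> \<omega>)) \<and>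
      (\<lambda>k. LINT x|N. \<bar>B (snd x) (grad (v k) x) (grad (v k) x)\<bar> powr (p / 2)) \<longlonglongrightarrow> n \<and>
      (\<lambda>k. LINT x|N. \<bar>v k x\<bar> powr p) \<longlonglongrightarrow> d \<and>
      n - \<mu> * d \<le> - (LINT X|M. W X * L X (1, 0)) - t * p * (LINT X|M. 0 * L X (1, 0)) + K * (t\<^sup>2 + 1 / T) \<and>
      (t = 0 \<longrightarrow> d \<ge> T)"
    by (rule trial_functions[OF z]) blast
  have *: "\<nu> < \<mu> + e \<and> {u \<in> V_space p \<omega>. nonzero_on U u} \<noteq> {}" if e: "e > 0" for e
  proof -
    \<comment> \<open>Gives e T > |I| + |K|, which bounds the excess, while the mass d is at least
      T.\<close>
    define T where "T = 2 + (\<bar>I\<bar> + \<bar>K\<bar>) / e"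
    have T: "T \<ge> 2" using e by (simp add: T_def)
    have eT: "e * T > \<bar>I\<bar> + \<bar>K\<bar>" using e by (simp add: T_def field_simps)
    have "\<bar>0 :: real\<bar> \<le> 1" by simp
    from K[OF this T]
    obtain v n d where v: "\<And>k. v k \<in> test_functions (UNIV \<times> \<omega>)"
      "(\<lambda>k. LINT x|N. \<bar>B (snd x) (grad (v k) x) (grad (v k) x)\<bar> powr (p / 2)) \<longlonglongrightarrow> n"
      "(\<lambda>k. LINT x|N. \<bar>v k x\<bar> powr p) \<longlonglongrightarrow> d" "n - \<mu> * d \<le> - I + K / T" "d \<ge> T"
      unfolding I_def by auto
    have "K / T \<le> \<bar>K\<bar> / 1" using T by (intro frac_le) auto
    then have "n - \<mu> * d < e * T" using v(4) eT by linarith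
    also have "\<dots> \<le> e * d" using v(5) e by simp
    finally have "n < (\<mu> + e) * d" by (simp add: distrib_right)
    from nu_less_limit[OF v(1,2,3) this] show ?thesis by blast
  qed
  show "\<nu> \<le> \<mu>" by (rule field_le_epsilon) (use * in \<open>blast intro: less_imp_le\<close>)
  show "{u \<in> V_space p \<omega>. nonzero_on U u} \<noteq> {}" using *[of 1] by simp
qed

text \<open>Strictness for each single competitor carries both conclusions: it bounds \<nu> from
  below and, once \<nu> = \<mu>, excludes a minimizer. Equality would make u vanish by
  \<open>V_inequality\<close>.\<close>

lemma V_rayleigh:
  assumes A: "AE X in M. A12 X \<bullet> g X \<le> 0" and u: "u \<in> V_space p \<omega>" and nz: "nonzero_on U u"
  shows "\<mu> < rayleigh_cyl p \<omega> a11 A12 A22 u"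
proof -
  have uV: "u \<in> W1p_closure p U (test_functions (UNIV \<times> \<omega>))" using u by (simp add: V_space_def)
  then have uW: "u \<in> W1p p U" by (simp add: W1p_closure_def)
  have p0: "p > 0" using p by simp
  have sm: "smooth f" if "f \<in> test_functions (UNIV \<times> \<omega>)" for f by (rule test_smooth[OF that])
  obtain v \<Phi> where v: "\<And>k. v k \<in> test_functions (UNIV \<times> \<omega>)" "\<Phi> \<in> borel_measurable N" "\<And>x. \<Phi> x \<ge> 0"
    "integrable N (\<lambda>x. \<Phi> x powr p)" "AE x in N. (\<lambda>k. v k x) \<longlonglongrightarrow> u x"
    "AE x in N. (\<lambda>k. grad (v k) x) \<longlonglongrightarrow> weak_grad U u x"
    "AE x in N. \<forall>k. \<bar>v k x\<bar> \<le> \<Phi> x \<and> norm (grad (v k) x) \<le> \<Phi> x"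
    "AE x in N. \<bar>u x\<bar> \<le> \<Phi> x \<and> norm (weak_grad U u x) \<le> \<Phi> x"
    by (rule W1p_approx[OF open_U p0 _ uV]) (rule sm, assumption, rule that)
  note V = V_inequality[OF A v(1,2,4) W1p_measurable(1,2)[OF open_U uW] v(5-8)]
  have d: "(LINT x|N. \<bar>u x\<bar> powr p) > 0" using nz nonzero_on_iff[OF open_U uW] by simp
  have "(LINT x|N. \<bar>B (snd x) (weak_grad U u x) (weak_grad U u x)\<bar> powr (p / 2)) \<noteq> \<mu> * (LINT x|N. \<bar>u x\<bar> powr p)"
    using V(2) nz unfolding nonzero_on_def by blast
  with V(1) have "\<mu> * (LINT x|N. \<bar>u x\<bar> powr p) < (LINT x|N. \<bar>B (snd x) (weak_grad U u x) (weak_grad U u x)\<bar> powr (p / 2))"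
    by linarith
  then show ?thesis unfolding rayleigh_cyl_eq using d by (simp add: less_divide_eq)
qed

lemma nu_eq_mu:
  assumes A: "AE X in M. A12 X \<bullet> g X \<le> 0"
  shows "\<nu> = \<mu>"
proof (rule antisym[OF nu_le_mu])
  show "\<mu> \<le> \<nu>"
    unfolding nu_plus_def
    by (rule cINF_greatest[OF V_nonempty]) (use V_rayleigh[OF A] in \<open>auto intro: less_imp_le\<close>)
qed

end

theorem theorem1p3:
  fixes p C lam :: real
    and \<omega> :: "(real ^ 'm) set"
    and a11 :: "real ^ 'm \<Rightarrow> real"
    and A12 :: "real ^ 'm \<Rightarrow> real ^ 'm"
    and A22 :: "real ^ 'm \<Rightarrow> real ^ 'm ^ 'm"
    and W :: "real ^ 'm \<Rightarrow> real"
  assumes p: "p \<ge> 2"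
    and omega: "open \<omega>" "connected \<omega>" "bounded \<omega>"
    and a11_meas: "a11 \<in> borel_measurable (lebesgue_on \<omega>)"
    and A12_meas: "\<forall>i. (\<lambda>X. A12 X $ i) \<in> borel_measurable (lebesgue_on \<omega>)"
    and A22_meas: "\<forall>i j. (\<lambda>X. A22 X $ i $ j) \<in> borel_measurable (lebesgue_on \<omega>)"
    and A22_sym: "\<forall>X\<in>\<omega>. transpose (A22 X) = A22 X"
    and constants: "C > 0" "lam > 0"
    and A_bounded: "AE X in lebesgue_on \<omega>. onorm (block_app (a11 X) (A12 X) (A22 X)) \<le> C"
    and A_elliptic: "AE X in lebesgue_on \<omega>. \<forall>\<xi>.
                       block_app (a11 X) (A12 X) (A22 X) \<xi> \<bullet> \<xi> \<ge> lam * (norm \<xi>)\<^sup>2"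
    and W_space: "W \<in> W1p_0 p \<omega>"
    and W_nonneg: "AE X in lebesgue_on \<omega>. W X \<ge> 0"
    and W_normalized: "(LINT X:\<omega>|lebesgue. \<bar>W X\<bar> powr p) = 1"
    and W_minimizer: "rayleigh_sec p \<omega> A22 W = mu1 p \<omega> A22"
  shows
    "(\<not> (AE X in lebesgue_on \<omega>. A12 X \<bullet> weak_grad \<omega> W X = 0) \<longrightarrow>
      (LINT X:\<omega>|lebesgue.
         \<bar>(A22 X *v weak_grad \<omega> W X) \<bullet> weak_grad \<omega> W X\<bar> powr ((p - 2) / 2)
           * (A12 X \<bullet> weak_grad \<omega> W X) * W X) \<ge> 0 \<longrightarrow>
      nu_plus p \<omega> a11 A12 A22 < mu1 p \<omega> A22)
   \<and> ((AE X in lebesgue_on \<omega>. A12 X \<bullet> weak_grad \<omega> W X \<le> 0) \<longrightarrow>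
      nu_plus p \<omega> a11 A12 A22 = mu1 p \<omega> A22 \<and>
      \<not> (\<exists>u \<in> V_space p \<omega>. nonzero_on (half_cylinder \<omega>) u \<and>
            rayleigh_cyl p \<omega> a11 A12 A22 u = nu_plus p \<omega> a11 A12 A22))"
proof -
  let ?M = "lebesgue_on \<omega>"
  let ?g = "weak_grad \<omega> W"
  let ?\<mu> = "mu1 p \<omega> A22"
  have os: "\<omega> \<in> sets lebesgue" using omega by auto
  have p0: "p > 0" using p by simp
  have Wc: "W \<in> W1p_closure p \<omega> (test_functions \<omega>)" using W_space by (simp add: W1p_0_def)
  then have W1: "W \<in> W1p p \<omega>" by (simp add: W1p_closure_def)
  have sm: "smooth f" if "f \<in> test_functions \<omega>" for f by (rule test_smooth[OF that])
  obtain w F where w: "\<And>k. w k \<in> test_functions \<omega>" "F \<in> borel_measurable ?M" "\<And>x. F x \<ge> 0"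
    "integrable ?M (\<lambda>x. F x powr p)" "AE x in ?M. (\<lambda>k. w k x) \<longlonglongrightarrow> W x"
    "AE x in ?M. (\<lambda>k. grad (w k) x) \<longlonglongrightarrow> ?g x"
    "AE x in ?M. \<forall>k. \<bar>w k x\<bar> \<le> F x \<and> norm (grad (w k) x) \<le> F x"
    "AE x in ?M. \<bar>W x\<bar> \<le> F x \<and> norm (?g x) \<le> F x"
    by (rule W1p_approx[OF omega(1) p0 _ Wc]) (rule sm, assumption, rule that)
  have W_norm: "(LINT X|?M. \<bar>W X\<bar> powr p) = 1" using W_normalized by (simp only: LINT_lebesgue_on[OF os])
  have W_energy: "(LINT X|?M. \<bar>(A22 X *v ?g X) \<bullet> ?g X\<bar> powr (p / 2)) = ?\<mu>"
    using W_minimizer unfolding rayleigh_sec_def rayleigh_lebesgue_on[OF omega(1)] W_norm by simp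
  have section_min: "?\<mu> * (LINT X|?M. \<bar>\<psi> X\<bar> powr p) \<le> (LINT X|?M. \<bar>(A22 X *v grad \<psi> X) \<bullet> grad \<psi> X\<bar> powr (p / 2))"
    if \<psi>: "\<psi> \<in> test_functions \<omega>" for \<psi>
  \<comment> \<open>For positive mass this is the defining bound of the infimum; otherwise the left
    side is zero and the energy is nonnegative.\<close>
  proof (cases "(LINT X|?M. \<bar>\<psi> X\<bar> powr p) > 0")
    case True
    have c: "\<psi> \<in> W1p_0 p \<omega>" unfolding W1p_0_def by (rule test_in_W1p_closure[OF omega(1) p0 \<psi> refl])
    then have "\<psi> \<in> W1p p \<omega>" by (simp add: W1p_0_def W1p_closure_def)
    with True have nz: "nonzero_on \<omega> \<psi>" using nonzero_on_iff[OF omega(1)] by blast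
    have gm: "(\<lambda>X. (0::real, grad \<psi> X)) \<in> borel_measurable ?M"
      by (intro borel_measurable_Pair borel_measurable_const measurable_continuous_on_lebesgue_on
          continuous_on_grad[OF test_smooth[OF \<psi>]])
    \<comment> \<open>Padding A22 with zero blocks reuses the measurability lemma for block
      matrices.\<close>
    have "(\<lambda>X. block_app 0 0 (A22 X) (0, grad \<psi> X) \<bullet> (0, grad \<psi> X)) \<in> borel_measurable ?M"
      by (rule borel_measurable_block_inner) (use A22_meas gm in auto)
    then have m: "(\<lambda>X. \<bar>(A22 X *v grad \<psi> X) \<bullet> grad \<psi> X\<bar> powr (p / 2)) \<in> borel_measurable ?M"
      unfolding block_app_inner by simp
    have "?\<mu> \<le> rayleigh_sec p \<omega> A22 \<psi>"
      unfolding mu1_def rayleigh_sec_def by (rule rayleigh_INF_le) (use c nz in blast)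
    also have "\<dots> = (LINT X|?M. \<bar>(A22 X *v grad \<psi> X) \<bullet> grad \<psi> X\<bar> powr (p / 2)) / (LINT X|?M. \<bar>\<psi> X\<bar> powr p)"
      unfolding rayleigh_sec_def by (rule rayleigh_smooth) (rule omega(1) sm[OF \<psi>] m)+
    finally show ?thesis using True by (simp add: le_divide_eq)
  next
    case False
    moreover have "(LINT X|?M. \<bar>\<psi> X\<bar> powr p) \<ge> 0" "(LINT X|?M. \<bar>(A22 X *v grad \<psi> X) \<bullet> grad \<psi> X\<bar> powr (p / 2)) \<ge> 0"
      by (rule integral_nonneg_AE; simp)+
    ultimately show ?thesis by simp
  qed
  interpret cylinder p C lam ?\<mu> \<omega> a11 A12 A22 W ?g w F
    by (rule cylinder.intro)
      (fact p omega a11_meas A12_meas[rule_format] A22_meas[rule_format] A22_sym[rule_format] constants A_bounded A_elliptic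
        w W1p_measurable(1,2)[OF omega(1) W1] W_nonneg W_norm section_min W_energy)+
  \<comment> \<open>By ellipticity A22 g \<cdot> g is nonnegative almost everywhere, so the absolute
    value disappears and the integrand is W times the axial flux.\<close>
  have I: "(LINT X:\<omega>|lebesgue. \<bar>(A22 X *v ?g X) \<bullet> ?g X\<bar> powr ((p - 2) / 2) * (A12 X \<bullet> ?g X) * W X)
      = (LINT X|M. W X * L X (1, 0))"
    unfolding LINT_lebesgue_on[OF os]
  proof (rule integral_cong_AE)
    have L: "(\<lambda>X. W X * L X (1, 0)) \<in> borel_measurable M"
      by (intro borel_measurable_times W_meas measurable_L borel_measurable_const)
    then show "(\<lambda>X. W X * L X (1, 0)) \<in> borel_measurable M" .
    have ae: "AE X in M. W X * L X (1, 0) = \<bar>(A22 X *v ?g X) \<bullet> ?g X\<bar> powr ((p - 2) / 2) * (A12 X \<bullet> ?g X) * W X"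
      using AE_good
    proof eventually_elim
      case (elim X)
      have "(A22 X *v ?g X) \<bullet> ?g X = E X" by (simp add: E_def B_sec)
      moreover have "E X \<ge> 0" unfolding E_def by (rule good_B_nonneg[OF elim])
      ultimately show ?case by (simp add: L_axial)
    qed
    then show "AE X in M. \<bar>(A22 X *v ?g X) \<bullet> ?g X\<bar> powr ((p - 2) / 2) * (A12 X \<bullet> ?g X) * W X = W X * L X (1, 0)"
      by eventually_elim (rule sym)
    show "(\<lambda>X. \<bar>(A22 X *v ?g X) \<bullet> ?g X\<bar> powr ((p - 2) / 2) * (A12 X \<bullet> ?g X) * W X) \<in> borel_measurable M"
      by (rule borel_measurable_lebesgue_on_AE[OF os L ae])
  qed
  show ?thesis
    unfolding I
  proof (intro conjI impI)
    assume "\<not> (AE X in M. A12 X \<bullet> ?g X = 0)" "(LINT X|M. W X * L X (1, 0)) \<ge> 0"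
    then show "\<nu> < ?\<mu>" by (rule nu_less_mu)
  next
    assume A: "AE X in M. A12 X \<bullet> ?g X \<le> 0"
    then show "\<nu> = ?\<mu>" by (rule nu_eq_mu)
    show "\<not> (\<exists>u \<in> V_space p \<omega>. nonzero_on U u \<and> rayleigh_cyl p \<omega> a11 A12 A22 u = \<nu>)"
      using V_rayleigh[OF A] nu_eq_mu[OF A] by fastforce
  qed
qed

end
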